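(* If $\dim(S^+)=\dim(\operatorname{Null}(\mathbf I-\mathbf N))$, then \[ H=R^+\oplus S^- . \]
   Context: $G$ is an unbounded multiply connected region of connectivity $m$ with $\infty\in G$ and $0\in G$. Its boundary is $\Gamma=\Gamma_1\cup\dots\cup\Gamma_m$, consisting of simple, non-intersecting, smooth, clockwise oriented closed curves. $G^-:=(\mathbb C\cup\{\infty\})\setminus(G\cup\Gamma)$ is the union of the bounded simply connected regions enclosed by the $\Gamma_k$. Each $\Gamma_k$ is parametrized by a $2\pi$-periodic, twice continuously differentiable function $\eta_k$ with $\dot\eta_k\ne0$. $J$ is the disjoint union of $J_k=[0,2\pi]$, and $\eta=\eta_k$ on $J_k$. $H$ is the space of real functions on $J$ that are Hölder continuous and $2\pi$-periodic on each $J_k$. Functions on $\Gamma$ are identified with functions on $J$ via $\eta$. $A$ is a nonvanishing complex function on $\Gamma$ with continuously differentiable parametric form on $J$. The real kernels are given by \[ M(s,t)+iN(s,t):=\frac1\pi\frac{A(s)}{A(t)}\frac{\dot\eta(t)}{\eta(t)-\eta(s)} , \] with $\mathbf N\mu(s)=\int_J N(s,t)\mu(t)\,dt$ acting on $H$ and $\mathbf I$ the identity. Analytic functions are continuous up to $\Gamma$; $f^+$ and $g^-$ are the boundary values from $G$ and $G^-$ respectively. The spaces are \[ \begin{aligned} R^+&=\{\gamma\in H:\gamma=\operatorname{Re}[Af^+],\ f \text{ analytic in } G,\ f(\infty)=0\},\\ S^+&=\{\gamma\in H:\gamma=Af^+,\ f \text{ analytic in } G,\ f(\infty)=0\},\\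 S^-&=\{\gamma\in H:\gamma=Ag^-,\ g \text{ analytic in } G^-\}. \end{aligned} \] *)

theory Defs
  imports "HOL-Complex_Analysis.Complex_Analysis" "HOL-Library.Function_Algebras"
begin

text \<open>Functions on J (the disjoint union of J_k = [0,2pi], k < m) are represented as
  functions nat => real => real, mu k t, extended 2pi-periodically in t, and normalised
  to 0 for indices k >= m.\<close>

definition holder_continuous :: "(real \<Rightarrow> real) \<Rightarrow> bool" where
  "holder_continuous f \<longleftrightarrow>
     (\<exists>C \<alpha>. 0 < \<alpha> \<and> \<alpha> \<le> 1 \<and> (\<forall>s t. \<bar>f s - f t\<bar> \<le> C * \<bar>s - t\<bar> powr \<alpha>))"

definition Hsp :: "nat \<Rightarrow> (nat \<Rightarrow> real \<Rightarrow> real) set" where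
  "Hsp m = {\<mu>. (\<forall>k<m. (\<forall>t. \<mu> k (t + 2*pi) = \<mu> k t) \<and> holder_continuous (\<mu> k))
              \<and> (\<forall>k\<ge>m. \<forall>t. \<mu> k t = 0)}"

definition Gam :: "nat \<Rightarrow> (nat \<Rightarrow> real \<Rightarrow> complex) \<Rightarrow> complex set" where
  "Gam m \<eta> = (\<Union>k<m. range (\<eta> k))"

definition curve :: "(real \<Rightarrow> complex) \<Rightarrow> real \<Rightarrow> complex" where
  "curve e = (\<lambda>u. e (2 * pi * u))"

definition Nker :: "(nat \<Rightarrow> real \<Rightarrow> complex) \<Rightarrow> (nat \<Rightarrow> real \<Rightarrow> complex) \<Rightarrow> (complex \<Rightarrow> complex)
    \<Rightarrow> nat \<Rightarrow> real \<Rightarrow> nat \<Rightarrow> real \<Rightarrow> real" where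
  "Nker \<eta> d\<eta> A j s k t =
     Im ((1 / complex_of_real pi) * (A (\<eta> j s) / A (\<eta> k t)) * (d\<eta> k t / (\<eta> k t - \<eta> j s)))"

definition Nop :: "nat \<Rightarrow> (nat \<Rightarrow> real \<Rightarrow> complex) \<Rightarrow> (nat \<Rightarrow> real \<Rightarrow> complex) \<Rightarrow> (complex \<Rightarrow> complex)
    \<Rightarrow> (nat \<Rightarrow> real \<Rightarrow> real) \<Rightarrow> nat \<Rightarrow> real \<Rightarrow> real" where
  "Nop m \<eta> d\<eta> A \<mu> j s = (\<Sum>k<m. integral {0..2*pi} (\<lambda>t. Nker \<eta> d\<eta> A j s k t * \<mu> k t))"

definition NullIN :: "nat \<Rightarrow> (nat \<Rightarrow> real \<Rightarrow> complex) \<Rightarrow> (nat \<Rightarrow> real \<Rightarrow> complex) \<Rightarrow> (complex \<Rightarrow> complex)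
    \<Rightarrow> (nat \<Rightarrow> real \<Rightarrow> real) set" where
  "NullIN m \<eta> d\<eta> A = {\<mu> \<in> Hsp m. \<forall>j<m. \<forall>s. \<mu> j s - Nop m \<eta> d\<eta> A \<mu> j s = 0}"

text \<open>f analytic in G (G unbounded, containing infinity), continuous up to Gamma, f(infinity) = 0.\<close>
definition analytic_ext :: "complex set \<Rightarrow> complex set \<Rightarrow> (complex \<Rightarrow> complex) \<Rightarrow> bool" where
  "analytic_ext G \<Gamma> f \<longleftrightarrow> f holomorphic_on G \<and> continuous_on (G \<union> \<Gamma>) f \<and> (f \<longlongrightarrow> 0) at_infinity"

definition analytic_int :: "complex set \<Rightarrow> complex set \<Rightarrow> (complex \<Rightarrow> complex) \<Rightarrow> bool" where
  "analytic_int Gm \<Gamma> g \<longleftrightarrow> g holomorphic_on Gm \<and> continuous_on (Gm \<union> \<Gamma>) g"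

definition Rplus :: "nat \<Rightarrow> (nat \<Rightarrow> real \<Rightarrow> complex) \<Rightarrow> (complex \<Rightarrow> complex) \<Rightarrow> complex set
    \<Rightarrow> (nat \<Rightarrow> real \<Rightarrow> real) set" where
  "Rplus m \<eta> A G = {\<gamma> \<in> Hsp m. \<exists>f. analytic_ext G (Gam m \<eta>) f \<and>
      (\<forall>k<m. \<forall>t. \<gamma> k t = Re (A (\<eta> k t) * f (\<eta> k t)))}"

definition Splus :: "nat \<Rightarrow> (nat \<Rightarrow> real \<Rightarrow> complex) \<Rightarrow> (complex \<Rightarrow> complex) \<Rightarrow> complex set
    \<Rightarrow> (nat \<Rightarrow> real \<Rightarrow> real) set" where
  "Splus m \<eta> A G = {\<gamma> \<in> Hsp m. \<exists>f. analytic_ext G (Gam m \<eta>) f \<and>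
      (\<forall>k<m. \<forall>t. complex_of_real (\<gamma> k t) = A (\<eta> k t) * f (\<eta> k t))}"

definition Sminus :: "nat \<Rightarrow> (nat \<Rightarrow> real \<Rightarrow> complex) \<Rightarrow> (complex \<Rightarrow> complex) \<Rightarrow> complex set
    \<Rightarrow> (nat \<Rightarrow> real \<Rightarrow> real) set" where
  "Sminus m \<eta> A G = {\<gamma> \<in> Hsp m. \<exists>g. analytic_int (- (G \<union> Gam m \<eta>)) (Gam m \<eta>) g \<and>
      (\<forall>k<m. \<forall>t. complex_of_real (\<gamma> k t) = A (\<eta> k t) * g (\<eta> k t))}"

definition fscale :: "real \<Rightarrow> (nat \<Rightarrow> real \<Rightarrow> real) \<Rightarrow> (nat \<Rightarrow> real \<Rightarrow> real)" where
  "fscale r f = (\<lambda>k t. r * f k t)"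

definition fdim :: "(nat \<Rightarrow> real \<Rightarrow> real) set \<Rightarrow> nat" where
  "fdim V = vector_space.dim fscale V"

end

theory Submission
  imports Defs "HOL-Probability.Discrete_Topology"
begin

text \<open>
Write \<open>\<gamma> = A (f\<^sup>+ - g\<^sup>-)\<close> with the Cauchy integrals of \<open>\<gamma>/A\<close>; then \<open>N \<gamma> = Re (A (f\<^sup>+ + g\<^sup>-))\<close>. Hence \<open>\<gamma> + N \<gamma>\<close> lies in
\<open>R\<^sup>+\<close>, and the null space of \<open>I - N\<close> contains \<open>S\<^sup>+\<close>. By the dimension hypothesis the two coincide, which forces \<open>R\<^sup>+ \<inter> S\<^sup>- = 0\<close>.
Since \<open>N\<close> is compact, \<open>H\<close> is the sum of the range and the null space of \<open>I + N\<close> once these meet in zero, so everything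
follows if the null space of \<open>I + N\<close> is contained in \<open>S\<^sup>-\<close>. This amounts to: if \<open>A f\<^sup>+\<close> is real and equals \<open>Re (A g\<^sup>-)\<close>, then
\<open>f = 0\<close>.

That statement is an index argument. Let \<open>-\<kappa>\<close> be the index of \<open>A\<close> on a boundary curve. If \<open>\<kappa> > 0\<close>, the function \<open>g\<close>
forces \<open>A f\<^sup>+\<close> to change its sign at least \<open>2\<kappa>\<close> times on that curve; the sign changes push the index of \<open>f\<close> on nearby
parallel curves down to at most 0. But the argument principle gives total index at least 1, because \<open>f\<close> vanishes at infinity.
The boundary values may have infinitely many zeros, so both index estimates are made for small perturbations with
prescribed real or imaginary part, obtained from the Dirichlet problem for a single curve; the latter is solved with the
same integral equation.
\<close>

section \<open>Smooth closed curves and tubular coordinates\<close>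

text \<open>The triviality of \<open>R\<^sup>+ \<inter> S\<^sup>-\<close> is obtained as follows. If
  \<open>Re (A f) = A g\<close> on the boundary, then \<open>\<gamma> = - Im (A f)\<close> equals
  \<open>A (\<i> f - \<i> g)\<close> and satisfies \<open>N \<gamma> = \<gamma>\<close>; the
  hypothesis gives \<open>\<gamma> = A h\<close> with \<open>h\<close> exterior, so
  \<open>\<i> f - h\<close> and \<open>\<i> g\<close> share their boundary values and both vanish
  there. At first \<open>\<gamma>\<close> is only continuous, but \<open>N\<close> maps continuous
  data to Hoelder data of exponent 1/2, so the equation itself puts \<open>\<gamma>\<close> into
  \<open>H\<close>. For the same reason the Fredholm argument can run in the sup norm, where
  \<open>N\<close> is within 1/2 of a finite rank operator; a contraction and finite dimensional
  linear algebra then suffice. Functions are merely continuous up to the boundary, so contour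
  arguments use parallel curves \<open>tub s r\<close>. As the curves are clockwise,
  \<open>r > 0\<close> leads into \<open>G\<close>, and a zero enclosed by a curve counts -1. Zeros
  may accumulate at the boundary: finitely many are divided out on compact parts, and radii avoid
  the countable set of all zeros.\<close>

lemma periodic_int:
	fixes f :: "real => 'a"
	assumes "!!t. f (t + 2*pi) = f t"
	shows "f (t + 2*pi* of_int n) = f t"
proof (induction n rule: int_induct[where k=0])
	case (step1 i)
	have "t + 2*pi* of_int (i+1) = (t + 2*pi* of_int i) + 2*pi" by (simp add: algebra_simps)
	then show ?case using assms step1 by metis
next
	case (step2 i)
	have "t + 2*pi* of_int i = (t + 2*pi* of_int (i-1)) + 2*pi" by (simp add: algebra_simps)
	then show ?case using assms step2 by metis
qed auto

lemma reduce_mod_2pi: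
	obtains n :: int where "a <= t + 2*pi* of_int n" "t + 2*pi* of_int n < a + 2*pi"
proof
	let ?n = "- \<lfloor>(t-a)/(2*pi)\<rfloor>"
	have 1: "of_int \<lfloor>(t-a)/(2*pi)\<rfloor> <= (t-a)/(2*pi)" "(t-a)/(2*pi) < of_int \<lfloor>(t-a)/(2*pi)\<rfloor> + 1"
		by linarith+
	from 1(1) have "of_int \<lfloor>(t-a)/(2*pi)\<rfloor> * (2*pi) <= t - a"
		by (subst (asm) pos_le_divide_eq) auto
	then show "a <= t + 2*pi* of_int ?n" by (simp add: algebra_simps)
	from 1(2) have "t - a < (of_int \<lfloor>(t-a)/(2*pi)\<rfloor> + 1) * (2*pi)"
		by (subst (asm) pos_divide_less_eq) auto
	then show "t + 2*pi* of_int ?n < a + 2*pi" by (simp add: algebra_simps)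
qed

lemma periodic_bounded:
	fixes f :: "real => 'a::real_normed_vector"
	assumes per: "!!t. f (t + 2*pi) = f t" and cont: "continuous_on UNIV f"
	obtains B where "B > 0" "!!t. norm (f t) <= B"
proof -
	have "compact (f ` {0..2*pi})"
		by (intro compact_continuous_image continuous_on_subset[OF cont]) auto
	then have "bounded (f ` {0..2*pi})" by (rule compact_imp_bounded)
	then obtain B where B: "B > 0" "!!x. x \<in> f ` {0..2*pi} ==> norm x <= B"
		by (auto simp: bounded_pos)
	have "norm (f t) <= B" for t
	proof -
		obtain n :: int where "0 <= t + 2*pi* of_int n" "t + 2*pi* of_int n < 0 + 2*pi"
			by (rule reduce_mod_2pi)
		then have "norm (f (t + 2*pi* of_int n)) <= B" by (intro B) auto
		then show ?thesis using periodic_int[of f t n] per by simp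
	qed
	with B that show ?thesis by blast
qed

lemma periodic_bounded_below:
	fixes f :: "real => 'a::real_normed_vector"
	assumes per: "!!t. f (t + 2*pi) = f t" and cont: "continuous_on UNIV f" and nz: "!!t. f t ~= 0"
	obtains B where "B > 0" "!!t. norm (f t) >= B"
proof -
	have "continuous_on {0..2*pi} (%t. norm (f t))"
		by (intro continuous_intros continuous_on_subset[OF cont]) auto
	then obtain x where x: "x \<in> {0..2*pi}" "!!y. y \<in> {0..2*pi} ==> norm (f x) <= norm (f y)"
		using continuous_attains_inf[of "{0..2*pi}" "%t. norm (f t)"] by auto
	have "norm (f x) <= norm (f t)" for t
	proof -
		obtain n :: int where "0 <= t + 2*pi* of_int n" "t + 2*pi* of_int n < 0 + 2*pi"
			by (rule reduce_mod_2pi)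
		then have "norm (f x) <= norm (f (t + 2*pi* of_int n))" by (intro x) auto
		then show ?thesis using periodic_int[of f t n] per by simp
	qed
	then show ?thesis using that[of "norm (f x)"] nz by simp
qed

lemma has_integral_periodic:
	fixes f :: "real => 'a::euclidean_space"
	assumes per: "!!t. f (t + 2*pi) = f t" and int: "f integrable_on {0..2*pi}"
	shows "(f has_integral integral {0..2*pi} f) {a..a+2*pi}"
proof -
	obtain n :: int where n: "0 <= a + 2*pi* of_int n" "a + 2*pi* of_int n < 0 + 2*pi"
		by (rule reduce_mod_2pi)
	define b where "b = a + 2*pi* of_int n"
	have b: "0 <= b" "b <= 2*pi" using n by (auto simp: b_def)
	have i1: "f integrable_on {0..b}" and i2: "f integrable_on {b..2*pi}"
		using integrable_subinterval_real[OF int] b by auto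
	have "((%x. f (x + - (2*pi))) has_integral integral {0..b} f) {0-(-(2*pi))..b-(-(2*pi))}"
		by (rule has_integral_shift_real_ivl) (use i1 in blast)
	moreover have "f (x + - (2*pi)) = f x" for x using per[of "x + -(2*pi)"] by simp
	ultimately have "(f has_integral integral {0..b} f) {2*pi..b+2*pi}" by (simp add: algebra_simps)
	with integrable_integral[OF i2] have "(f has_integral (integral {b..2*pi} f + integral {0..b} f)) {b..b+2*pi}"
		using b by (intro has_integral_combine[of b "2*pi"]) auto
	also have "integral {b..2*pi} f + integral {0..b} f = integral {0..2*pi} f"
		using Henstock_Kurzweil_Integration.integral_combine[of 0 b "2*pi" f] b int by (simp add: add.commute)
	finally have "((%x. f (x + 2*pi* of_int n)) has_integral integral {0..2*pi} f) {b-2*pi* of_int n..b+2*pi-2*pi* of_int n}"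
		by (rule has_integral_shift_real_ivl)
	then show ?thesis using periodic_int[of f, OF per] by (simp add: b_def)
qed

lemma has_integral_periodic_centred:
	fixes f :: "real => 'a::euclidean_space"
	assumes per: "!!t. f (t + 2*pi) = f t" and int: "f integrable_on {0..2*pi}"
	shows "((%u. f (s+u)) has_integral integral {0..2*pi} f) {-pi..pi}"
	using has_integral_shift_real_ivl[OF has_integral_periodic[OF assms, of "s-pi"], of s]
	by (simp add: algebra_simps)

text \<open>Continuity off a finite set gives measurability and the bound gives integrability. The
  exceptional points will be the parameters where the denominator of the kernel vanishes.\<close>

lemma absolutely_integrable_bounded_continuous_except:
	fixes f :: "real => 'a::euclidean_space"
	assumes "finite F" "continuous_on ({a..b}-F) f" "!!x. x \<in> {a..b}-F ==> norm (f x) <= C"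
	shows "f absolutely_integrable_on {a..b}"
proof -
	have neg: "negligible F" using assms(1) by (rule negligible_finite)
	have ms: "{a..b} - F \<in> sets lebesgue"
		using assms(1) by (intro sets.Diff) (auto intro: negligible_imp_sets negligible_finite)
	have "f absolutely_integrable_on ({a..b} - F)"
	proof (rule measurable_bounded_by_integrable_imp_absolutely_integrable[where g="%_. C"])
		show "f \<in> borel_measurable (lebesgue_on ({a..b}-F))"
			by (rule continuous_imp_measurable_on_sets_lebesgue[OF assms(2) ms])
		have "(%_. C) integrable_on {a..b}" by (rule integrable_const_ivl)
		then show "(%_. C) integrable_on {a..b}-F"
			by (rule integrable_spike_set) (auto intro: negligible_subset[OF neg])
	qed (use ms assms(3) in auto)
	then show ?thesis
		by (rule absolutely_integrable_spike_set) (auto intro: negligible_subset[OF neg])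
qed

lemma powr_abs_integrable:
	assumes "\<beta> > -1"
	shows "(%u::real. abs u powr \<beta>) integrable_on {-pi..pi}"
proof -
	have p: "((%u::real. u powr \<beta>) has_integral (pi powr (\<beta>+1)/(\<beta>+1))) {0..pi}"
		by (rule has_integral_powr_from_0) (use assms in auto)
	have q: "((%u::real. (-u) powr \<beta>) has_integral (pi powr (\<beta>+1)/(\<beta>+1))) {-pi..0}"
		using has_integral_reflect_real[THEN iffD2, OF p] by simp
	have "((%u::real. abs u powr \<beta>) has_integral (pi powr (\<beta>+1)/(\<beta>+1))) {0..pi}"
		by (rule has_integral_eq[OF _ p]) auto
	moreover have "((%u::real. abs u powr \<beta>) has_integral (pi powr (\<beta>+1)/(\<beta>+1))) {-pi..0}"
		by (rule has_integral_eq[OF _ q]) auto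
	ultimately show ?thesis
		using has_integral_combine[of "-pi" 0 pi] by (meson integrable_on_def neg_le_0_iff_le pi_ge_zero)
qed

lemma vector_derivative_bound:
	fixes f :: "real => complex"
	assumes "!!t. (f has_vector_derivative f' t) (at t)" "!!t. norm (f' t) <= B"
	shows "norm (f t - f s) <= B * abs (t - s)"
proof -
	have "norm (f t - f s) <= B * norm (t - s)"
	proof (rule differentiable_bound[of UNIV f "%t x. x *\<^sub>R f' t"])
		show "(f has_derivative (%x. x *\<^sub>R f' t)) (at t within UNIV)" for t
			using assms(1)[of t] by (simp add: has_vector_derivative_def)
		show "onorm (%x. x *\<^sub>R f' t) <= B" for t
			by (rule onorm_le) (simp add: mult.commute[of B] mult_left_mono assms)
	qed auto
	then show ?thesis by simp
qed

text \<open>\<open>d\<close> and \<open>dd\<close> are the first two derivatives of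
  \<open>e\<close>. The orientation is left open, since the kernel estimates do not depend on it;
  \<open>cw_loop\<close> fixes it.\<close>

locale smooth_loop =
	fixes e d dd :: "real => complex"
	assumes per: "!!t. e (t + 2*pi) = e t"
		and der: "!!t. (e has_vector_derivative d t) (at t)"
		and der2: "!!t. (d has_vector_derivative dd t) (at t)"
		and dd_cont: "continuous_on UNIV dd"
		and reg: "!!t. d t ~= 0"
		and inj: "inj_on e {0..<2*pi}"
begin

lemma e_cont: "continuous_on UNIV e"
	using der by (meson continuous_at_imp_continuous_on has_vector_derivative_continuous)

lemma d_cont: "continuous_on UNIV d"
	using der2 by (meson continuous_at_imp_continuous_on has_vector_derivative_continuous)

lemma e_cont': "continuous_on S g ==> continuous_on S (%x. e (g x))"
	and d_cont': "continuous_on S g ==> continuous_on S (%x. d (g x))"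
	by (auto intro: continuous_on_compose2[OF e_cont] continuous_on_compose2[OF d_cont])

lemma d_per: "d (t + 2*pi) = d t"
proof -
	have "((e \<circ> (%t. t + 2*pi)) has_vector_derivative (1 *\<^sub>R d (t+2*pi))) (at t)"
		by (rule vector_diff_chain_at) (auto intro!: derivative_eq_intros der)
	then have "(e has_vector_derivative d (t+2*pi)) (at t)" by (simp add: per o_def)
	then show ?thesis using der vector_derivative_unique_at by blast
qed

lemma dd_per: "dd (t + 2*pi) = dd t"
proof -
	have "((d \<circ> (%t. t + 2*pi)) has_vector_derivative (1 *\<^sub>R dd (t+2*pi))) (at t)"
		by (rule vector_diff_chain_at) (auto intro!: derivative_eq_intros der2)
	then have "(d has_vector_derivative dd (t+2*pi)) (at t)" by (simp add: d_per o_def)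
	then show ?thesis using der2 vector_derivative_unique_at by blast
qed

lemma e_int: "e (t + 2*pi* of_int n) = e t" and d_int: "d (t + 2*pi* of_int n) = d t"
	using periodic_int per d_per by blast+

lemma e_eqD:
	assumes "e s = e t"
	shows "\<exists>n::int. s = t + 2*pi* of_int n"
proof -
	obtain n :: int where n: "0 <= t + 2*pi* of_int n" "t + 2*pi* of_int n < 0 + 2*pi"
		by (rule reduce_mod_2pi)
	obtain k :: int where k: "0 <= s + 2*pi* of_int k" "s + 2*pi* of_int k < 0 + 2*pi"
		by (rule reduce_mod_2pi)
	have "e (s + 2*pi* of_int k) = e (t + 2*pi* of_int n)" using assms by (simp add: e_int)
	then have "s + 2*pi* of_int k = t + 2*pi* of_int n"
		using inj n k by (auto simp: inj_on_def)
	then have "s = t + 2*pi* of_int (n-k)" by (simp add: algebra_simps)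
	then show ?thesis by blast
qed

text \<open>One constant serves in all later estimates. The quadratic remainder is the mean value
  inequality for \<open>e t - t * d s\<close>, whose derivative \<open>d t - d s\<close> has just
  been bounded by a multiple of \<open>abs (t-s)\<close>.\<close>

lemma taylor_bounds:
	obtains L where "L > 0" "!!t. norm (d t) <= L" "!!s t. norm (d t - d s) <= L * abs (t-s)"
		"!!s t. norm (e t - e s) <= L * abs (t-s)"
		"!!s t. norm (e t - e s - of_real (t-s) * d s) <= L * (t-s)^2"
proof -
	obtain B1 where B1: "B1 > 0" "!!t. norm (d t) <= B1"
		using periodic_bounded[of d] d_per d_cont by metis
	obtain B2 where B2: "B2 > 0" "!!t. norm (dd t) <= B2"
		using periodic_bounded[of dd] dd_per dd_cont by metis
	define L where "L = B1 + B2"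
	have l1: "norm (d t - d s) <= B2 * abs (t-s)" for s t
		using vector_derivative_bound[of d dd B2] der2 B2 by blast
	have l2: "norm (e t - e s) <= B1 * abs (t-s)" for s t
		using vector_derivative_bound[of e d B1] der B1 by blast
	have l3: "norm (e t - e s - of_real (t-s) * d s) <= B2 * (t-s)^2" for s t
	proof -
		have "norm ((e t - of_real t * d s) - (e s - of_real s * d s)) <= (B2*abs (t-s)) * norm (t - s)"
		proof (rule differentiable_bound[of "closed_segment s t" _ "%x h. h *\<^sub>R (d x - d s)"])
			fix x assume x: "x \<in> closed_segment s t"
			have "((%t. e t - of_real t * d s) has_vector_derivative (d x - d s)) (at x)"
				by (auto intro!: derivative_eq_intros der)
			then show "((%t. e t - of_real t * d s) has_derivative (%h. h *\<^sub>R (d x - d s))) (at x within closed_segment s t)"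
				unfolding has_vector_derivative_def by (rule has_derivative_at_withinI)
			have "norm (d x - d s) <= B2 * abs (t-s)"
			proof (rule order_trans[OF l1[of x s]])
				show "B2 * abs (x-s) <= B2 * abs (t-s)"
					using segment_bound1[OF x] B2(1) by (intro mult_left_mono) auto
			qed
			then show "onorm (%h. h *\<^sub>R (d x - d s)) <= B2 * abs (t-s)"
				by (intro onorm_le) (simp add: mult.commute[of "B2*_"] mult_left_mono)
		qed auto
		then show ?thesis by (simp add: algebra_simps power2_eq_square)
	qed
	have m: "B2 * x <= L * x" "B1 * x <= L * x" if "x >= 0" for x
		using B1 B2 that by (auto simp: L_def algebra_simps)
	show ?thesis
	proof (rule that[of L])
		show "norm (d t) <= L" for t using B1(2)[of t] B2(1) by (simp add: L_def)
		show "norm (d t - d s) <= L * abs (t-s)" for s t using order_trans[OF l1 m(1)] by simp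
		show "norm (e t - e s) <= L * abs (t-s)" for s t using order_trans[OF l2 m(2)] by simp
		show "norm (e t - e s - of_real (t-s) * d s) <= L * (t-s)^2" for s t
			using order_trans[OF l3 m(1)] by simp
	qed (use B1 B2 in \<open>simp add: L_def\<close>)
qed

text \<open>To first order this is the holomorphic continuation of \<open>e\<close> to
  \<open>s + \<i> r\<close>, so \<open>e t - tub s r\<close> behaves like
  \<open>(t - s - \<i> r) * d s\<close>. This is why the normal \<open>\<i> * d s\<close> is not
  normalised.\<close>

definition tub :: "real => real => complex" where
	"tub s r = e s + \<i> * of_real r * d s"

lemma tub_0 [simp]: "tub s 0 = e s" by (simp add: tub_def)

lemma tub_per: "tub (s + 2*pi) r = tub s r" by (simp add: tub_def per d_per)

lemma tub_int: "tub (s + 2*pi* of_int n) r = tub s r"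
	using periodic_int[of "%s. tub s r"] tub_per by blast

lemma tub_cont:
	assumes "continuous_on S f" "continuous_on S g"
	shows "continuous_on S (%x. tub (f x) (g x))"
	unfolding tub_def
	by (intro continuous_intros continuous_on_compose2[OF e_cont] continuous_on_compose2[OF d_cont] assms) auto

text \<open>Compactness of the set of admissible parameter pairs. The range up to
  \<open>3*pi/2\<close> rather than \<open>pi\<close> leaves room to move one end point, as
  \<open>kern_diff_bound\<close> does.\<close>

lemma chord_bound:
	assumes h: "h > 0"
	obtains c where "c > 0" "!!s t. [|h <= abs (t-s); abs (t-s) <= 3*pi/2|] ==> norm (e t - e s) >= c"
proof -
	define K where "K = {0..2*pi} \<times> ({-3*pi/2..-h} Un {h..3*pi/2})"
	have "compact K" unfolding K_def by (intro compact_Times compact_Un compact_Icc)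
	moreover have "continuous_on K (%p. norm (e (fst p + snd p) - e (fst p)))"
		by (intro continuous_intros continuous_on_compose2[OF e_cont]) auto
	moreover have nz: "norm (e (fst p + snd p) - e (fst p)) > 0" if "p \<in> K" for p
	proof (rule ccontr)
		assume "\<not> ?thesis"
		then have "e (fst p + snd p) = e (fst p)" by simp
		then obtain n :: int where "fst p + snd p = fst p + 2*pi* of_int n" using e_eqD by blast
		then have n: "snd p = 2*pi* of_int n" by simp
		have sp: "snd p ~= 0" "abs (snd p) <= 3*pi/2" using that h pi_gt_zero by (auto simp: K_def)
		then have "n ~= 0" using n by auto
		then have "abs (real_of_int n) >= 1" by linarith
		then have "abs (snd p) >= 2*pi" unfolding n by (simp add: abs_mult)
		then show False using sp pi_gt_zero by linarith
	qed
	moreover have "\<exists>c>0. \<forall>p\<in>K. norm (e (fst p + snd p) - e (fst p)) >= c"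
	proof (cases "K = {}")
		case False
		then show ?thesis
			using continuous_attains_inf[OF calculation(1) False calculation(2)] nz by blast
	qed (auto intro: exI[of _ 1])
	then obtain c where c: "c > 0" "!!p. p \<in> K ==> norm (e (fst p + snd p) - e (fst p)) >= c" by blast
	have "norm (e t - e s) >= c" if "h <= abs (t-s)" "abs (t-s) <= 3*pi/2" for s t
	proof -
		obtain n :: int where n: "0 <= s + 2*pi* of_int n" "s + 2*pi* of_int n < 0 + 2*pi"
			by (rule reduce_mod_2pi)
		have "(s + 2*pi* of_int n, t-s) \<in> K" using n that by (auto simp: K_def)
		from c(2)[OF this] have "c <= norm (e (t + 2*pi* of_int n) - e (s + 2*pi* of_int n))" by (simp add: algebra_simps)
		then show ?thesis by (simp add: e_int)
	qed
	with c that show ?thesis by blast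
qed

lemma norm_Complex_ge: "norm (of_real x + \<i> * of_real y) >= (abs x + abs y) / 2"
proof -
	have "abs x <= norm (Complex x y)" "abs y <= norm (Complex x y)"
		using abs_Re_le_cmod[of "Complex x y"] abs_Im_le_cmod[of "Complex x y"] by auto
	then show ?thesis by (simp add: Complex_eq)
qed

text \<open>Quantitative injectivity of the tubular coordinates \<open>(s, r) \<mapsto> tub s r\<close>; with \<open>r = 0\<close> or
	\<open>r' = 0\<close> it bounds the denominators of Cauchy kernels from below.\<close>

lemma tub_bound:
	obtains \<rho> c where "\<rho> > 0" "c > 0"
		"!!s t r r'. [|abs (t-s) <= 3*pi/2; abs r <= \<rho>; abs r' <= \<rho>|] ==> norm (tub t r - tub s r') >= c * (abs (t-s) + abs (r-r'))"
proof -
	obtain L where L: "L > 0" "!!t. norm (d t) <= L" "!!s t. norm (d t - d s) <= L * abs (t-s)"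
		"!!s t. norm (e t - e s) <= L * abs (t-s)"
		"!!s t. norm (e t - e s - of_real (t-s) * d s) <= L * (t-s)^2"
		using taylor_bounds by blast
	obtain c0 where c0: "c0 > 0" "!!t. norm (d t) >= c0"
		using periodic_bounded_below[of d] d_per d_cont reg by metis
	\<comment> \<open>With this \<open>h\<close> the two remainder terms add up to at most
	  \<open>c0/4 * abs (t-s)\<close>, half of what the main term guarantees.\<close>
	define h where "h = c0 / (8*L)"
	have h: "h > 0" using c0 L by (simp add: h_def)
	obtain c1 where c1: "c1 > 0" "!!s t. [|h <= abs (t-s); abs (t-s) <= 3*pi/2|] ==> norm (e t - e s) >= c1"
		using chord_bound[OF h] by metis
	\<comment> \<open>The normal displacements then have length at most \<open>c1/4\<close> each,
	  against a chord of length at least \<open>c1\<close>.\<close>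
	define \<rho> where "\<rho> = min h (c1 / (4*L))"
	have rho: "\<rho> > 0" "\<rho> <= h" "\<rho> <= c1/(4*L)" using h c1 L by (auto simp: \<rho>_def)
	define c where "c = min (c0/4) (c1 / (2 * (3*pi/2 + 2*\<rho>)))"
	have pos: "3*pi/2 + 2*\<rho> > 0" using rho(1) pi_gt_zero by linarith
	have c: "c > 0" "c <= c0/4" "c <= c1 / (2 * (3*pi/2 + 2*\<rho>))"
	proof -
		show "c > 0" unfolding c_def using c0 c1 pos by (simp only: min_less_iff_conj) simp
	qed (auto simp only: c_def min.cobounded1 min.cobounded2)
	show ?thesis
	proof (rule that[OF rho(1) c(1)])
		fix s t r r' :: real assume *: "abs (t-s) <= 3*pi/2" "abs r <= \<rho>" "abs r' <= \<rho>"
		show "norm (tub t r - tub s r') >= c * (abs (t-s) + abs (r-r'))"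
		proof (cases "abs (t-s) < h")
			case True
			have eq: "tub t r - tub s r' = (of_real (t-s) + \<i> * of_real (r-r')) * d s
					+ ((e t - e s - of_real (t-s) * d s) + \<i> * of_real r * (d t - d s))"
				by (simp add: tub_def algebra_simps)
			have a: "norm ((of_real (t-s) + \<i> * of_real (r-r')) * d s) >= (abs (t-s) + abs (r-r'))/2 * c0"
				unfolding norm_mult by (intro mult_mono norm_Complex_ge c0) (use c0 in auto)
			have "norm (e t - e s - of_real (t-s) * d s) <= L * h * abs (t-s)"
			proof (rule order_trans[OF L(5)[of t s]])
				have "(t-s)^2 = abs (t-s) * abs (t-s)" by (simp add: power2_eq_square)
				also have "\<dots> <= h * abs (t-s)" using True by (intro mult_right_mono) auto
				finally show "L * (t-s)^2 <= L * h * abs (t-s)" using L(1) by (simp add: mult.assoc)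
			qed
			moreover have "norm (\<i> * of_real r * (d t - d s)) <= L * h * abs (t-s)"
			proof -
				have "norm (\<i> * of_real r * (d t - d s)) = abs r * norm (d t - d s)" by (simp add: norm_mult)
				also have "\<dots> <= h * (L * abs (t-s))"
					by (intro mult_mono L) (use * rho h in auto)
				finally show ?thesis by (simp add: mult_ac)
			qed
			ultimately have "norm ((e t - e s - of_real (t-s) * d s) + \<i> * of_real r * (d t - d s)) <= 2 * (L * h) * abs (t-s)"
				by (intro order_trans[OF norm_triangle_ineq]) auto
			also have "2 * (L*h) = c0/4" using L by (simp add: h_def)
			finally have b: "norm ((e t - e s - of_real (t-s) * d s) + \<i> * of_real r * (d t - d s)) <= c0/4 * abs (t-s)" .
			have "norm (tub t r - tub s r') >= (abs (t-s) + abs (r-r'))/2 * c0 - c0/4 * abs (t-s)"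
				unfolding eq using a b norm_diff_ineq by (smt (verit, best))
			also have "(abs (t-s) + abs (r-r'))/2 * c0 - c0/4 * abs (t-s) = c0/4 * (abs (t-s) + abs (r-r')) + c0/4 * abs (r-r')"
				by (simp add: field_simps)
			finally have "norm (tub t r - tub s r') >= c0/4 * (abs (t-s) + abs (r-r'))"
				using c0 by (smt (verit, best) divide_nonneg_nonneg mult_nonneg_nonneg abs_ge_zero)
			moreover have "c0/4 * (abs (t-s) + abs (r-r')) >= c * (abs (t-s) + abs (r-r'))"
				by (intro mult_right_mono c) auto
			ultimately show ?thesis by linarith
		next
			case False
			then have A: "norm (e t - e s) >= c1" using c1(2) * by simp
			have eq: "tub t r - tub s r' = (e t - e s) + (\<i> * of_real r * d t - \<i> * of_real r' * d s)"
				by (simp add: tub_def)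
			have n1: "norm (\<i> * of_real r * d t) <= c1/(4*L) * L"  "norm (\<i> * of_real r' * d s) <= c1/(4*L) * L"
			proof -
				have "norm (\<i> * of_real x * d y) <= c1/(4*L) * L" if "abs x <= \<rho>" for x y
				proof -
					have "norm (\<i> * of_real x * d y) = abs x * norm (d y)" by (simp add: norm_mult)
					also have "\<dots> <= c1/(4*L) * L" by (rule mult_mono) (use that rho L c1 in auto)
					finally show ?thesis .
				qed
				then show "norm (\<i> * of_real r * d t) <= c1/(4*L) * L"  "norm (\<i> * of_real r' * d s) <= c1/(4*L) * L"
					using * by blast+
			qed
			then have "norm (\<i> * of_real r * d t - \<i> * of_real r' * d s) <= c1/2"
				using L(1) norm_triangle_ineq4[of "\<i> * of_real r * d t" "\<i> * of_real r' * d s"] by (simp add: field_simps)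
			then have B: "norm (tub t r - tub s r') >= c1/2"
				unfolding eq using A norm_diff_ineq[of "e t - e s" "\<i> * of_real r * d t - \<i> * of_real r' * d s"] by linarith
			have "c * (abs (t-s) + abs (r-r')) <= c1 / (2 * (3*pi/2 + 2*\<rho>)) * (3*pi/2 + 2*\<rho>)"
			proof (rule mult_mono)
				show "abs (t-s) + abs (r-r') <= 3*pi/2 + 2*\<rho>" using * by linarith
			qed (use c c1 pos in auto)
			also have "\<dots> = c1/2"
				using pos by (simp add: divide_simps)
			finally show ?thesis using B by linarith
		qed
	qed
qed

text \<open>One pair of constants from \<open>tub_bound\<close> is fixed, so that all later
  statements about the collar refer to the same radius.\<close>

definition rho_cst :: "real \<times> real" where
	"rho_cst = (SOME p. fst p > 0 & snd p > 0 & (\<forall>s t r r'. abs (t-s) <= 3*pi/2 --> abs r <= fst p --> abs r' <= fst p -->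
		 norm (tub t r - tub s r') >= snd p * (abs (t-s) + abs (r-r'))))"

definition rho :: real where "rho = fst rho_cst"
definition cst :: real where "cst = snd rho_cst"

lemma rho_pos: "rho > 0" and cst_pos: "cst > 0"
	and tub_lower: "!!s t r r'. [|abs (t-s) <= 3*pi/2; abs r <= rho; abs r' <= rho|] ==> norm (tub t r - tub s r') >= cst * (abs (t-s) + abs (r-r'))"
proof -
	have "\<exists>p. fst p > 0 & snd p > 0 & (\<forall>s t r r'. abs (t-s) <= 3*pi/2 --> abs r <= fst p --> abs r' <= fst p -->
		 norm (tub t r - tub s r') >= snd p * (abs (t-s) + abs (r-r')))"
		using tub_bound by (metis fst_conv snd_conv)
	from someI_ex[OF this, folded rho_cst_def]
	show "rho > 0" "cst > 0"
		"!!s t r r'. [|abs (t-s) <= 3*pi/2; abs r <= rho; abs r' <= rho|] ==> norm (tub t r - tub s r') >= cst * (abs (t-s) + abs (r-r'))"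
		by (auto simp: rho_def cst_def)
qed

lemma tub_eqD:
	assumes "tub t r = tub s r'" "abs r <= rho" "abs r' <= rho"
	shows "r = r' & (\<exists>n::int. t = s + 2*pi* of_int n)"
proof -
	obtain n :: int where n: "s-pi <= t + 2*pi* of_int n" "t + 2*pi* of_int n < s-pi + 2*pi"
		by (rule reduce_mod_2pi)
	let ?t = "t + 2*pi* of_int n"
	have "abs (?t-s) <= 3*pi/2" using n pi_gt_zero by linarith
	from tub_lower[OF this assms(2,3)] assms(1) have "cst * (abs (?t-s) + abs (r-r')) <= 0"
		by (simp add: tub_int)
	then have "abs (?t-s) + abs (r-r') <= 0" using cst_pos by (simp add: mult_le_0_iff)
	then have "?t = s" "r = r'" by auto
	then have "t = s + 2*pi* of_int (-n)" by simp
	then show ?thesis using \<open>r = r'\<close> by blast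
qed

lemma tub_ne: "[|r ~= 0; abs r <= rho|] ==> e t ~= tub s r"
	using tub_eqD[of t 0 s r] rho_pos by auto

lemma finite_e_eq: "finite {t\<in>{0..2*pi}. e t = e s}"
proof -
	obtain n :: int where n: "0 <= s + 2*pi* of_int n" "s + 2*pi* of_int n < 0 + 2*pi"
		by (rule reduce_mod_2pi)
	have "{t\<in>{0..2*pi}. e t = e s} <= {s + 2*pi* of_int n, 2*pi}"
	proof
		fix t assume t: "t \<in> {t\<in>{0..2*pi}. e t = e s}"
		show "t \<in> {s + 2*pi* of_int n, 2*pi}"
		proof (cases "t = 2*pi")
			case False
			then have "t \<in> {0..<2*pi}" "s + 2*pi* of_int n \<in> {0..<2*pi}" using t n by auto
			moreover have "e t = e (s + 2*pi* of_int n)" using t by (simp add: e_int)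
			ultimately show ?thesis using inj by (auto simp: inj_on_def)
		qed auto
	qed
	then show ?thesis using finite_subset by blast
qed

end

section \<open>Cauchy kernels on a closed curve\<close>

text \<open>The mass of the Poisson kernel over one period. It tends to \<open>pi\<close> as
  \<open>r\<close> goes to 0 and is the source of the jump in \<open>jump_limit\<close>.\<close>

lemma arctan_integral:
	assumes "r > 0"
	shows "((%u. r / (u^2 + r^2)) has_integral (2 * arctan (pi/r))) {-pi..pi}"
proof -
	have "((%u. r / (u^2 + r^2)) has_integral (arctan (pi/r) - arctan (-pi/r))) {-pi..pi}"
	proof (rule fundamental_theorem_of_calculus)
		fix u :: real
		have "((%u. arctan (u/r)) has_real_derivative inverse (1 + (u/r)^2) * (1/r)) (at u within {-pi..pi})"
			using assms by (auto intro!: derivative_eq_intros)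
		moreover have "inverse (1 + (u/r)^2) * (1/r) = r / (u^2 + r^2)"
		proof -
			have "1 + (u/r)^2 = (u^2 + r^2)/r^2" using assms by (simp add: field_simps)
			then show ?thesis using assms by (simp add: power2_eq_square)
		qed
		ultimately show "((%u. arctan (u/r)) has_vector_derivative r / (u^2 + r^2)) (at u within {-pi..pi})"
			by (simp add: has_real_derivative_iff_has_vector_derivative)
	qed auto
	then show ?thesis by (simp add: arctan_minus)
qed

lemma square_sum_le: "(x::real) >= 0 ==> y >= 0 ==> x^2 <= (x+y)^2"
	by (simp add: power_mono)

text \<open>\<open>a\<close> is the coefficient \<open>A\<close> along the curve; the estimates use
  its regularity through a Lipschitz constant.\<close>

locale weighted_loop = smooth_loop +
	fixes a :: "real => complex"
	assumes a_per: "!!t. a (t + 2*pi) = a t"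
		and a_nz: "!!t. a t ~= 0"
		and a_lip: "\<exists>L. \<forall>s t. norm (a t - a s) <= L * abs (t-s)"
begin

lemma a_cont: "continuous_on UNIV a"
proof -
	obtain L where L: "!!s t. norm (a t - a s) <= L * abs (t-s)" using a_lip by blast
	have "0 <= norm (a 1 - a 0)" by simp
	then have "L >= 0" using L[of 1 0] by (smt (verit) mult_cancel_left1)
	then have "L-lipschitz_on UNIV a" using L by (auto simp: lipschitz_on_def dist_norm)
	then show ?thesis by (rule lipschitz_on_continuous_on)
qed

text \<open>Since \<open>w s s = d s\<close>, the quotient \<open>w s t / (e t - e s)\<close> has
  the real singularity \<open>1/(t-s)\<close>, whatever the weight \<open>a\<close>.\<close>

definition w :: "real => real => complex" where "w s t = a s / a t * d t"

lemma w_per: "w s (t + 2*pi) = w s t" by (simp add: w_def a_per d_per)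

lemma w_cont: "continuous_on UNIV (w s)"
	unfolding w_def by (intro continuous_intros a_cont d_cont) (simp add: a_nz)

lemma kernel_consts:
	obtains L where "L > 0" "!!t. norm (d t) <= L" "!!s t. norm (d t - d s) <= L * abs (t-s)"
		"!!s t. norm (e t - e s) <= L * abs (t-s)"
		"!!s t. norm (e t - e s - of_real (t-s) * d s) <= L * (t-s)^2"
		"!!s t. norm (w s t - d s) <= L * abs (t-s)"
		"!!s t. norm (a t - a s) <= L * abs (t-s)" "!!t. norm (d t / a t) <= L"
proof -
	obtain L where L: "L > 0" "!!t. norm (d t) <= L" "!!s t. norm (d t - d s) <= L * abs (t-s)"
		"!!s t. norm (e t - e s) <= L * abs (t-s)"
		"!!s t. norm (e t - e s - of_real (t-s) * d s) <= L * (t-s)^2"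
		using taylor_bounds by blast
	obtain La where La: "!!s t. norm (a t - a s) <= La * abs (t-s)" using a_lip by blast
	obtain B where B: "B > 0" "!!t. norm (d t / a t) <= B"
	proof (rule periodic_bounded[of "%t. d t / a t"])
		show "continuous_on UNIV (%t. d t / a t)" by (intro continuous_intros d_cont a_cont) (simp add: a_nz)
	qed (auto simp: d_per a_per)
	define M where "M = L + abs La + B + B * abs La"
	have "B * abs La >= 0" using B by simp
	then have M: "M >= L" "M >= La" "M >= B" "M >= L + B * abs La" "M > 0" unfolding M_def using L(1) B(1) by linarith+
	have mm: "x <= M * z" if "x <= y * z" "y <= M" "z >= 0" for x y z
		using that mult_right_mono[of y M z] by linarith
	show ?thesis
	proof (rule that[of M])
		show "norm (w s t - d s) <= M * abs (t-s)" for s t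
		proof (rule mm[OF _ M(4)])
			have "w s t - d s = (d t / a t) * (a s - a t) + (d t - d s)"
				using a_nz[of t] by (simp add: w_def field_simps)
			also have "norm \<dots> <= B * (abs La * abs (t-s)) + L * abs (t-s)"
			proof (intro order_trans[OF norm_triangle_ineq] add_mono L)
				have "norm (a s - a t) <= abs La * abs (t-s)"
					using La[of s t] mult_right_mono[of La "abs La" "abs (s-t)"] by (simp add: abs_minus_commute abs_ge_self)
				then show "norm (d t / a t * (a s - a t)) <= B * (abs La * abs (t-s))"
					unfolding norm_mult by (intro mult_mono B) (use B in auto)
			qed
			finally show "norm (w s t - d s) <= (L + B * abs La) * abs (t-s)" by (simp add: algebra_simps)
		qed simp
		show "norm (d t) <= M" for t using L(2)[of t] M by linarith
		show "norm (d t / a t) <= M" for t using B(2)[of t] M by linarith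
	qed (use mm[OF _ M(1)] mm[OF _ M(2)] L La M in auto)
qed

lemma denominator_bound:
	assumes "abs (t-s) <= pi" "abs r <= rho"
	shows "norm (e t - tub s r) >= cst * (abs (t-s) + abs r)"
proof -
	have "abs (t-s) <= 3*pi/2" using assms pi_gt_zero by linarith
	from tub_lower[OF this, of 0 r] assms rho_pos show ?thesis by simp
qed

text \<open>The mirror points \<open>tub s r\<close> and \<open>tub s (-r)\<close> are symmetric
  about \<open>e s\<close>, so their product is a difference of squares with
  \<open>(\<i> r d s)^2\<close>.\<close>

lemma product_denominator:
	assumes "abs (t-s) <= pi" "0 < r" "r <= rho"
	shows "(e t - tub s r) * (e t - tub s (-r)) = (e t - e s)^2 + (of_real r * d s)^2"
		and "norm ((e t - e s)^2 + (of_real r * d s)^2) >= cst^2 * (abs (t-s) + r)^2"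
proof -
	show eq: "(e t - tub s r) * (e t - tub s (-r)) = (e t - e s)^2 + (of_real r * d s)^2"
		by (simp add: tub_def algebra_simps power2_eq_square)
	have "(cst * (abs (t-s) + r)) * (cst * (abs (t-s) + r)) <= norm (e t - tub s r) * norm (e t - tub s (-r))"
		using denominator_bound[of t s r] denominator_bound[of t s "-r"] assms cst_pos by (intro mult_mono) auto
	then show "norm ((e t - e s)^2 + (of_real r * d s)^2) >= cst^2 * (abs (t-s) + r)^2"
		unfolding eq[symmetric] norm_mult by (simp add: power2_eq_square mult_ac)
qed

text \<open>In both combinations of the two Cauchy kernels at the mirror points \<open>tub s r\<close>, \<open>tub s (- r)\<close>
	the singular part is an explicit real kernel: \<open>u / (u\<^sup>2 + r\<^sup>2)\<close>, invisible to the
	imaginary part, for the sum, and the Poisson kernel \<open>r / (u\<^sup>2 + r\<^sup>2)\<close> for the difference.\<close>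

lemma sum_kernel_bound:
	obtains C where "C > 0"
	 "!!s t r. [|abs (t-s) <= pi; 0 < r; r <= rho|] ==> abs (Im (w s t * (1/(e t - tub s r) + 1/(e t - tub s (-r))))) <= C"
proof -
	obtain L where L: "L > 0" "!!t. norm (d t) <= L" "!!s t. norm (d t - d s) <= L * abs (t-s)"
		"!!s t. norm (e t - e s) <= L * abs (t-s)"
		"!!s t. norm (e t - e s - of_real (t-s) * d s) <= L * (t-s)^2"
		"!!s t. norm (w s t - d s) <= L * abs (t-s)"
		"!!s t. norm (a t - a s) <= L * abs (t-s)" "!!t. norm (d t / a t) <= L"
		using kernel_consts by blast
	show ?thesis
	proof (rule that[of "4 * L^2 / cst^2"])
		show "4 * L^2 / cst^2 > 0" using L cst_pos by simp
		fix s t r :: real assume *: "abs (t-s) <= pi" "0 < r" "r <= rho"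
		define u where "u = t - s"
		define \<Delta> where "\<Delta> = e t - e s"
		define W where "W = w s t"
		define D where "D = \<Delta>^2 + (of_real r * d s)^2"
		have D: "(e t - tub s r) * (e t - tub s (-r)) = D" "norm D >= cst^2 * (abs u + r)^2"
			using product_denominator[OF *] by (auto simp: D_def \<Delta>_def u_def)
		have ur: "abs u + r > 0" using * by linarith
		have Dp: "norm D > 0" using D(2) cst_pos ur by (smt (verit) zero_less_power zero_less_mult_iff)
		then have nz: "e t - tub s r ~= 0" "e t - tub s (-r) ~= 0" "D ~= 0" using D(1) by auto
		have q: "u^2 + r^2 > 0" using * by (simp add: add_nonneg_pos)
		then have nq: "norm (complex_of_real (u^2+r^2)) = u^2+r^2" by (simp only: norm_of_real abs_of_pos)
		have sum: "w s t * (1/(e t - tub s r) + 1/(e t - tub s (-r))) = 2 * (W * \<Delta> / D)"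
		proof -
			have "1/(e t - tub s r) + 1/(e t - tub s (-r)) = ((e t - tub s r) + (e t - tub s (-r))) / ((e t - tub s r) * (e t - tub s (-r)))"
				using nz by (simp add: field_simps)
			also have "(e t - tub s r) + (e t - tub s (-r)) = 2 * \<Delta>" by (simp add: tub_def \<Delta>_def)
			finally show ?thesis unfolding D(1) W_def by simp
		qed
		\<comment> \<open>\<open>X\<close> is what remains after removal of the real singular part.
		  Multiplied by both denominators it becomes a polynomial expression whose leading terms
		  cancel.\<close>
		define X where "X = W * \<Delta> / D - of_real (u / (u^2 + r^2))"
		have Xeq: "X * (D * of_real (u^2+r^2)) = of_real u * \<Delta> * (W * of_real u - \<Delta>) + of_real (r^2) * (W * \<Delta> - of_real u * d s^2)"
		proof -
			have "W * \<Delta> / D * (D * of_real (u^2+r^2)) = W * \<Delta> * of_real (u^2+r^2)" using nz by simp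
			moreover have "complex_of_real (u / (u^2 + r^2)) * (D * of_real (u^2+r^2)) = of_real u * D"
			proof -
				have "complex_of_real (u / (u^2 + r^2)) * of_real (u^2+r^2) = of_real u"
					unfolding of_real_mult[symmetric] using q by simp
				then show ?thesis by (metis (no_types, lifting) mult.assoc mult.commute)
			qed
			ultimately have "X * (D * of_real (u^2+r^2)) = W * \<Delta> * of_real (u^2+r^2) - of_real u * D"
				unfolding X_def left_diff_distrib by simp
			then show ?thesis by (simp add: D_def algebra_simps power2_eq_square)
		qed
		have b0: "norm \<Delta> <= L * abs u" "norm (\<Delta> - of_real u * d s) <= L * u^2" "norm (W - d s) <= L * abs u"
			using L by (auto simp: \<Delta>_def u_def W_def)
		have b1: "norm (W * of_real u - \<Delta>) <= 2 * L * u^2"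
		proof -
			have "W * of_real u - \<Delta> = (W - d s) * of_real u - (\<Delta> - of_real u * d s)" by (simp add: algebra_simps)
			also have "norm \<dots> <= (L * abs u) * abs u + L * u^2"
				by (intro order_trans[OF norm_triangle_ineq4] add_mono b0) (simp add: norm_mult mult_right_mono b0)
			finally show ?thesis by (simp add: power2_eq_square)
		qed
		have b2: "norm (W * \<Delta> - of_real u * d s^2) <= 2 * L^2 * u^2"
		proof -
			have "W * \<Delta> - of_real u * d s^2 = (W - d s) * \<Delta> + d s * (\<Delta> - of_real u * d s)" by (simp add: algebra_simps power2_eq_square)
			also have "norm \<dots> <= (L * abs u) * (L * abs u) + L * (L * u^2)"
				unfolding norm_mult[symmetric]
				by (intro order_trans[OF norm_triangle_ineq] add_mono) (auto simp: norm_mult intro!: mult_mono b0 L, use L in auto)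
			finally show ?thesis by (simp add: power2_eq_square algebra_simps)
		qed
		have "norm (X * (D * of_real (u^2+r^2))) <= (abs u * (L * abs u)) * (2 * L * u^2) + r^2 * (2 * L^2 * u^2)"
			unfolding Xeq
		proof (intro order_trans[OF norm_triangle_ineq] add_mono)
			show "norm (of_real u * \<Delta> * (W * of_real u - \<Delta>)) <= abs u * (L * abs u) * (2 * L * u^2)"
				unfolding norm_mult by (intro mult_mono b0 b1) (use L in auto)
			show "norm (of_real (r^2) * (W * \<Delta> - of_real u * d s^2)) <= r^2 * (2 * L^2 * u^2)"
				unfolding norm_mult by (intro mult_mono b2) (auto simp: norm_power)
		qed
		also have "\<dots> = 2 * L^2 * u^2 * (u^2 + r^2)" by (simp add: power2_eq_square algebra_simps)
		finally have "norm X * norm D * (u^2+r^2) <= 2 * L^2 * u^2 * (u^2 + r^2)"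
			unfolding norm_mult nq mult.assoc .
		then have "norm X * norm D <= 2 * L^2 * u^2" using q by simp
		moreover have "norm D >= cst^2 * u^2"
			using D(2) mult_left_mono[OF square_sum_le[of "abs u" r], of "cst^2"] * by simp
		ultimately have Xb: "norm X <= 2 * L^2 / cst^2"
		proof (cases "u = 0")
			case False
			have "norm X * (cst^2 * u^2) <= 2 * L^2 * u^2"
				using \<open>norm X * norm D <= _\<close> mult_left_mono[OF \<open>norm D >= cst^2 * u^2\<close>, of "norm X"] by simp
			then show ?thesis using False cst_pos by (simp add: field_simps)
		qed (use Dp cst_pos in \<open>auto simp: mult_le_0_iff\<close>)
		have "W * \<Delta> / D = X + of_real (u / (u^2 + r^2))" by (simp add: X_def)
		then have "Im (2 * (W * \<Delta> / D)) = 2 * Im X" by (simp only: distrib_left) simp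
		then show "abs (Im (w s t * (1/(e t - tub s r) + 1/(e t - tub s (-r))))) <= 4 * L^2 / cst^2"
			unfolding sum using abs_Im_le_cmod[of X] Xb by (simp add: abs_mult)
	qed
qed

text \<open>The weight is left out because only winding numbers will be compared. As
  \<open>r\<close> goes to 0 the error stays below \<open>C\<close> and tends to 0 for each fixed
  \<open>t\<close>, though not uniformly; this is the form that dominated convergence asks
  for.\<close>

lemma diff_kernel_bound:
	obtains C where "C > 0"
	 "!!s t r. [|abs (t-s) <= pi; 0 < r; r <= rho|] ==>
			norm (d t * (1/(e t - tub s r) - 1/(e t - tub s (-r))) - 2 * \<i> * of_real (r / ((t-s)^2+r^2))) <= C * (r * abs (t-s) / (abs (t-s) + r)^2)"
proof -
	obtain L where L: "L > 0" "!!t. norm (d t) <= L" "!!s t. norm (d t - d s) <= L * abs (t-s)"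
		"!!s t. norm (e t - e s) <= L * abs (t-s)"
		"!!s t. norm (e t - e s - of_real (t-s) * d s) <= L * (t-s)^2"
		using taylor_bounds by blast
	show ?thesis
	proof (rule that[of "8 * L^2 / cst^2"])
		show "8 * L^2 / cst^2 > 0" using L cst_pos by simp
		fix s t r :: real assume *: "abs (t-s) <= pi" "0 < r" "r <= rho"
		define u where "u = t - s"
		define \<Delta> where "\<Delta> = e t - e s"
		define D where "D = \<Delta>^2 + (of_real r * d s)^2"
		have D: "(e t - tub s r) * (e t - tub s (-r)) = D" "norm D >= cst^2 * (abs u + r)^2"
			using product_denominator[OF *] by (auto simp: D_def \<Delta>_def u_def)
		have ur: "abs u + r > 0" using * by linarith
		have Dp: "norm D > 0" using D(2) cst_pos ur by (smt (verit) zero_less_power zero_less_mult_iff)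
		then have nz: "e t - tub s r ~= 0" "e t - tub s (-r) ~= 0" "D ~= 0" using D(1) by auto
		have q: "u^2 + r^2 > 0" using * by (simp add: add_nonneg_pos)
		then have nq: "norm (complex_of_real (u^2+r^2)) = u^2+r^2" by (simp only: norm_of_real abs_of_pos)
		have dif: "d t * (1/(e t - tub s r) - 1/(e t - tub s (-r))) = 2 * \<i> * (d t * of_real r * d s / D)"
		proof -
			have "1/(e t - tub s r) - 1/(e t - tub s (-r)) = ((e t - tub s (-r)) - (e t - tub s r)) / ((e t - tub s r) * (e t - tub s (-r)))"
				using nz by (simp add: field_simps)
			also have "(e t - tub s (-r)) - (e t - tub s r) = 2 * \<i> * of_real r * d s" by (simp add: tub_def)
			finally show ?thesis unfolding D(1) by simp
		qed
		define Y where "Y = d t * of_real r * d s / D - of_real (r / (u^2 + r^2))"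
		have Yeq: "Y * (D * of_real (u^2+r^2)) = of_real r * (of_real u * d s * (of_real u * (d t - d s) - (\<Delta> - of_real u * d s)) - \<Delta> * (\<Delta> - of_real u * d s)
								 + of_real (r^2) * (d s * (d t - d s)))"
		proof -
			have "d t * of_real r * d s / D * (D * of_real (u^2+r^2)) = d t * of_real r * d s * of_real (u^2+r^2)" using nz by simp
			moreover have "complex_of_real (r / (u^2 + r^2)) * (D * of_real (u^2+r^2)) = of_real r * D"
			proof -
				have "complex_of_real (r / (u^2 + r^2)) * of_real (u^2+r^2) = of_real r"
					unfolding of_real_mult[symmetric] using q by simp
				then show ?thesis by (metis (no_types, lifting) mult.assoc mult.commute)
			qed
			ultimately have "Y * (D * of_real (u^2+r^2)) = d t * of_real r * d s * of_real (u^2+r^2) - of_real r * D"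
				unfolding Y_def left_diff_distrib by simp
			then show ?thesis by (simp add: D_def algebra_simps power2_eq_square)
		qed
		have b0: "norm \<Delta> <= L * abs u" "norm (\<Delta> - of_real u * d s) <= L * u^2" "norm (d t - d s) <= L * abs u"
			using L by (auto simp: \<Delta>_def u_def)
		have b1: "norm (of_real u * (d t - d s) - (\<Delta> - of_real u * d s)) <= 2 * L * u^2"
		proof -
			have "norm (of_real u * (d t - d s) - (\<Delta> - of_real u * d s)) <= abs u * (L * abs u) + L * u^2"
				by (intro order_trans[OF norm_triangle_ineq4] add_mono b0) (simp add: norm_mult mult_left_mono b0)
			then show ?thesis by (simp add: power2_eq_square algebra_simps)
		qed
		have "norm (Y * (D * of_real (u^2+r^2))) <= r * ((abs u * L) * (2 * L * u^2) + (L * abs u) * (L * u^2) + r^2 * (L * (L * abs u)))"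
			unfolding Yeq norm_mult[of "of_real r"]
		proof (intro mult_mono order_trans[OF norm_triangle_ineq] order_trans[OF norm_triangle_ineq4] add_mono)
			show "norm (of_real u * d s * (of_real u * (d t - d s) - (\<Delta> - of_real u * d s))) <= abs u * L * (2 * L * u^2)"
				unfolding norm_mult[of "of_real u * d s"] using L
				by (intro mult_mono b1) (auto simp: norm_mult intro!: mult_left_mono)
			show "norm (\<Delta> * (\<Delta> - of_real u * d s)) <= L * abs u * (L * u^2)"
				unfolding norm_mult by (intro mult_mono b0) (use L in auto)
			have "norm (d s * (d t - d s)) <= L * (L * abs u)"
				unfolding norm_mult by (intro mult_mono b0 L) (use L in auto)
			then show "norm (of_real (r^2) * (d s * (d t - d s))) <= r^2 * (L * (L * abs u))"
				unfolding norm_mult[of "of_real (r^2)"] by (intro mult_mono) (auto simp: norm_power)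
		qed (use * in auto)
		also have "\<dots> = L^2 * (r * abs u) * (3 * u^2 + r^2)" by (simp add: power2_eq_square algebra_simps)
		also have "\<dots> <= L^2 * (r * abs u) * (4 * (u^2 + r^2))" using * by (intro mult_left_mono) auto
		also have "\<dots> = 4 * L^2 * (r * abs u) * (u^2 + r^2)" by simp
		finally have "norm Y * norm D * (u^2+r^2) <= 4 * L^2 * (r * abs u) * (u^2 + r^2)"
			unfolding norm_mult nq mult.assoc .
		then have "norm Y * norm D <= 4 * L^2 * (r * abs u)" using q by (metis mult_le_cancel_right_pos)
		then have "norm Y * (cst^2 * (abs u + r)^2) <= 4 * L^2 * (r * abs u)"
			using mult_left_mono[OF D(2), of "norm Y"] by simp
		then have "norm Y <= 4 * L^2 * (r * abs u) / (cst^2 * (abs u + r)^2)"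
			using cst_pos ur by (simp add: pos_le_divide_eq)
		then have "2 * norm Y <= 8 * L^2 / cst^2 * (r * abs u / (abs u + r)^2)" by simp
		moreover have "d t * (1/(e t - tub s r) - 1/(e t - tub s (-r))) - 2 * \<i> * of_real (r / ((t-s)^2+r^2)) = 2 * \<i> * Y"
			unfolding dif Y_def u_def by (simp add: algebra_simps)
		ultimately show "norm (d t * (1/(e t - tub s r) - 1/(e t - tub s (-r))) - 2 * \<i> * of_real (r / ((t-s)^2+r^2))) <= 8 * L^2 / cst^2 * (r * abs (t-s) / (abs (t-s) + r)^2)"
			by (simp add: norm_mult u_def)
	qed
qed

end

lemma absolutely_integrable_dominated_continuous_except:
	fixes f :: "real => 'a::euclidean_space"
	assumes "finite F" "continuous_on ({a..b}-F) f" "!!x. x \<in> {a..b}-F ==> norm (f x) <= g x"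
		"g integrable_on {a..b}"
	shows "f absolutely_integrable_on {a..b}"
proof -
	have neg: "negligible F" using assms(1) by (rule negligible_finite)
	have ms: "{a..b} - F \<in> sets lebesgue"
		using assms(1) by (intro sets.Diff) (auto intro: negligible_imp_sets negligible_finite)
	have "f absolutely_integrable_on ({a..b} - F)"
	proof (rule measurable_bounded_by_integrable_imp_absolutely_integrable[where g=g])
		show "f \<in> borel_measurable (lebesgue_on ({a..b}-F))"
			by (rule continuous_imp_measurable_on_sets_lebesgue[OF assms(2) ms])
		show "g integrable_on {a..b}-F"
			using assms(4) by (rule integrable_spike_set) (auto intro: negligible_subset[OF neg])
	qed (use ms assms(3) in auto)
	then show ?thesis
		by (rule absolutely_integrable_spike_set) (auto intro: negligible_subset[OF neg])
qed

section \<open>Cauchy integrals of Hoelder continuous densities near the curve\<close>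

context smooth_loop
begin

lemma e_tendsto: "(f \<longlongrightarrow> x) F ==> ((%n. e (f n)) \<longlongrightarrow> e x) F"
	and d_tendsto: "(f \<longlongrightarrow> x) F ==> ((%n. d (f n)) \<longlongrightarrow> d x) F"
	using e_cont d_cont by (auto simp: continuous_on_eq_continuous_at intro: isCont_tendsto_compose)

lemma tub_tendsto: "(f \<longlongrightarrow> x) F ==> (g \<longlongrightarrow> y) F ==> ((%n. tub (f n) (g n)) \<longlongrightarrow> tub x y) F"
	unfolding tub_def by (intro tendsto_intros e_tendsto d_tendsto)

lemma denominator_lower:
	assumes "abs u <= pi" "abs r <= rho"
	shows "norm (e (s+u) - tub s r) >= cst * (abs u + abs r)"
proof -
	have "abs ((s+u)-s) <= 3*pi/2" using assms pi_gt_zero by linarith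
	from tub_lower[OF this, of 0 r] assms rho_pos show ?thesis by simp
qed

text \<open>The Cauchy integral with the value of the density at the foot point subtracted; for a
  Hoelder density the integrand has an integrable majorant, even at \<open>r = 0\<close>.\<close>

definition Phi :: "(real => complex) => real => real => complex" where
	"Phi \<phi> s r = integral {-pi..pi} (%u. (\<phi> (s+u) - \<phi> s) * d (s+u) / (e (s+u) - tub s r))"

lemma Phi_integrand:
	assumes cont: "continuous_on UNIV \<phi>" and "\<alpha> > 0"
		and hol: "!!s u. abs u <= pi ==> norm (\<phi> (s+u) - \<phi> s) <= C * abs u powr \<alpha>"
	obtains K where "!!s r. abs r <= rho ==> (%u. (\<phi> (s+u) - \<phi> s) * d (s+u) / (e (s+u) - tub s r)) integrable_on {-pi..pi}"
		"!!s r u. abs r <= rho ==> u \<in> {-pi..pi} ==> norm ((\<phi> (s+u) - \<phi> s) * d (s+u) / (e (s+u) - tub s r)) <= K * abs u powr (\<alpha>-1)"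
proof -
	obtain L where L: "L > 0" "!!t. norm (d t) <= L" "!!s t. norm (d t - d s) <= L * abs (t-s)"
		"!!s t. norm (e t - e s) <= L * abs (t-s)"
		"!!s t. norm (e t - e s - of_real (t-s) * d s) <= L * (t-s)^2"
		using taylor_bounds by blast
	define K where "K = C * L / cst"
	have b: "norm ((\<phi> (s+u) - \<phi> s) * d (s+u) / (e (s+u) - tub s r)) <= K * abs u powr (\<alpha>-1)"
		if "abs r <= rho" "u \<in> {-pi..pi}" for s r u
	proof (cases "u = 0")
		case False
		have u: "abs u <= pi" using that by auto
		have den: "norm (e (s+u) - tub s r) >= cst * abs u"
		proof (rule order_trans[OF _ denominator_lower[OF u that(1), of s]])
			show "cst * abs u <= cst * (abs u + abs r)" using cst_pos by (intro mult_left_mono) auto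
		qed
		have pos: "cst * abs u > 0" using False cst_pos by simp
		have h0: "0 <= C * abs u powr \<alpha>" using hol[OF u, of s] norm_ge_zero order_trans by blast
		have "norm ((\<phi> (s+u) - \<phi> s) * d (s+u) / (e (s+u) - tub s r)) <= (C * abs u powr \<alpha>) * L / (cst * abs u)"
			unfolding norm_mult norm_divide
			by (intro frac_le mult_mono hol u L den pos) (use L h0 in auto)
		also have "\<dots> = K * (abs u powr \<alpha> / abs u)" by (simp add: K_def)
		also have "abs u powr \<alpha> / abs u = abs u powr (\<alpha>-1)" using False by (simp add: powr_diff)
		finally show ?thesis .
	qed simp
	show ?thesis
	proof (rule that[OF _ b])
		fix s r :: real assume r: "abs r <= rho"
		have "(%u. (\<phi> (s+u) - \<phi> s) * d (s+u) / (e (s+u) - tub s r)) absolutely_integrable_on {-pi..pi}"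
		proof (rule absolutely_integrable_dominated_continuous_except[where F="{0}" and g="%u. K * abs u powr (\<alpha>-1)"])
			have "e (s+u) - tub s r ~= 0" if "u \<in> {-pi..pi} - {0}" for u
			proof -
				have "cst * (abs u + abs r) > 0" using that cst_pos by (intro mult_pos_pos) auto
				moreover have "abs u <= pi" using that by auto
				ultimately show ?thesis using denominator_lower[of u r s] r by fastforce
			qed
			then show "continuous_on ({-pi..pi} - {0}) (%u. (\<phi> (s+u) - \<phi> s) * d (s+u) / (e (s+u) - tub s r))"
				by (intro continuous_intros continuous_on_compose2[OF cont] e_cont' d_cont') auto
			show "(%u. K * abs u powr (\<alpha>-1)) integrable_on {-pi..pi}"
				by (intro integrable_on_mult_right powr_abs_integrable) (use \<open>\<alpha> > 0\<close> in auto)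
		qed (use b r in auto)
		then show "(%u. (\<phi> (s+u) - \<phi> s) * d (s+u) / (e (s+u) - tub s r)) integrable_on {-pi..pi}"
			by (rule absolutely_integrable_on_def[THEN iffD1, THEN conjunct1])
	qed
qed

text \<open>The majorant \<open>K * abs u powr (\<alpha>-1)\<close> is independent of
  \<open>s\<close> and \<open>r\<close>, so dominated convergence applies even when \<open>r\<close>
  tends to 0 from either side. This part of the Cauchy integral has no jump.\<close>

lemma Phi_tendsto:
	assumes cont: "continuous_on UNIV \<phi>" and al: "\<alpha> > 0"
		and hol: "!!s u. abs u <= pi ==> norm (\<phi> (s+u) - \<phi> s) <= C * abs u powr \<alpha>"
		and s: "s \<longlonglongrightarrow> s0" and r: "r \<longlonglongrightarrow> r0" and rb: "!!n. abs (r n) <= rho"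
	shows "(%n. Phi \<phi> (s n) (r n)) \<longlonglongrightarrow> Phi \<phi> s0 r0"
proof -
	obtain K where K: "!!s r. abs r <= rho ==> (%u. (\<phi> (s+u) - \<phi> s) * d (s+u) / (e (s+u) - tub s r)) integrable_on {-pi..pi}"
		"!!s r u. abs r <= rho ==> u \<in> {-pi..pi} ==> norm ((\<phi> (s+u) - \<phi> s) * d (s+u) / (e (s+u) - tub s r)) <= K * abs u powr (\<alpha>-1)"
		using Phi_integrand[OF cont al hol] by blast
	have r0: "abs r0 <= rho"
		by (rule LIMSEQ_le_const2[OF tendsto_rabs[OF r]]) (use rb in auto)
	have ph: "(%n. \<phi> (f n)) \<longlonglongrightarrow> \<phi> x" if "f \<longlonglongrightarrow> x" for f x
		using cont that by (auto simp: continuous_on_eq_continuous_at intro: isCont_tendsto_compose)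
	show ?thesis unfolding Phi_def
	proof (rule dominated_convergence(2)[where h="%u. K * abs u powr (\<alpha>-1)"])
		show "(%u. K * abs u powr (\<alpha>-1)) integrable_on {-pi..pi}"
			by (intro integrable_on_mult_right powr_abs_integrable) (use al in auto)
		fix u assume u: "u \<in> {-pi..pi}"
		show "(%n. (\<phi> (s n+u) - \<phi> (s n)) * d (s n+u) / (e (s n+u) - tub (s n) (r n))) \<longlonglongrightarrow>
						(\<phi> (s0+u) - \<phi> s0) * d (s0+u) / (e (s0+u) - tub s0 r0)"
		proof (cases "u = 0")
			case False
			have "cst * (abs u + abs r0) > 0" using False cst_pos by (intro mult_pos_pos) auto
			moreover have "abs u <= pi" using u by auto
			ultimately have "e (s0+u) - tub s0 r0 ~= 0" using denominator_lower[of u r0 s0] r0 by fastforce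
			then show ?thesis by (intro tendsto_intros ph e_tendsto d_tendsto tub_tendsto s r)
		qed auto
	qed (use K rb in auto)
qed

lemma e_ne_tub_cont:
	assumes "r ~= 0" "abs r <= rho" "continuous_on UNIV \<phi>"
	shows "continuous_on S (%t. \<phi> t * d t / (e t - tub s r))"
	using assms tub_ne[of r _ s]
	by (intro continuous_intros continuous_on_subset[OF assms(3)] e_cont' d_cont') auto

text \<open>The last integral is \<open>2*pi*\<i>\<close> times a winding number, so the whole jump
  across the curve sits in it.\<close>

lemma Cauchy_split:
	assumes cont: "continuous_on UNIV \<phi>" and al: "\<alpha> > 0"
		and hol: "!!s u. abs u <= pi ==> norm (\<phi> (s+u) - \<phi> s) <= C * abs u powr \<alpha>"
		and p: "!!t. \<phi> (t + 2*pi) = \<phi> t" and r: "r ~= 0" "abs r <= rho"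
	shows "integral {0..2*pi} (%t. \<phi> t * d t / (e t - tub s r)) =
		Phi \<phi> s r + \<phi> s * integral {0..2*pi} (%t. d t / (e t - tub s r))"
proof -
	have c1: "continuous_on S (%t. d t / (e t - tub s r))" for S
		using e_ne_tub_cont[OF r, of "%_. 1"] by simp
	have "((%u. \<phi> (s+u) * d (s+u) / (e (s+u) - tub s r)) has_integral integral {0..2*pi} (%t. \<phi> t * d t / (e t - tub s r))) {-pi..pi}"
		by (rule has_integral_periodic_centred[of "%t. \<phi> t * d t / (e t - tub s r)"])
			 (auto simp: p per d_per intro!: integrable_continuous_real e_ne_tub_cont r cont)
	moreover have "((%u. d (s+u) / (e (s+u) - tub s r)) has_integral integral {0..2*pi} (%t. d t / (e t - tub s r))) {-pi..pi}"
		by (rule has_integral_periodic_centred[of "%t. d t / (e t - tub s r)"])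
			 (auto simp: per d_per intro!: integrable_continuous_real c1)
	ultimately have "((%u. \<phi> (s+u) * d (s+u) / (e (s+u) - tub s r) - \<phi> s * (d (s+u) / (e (s+u) - tub s r))) has_integral
		(integral {0..2*pi} (%t. \<phi> t * d t / (e t - tub s r)) - \<phi> s * integral {0..2*pi} (%t. d t / (e t - tub s r)))) {-pi..pi}"
		by (intro has_integral_diff has_integral_mult_right)
	moreover have "\<phi> (s+u) * d (s+u) / (e (s+u) - tub s r) - \<phi> s * (d (s+u) / (e (s+u) - tub s r))
		 = (\<phi> (s+u) - \<phi> s) * d (s+u) / (e (s+u) - tub s r)" for u
		by (simp add: left_diff_distrib diff_divide_distrib)
	ultimately have "Phi \<phi> s r = integral {0..2*pi} (%t. \<phi> t * d t / (e t - tub s r)) - \<phi> s * integral {0..2*pi} (%t. d t / (e t - tub s r))"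
		unfolding Phi_def by (simp add: integral_unique)
	then show ?thesis by simp
qed

end

context weighted_loop
begin

text \<open>Up to an error removed by dominated convergence, the difference is \<open>2*\<i>\<close>
  times the mass of the Poisson kernel, which tends to \<open>pi\<close>. The limit decides in
  \<open>tub_sides\<close> which of two mirror points is inside.\<close>

lemma jump_limit:
	assumes r: "!!n. 0 < r n" "!!n. r n <= rho" "r \<longlonglongrightarrow> 0"
	shows "(%n. integral {0..2*pi} (%t. d t / (e t - tub s (r n))) - integral {0..2*pi} (%t. d t / (e t - tub s (- r n)))) \<longlonglongrightarrow> 2*pi*\<i>"
proof -
	obtain C where C: "C > 0" "!!s t r. [|abs (t-s) <= pi; 0 < r; r <= rho|] ==>
			norm (d t * (1/(e t - tub s r) - 1/(e t - tub s (-r))) - 2 * \<i> * of_real (r / ((t-s)^2+r^2))) <= C * (r * abs (t-s) / (abs (t-s) + r)^2)"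
		using diff_kernel_bound by blast
	define Y where "Y = (%n u. d (s+u) * (1/(e (s+u) - tub s (r n)) - 1/(e (s+u) - tub s (- r n))) - 2 * \<i> * of_real (r n / (u^2+(r n)^2)))"
	have Yb: "norm (Y n u) <= C * (r n * abs u / (abs u + r n)^2)" if "u \<in> {-pi..pi}" for n u
		using C(2)[of "s+u" s "r n"] r that by (auto simp: Y_def)
	have c1: "continuous_on S (%t. d t / (e t - tub s x))" if "x ~= 0" "abs x <= rho" for S x
		using e_ne_tub_cont[OF that, of "%_. 1"] by simp
	have I1: "((%u. d (s+u) / (e (s+u) - tub s x)) has_integral integral {0..2*pi} (%t. d t / (e t - tub s x))) {-pi..pi}"
		if "x ~= 0" "abs x <= rho" for x
		by (rule has_integral_periodic_centred[of "%t. d t / (e t - tub s x)"])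
			 (auto simp: per d_per intro!: integrable_continuous_real c1 that)
	have rn: "r n ~= 0" "abs (r n) <= rho" "- r n ~= 0" "abs (- r n) <= rho" for n using r(1)[of n] r(2)[of n] by auto
	have I2: "((%u. complex_of_real (r n / (u^2+(r n)^2))) has_integral of_real (2 * arctan (pi / r n))) {-pi..pi}" for n
		by (rule has_integral_of_real[OF arctan_integral[OF r(1)]])
	have YI: "(Y n has_integral (integral {0..2*pi} (%t. d t / (e t - tub s (r n))) - integral {0..2*pi} (%t. d t / (e t - tub s (- r n)))
			 - 2 * \<i> * of_real (2 * arctan (pi / r n)))) {-pi..pi}" for n
		using has_integral_diff[OF has_integral_diff[OF I1[OF rn(1,2)[of n]] I1[OF rn(3,4)[of n]]] has_integral_mult_right[OF I2[of n], of "2*\<i>"]]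
		unfolding Y_def by (simp add: right_diff_distrib)
	have frac_le1: "x * abs y / (abs y+x)^2 <= 1" if "x > 0" for x y :: real
	proof -
		have "x * abs y <= (abs y+x)^2" using that by (simp add: power2_eq_square algebra_simps)
		moreover have "(abs y+x)^2 > 0" using that by (simp add: add_nonneg_pos)
		ultimately show ?thesis by simp
	qed
	have "(%n. integral {-pi..pi} (Y n)) \<longlonglongrightarrow> integral {-pi..pi} (%u. 0::complex)"
	proof (rule dominated_convergence(2)[where h="%_. C"])
		show "Y n integrable_on {-pi..pi}" for n using YI by blast
		show "norm (Y n u) <= C" if "u \<in> {-pi..pi}" for n u
			using Yb[OF that, of n] mult_left_mono[OF frac_le1[OF r(1)[of n], of u], of C] C(1) by simp
		show "(%n. Y n u) \<longlonglongrightarrow> 0" if u: "u \<in> {-pi..pi}" for u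
		proof (rule tendsto_norm_zero_cancel, rule tendsto_sandwich[OF _ _ tendsto_const])
			show "\<forall>\<^sub>F n in sequentially. norm (Y n u) <= C * (r n * abs u / (abs u + r n)^2)" using Yb[OF u] by simp
			show "(%n. C * (r n * abs u / (abs u + r n)^2)) \<longlonglongrightarrow> 0"
			proof (cases "u = 0")
				case False
				then have "(%n. C * (r n * abs u / (abs u + r n)^2)) \<longlonglongrightarrow> C * (0 * abs u / (abs u + 0)^2)"
					by (intro tendsto_intros r) auto
				then show ?thesis by simp
			qed auto
		qed auto
	qed auto
	then have "(%n. integral {0..2*pi} (%t. d t / (e t - tub s (r n))) - integral {0..2*pi} (%t. d t / (e t - tub s (- r n)))
			 - 2 * \<i> * of_real (2 * arctan (pi / r n))) \<longlonglongrightarrow> 0"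
		using integral_unique[OF YI] by simp
	moreover have "(%n. 2 * \<i> * complex_of_real (2 * arctan (pi / r n))) \<longlonglongrightarrow> 2 * \<i> * of_real (2 * (pi/2))"
	proof -
		have "filterlim r (at_right 0) sequentially"
		proof -
			have "r n \<in> {0<..} & r n ~= 0" for n using r(1)[of n] by simp
			then show ?thesis using r(3) unfolding filterlim_at by simp
		qed
		then have "filterlim (%n. pi / r n) at_top sequentially"
			using filterlim_tendsto_pos_mult_at_top[OF tendsto_const pi_gt_zero filterlim_compose[OF filterlim_inverse_at_top_right]]
			by (simp add: divide_inverse)
		then have "(%n. arctan (pi / r n)) \<longlonglongrightarrow> pi/2"
			by (rule filterlim_compose[OF tendsto_arctan_at_top])
		then show ?thesis by (intro tendsto_intros)
	qed
	ultimately have "(%n. (integral {0..2*pi} (%t. d t / (e t - tub s (r n))) - integral {0..2*pi} (%t. d t / (e t - tub s (- r n)))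
			 - 2 * \<i> * of_real (2 * arctan (pi / r n))) + 2 * \<i> * of_real (2 * arctan (pi / r n))) \<longlonglongrightarrow> 0 + 2 * \<i> * of_real (2 * (pi/2))"
		by (rule tendsto_add)
	then show ?thesis by (simp add: mult_ac)
qed

text \<open>\<open>pi\<close> times the kernel of \<open>N\<close> on a single curve, see
  \<open>Nker_diag\<close>. Where \<open>e t = e s\<close> the value is 0 by division by zero;
  within one period this concerns finitely many \<open>t\<close>.\<close>

definition kern :: "real => real => real" where "kern s t = Im (w s t / (e t - e s))"

lemma kern_per: "kern s (t + 2*pi) = kern s t" by (simp add: kern_def w_per per)

lemma kern_int2: "kern s (t + 2*pi* of_int n) = kern s t"
	using periodic_int[of "kern s"] kern_per by blast

text \<open>Subtracting the real number \<open>1/(t-s)\<close> leaves the imaginary part unchanged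
  and produces a numerator that vanishes to second order. Hence the kernel is bounded.\<close>

lemma kern_eq:
	assumes "t ~= s" "e t ~= e s"
	shows "kern s t = Im ((w s t * of_real (t-s) - (e t - e s)) / ((e t - e s) * of_real (t-s)))"
proof -
	have "W / y = (W * x - y) / (y * x) + 1 / x" if "x ~= 0" "y ~= 0" for W x y :: complex
		using that by (simp add: field_simps)
	from this[of "of_real (t-s)" "e t - e s" "w s t"]
	have "w s t / (e t - e s) = (w s t * of_real (t-s) - (e t - e s)) / ((e t - e s) * of_real (t-s)) + of_real (1/(t-s))"
		using assms by simp
	then show ?thesis unfolding kern_def by simp
qed

lemma numerator_bound:
	assumes "!!s t. norm (e t - e s - of_real (t-s) * d s) <= L * (t-s)^2" "!!s t. norm (w s t - d s) <= L * abs (t-s)"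
	shows "norm (w s t * of_real (t-s) - (e t - e s)) <= 2 * L * (t-s)^2"
proof -
	have "w s t * of_real (t-s) - (e t - e s) = (w s t - d s) * of_real (t-s) - (e t - e s - of_real (t-s) * d s)" by (simp add: algebra_simps)
	also have "norm \<dots> <= (L * abs (t-s)) * abs (t-s) + L * (t-s)^2"
		by (intro order_trans[OF norm_triangle_ineq4] add_mono assms) (simp add: norm_mult mult_right_mono assms flip: of_real_diff)
	finally show ?thesis by (simp add: power2_eq_square algebra_simps)
qed

lemma chord_lower:
	assumes "abs (t-s) <= 3*pi/2"
	shows "norm (e t - e s) >= cst * abs (t-s)"
	using tub_lower[OF assms, of 0 0] rho_pos by simp

lemma kern_bound:
	obtains C where "C > 0" "!!s t. abs (kern s t) <= C"
proof -
	obtain L where LL: "L > 0" "!!t. norm (d t) <= L" "!!s t. norm (d t - d s) <= L * abs (t-s)"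
		"!!s t. norm (e t - e s) <= L * abs (t-s)"
		"!!s t. norm (e t - e s - of_real (t-s) * d s) <= L * (t-s)^2"
		"!!s t. norm (w s t - d s) <= L * abs (t-s)"
		"!!s t. norm (a t - a s) <= L * abs (t-s)" "!!t. norm (d t / a t) <= L"
		using kernel_consts by blast
	note L = LL(1,5,6)
	have b: "abs (kern s t) <= 2 * L / cst" if "abs (t-s) <= pi" for s t
	proof (cases "t = s")
		case False
		have ch: "norm (e t - e s) >= cst * abs (t-s)" by (rule chord_lower) (use that pi_gt_zero in linarith)
		have pos: "cst * abs (t-s) * abs (t-s) > 0" using False cst_pos by simp
		then have ne: "e t ~= e s" using ch False cst_pos by (auto simp: mult_le_0_iff)
		have "abs (kern s t) <= norm ((w s t * of_real (t-s) - (e t - e s)) / ((e t - e s) * of_real (t-s)))"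
			unfolding kern_eq[OF False ne] by (rule abs_Im_le_cmod)
		also have "\<dots> <= 2 * L * (t-s)^2 / (cst * abs (t-s) * abs (t-s))"
			unfolding norm_divide norm_mult norm_of_real
			using numerator_bound[OF L(2,3), of s t] ch pos L(1) by (intro frac_le mult_right_mono) auto
		also have "cst * abs (t-s) * abs (t-s) = cst * (t-s)^2" by (simp add: power2_eq_square mult.assoc)
		also have "2 * L * (t-s)^2 / (cst * (t-s)^2) = 2 * L / cst" using False cst_pos by simp
		finally show ?thesis .
	qed (use L cst_pos in \<open>simp add: kern_def\<close>)
	have "abs (kern s t) <= 2 * L / cst" for s t
	proof -
		obtain n :: int where n: "s-pi <= t + 2*pi* of_int n" "t + 2*pi* of_int n < s-pi + 2*pi"
			by (rule reduce_mod_2pi)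
		then have "abs ((t + 2*pi* of_int n) - s) <= pi" by linarith
		from b[OF this] show ?thesis by (simp add: kern_int2)
	qed
	then show ?thesis using that[of "2*L/cst"] L cst_pos by simp
qed

lemma kern_continuous: "continuous_on ({0..2*pi} - {t\<in>{0..2*pi}. e t = e s}) (kern s)"
	unfolding kern_def using w_cont
	by (intro continuous_intros e_cont') (auto intro: continuous_on_subset)

lemma kern_abs_integrable:
	assumes x: "continuous_on {0..2*pi} x"
	shows "(%t. kern s t * x t) absolutely_integrable_on {0..2*pi}"
proof -
	obtain C where C: "C > 0" "!!s t. abs (kern s t) <= C" using kern_bound by blast
	have "bounded (x ` {0..2*pi})" by (intro compact_imp_bounded compact_continuous_image x) auto
	then obtain B where B: "!!t. t \<in> {0..2*pi} ==> abs (x t) <= B" by (metis bounded_iff imageI real_norm_def)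
	show ?thesis
	proof (rule absolutely_integrable_bounded_continuous_except[OF finite_e_eq])
		show "continuous_on ({0..2*pi} - {t\<in>{0..2*pi}. e t = e s}) (%t. kern s t * x t)"
			by (intro continuous_intros kern_continuous continuous_on_subset[OF x]) auto
		show "norm (kern s t * x t) <= C * B" if "t \<in> {0..2*pi} - {t\<in>{0..2*pi}. e t = e s}" for t
			using C B[of t] that by (auto simp: abs_mult intro!: mult_mono)
	qed
qed

lemma kern_integrable: "continuous_on {0..2*pi} x ==> (%t. kern s t * x t) integrable_on {0..2*pi}"
	using kern_abs_integrable[of x s] by (simp add: absolutely_integrable_on_def)

lemma sum_limit:
	fixes \<gamma> :: "real => real"
	assumes g: "continuous_on UNIV \<gamma>" "!!t. \<gamma> (t + 2*pi) = \<gamma> t"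
		and r: "!!n. 0 < r n" "!!n. r n <= rho" "r \<longlonglongrightarrow> 0"
	shows "(%n. Im (a s * (integral {0..2*pi} (%t. \<gamma> t / a t * d t / (e t - tub s (r n)))
						 + integral {0..2*pi} (%t. \<gamma> t / a t * d t / (e t - tub s (- r n))))))
					 \<longlonglongrightarrow> 2 * integral {0..2*pi} (%t. kern s t * \<gamma> t)"
proof -
	obtain C where C: "C > 0" "!!s t r. [|abs (t-s) <= pi; 0 < r; r <= rho|] ==> abs (Im (w s t * (1/(e t - tub s r) + 1/(e t - tub s (-r))))) <= C"
		using sum_kernel_bound by blast
	obtain B where B: "B > 0" "!!t. norm (\<gamma> t) <= B" using periodic_bounded[of \<gamma>] g by metis
	define \<phi> where "\<phi> = (%t. complex_of_real (\<gamma> t) / a t)"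
	have phc: "continuous_on UNIV \<phi>" unfolding \<phi>_def by (intro continuous_intros g a_cont) (simp add: a_nz)
	have php: "\<phi> (t + 2*pi) = \<phi> t" for t by (simp add: \<phi>_def g a_per)
	have rn: "r n ~= 0" "abs (r n) <= rho" "- r n ~= 0" "abs (- r n) <= rho" for n using r(1)[of n] r(2)[of n] by auto
	have I: "((%u. \<phi> (s+u) * d (s+u) / (e (s+u) - tub s x)) has_integral integral {0..2*pi} (%t. \<phi> t * d t / (e t - tub s x))) {-pi..pi}"
		if "x ~= 0" "abs x <= rho" for x
		by (rule has_integral_periodic_centred[of "%t. \<phi> t * d t / (e t - tub s x)"])
			 (auto simp: php per d_per intro!: integrable_continuous_real e_ne_tub_cont that phc)
	define F where "F = (%n u. \<gamma> (s+u) * Im (w s (s+u) * (1/(e (s+u) - tub s (r n)) + 1/(e (s+u) - tub s (- r n)))))"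
	have FI: "(F n has_integral Im (a s * (integral {0..2*pi} (%t. \<phi> t * d t / (e t - tub s (r n)))
						 + integral {0..2*pi} (%t. \<phi> t * d t / (e t - tub s (- r n)))))) {-pi..pi}" for n
	proof -
		have "((%u. Im (a s * (\<phi> (s+u) * d (s+u) / (e (s+u) - tub s (r n)) + \<phi> (s+u) * d (s+u) / (e (s+u) - tub s (- r n))))) has_integral Im (a s * (integral {0..2*pi} (%t. \<phi> t * d t / (e t - tub s (r n)))
						 + integral {0..2*pi} (%t. \<phi> t * d t / (e t - tub s (- r n)))))) {-pi..pi}"
			by (intro has_integral_Im has_integral_mult_right has_integral_add I rn)
		moreover have "Im (a s * (\<phi> (s+u) * d (s+u) / (e (s+u) - tub s (r n)) + \<phi> (s+u) * d (s+u) / (e (s+u) - tub s (- r n)))) = F n u" for u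
		proof -
			have "a s * (\<phi> (s+u) * d (s+u) / (e (s+u) - tub s (r n)) + \<phi> (s+u) * d (s+u) / (e (s+u) - tub s (- r n)))
				= of_real (\<gamma> (s+u)) * (w s (s+u) * (1/(e (s+u) - tub s (r n)) + 1/(e (s+u) - tub s (- r n))))"
				by (simp add: \<phi>_def w_def divide_inverse algebra_simps)
			moreover have "Im (of_real x * z) = x * Im z" for x z by simp
			ultimately show ?thesis unfolding F_def by (simp only:)
		qed
		ultimately show ?thesis by simp
	qed
	have ki: "((%u. kern s (s+u) * \<gamma> (s+u)) has_integral integral {0..2*pi} (%t. kern s t * \<gamma> t)) {-pi..pi}"
		by (rule has_integral_periodic_centred[of "%t. kern s t * \<gamma> t"])
			 (auto simp: kern_per g intro!: kern_integrable continuous_on_subset[OF g(1)])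
	have "(%n. integral {-pi..pi} (F n)) \<longlonglongrightarrow> integral {-pi..pi} (%u. 2 * (kern s (s+u) * \<gamma> (s+u)))"
	proof (rule dominated_convergence(2)[where h="%_. B * C"])
		show "F n integrable_on {-pi..pi}" for n using FI by blast
		show "norm (F n u) <= B * C" if "u \<in> {-pi..pi}" for n u
		proof -
			have "abs ((s+u)-s) <= pi" using that by auto
			then show ?thesis unfolding F_def real_norm_def abs_mult
				using B(1) B(2)[of "s+u"] C(2)[of "s+u" s "r n"] r by (intro mult_mono) auto
		qed
		show "(%n. F n u) \<longlonglongrightarrow> 2 * (kern s (s+u) * \<gamma> (s+u))" if u: "u \<in> {-pi..pi}" for u
		proof (cases "u = 0")
			case True
			\<comment> \<open>At \<open>u = 0\<close> the two denominators are opposite to each other, so the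
			  reciprocals cancel.\<close>
			have "F n u = 0" for n
				using True by (simp add: F_def tub_def)
			moreover have "kern s (s+u) = 0" using True by (simp add: kern_def)
			ultimately show ?thesis by simp
		next
			case False
			have "cst * (abs u + abs (0)) > 0" using False cst_pos by (intro mult_pos_pos) auto
			moreover have "abs u <= pi" using u by auto
			ultimately have "e (s+u) - tub s 0 ~= 0" using denominator_lower[of u 0 s] rho_pos by fastforce
			then have "(%n. F n u) \<longlonglongrightarrow> \<gamma> (s+u) * Im (w s (s+u) * (1/(e (s+u) - tub s 0) + 1/(e (s+u) - tub s (- 0))))"
				unfolding F_def by (intro tendsto_intros tub_tendsto r) auto
			also have "\<gamma> (s+u) * Im (w s (s+u) * (1/(e (s+u) - tub s 0) + 1/(e (s+u) - tub s (- 0)))) = 2 * (kern s (s+u) * \<gamma> (s+u))"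
			proof -
				have "w s (s+u) * (1/(e (s+u) - tub s 0) + 1/(e (s+u) - tub s (- 0))) = 2 * (w s (s+u) / (e (s+u) - e s))" by simp
				moreover have "Im (2 * z) = 2 * Im z" for z by simp
				ultimately show ?thesis unfolding kern_def by (simp only:) simp
			qed
			finally show ?thesis .
		qed
	qed auto
	then have "(%n. integral {-pi..pi} (F n)) \<longlonglongrightarrow> 2 * integral {0..2*pi} (%t. kern s t * \<gamma> t)"
		using integral_unique[OF has_integral_mult_right[OF ki, of 2]] by simp
	then show ?thesis using integral_unique[OF FI] by (simp add: \<phi>_def)
qed

end

section \<open>Regularity of the kernel in its first variable\<close>

context weighted_loop
begin

text \<open>Away from the diagonal the form of the kernel in \<open>kern_eq\<close> is compared at
  \<open>s\<close> and \<open>s'\<close>; the condition \<open>2 * abs (s-s') <= abs (t-s)\<close>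
  keeps \<open>t-s\<close> and \<open>t-s'\<close> of comparable size.\<close>

lemma kern_diff_bound:
	obtains C where "C > 0" "!!s s' t. [|abs (t-s) <= pi; 2 * abs (s-s') <= abs (t-s); t ~= s|] ==> abs (kern s t - kern s' t) <= C * (abs (s-s') / abs (t-s))"
proof -
	obtain L where L: "L > 0" "!!t. norm (d t) <= L" "!!s t. norm (d t - d s) <= L * abs (t-s)"
		"!!s t. norm (e t - e s) <= L * abs (t-s)"
		"!!s t. norm (e t - e s - of_real (t-s) * d s) <= L * (t-s)^2"
		"!!s t. norm (w s t - d s) <= L * abs (t-s)"
		"!!s t. norm (a t - a s) <= L * abs (t-s)" "!!t. norm (d t / a t) <= L"
		using kernel_consts by blast
	define C where "C = (L^2 + 2*L) / cst + 5 * L^2 / cst^2"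
	show ?thesis
	proof (rule that[of C])
		show "C > 0" using L(1) cst_pos by (simp add: C_def add_pos_pos)
		fix s s' t :: real assume *: "abs (t-s) <= pi" "2 * abs (s-s') <= abs (t-s)" "t ~= s"
		define u u' \<delta> where "u = t-s" and "u' = t-s'" and "\<delta> = abs (s-s')"
		define y y' where "y = e t - e s" and "y' = e t - e s'"
		define p p' where "p = w s t * of_real u - y" and "p' = w s' t * of_real u' - y'"
		have u: "abs u > 0" "abs u' >= abs u/2" "2 * abs u' <= 3 * abs u" "\<delta> >= 0" "2 * \<delta> <= abs u" "abs u' > 0"
		proof -
			have 1: "abs (t-s) > 0" using *(3) by simp
			have 2: "abs (t-s)/2 <= abs (t-s')" using *(2) by argo
			have 3: "2 * abs (t-s') <= 3 * abs (t-s)" using *(2) by argo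
			show "abs u > 0" "abs u' >= abs u/2" "2 * abs u' <= 3 * abs u" "\<delta> >= 0" "2 * \<delta> <= abs u" "abs u' > 0"
				using 1 2 3 *(2) unfolding u_def u'_def \<delta>_def by auto
		qed
		have "abs (t-s) <= 3*pi/2" "abs (t-s') <= 3*pi/2" using *(1,2) pi_gt_zero by argo+
		then have ch: "norm y >= cst * abs u" "norm y' >= cst * abs u'"
			using chord_lower unfolding y_def y'_def u_def u'_def by auto
		have cp: "cst * abs u > 0" "cst * abs u' > 0" using u cst_pos by auto
		then have ny: "y ~= 0" "y' ~= 0" using ch by auto
		have nu: "u ~= 0" "u' ~= 0" using u by auto
		have k: "kern s t = Im (p / (y * of_real u))" "kern s' t = Im (p' / (y' * of_real u'))"
			using kern_eq[of t s] kern_eq[of t s'] ny nu by (auto simp: p_def p'_def y_def y'_def u_def u'_def)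
		have split: "p / (y * of_real u) - p' / (y' * of_real u') =
				(p - p') / (y * of_real u) + p' * (y' * of_real u' - y * of_real u) / ((y * of_real u) * (y' * of_real u'))"
			using ny nu by (simp add: field_simps)
		\<comment> \<open>Expanding at \<open>s'\<close> cancels the terms of first order in
		  \<open>s-s'\<close> alone; each summand that is left is at most a constant times
		  \<open>\<delta> * abs u\<close>.\<close>
		have pp: "p - p' = (d t / a t) * (a s - a s') * of_real u + of_real (s'-s) * (w s' t - d s') + (e s - e s' - of_real (s-s') * d s')"
			using a_nz[of t] unfolding p_def p'_def w_def u_def u'_def y_def y'_def by (simp add: field_simps)
		have b1: "norm (p - p') <= (L^2 + 2*L) * \<delta> * abs u"
		proof -
			have "norm (p - p') <= (L * (L * \<delta>)) * abs u + \<delta> * (L * abs u') + L * \<delta>^2"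
				unfolding pp
			proof (intro order_trans[OF norm_triangle_ineq] add_mono)
				show "norm (d t / a t * (a s - a s') * of_real u) <= L * (L * \<delta>) * abs u"
					unfolding norm_mult norm_of_real using L u by (intro mult_mono) (auto simp: \<delta>_def)
				show "norm (of_real (s'-s) * (w s' t - d s')) <= \<delta> * (L * abs u')"
					unfolding norm_mult norm_of_real using L u by (intro mult_mono) (auto simp: \<delta>_def u'_def)
				show "norm (e s - e s' - of_real (s-s') * d s') <= L * \<delta>^2"
					using L(5)[of s s'] by (simp add: \<delta>_def)
			qed
			moreover have "2 * (\<delta> * (L * abs u')) <= 3 * (L * \<delta> * abs u)"
				using mult_left_mono[OF u(3), of "L * \<delta>"] L(1) u(4) by (simp add: algebra_simps)
			moreover have "2 * (L * \<delta>^2) <= L * \<delta> * abs u"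
				using mult_left_mono[OF u(5), of "L * \<delta>"] L(1) u(4) by (simp add: algebra_simps power2_eq_square)
			ultimately show ?thesis by (simp add: algebra_simps power2_eq_square)
		qed
		have b2: "norm p' <= 2 * L * u'^2"
			unfolding p'_def u'_def y'_def by (rule numerator_bound[OF L(5,6)])
		have b3: "norm (y' * of_real u' - y * of_real u) <= 5/2 * L * \<delta> * abs u"
		proof -
			have "y' * of_real u' - y * of_real u = y' * of_real (s - s') + of_real u * (e s - e s')"
				by (simp add: y_def y'_def u_def u'_def algebra_simps)
			also have "norm \<dots> <= (L * abs u') * \<delta> + abs u * (L * \<delta>)"
				using L by (intro order_trans[OF norm_triangle_ineq] add_mono; unfold norm_mult norm_of_real; intro mult_mono)
					 (auto simp: \<delta>_def u'_def y'_def)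
			also have "\<dots> <= 5/2 * L * \<delta> * abs u"
				using mult_left_mono[OF u(3), of "L * \<delta>"] L(1) u(4) by (simp add: algebra_simps)
			finally show ?thesis .
		qed
		have "abs (kern s t - kern s' t) <= norm (p / (y * of_real u) - p' / (y' * of_real u'))"
			unfolding k using abs_Im_le_cmod by (metis minus_complex.simps(2))
		also have "\<dots> <= (L^2 + 2*L) * \<delta> * abs u / (cst * abs u * abs u) + (2 * L * u'^2) * (5/2 * L * \<delta> * abs u) / ((cst * abs u * abs u) * (cst * abs u' * abs u'))"
			unfolding split
		proof (intro order_trans[OF norm_triangle_ineq] add_mono)
			show "norm ((p - p') / (y * of_real u)) <= (L^2 + 2*L) * \<delta> * abs u / (cst * abs u * abs u)"
				unfolding norm_divide norm_mult norm_of_real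
				using b1 ch cp u L(1) by (intro frac_le mult_right_mono) auto
			show "norm (p' * (y' * of_real u' - y * of_real u) / ((y * of_real u) * (y' * of_real u'))) <= (2 * L * u'^2) * (5/2 * L * \<delta> * abs u) / ((cst * abs u * abs u) * (cst * abs u' * abs u'))"
				unfolding norm_divide norm_mult[of p'] norm_mult[of "y * of_real u"] norm_mult[of y "of_real u"] norm_mult[of y' "of_real u'"] norm_of_real
				using b2 b3 ch cp u L(1) cst_pos by (intro frac_le mult_mono mult_right_mono mult_pos_pos) auto
		qed
		also have "\<dots> = C * (\<delta> / abs u)"
		proof -
			have "(2 * L * V) * (5/2 * L * \<delta> * U) / ((cst * U * U) * (cst * W * W)) = 5 * L^2 / cst^2 * (\<delta> / U)"
				if "V = W * W" "W ~= 0" "U ~= 0" for U V W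
				using that cst_pos by (simp add: field_simps power2_eq_square)
			from this[of "u'^2" "abs u'" "abs u"]
			have "(2 * L * u'^2) * (5/2 * L * \<delta> * abs u) / ((cst * abs u * abs u) * (cst * abs u' * abs u')) = 5 * L^2 / cst^2 * (\<delta> / abs u)"
				using nu by (simp only: abs_mult_self_eq power2_eq_square)
			moreover have "(L^2 + 2*L) * \<delta> * abs u / (cst * abs u * abs u) = (L^2 + 2*L) / cst * (\<delta> / abs u)"
				using nu by simp
			ultimately show ?thesis unfolding C_def by (simp only: distrib_right)
		qed
		finally show "abs (kern s t - kern s' t) <= C * (abs (s-s') / abs (t-s))" by (simp add: \<delta>_def u_def)
	qed
qed

text \<open>The crude bound near the diagonal and \<open>kern_diff_bound\<close> away from it are
  both dominated by a multiple of \<open>sqrt (abs (s-s') / abs u)\<close>, which is integrable in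
  \<open>u\<close>. The exponent 1/2 chosen here becomes the Hoelder exponent of
  \<open>N x\<close>.\<close>

lemma kern_L1_holder:
	obtains C where "C > 0" "!!s s'. integral {0..2*pi} (%t. abs (kern s t - kern s' t)) <= C * sqrt (abs (s-s'))"
proof -
	obtain C1 where C1: "C1 > 0" "!!s t. abs (kern s t) <= C1" using kern_bound by blast
	obtain C2 where C2: "C2 > 0" "!!s s' t. [|abs (t-s) <= pi; 2 * abs (s-s') <= abs (t-s); t ~= s|] ==> abs (kern s t - kern s' t) <= C2 * (abs (s-s') / abs (t-s))"
		using kern_diff_bound by blast
	define C3 where "C3 = 4 * C1 + C2"
	have C3: "C3 > 0" using C1(1) C2(1) by (simp add: C3_def)
	have pt: "abs (kern s (s+u) - kern s' (s+u)) <= C3 * (sqrt (abs (s-s')) * abs u powr (-1/2))" if "abs u <= pi" "u ~= 0" for s s' u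
	proof -
		have pw: "abs u powr (-1/2) = 1 / sqrt (abs u)"
			using that(2) by (simp add: powr_minus_divide powr_half_sqrt)
		have q: "sqrt (abs (s-s')) * abs u powr (-1/2) = sqrt (abs (s-s') / abs u)" unfolding pw by (simp add: real_sqrt_divide)
		have q0: "abs (s-s') / abs u >= 0" by simp
		show ?thesis
		proof (cases "2 * abs (s-s') <= abs u")
			case True
			then have "abs (s-s') <= abs u" by argo
			then have le1: "abs (s-s') / abs u <= 1" using that by simp
			have "abs (s-s') / abs u = sqrt (abs (s-s') / abs u) * sqrt (abs (s-s') / abs u)" using q0 by simp
			also have "\<dots> <= sqrt (abs (s-s') / abs u) * 1" using le1 q0 by (intro mult_left_mono) auto
			finally have le: "abs (s-s') / abs u <= sqrt (abs (s-s') / abs u)" by simp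
			have "abs (kern s (s+u) - kern s' (s+u)) <= C2 * (abs (s-s') / abs u)"
				using C2(2)[of "s+u" s s'] that True by simp
			also have "\<dots> <= C3 * sqrt (abs (s-s') / abs u)"
				using le q0 C1(1) C2(1) by (intro mult_mono) (auto simp: C3_def)
			finally show ?thesis unfolding q .
		next
			case False
			then have "abs (s-s') / abs u >= (1/2)^2" using that by (simp add: field_simps power2_eq_square)
			then have "sqrt (abs (s-s') / abs u) >= 1/2" by (rule real_le_rsqrt)
			then have "C3 * (1/2) <= C3 * sqrt (abs (s-s') / abs u)" using C3 by (intro mult_left_mono) auto
			moreover have "abs (kern s (s+u) - kern s' (s+u)) <= 2 * C1"
				using C1(2)[of s "s+u"] C1(2)[of s' "s+u"] by linarith
			ultimately show ?thesis unfolding q C3_def using C2(1) by (simp add: algebra_simps)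
		qed
	qed
	define I where "I = integral {-pi..pi} (%u::real. abs u powr (-1/2))"
	have Ii: "((%u::real. abs u powr (-1/2)) has_integral I) {-pi..pi}"
		unfolding I_def by (rule integrable_integral[OF powr_abs_integrable]) simp
	have I0: "I >= 0" using has_integral_nonneg[OF Ii] by simp
	show ?thesis
	proof (rule that[of "C3 * I + 1"])
		show "C3 * I + 1 > 0" using C3 I0 by (simp add: add_nonneg_pos)
		fix s s' :: real
		have ai: "(%t. kern s t - kern s' t) absolutely_integrable_on {0..2*pi}"
			using set_integral_diff(1)[OF kern_abs_integrable[of "%_. 1" s] kern_abs_integrable[of "%_. 1" s']] by simp
		then have i: "(%t. abs (kern s t - kern s' t)) integrable_on {0..2*pi}"
			by (simp add: absolutely_integrable_on_def)
		have "((%u. abs (kern s (s+u) - kern s' (s+u))) has_integral integral {0..2*pi} (%t. abs (kern s t - kern s' t))) {-pi..pi}"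
			by (rule has_integral_periodic_centred[of "%t. abs (kern s t - kern s' t)"]) (use i in \<open>auto simp: kern_per\<close>)
		\<comment> \<open>The value at \<open>u = 0\<close> is replaced because the majorant is 0 there:
		  \<open>0 powr (-1/2) = 0\<close>.\<close>
		then have "((%u. if u = 0 then 0 else (abs (kern s (s+u) - kern s' (s+u)))) has_integral integral {0..2*pi} (%t. abs (kern s t - kern s' t))) {-pi..pi}"
			by (rule has_integral_spike_finite[of "{0}", rotated 2]) auto
		moreover have "((%u. C3 * (sqrt (abs (s-s')) * abs u powr (-1/2))) has_integral (C3 * (sqrt (abs (s-s')) * I))) {-pi..pi}"
			by (intro has_integral_mult_right Ii)
		ultimately have "integral {0..2*pi} (%t. abs (kern s t - kern s' t)) <= C3 * (sqrt (abs (s-s')) * I)"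
		proof (rule has_integral_le)
			fix u assume u: "u \<in> {-pi..pi}"
			then have "abs u <= pi" by auto
			then show "(if u = 0 then 0 else (abs (kern s (s+u) - kern s' (s+u)))) <= C3 * (sqrt (abs (s-s')) * abs u powr (-1/2))"
				using pt[of u s s'] by simp
		qed
		also have "\<dots> <= (C3 * I + 1) * sqrt (abs (s-s'))" by (simp add: algebra_simps)
		finally show "integral {0..2*pi} (%t. abs (kern s t - kern s' t)) <= (C3 * I + 1) * sqrt (abs (s-s'))" .
	qed
qed

lemma kern_op_bound:
	obtains C where "C > 0"
		"!!x B s. [|continuous_on {0..2*pi} x; !!t. t \<in> {0..2*pi} ==> abs (x t) <= B|] ==>
				abs (integral {0..2*pi} (%t. kern s t * x t)) <= C * B"
		"!!x B s s'. [|continuous_on {0..2*pi} x; !!t. t \<in> {0..2*pi} ==> abs (x t) <= B|] ==>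
				abs (integral {0..2*pi} (%t. kern s t * x t) - integral {0..2*pi} (%t. kern s' t * x t)) <= C * B * sqrt (abs (s-s'))"
proof -
	obtain C1 where C1: "C1 > 0" "!!s t. abs (kern s t) <= C1" using kern_bound by blast
	obtain C2 where C2: "C2 > 0" "!!s s'. integral {0..2*pi} (%t. abs (kern s t - kern s' t)) <= C2 * sqrt (abs (s-s'))"
		using kern_L1_holder by blast
	show ?thesis
	proof (rule that[of "2*pi*C1 + C2"])
		show "2*pi*C1 + C2 > 0" using C1(1) C2(1) by (simp add: add_pos_pos)
		fix x :: "real => real" and B s s' :: real
		assume x: "continuous_on {0..2*pi} x" "!!t. t \<in> {0..2*pi} ==> abs (x t) <= B"
		have B: "B >= 0" using x(2)[of 0] by auto
		have "norm (integral {0..2*pi} (%t. kern s t * x t)) <= integral {0..2*pi} (%t. C1 * B)"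
		proof (rule Henstock_Kurzweil_Integration.integral_norm_bound_integral)
			show "norm (kern s t * x t) <= C1 * B" if "t \<in> {0..2*pi}" for t
				unfolding real_norm_def abs_mult
				by (rule mult_mono[OF C1(2) x(2)[OF that]]) (use C1(1) in simp_all)
			show "(%t. kern s t * x t) integrable_on {0..2*pi}" by (rule kern_integrable[OF x(1)])
			show "(%t. C1 * B) integrable_on {0..2*pi}" by (rule integrable_const_ivl)
		qed
		also have "\<dots> = 2*pi*C1*B" by simp
		also have "\<dots> <= (2*pi*C1 + C2) * B" using C2(1) B by (simp add: algebra_simps)
		finally show "abs (integral {0..2*pi} (%t. kern s t * x t)) <= (2*pi*C1 + C2) * B" by simp
		have ai: "(%t. kern s t - kern s' t) absolutely_integrable_on {0..2*pi}"
			using set_integral_diff(1)[OF kern_abs_integrable[of "%_. 1" s] kern_abs_integrable[of "%_. 1" s']] by simp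
		then have i: "(%t. abs (kern s t - kern s' t)) integrable_on {0..2*pi}"
			by (simp add: absolutely_integrable_on_def)
		have eq: "integral {0..2*pi} (%t. kern s t * x t) - integral {0..2*pi} (%t. kern s' t * x t)
				= integral {0..2*pi} (%t. kern s t * x t - kern s' t * x t)"
			by (rule integral_diff[symmetric]) (intro kern_integrable x)+
		have "norm (integral {0..2*pi} (%t. kern s t * x t - kern s' t * x t)) <= integral {0..2*pi} (%t. abs (kern s t - kern s' t) * B)"
		proof (rule Henstock_Kurzweil_Integration.integral_norm_bound_integral)
			show "(%t. kern s t * x t - kern s' t * x t) integrable_on {0..2*pi}"
				by (intro integrable_diff kern_integrable x)
			show "(%t. abs (kern s t - kern s' t) * B) integrable_on {0..2*pi}"
				by (rule integrable_on_mult_left[OF i])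
			show "norm (kern s t * x t - kern s' t * x t) <= abs (kern s t - kern s' t) * B" if "t \<in> {0..2*pi}" for t
			proof -
				have "kern s t * x t - kern s' t * x t = (kern s t - kern s' t) * x t" by (simp add: algebra_simps)
				then show ?thesis using x(2)[OF that] by (simp only: real_norm_def abs_mult) (simp add: mult_left_mono)
			qed
		qed
		also have "\<dots> = integral {0..2*pi} (%t. abs (kern s t - kern s' t)) * B"
			by (rule integral_mult_left)
		also have "\<dots> <= (C2 * sqrt (abs (s-s'))) * B" by (intro mult_right_mono C2 B)
		also have "\<dots> <= (2*pi*C1 + C2) * B * sqrt (abs (s-s'))"
			using C1(1) B by (simp add: algebra_simps)
		finally show "abs (integral {0..2*pi} (%t. kern s t * x t) - integral {0..2*pi} (%t. kern s' t * x t)) <= (2*pi*C1 + C2) * B * sqrt (abs (s-s'))"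
			unfolding eq by simp
	qed
qed

end

section \<open>Contour integrals and winding numbers along parametrised loops\<close>

lemma curve_ends [simp]: "pathstart (curve c) = c 0" "pathfinish (curve c) = c (2*pi)"
	by (auto simp: curve_def pathstart_def pathfinish_def)

lemma path_image_curve: "path_image (curve c) = c ` {0..2*pi}"
proof -
	have "(%u. 2*pi*u) ` {0..1} = {0..2*pi}"
		using image_mult_atLeastAtMost[of "2*pi" 0 1] by simp
	then have "c ` {0..2*pi} = (%u. c (2*pi*u)) ` {0..1}" by (simp only: image_image flip: \<open>(%u. 2*pi*u) ` {0..1} = {0..2*pi}\<close>)
	then show ?thesis unfolding path_image_def curve_def by simp
qed

lemma curve_vector_derivative:
	fixes c c' :: "real => complex"
	assumes "!!t. (c has_vector_derivative c' t) (at t)"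
	shows "(curve c has_vector_derivative (2*pi) * c' (2*pi*x)) (at x)"
proof -
	have "((c \<circ> (%u. 2*pi*u)) has_vector_derivative ((2*pi) *\<^sub>R c' (2*pi*x))) (at x)"
		by (rule vector_diff_chain_at) (auto intro!: derivative_eq_intros assms)
	then show ?thesis by (simp add: curve_def o_def scaleR_conv_of_real)
qed

lemma valid_path_curve:
	fixes c c' :: "real => complex"
	assumes "!!t. (c has_vector_derivative c' t) (at t)" "continuous_on UNIV c'"
	shows "valid_path (curve c)"
proof -
	have "curve c C1_differentiable_on {0..1}"
		unfolding C1_differentiable_on_def
	proof (intro exI[of _ "%x. (2*pi) * c' (2*pi*x)"] conjI ballI)
		show "(curve c has_vector_derivative (2*pi) * c' (2*pi*x)) (at x)" for x
			by (rule curve_vector_derivative[OF assms(1)])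
		show "continuous_on {0..1} (%x. (2*pi) * c' (2*pi*x))"
			by (intro continuous_intros continuous_on_compose2[OF assms(2)]) auto
	qed
	then show ?thesis
		unfolding valid_path_def by (rule C1_differentiable_imp_piecewise)
qed

lemma has_contour_integral_curve:
	fixes c c' :: "real => complex"
	assumes c: "!!t. (c has_vector_derivative c' t) (at t)" "continuous_on UNIV c'"
		and f: "continuous_on (c ` {0..2*pi}) f"
	shows "(f has_contour_integral integral {0..2*pi} (%t. f (c t) * c' t)) (curve c)"
proof -
	have cc: "continuous_on UNIV c"
		using c(1) by (meson continuous_at_imp_continuous_on has_vector_derivative_continuous)
	have "continuous_on {0..2*pi} (%t. f (c t) * c' t)"
		by (intro continuous_intros continuous_on_compose2[OF f] continuous_on_subset[OF cc] continuous_on_subset[OF c(2)]) auto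
	then have "((%t. f (c t) * c' t) has_integral integral {0..2*pi} (%t. f (c t) * c' t)) (cbox 0 (2*pi))"
		unfolding cbox_interval by (intro integrable_integral integrable_continuous_real)
	from has_integral_affinity'[OF this, of "2*pi" 0]
	have "((%x. f (c (2*pi*x)) * c' (2*pi*x)) has_integral (integral {0..2*pi} (%t. f (c t) * c' t) /\<^sub>R (2*pi))) {0..1}"
		by simp
	note A = this
	have B: "of_real (2*pi) * (I /\<^sub>R (2*pi)) = I" for I :: complex
		by (simp add: scaleR_conv_of_real)
	have "((%x. of_real (2*pi) * (f (c (2*pi*x)) * c' (2*pi*x))) has_integral (integral {0..2*pi} (%t. f (c t) * c' t))) {0..1}"
		using has_integral_mult_right[OF A, of "of_real (2*pi)"] unfolding B .
	then have "((%x. f (curve c x) * ((2*pi) * c' (2*pi*x))) has_integral (integral {0..2*pi} (%t. f (c t) * c' t))) {0..1}"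
		by (simp add: curve_def mult_ac)
	moreover have "vector_derivative (curve c) (at x) = (2*pi) * c' (2*pi*x)" for x
		by (rule vector_derivative_at[OF curve_vector_derivative[OF c(1)]])
	ultimately show ?thesis unfolding has_contour_integral by simp
qed

lemma winding_number_curve:
	fixes c c' :: "real => complex"
	assumes c: "!!t. (c has_vector_derivative c' t) (at t)" "continuous_on UNIV c'"
		and z: "z ~: c ` {0..2*pi}"
	shows "winding_number (curve c) z = integral {0..2*pi} (%t. c' t / (c t - z)) / (2*pi*\<i>)"
proof -
	have "((%w. 1/(w-z)) has_contour_integral integral {0..2*pi} (%t. 1/(c t - z) * c' t)) (curve c)"
		by (rule has_contour_integral_curve[OF c]) (use z in \<open>auto intro!: continuous_intros\<close>)
	then show ?thesis
		using winding_number_valid_path[OF valid_path_curve[OF c], of z] z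
		by (simp add: path_image_curve contour_integral_unique)
qed

locale cw_loop = smooth_loop +
	assumes cw: "!!z. z \<in> inside (range e) ==> winding_number (curve e) z = -1"
begin

abbreviation "Ins \<equiv> inside (range e)"
abbreviation "Out \<equiv> outside (range e)"

lemma range_e: "range e = e ` {0..2*pi}"
proof -
	have "e t \<in> e ` {0..2*pi}" for t
	proof -
		obtain n :: int where "0 <= t + 2*pi* of_int n" "t + 2*pi* of_int n < 0 + 2*pi"
			by (rule reduce_mod_2pi)
		then show ?thesis by (intro image_eqI[of _ _ "t + 2*pi* of_int n"]) (auto simp: e_int)
	qed
	then show ?thesis by auto
qed

lemma path_image_e: "path_image (curve e) = range e"
	by (simp add: path_image_curve range_e)

lemma compact_range: "compact (range e)"
	unfolding range_e by (intro compact_continuous_image e_cont') auto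

lemma valid_e: "valid_path (curve e)" by (rule valid_path_curve[OF der d_cont])

lemma path_e: "path (curve e)" by (rule valid_path_imp_path[OF valid_e])

lemma loop_e: "pathfinish (curve e) = pathstart (curve e)" using per[of 0] by simp

lemma simple_e: "simple_path (curve e)"
	unfolding simple_path_def loop_free_def
proof (intro conjI path_e ballI impI)
	fix x y :: real assume xy: "x \<in> {0..1}" "y \<in> {0..1}" "curve e x = curve e y"
	then obtain n :: int where "2*pi*x = 2*pi*y + 2*pi* of_int n" unfolding curve_def using e_eqD by blast
	then have "2*pi*(x - y - of_int n) = 0" by (simp add: algebra_simps)
	then have n: "x - y = of_int n" by simp
	then have "abs (real_of_int n) <= 1" using xy by auto
	then have "n = 0 \<or> n = 1 \<or> n = -1" by linarith
	then show "x = y \<or> x = 0 & y = 1 \<or> x = 1 & y = 0" using n xy by auto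
qed

lemmas jordan = Jordan_inside_outside[OF simple_e loop_e, unfolded path_image_e]

lemma open_inside_e: "open Ins" and open_outside_e: "open Out"
	and connected_inside_e: "connected Ins" and connected_outside_e: "connected Out"
	and bounded_inside_e: "bounded Ins" and inside_ne: "Ins ~= {}"
	and in_out_disj: "Ins \<inter> Out = {}"
	and in_out_Un: "Ins Un Out = - range e"
	and frontier_inside_e: "frontier Ins = range e"
	and frontier_outside_e: "frontier Out = range e"
	using jordan by auto

lemma in_or_out: "z ~: range e ==> z \<in> Ins \<or> z \<in> Out"
	using in_out_Un by blast

lemma winding_out: "z \<in> Out ==> winding_number (curve e) z = 0"
	by (rule winding_number_zero_in_outside[OF path_e loop_e]) (simp add: path_image_e)

lemma winding_integral:
	"z ~: range e ==> winding_number (curve e) z = integral {0..2*pi} (%t. d t / (e t - z)) / (2*pi*\<i>)"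
	by (rule winding_number_curve[OF der d_cont]) (auto simp: range_e)

lemma connected_tube:
	assumes "convex I"
	shows "connected {tub s r | s r. r \<in> I}"
proof -
	have "connected ((%p. tub (fst p) (snd p)) ` (UNIV \<times> I))"
		by (intro connected_continuous_image tub_cont continuous_intros connected_Times connected_UNIV convex_connected assms)
	moreover have "(%p. tub (fst p) (snd p)) ` (UNIV \<times> I) = {tub s r | s r. r \<in> I}" by force
	ultimately show ?thesis by simp
qed

lemma connected_in_or_out:
	assumes "connected S" "S \<inter> range e = {}"
	shows "S <= Ins \<or> S <= Out"
proof -
	have "Ins \<inter> S = {} \<or> Out \<inter> S = {}"
		using connectedD[OF assms(1) open_inside_e open_outside_e] in_out_disj in_out_Un assms(2) by blast
	then show ?thesis using in_out_Un assms(2) by blast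
qed

text \<open>Each open half collar is connected and misses the curve, hence lies on one side. By
  \<open>jump_limit\<close> the winding number at \<open>tub s r\<close> exceeds that at
  \<open>tub s (-r)\<close> by 1 in the limit, and the values -1 inside and 0 outside leave a single
  assignment.\<close>

lemma tub_sides:
	assumes "0 < r" "r <= rho"
	shows "tub s r \<in> Out" "tub s (-r) \<in> Ins"
proof -
	interpret W: weighted_loop e d dd "%_. 1" by unfold_locales (auto intro: exI[of _ 0])
	define Up where "Up = {tub s r | s r. r \<in> {0<..rho}}"
	define Um where "Um = {tub s r | s r. r \<in> {-rho..<0}}"
	have dis: "Up \<inter> range e = {}" "Um \<inter> range e = {}"
	proof -
		have "tub s r ~= e t" if "r ~= 0" "abs r <= rho" for s r t using tub_ne[OF that, of t s] by simp
		then have ne: "tub s r ~: range e" if "r ~= 0" "abs r <= rho" for s r using that by blast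
		have "x ~: range e" if "x \<in> Up" for x
		proof -
			from that obtain s r where "x = tub s r" "0 < r" "r <= rho" by (auto simp: Up_def)
			then show ?thesis using ne[of r s] by simp
		qed
		moreover have "x ~: range e" if "x \<in> Um" for x
		proof -
			from that obtain s r where "x = tub s r" "r < 0" "-rho <= r" by (auto simp: Um_def)
			then show ?thesis using ne[of r s] by simp
		qed
		ultimately show "Up \<inter> range e = {}" "Um \<inter> range e = {}" by blast+
	qed
	have side: "Up <= Ins \<or> Up <= Out" "Um <= Ins \<or> Um <= Out"
	proof -
		have "connected Up" "connected Um" unfolding Up_def Um_def by (intro connected_tube convex_real_interval)+
		then show "Up <= Ins \<or> Up <= Out" "Um <= Ins \<or> Um <= Out"
			using dis connected_in_or_out by blast+
	qed
	define x where "x = (%n. rho / real (Suc n))"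
	have x: "0 < x n" "x n <= rho" for n using rho_pos by (auto simp: x_def field_simps)
	have x0: "x \<longlonglongrightarrow> 0" unfolding x_def by (rule lim_const_over_n[THEN LIMSEQ_Suc])
	have mem: "tub s (x n) \<in> Up" "tub s (- x n) \<in> Um" for n
		using x[of n] by (force simp: Up_def, intro CollectI[of "%z. \<exists>s r. z = tub s r & r \<in> {-rho..<0}", folded Um_def] exI[of _ s] exI[of _ "- x n"]) auto
	have "(%n. integral {0..2*pi} (%t. d t / (e t - tub s (x n))) - integral {0..2*pi} (%t. d t / (e t - tub s (- x n)))) \<longlonglongrightarrow> 2*pi*\<i>"
		by (rule W.jump_limit[OF x x0])
	then have "(%n. (integral {0..2*pi} (%t. d t / (e t - tub s (x n))) - integral {0..2*pi} (%t. d t / (e t - tub s (- x n)))) / (2*pi*\<i>)) \<longlonglongrightarrow> 2*pi*\<i> / (2*pi*\<i>)"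
		by (intro tendsto_divide tendsto_const) auto
	moreover have "(integral {0..2*pi} (%t. d t / (e t - tub s (x n))) - integral {0..2*pi} (%t. d t / (e t - tub s (- x n)))) / (2*pi*\<i>)
		 = winding_number (curve e) (tub s (x n)) - winding_number (curve e) (tub s (- x n))" for n
		using winding_integral[of "tub s (x n)"] winding_integral[of "tub s (- x n)"] mem[of n] dis
		by (simp add: diff_divide_distrib disjoint_iff)
	ultimately have lim: "(%n. winding_number (curve e) (tub s (x n)) - winding_number (curve e) (tub s (- x n))) \<longlonglongrightarrow> 1"
		by simp
	have no: False if "!!n. winding_number (curve e) (tub s (x n)) - winding_number (curve e) (tub s (- x n)) = c" "c ~= 1" for c
		using lim that by (simp add: LIMSEQ_const_iff)
	have Wi: "winding_number (curve e) (tub s (x n)) = -1" if "Up <= Ins" for n using cw mem that by blast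
	have Wo: "winding_number (curve e) (tub s (x n)) = 0" if "Up <= Out" for n using winding_out mem that by blast
	have Vi: "winding_number (curve e) (tub s (- x n)) = -1" if "Um <= Ins" for n using cw mem that by blast
	have Vo: "winding_number (curve e) (tub s (- x n)) = 0" if "Um <= Out" for n using winding_out mem that by blast
	have "Up <= Out & Um <= Ins"
	proof -
		have "\<not> Up <= Ins"
		proof
			assume u: "Up <= Ins"
			show False using side(2) no[of 0] no[of "-1"] Wi[OF u] Vi Vo by auto
		qed
		moreover have "\<not> Um <= Out"
			using side(1) no[of 0] Wo Vo calculation by auto
		ultimately show ?thesis using side by blast
	qed
	moreover have "tub s r \<in> Up" "tub s (-r) \<in> Um" 
		using assms by (force simp: Up_def, intro CollectI[of "%z. \<exists>s r. z = tub s r & r \<in> {-rho..<0}", folded Um_def] exI[of _ s] exI[of _ "- r"]) auto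
	ultimately show "tub s r \<in> Out" "tub s (-r) \<in> Ins" by blast+
qed

text \<open>At a nearest point \<open>e s\<close> the derivative of the squared distance vanishes,
  so \<open>z - e s\<close> is orthogonal to the tangent and therefore a real multiple of
  \<open>\<i> * d s\<close>.\<close>

lemma nearest_tub:
	obtains s r where "z = tub s r" "abs r * norm (d s) = dist z (e s)" "!!t. dist z (e s) <= dist z (e t)"
proof -
	obtain p where p: "p \<in> range e" "!!y. y \<in> range e ==> dist z p <= dist z y"
		using distance_attains_inf[of "range e" z] compact_range compact_imp_closed by auto
	then obtain s where s: "p = e s" by auto
	define f where "f t = (e t - z) \<bullet> (e t - z)" for t
	have "(f has_vector_derivative ((e s - z) \<bullet> d s + d s \<bullet> (e s - z))) (at s)"
		unfolding f_def
		by (rule bounded_bilinear.has_vector_derivative[OF bounded_bilinear_inner]) (auto intro!: derivative_eq_intros der)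
	then have D: "DERIV f s :> 2 * ((e s - z) \<bullet> d s)"
		by (simp add: has_real_derivative_iff_has_vector_derivative inner_commute)
	have "f s <= f t" for t
		using p(2)[of "e t"] unfolding s f_def dot_square_norm by (intro power_mono) (auto simp: dist_norm norm_minus_commute)
	then have "2 * ((e s - z) \<bullet> d s) = 0" by (intro DERIV_local_min[OF D zero_less_one]) auto
	then have orth: "Re ((z - e s) * cnj (d s)) = 0" by (simp add: inner_complex_def algebra_simps)
	define r where "r = Im ((z - e s) * cnj (d s)) / (norm (d s))^2"
	have "(z - e s) * cnj (d s) = \<i> * of_real (r * (norm (d s))^2)"
		using orth reg[of s] by (simp add: complex_eq_iff r_def)
	then have "(z - e s) * cnj (d s) = (\<i> * of_real r * d s) * cnj (d s)"
		using complex_norm_square[of "d s"] by (simp add: mult_ac)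
	then have eq: "z - e s = \<i> * of_real r * d s" using reg[of s] by simp
	show ?thesis
	proof (rule that[of s r])
		show "z = tub s r" using eq by (simp add: tub_def algebra_simps)
		show "abs r * norm (d s) = dist z (e s)" unfolding dist_norm eq by (simp add: norm_mult)
	qed (use p s in auto)
qed

text \<open>Tubular coordinates cover a full neighbourhood of the curve. Thus every approach to the
  boundary, not only the normal one, can be expressed in them.\<close>

lemma near_tub:
	assumes "R > 0"
	obtains \<delta> where "\<delta> > 0" "!!z t. dist z (e t) < \<delta> ==> \<exists>s r. z = tub s r & abs r < R"
proof -
	obtain c0 where c0: "c0 > 0" "!!t. norm (d t) >= c0"
		using periodic_bounded_below[of d] d_per d_cont reg by metis
	show ?thesis
	proof (rule that[of "c0 * R"])
		fix z t assume z: "dist z (e t) < c0 * R"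
		obtain s r where sr: "z = tub s r" "abs r * norm (d s) = dist z (e s)" "!!t. dist z (e s) <= dist z (e t)"
			using nearest_tub by blast
		have "abs r * c0 <= abs r * norm (d s)" using c0 by (intro mult_left_mono) auto
		also have "\<dots> < c0 * R" using sr(2) sr(3)[of t] z by linarith
		finally have "abs r < R" using c0(1) by (simp add: mult.commute)
		then show "\<exists>s r. z = tub s r & abs r < R" using sr by blast
	qed (use c0 assms in auto)
qed

end

section \<open>Multiply connected regions\<close>

locale region =
	fixes m :: nat and \<eta> d\<eta> dd\<eta> :: "nat => real => complex" and G :: "complex set"
	assumes loops: "!!k. k < m ==> cw_loop (\<eta> k) (d\<eta> k) (dd\<eta> k)"
		and eta_disj: "!!k l. [|k < m; l < m; k ~= l|] ==> range (\<eta> k) \<inter> range (\<eta> l) = {}"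
		and G_open: "open G" and G_connected: "connected G"
		and G_frontier: "frontier G = Gam m \<eta>"
		and G_bounded: "bounded (- G)"
begin

lemma sloops: "k < m ==> smooth_loop (\<eta> k) (d\<eta> k) (dd\<eta> k)"
	using loops by (simp add: cw_loop_def)

abbreviation T :: "nat => real => real => complex" where
	"T k \<equiv> smooth_loop.tub (\<eta> k) (d\<eta> k)"

abbreviation Gm :: "complex set" where "Gm \<equiv> - (G Un Gam m \<eta>)"

abbreviation ins :: "nat => complex set" where "ins k \<equiv> inside (range (\<eta> k))"

lemma T_0 [simp]: "k < m ==> T k s 0 = \<eta> k s"
	using smooth_loop.tub_0[OF sloops] .

lemma eta_in_Gam: "k < m ==> \<eta> k s \<in> Gam m \<eta>" by (auto simp: Gam_def)

lemma Gam_compact: "compact (Gam m \<eta>)"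
	unfolding Gam_def using cw_loop.compact_range[OF loops] by (intro compact_UN) auto

lemma G_Gam_disj: "G \<inter> Gam m \<eta> = {}"
	using G_open G_frontier by (metis frontier_disjoint_eq inf_commute)

lemma G_Gam_closed: "closed (G Un Gam m \<eta>)"
	using G_frontier by (metis closure_Un_frontier closed_closure)

lemma Gm_open: "open Gm" using G_Gam_closed by (rule open_Compl)

lemma G_outside: assumes "k < m" shows "G <= outside (range (\<eta> k))"
proof -
	interpret K: cw_loop "\<eta> k" "d\<eta> k" "dd\<eta> k" by (rule loops[OF assms])
	have "G \<inter> range (\<eta> k) = {}" using G_Gam_disj assms by (auto simp: Gam_def)
	then consider "G <= ins k" | "G <= outside (range (\<eta> k))" using K.connected_in_or_out[OF G_connected] by blast
	then show ?thesis
	proof cases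
		case 1
		then have "bounded G" using K.bounded_inside_e bounded_subset by blast
		then have "bounded (G Un - G)" using G_bounded by (simp only: bounded_Un)
		then show ?thesis using not_bounded_UNIV[where 'a=complex] by simp
	qed
qed

lemma eta_outside: assumes "k < m" "l < m" "k ~= l" shows "range (\<eta> l) <= outside (range (\<eta> k))"
proof -
	interpret K: cw_loop "\<eta> k" "d\<eta> k" "dd\<eta> k" by (rule loops[OF assms(1)])
	have "range (\<eta> l) <= frontier G" using G_frontier assms by (auto simp: Gam_def)
	also have "\<dots> <= closure G" by (simp add: frontier_def)
	also have "\<dots> <= closure (outside (range (\<eta> k)))" by (rule closure_mono[OF G_outside[OF assms(1)]])
	also have "\<dots> = outside (range (\<eta> k)) Un range (\<eta> k)" using K.frontier_outside_e by (metis closure_Un_frontier)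
	finally show ?thesis using eta_disj[OF assms] by blast
qed

lemma tube_radius:
	obtains R where "R > 0" "!!k. k < m ==> R <= smooth_loop.rho (\<eta> k) (d\<eta> k)"
		"!!k l s s' r r'. [|k < m; l < m; k ~= l; abs r <= R; abs r' <= R|] ==> T k s r ~= T l s' r'"
proof -
	have "\<exists>R>0. \<forall>s s' r r'. abs r <= R --> abs r' <= R --> T (fst p) s r ~= T (snd p) s' r'"
		if pm: "p \<in> {p. fst p < m & snd p < m & fst p ~= snd p}" for p
	proof -
		obtain k l where p: "p = (k,l)" "k < m" "l < m" "k ~= l"
			using pm by (metis (mono_tags, lifting) mem_Collect_eq prod.collapse)
		interpret K: cw_loop "\<eta> k" "d\<eta> k" "dd\<eta> k" by (rule loops[OF p(2)])
		interpret L: cw_loop "\<eta> l" "d\<eta> l" "dd\<eta> l" by (rule loops[OF p(3)])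
		obtain \<delta> where \<delta>: "\<delta> > 0" "!!x y. x \<in> range (\<eta> k) ==> y \<in> range (\<eta> l) ==> \<delta> <= dist x y"
			using separate_compact_closed[OF K.compact_range compact_imp_closed[OF L.compact_range] eta_disj[OF p(2,3,4)]] by blast
		obtain B1 where B1: "B1 > 0" "!!t. norm (d\<eta> k t) <= B1"
			using periodic_bounded[OF K.d_per K.d_cont] by blast
		obtain B2 where B2: "B2 > 0" "!!t. norm (d\<eta> l t) <= B2"
			using periodic_bounded[OF L.d_per L.d_cont] by blast
		define B where "B = B1 + B2"
		define R where "R = (\<delta>/2) / B"
		have BB: "B > 0" using B1(1) B2(1) by (simp add: B_def)
		have R: "R > 0" "R * B < \<delta>" using \<delta>(1) BB by (auto simp: R_def)
		have "T k s r ~= T l s' r'" if "abs r <= R" "abs r' <= R" for s s' r r'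
		proof
			assume "T k s r = T l s' r'"
			then have "\<eta> k s - \<eta> l s' = \<i> * of_real r' * d\<eta> l s' - \<i> * of_real r * d\<eta> k s"
				by (simp add: K.tub_def L.tub_def algebra_simps)
			then have "dist (\<eta> k s) (\<eta> l s') <= abs r' * norm (d\<eta> l s') + abs r * norm (d\<eta> k s)"
				unfolding dist_norm by (metis (no_types, opaque_lifting) norm_triangle_ineq4 norm_mult norm_ii mult_1 norm_of_real)
			also have "\<dots> <= R * B2 + R * B1" using that R B1 B2 by (intro add_mono mult_mono) auto
			also have "\<dots> < \<delta>" using R by (simp add: algebra_simps B_def)
			finally show False using \<delta>(2)[of "\<eta> k s" "\<eta> l s'"] by simp
		qed
		then show ?thesis using R p by auto
	qed
	then have "\<forall>p\<in>{p. fst p < m & snd p < m & fst p ~= snd p}. \<exists>R. R > 0 &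
			(\<forall>s s' r r'. abs r <= R --> abs r' <= R --> T (fst p) s r ~= T (snd p) s' r')"
		by blast
	from bchoice[OF this] obtain Rf where Rf: "!!p. p \<in> {p. fst p < m & snd p < m & fst p ~= snd p} ==> Rf p > 0 &
			(\<forall>s s' r r'. abs r <= Rf p --> abs r' <= Rf p --> T (fst p) s r ~= T (snd p) s' r')"
		by blast
	define S where "S = insert 1 (Rf ` {p. fst p < m & snd p < m & fst p ~= snd p} Un (%k. smooth_loop.rho (\<eta> k) (d\<eta> k)) ` {..<m})"
	have fin: "finite S"
	proof -
		have "finite {p::nat\<times>nat. fst p < m & snd p < m & fst p ~= snd p}"
			by (rule finite_subset[of _ "{..<m} \<times> {..<m}"]) auto
		then show ?thesis by (simp add: S_def)
	qed
	have pos: "x > 0" if "x \<in> S" for x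
		using that Rf smooth_loop.rho_pos[OF sloops] by (auto simp: S_def)
	show ?thesis
	proof (rule that[of "Min S"])
		show "Min S > 0" using fin pos by (subst Min_gr_iff) (auto simp: S_def)
		show "Min S <= smooth_loop.rho (\<eta> k) (d\<eta> k)" if "k < m" for k
			using fin that by (intro Min_le) (auto simp: S_def)
		fix k l s s' r r' assume kl: "k < m" "l < m" "k ~= l" and r: "abs r <= Min S" "abs r' <= Min S"
		have mem: "(k,l) \<in> {p. fst p < m & snd p < m & fst p ~= snd p}" using kl by simp
		have "Rf (k,l) \<in> S" using mem unfolding S_def by blast
		then have "Min S <= Rf (k,l)" using fin by (intro Min_le)
		then show "T k s r ~= T l s' r'" using Rf[OF mem] r by auto
	qed
qed

text \<open>A radius common to all curves, fixed once like \<open>rho\<close>: up to it the collars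
  of different curves are disjoint.\<close>

definition RR :: real where
	"RR = (SOME R. R > 0 & (\<forall>k<m. R <= smooth_loop.rho (\<eta> k) (d\<eta> k)) &
		(\<forall>k l s s' r r'. k < m --> l < m --> k ~= l --> abs r <= R --> abs r' <= R --> T k s r ~= T l s' r'))"

lemma RR_pos: "RR > 0" and RR_rho: "!!k. k < m ==> RR <= smooth_loop.rho (\<eta> k) (d\<eta> k)"
	and T_disj: "!!k l s s' r r'. [|k < m; l < m; k ~= l; abs r <= RR; abs r' <= RR|] ==> T k s r ~= T l s' r'"
proof -
	have "\<exists>R. R > 0 & (\<forall>k<m. R <= smooth_loop.rho (\<eta> k) (d\<eta> k)) &
		(\<forall>k l s s' r r'. k < m --> l < m --> k ~= l --> abs r <= R --> abs r' <= R --> T k s r ~= T l s' r')"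
		by (rule tube_radius) blast
	from someI_ex[OF this, folded RR_def]
	show "RR > 0" "!!k. k < m ==> RR <= smooth_loop.rho (\<eta> k) (d\<eta> k)"
		"!!k l s s' r r'. [|k < m; l < m; k ~= l; abs r <= RR; abs r' <= RR|] ==> T k s r ~= T l s' r'"
		by blast+
qed

lemma T_notin_Gam:
	assumes "k < m" "r ~= 0" "abs r <= RR"
	shows "T k s r ~: Gam m \<eta>"
proof
	assume "T k s r \<in> Gam m \<eta>"
	then obtain l t where l: "l < m" "T k s r = \<eta> l t" by (auto simp: Gam_def)
	show False
	proof (cases "l = k")
		case True
		then show ?thesis
			using l smooth_loop.tub_ne[OF sloops[OF assms(1)] assms(2), of t s] RR_rho[OF assms(1)] assms by simp
	next
		case False
		then show ?thesis using T_disj[of k l r 0 s t] l assms RR_pos by simp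
	qed
qed

lemma T_inside: "[|k < m; 0 < r; r <= RR|] ==> T k s (-r) \<in> ins k"
	using cw_loop.tub_sides(2)[OF loops] RR_rho order_trans by blast

lemma T_outside: "[|k < m; 0 < r; r <= RR|] ==> T k s r \<in> outside (range (\<eta> k))"
	using cw_loop.tub_sides(1)[OF loops] RR_rho order_trans by blast

lemma inside_outside_disj: "x \<in> ins k ==> x \<in> outside (range (\<eta> k)) ==> False"
	by (meson disjoint_iff inside_Int_outside)

text \<open>The half collar is connected and misses the frontier of \<open>G\<close>, so one common
  point is enough. Points of \<open>G\<close> close to the curve have tubular coordinates, and
  \<open>r < 0\<close> is excluded because it would put them inside the curve.\<close>

lemma T_in_G:
	assumes "k < m" "0 < r" "r <= RR"
	shows "T k s r \<in> G"
proof -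
	interpret K: cw_loop "\<eta> k" "d\<eta> k" "dd\<eta> k" by (rule loops[OF assms(1)])
	define U where "U = {T k s r | s r. r \<in> {0<..RR}}"
	have con: "connected U" unfolding U_def by (rule K.connected_tube) (rule convex_real_interval)
	have dis: "U \<inter> frontier G = {}"
	proof -
		have "T k s r ~: Gam m \<eta>" if "r \<in> {0<..RR}" for s r using T_notin_Gam[OF assms(1)] that by simp
		then show ?thesis unfolding G_frontier U_def by blast
	qed
	have "U \<inter> G ~= {}"
	proof -
		obtain \<delta> where \<delta>: "\<delta> > 0" "!!z t. dist z (\<eta> k t) < \<delta> ==> \<exists>s r. z = T k s r & abs r < RR"
			using K.near_tub[OF RR_pos] by blast
		have "\<eta> k 0 \<in> closure G" using eta_in_Gam[OF assms(1), of 0] G_frontier by (auto simp: frontier_def)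
		then obtain z where z: "z \<in> G" "dist z (\<eta> k 0) < \<delta>" using \<delta>(1) by (auto simp: closure_approachable)
		then obtain s r where sr: "z = T k s r" "abs r < RR" using \<delta>(2) by blast
		have "r ~= 0"
		proof
			assume "r = 0"
			then have "z \<in> Gam m \<eta>" using sr eta_in_Gam[OF assms(1)] by simp
			then show False using z G_Gam_disj by blast
		qed
		moreover have "\<not> r < 0"
		proof
			assume "r < 0"
			then have "z \<in> ins k" using T_inside[OF assms(1), of "-r" s] sr by simp
			then show False using z G_outside[OF assms(1)] inside_outside_disj by blast
		qed
		ultimately have "r \<in> {0<..RR}" using sr by simp
		then have "z \<in> U" using sr unfolding U_def by blast
		then show ?thesis using z by blast
	qed
	then have "U <= G" using connected_Int_frontier[OF con] dis by blast
	moreover have "T k s r \<in> U" using assms unfolding U_def by auto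
	ultimately show ?thesis by blast
qed

lemma ins_Gm: assumes "k < m" shows "ins k <= Gm"
proof
	fix z assume z: "z \<in> ins k"
	have "z ~: G" using z G_outside[OF assms] inside_outside_disj by blast
	moreover have "z ~: Gam m \<eta>"
	proof
		assume "z \<in> Gam m \<eta>"
		then obtain l where l: "l < m" "z \<in> range (\<eta> l)" by (auto simp: Gam_def)
		show False
		proof (cases "l = k")
			case True
			then show ?thesis using z l by (metis disjoint_iff inside_no_overlap)
		next
			case False
			then show ?thesis using z eta_outside[OF assms l(1)] l inside_outside_disj by blast
		qed
	qed
	ultimately show "z \<in> Gm" by blast
qed

lemma near_Gam:
	assumes "k < m"
	obtains \<delta> where "\<delta> > 0" "!!z t. dist z (\<eta> k t) < \<delta> ==> \<exists>s r. z = T k s r & abs r < RR"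
	using cw_loop.near_tub[OF loops[OF assms] RR_pos] by blast

text \<open>The part \<open>U\<close> of the complement outside all curves is open. A frontier point
  of \<open>U\<close> would have to lie on a curve, but near a curve every point is in
  \<open>G\<close>, on the curve or inside it. So \<open>U\<close> has no frontier and is
  empty.\<close>

lemma Gm_eq: "Gm = (\<Union>k<m. ins k)"
proof (rule antisym)
	show "(\<Union>k<m. ins k) <= Gm" using ins_Gm by blast
	define U where "U = Gm - (\<Union>k<m. ins k Un range (\<eta> k))"
	have cl: "closed (ins k Un range (\<eta> k))" if "k < m" for k
		using cw_loop.frontier_inside_e[OF loops[OF that]] by (metis closure_Un_frontier closed_closure)
	have oU: "open U" unfolding U_def by (intro open_Diff Gm_open closed_UN) (auto intro: cl)
	have "U = {}"
	proof (rule ccontr)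
		assume ne: "U ~= {}"
		have "U ~= UNIV"
		proof
			assume "U = UNIV"
			then have "G = {}" by (auto simp: U_def)
			then show False using G_bounded not_bounded_UNIV by simp
		qed
		then have "frontier U ~= {}" using ne by (simp add: frontier_eq_empty)
		then obtain z where z: "z \<in> frontier U" by blast
		have zU: "z ~: U" "z \<in> closure U" using z oU by (auto simp: frontier_def interior_open)
		have noG: "z ~: V" if "open V" "V \<inter> U = {}" for V
			using zU(2) that by (meson disjoint_iff open_Int_closure_eq_empty)
		have zG: "z ~: G" by (rule noG[OF G_open]) (auto simp: U_def)
		have zi: "z ~: ins k" if "k < m" for k
			by (rule noG[OF cw_loop.open_inside_e[OF loops[OF that]]]) (use that in \<open>auto simp: U_def\<close>)
		have "z \<in> Gam m \<eta>"
		proof (rule ccontr)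
			assume n: "z ~: Gam m \<eta>"
			then have "z ~: range (\<eta> k)" if "k < m" for k using that by (auto simp: Gam_def)
			then have "z \<in> U" unfolding U_def using n zG zi by auto
			then show False using zU by simp
		qed
		then obtain k t where k: "k < m" "z = \<eta> k t" by (auto simp: Gam_def)
		obtain \<delta> where \<delta>: "\<delta> > 0" "!!z t. dist z (\<eta> k t) < \<delta> ==> \<exists>s r. z = T k s r & abs r < RR"
			using near_Gam[OF k(1)] by blast
		obtain y where y: "y \<in> U" "dist y z < \<delta>" using zU(2) \<delta>(1) by (auto simp: closure_approachable)
		then obtain s r where sr: "y = T k s r" "abs r < RR" using \<delta>(2) k by blast
		consider "r = 0" | "r > 0" | "r < 0" by linarith
		then show False
		proof cases
			case 1
			then show ?thesis using sr y k eta_in_Gam by (auto simp: U_def)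
		next
			case 2
			then show ?thesis using sr y T_in_G[OF k(1), of r s] by (auto simp: U_def)
		next
			case 3
			then show ?thesis using sr y T_inside[OF k(1), of "-r" s] k(1) by (auto simp: U_def)
		qed
	qed
	show "Gm <= (\<Union>k<m. ins k)"
	proof
		fix z assume z: "z \<in> Gm"
		then obtain k where k: "k < m" "z \<in> ins k Un range (\<eta> k)" using \<open>U = {}\<close> unfolding U_def by blast
		then have "z \<in> ins k" using z eta_in_Gam by auto
		then show "z \<in> (\<Union>k<m. ins k)" using k by blast
	qed
qed

end

text \<open>Global Cauchy theorems for one closed path are transferred to cycles: each loop is
  joined to the base point \<open>a\<close> by a path run forth and back, and the two runs cancel in
  every integral and winding number.\<close>

lemma cycle_to_path:
	fixes \<gamma> :: "nat => real => complex"
	assumes S: "open S" "connected S" "a \<in> S"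
		and "!!i. i < n ==> valid_path (\<gamma> i) & pathfinish (\<gamma> i) = pathstart (\<gamma> i) & path_image (\<gamma> i) <= S"
	shows "\<exists>g. valid_path g & pathstart g = a & pathfinish g = a & path_image g <= S &
		 (\<forall>f. f holomorphic_on S --> contour_integral g f = (\<Sum>i<n. contour_integral (\<gamma> i) f)) &
		 (\<forall>w. w ~: S --> winding_number g w = (\<Sum>i<n. winding_number (\<gamma> i) w))"
	using assms(4)
proof (induction n)
	case 0
	have "winding_number (linepath a a) w = 0" if "w ~: S" for w
		using winding_number_trivial[of w a] that S(3) by metis
	then have w: "winding_number (linepath a a) w = (\<Sum>i<0. winding_number (\<gamma> i) w)" if "w ~: S" for w
		using that by simp
	have c: "contour_integral (linepath a a) f = (\<Sum>i<0. contour_integral (\<gamma> i) f)" for f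
		by (subst contour_integral_trivial) simp
	have i: "path_image (linepath a a) <= S" by (subst path_image_linepath) (simp add: S)
	show ?case
		by (intro exI[of _ "linepath a a"] conjI allI impI valid_path_linepath pathstart_linepath pathfinish_linepath w c i)
next
	case (Suc n)
	then obtain g where g: "valid_path g" "pathstart g = a" "pathfinish g = a" "path_image g <= S"
		"!!f. f holomorphic_on S ==> contour_integral g f = (\<Sum>i<n. contour_integral (\<gamma> i) f)"
		"!!w. w ~: S ==> winding_number g w = (\<Sum>i<n. winding_number (\<gamma> i) w)"
		by (auto simp: less_Suc_eq)
	have c: "valid_path (\<gamma> n)" "pathfinish (\<gamma> n) = pathstart (\<gamma> n)" "path_image (\<gamma> n) <= S" using Suc.prems by auto
	then have st: "pathstart (\<gamma> n) \<in> S" using pathstart_in_path_image by blast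
	obtain p where p: "polynomial_function p" "path_image p <= S" "pathstart p = a" "pathfinish p = pathstart (\<gamma> n)"
		using connected_open_polynomial_connected[OF S(1,2,3) st] by blast
	have vp: "valid_path p" using p(1) by (rule valid_path_polynomial_function)
	define q where "q = p +++ (\<gamma> n +++ reversepath p)"
	have vr: "valid_path (reversepath p)" using vp by (rule valid_path_imp_reverse)
	have v2: "valid_path (\<gamma> n +++ reversepath p)" using c p vr by (intro valid_path_join) auto
	have vq: "valid_path q" unfolding q_def by (rule valid_path_join[OF vp v2]) (simp add: p)
	have i2: "path_image (\<gamma> n +++ reversepath p) <= S" using c p by (intro subset_path_image_join) auto
	have iq: "path_image q <= S" unfolding q_def by (rule subset_path_image_join[OF p(2) i2])
	have vg: "valid_path (g +++ q)" using g vq p by (intro valid_path_join) (auto simp: q_def)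
	have ig: "path_image (g +++ q) <= S" using g iq by (intro subset_path_image_join)
	have int: "f contour_integrable_on r" if "f holomorphic_on S" "valid_path r" "path_image r <= S" for f r
		using contour_integrable_holomorphic_simple[OF that(1) S(1) that(2,3)] .
	show ?case
	proof (intro exI[of _ "g +++ q"] conjI allI impI vg ig)
		show "pathstart (g +++ q) = a" "pathfinish (g +++ q) = a" using g p by (auto simp: q_def)
		fix f assume f: "f holomorphic_on S"
		have ri: "path_image (reversepath p) <= S" using p by simp
		have "contour_integral q f = contour_integral p f + (contour_integral (\<gamma> n) f + contour_integral (reversepath p) f)"
			unfolding q_def using vp v2 c vr
			by (simp add: contour_integral_join int[OF f vp p(2)] int[OF f v2 i2] int[OF f c(1,3)] int[OF f vr ri])
		then have "contour_integral q f = contour_integral (\<gamma> n) f" using vp by (simp add: contour_integral_reversepath)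
		moreover have "contour_integral (g +++ q) f = contour_integral g f + contour_integral q f"
			using g(1) vq by (simp add: contour_integral_join int[OF f g(1,4)] int[OF f vq iq])
		ultimately show "contour_integral (g +++ q) f = (\<Sum>i<Suc n. contour_integral (\<gamma> i) f)" using g(5)[OF f] by simp
	next
		fix w assume w: "w ~: S"
		have np: "w ~: path_image p" "w ~: path_image (\<gamma> n)" "w ~: path_image g" "w ~: path_image q" "w ~: path_image (\<gamma> n +++ reversepath p)"
			using w p c g iq i2 by auto
		note pa = valid_path_imp_path[OF vp] valid_path_imp_path[OF c(1)] valid_path_imp_path[OF g(1)] valid_path_imp_path[OF vq] valid_path_imp_path[OF v2]
			valid_path_imp_path[OF vr]
		have "winding_number (\<gamma> n +++ reversepath p) w = winding_number (\<gamma> n) w + winding_number (reversepath p) w"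
			using pa np c p by (intro winding_number_join) auto
		moreover have "winding_number q w = winding_number p w + winding_number (\<gamma> n +++ reversepath p) w"
			unfolding q_def using pa np c p by (intro winding_number_join) auto
		moreover have "winding_number (reversepath p) w = - winding_number p w"
			using pa np by (intro winding_number_reversepath)
		moreover have "winding_number (g +++ q) w = winding_number g w + winding_number q w"
			using pa np g p by (intro winding_number_join) (auto simp: q_def)
		ultimately show "winding_number (g +++ q) w = (\<Sum>i<Suc n. winding_number (\<gamma> i) w)" using g(6)[OF w] by simp
	qed
qed

lemma cycle_path:
	fixes \<gamma> :: "nat => real => complex"
	assumes "open S" "connected S" "a \<in> S"
		and "!!i. i < n ==> valid_path (\<gamma> i) & pathfinish (\<gamma> i) = pathstart (\<gamma> i) & path_image (\<gamma> i) <= S"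
	obtains c where "valid_path c" "pathstart c = a" "pathfinish c = a" "path_image c <= S"
		"!!f. f holomorphic_on S ==> contour_integral c f = (\<Sum>i<n. contour_integral (\<gamma> i) f)"
		"!!w. w ~: S ==> winding_number c w = (\<Sum>i<n. winding_number (\<gamma> i) w)"
proof -
	obtain c where c: "valid_path c & pathstart c = a & pathfinish c = a & path_image c <= S &
		 (\<forall>f. f holomorphic_on S --> contour_integral c f = (\<Sum>i<n. contour_integral (\<gamma> i) f)) &
		 (\<forall>w. w ~: S --> winding_number c w = (\<Sum>i<n. winding_number (\<gamma> i) w))"
		using cycle_to_path[OF assms] by (rule exE)
	show ?thesis by (rule that[of c]) (use c in simp_all)
qed

lemma Cauchy_theorem_cycle:
	fixes \<gamma> :: "nat => real => complex"
	assumes S: "open S" "connected S"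
		and g: "!!i. i < n ==> valid_path (\<gamma> i) & pathfinish (\<gamma> i) = pathstart (\<gamma> i) & path_image (\<gamma> i) <= S"
		and w0: "!!w. w ~: S ==> (\<Sum>i<n. winding_number (\<gamma> i) w) = 0"
		and f: "f holomorphic_on S"
	shows "(\<Sum>i<n. contour_integral (\<gamma> i) f) = 0"
proof (cases "n = 0")
	case False
	then have "path_image (\<gamma> 0) <= S" using g by auto
	then obtain a where "a \<in> S" using path_image_nonempty[of "\<gamma> 0"] by blast
	show ?thesis
	proof (rule cycle_path[OF S \<open>a \<in> S\<close> g])
		fix c assume c: "valid_path c" "pathstart c = a" "pathfinish c = a" "path_image c <= S"
		"!!f. f holomorphic_on S ==> contour_integral c f = (\<Sum>i<n. contour_integral (\<gamma> i) f)"
		"!!w. w ~: S ==> winding_number c w = (\<Sum>i<n. winding_number (\<gamma> i) w)"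
	have "(f has_contour_integral 0) c"
		by (rule Cauchy_theorem_global[OF S(1) f c(1)]) (use c w0 in auto)
	then show ?thesis using c(5)[OF f] by (simp add: contour_integral_unique)
	qed
qed simp

lemma Cauchy_integral_formula_cycle:
	fixes \<gamma> :: "nat => real => complex"
	assumes S: "open S" "connected S" "z \<in> S"
		and g: "!!i. i < n ==> valid_path (\<gamma> i) & pathfinish (\<gamma> i) = pathstart (\<gamma> i) & path_image (\<gamma> i) <= S - {z}"
		and w0: "!!w. w ~: S ==> (\<Sum>i<n. winding_number (\<gamma> i) w) = 0"
		and f: "f holomorphic_on S"
	shows "(\<Sum>i<n. contour_integral (\<gamma> i) (%w. f w / (w - z))) = 2*pi*\<i> * (\<Sum>i<n. winding_number (\<gamma> i) z) * f z"
proof (cases "n = 0")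
	case False
	then have "path_image (\<gamma> 0) <= S - {z}" using g by auto
	then obtain a where a: "a \<in> S - {z}" using path_image_nonempty[of "\<gamma> 0"] by blast
	have S': "open (S - {z})" "connected (S - {z})"
		using S by (auto intro: open_delete connected_open_delete)
	have f': "(%w. f w / (w - z)) holomorphic_on S - {z}"
		by (intro holomorphic_intros holomorphic_on_subset[OF f]) auto
	show ?thesis
	proof (rule cycle_path[OF S' a g])
		fix c assume c: "valid_path c" "pathstart c = a" "pathfinish c = a" "path_image c <= S - {z}"
		"!!f. f holomorphic_on S - {z} ==> contour_integral c f = (\<Sum>i<n. contour_integral (\<gamma> i) f)"
		"!!w. w ~: S - {z} ==> winding_number c w = (\<Sum>i<n. winding_number (\<gamma> i) w)"
	have "((%w. f w / (w - z)) has_contour_integral (2*pi*\<i> * winding_number c z * f z)) c"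
		by (rule Cauchy_integral_formula_global[OF S(1) f S(3) c(1)]) (use c w0 in auto)
	then show ?thesis using c(5)[OF f'] c(6)[of z] by (simp add: contour_integral_unique)
	qed
qed simp

section \<open>Parallel curves and the Cauchy integral over the whole boundary\<close>

context smooth_loop
begin

lemma tub_derivative: "((%t. tub t r) has_vector_derivative (d t + \<i> * of_real r * dd t)) (at t)"
	unfolding tub_def by (auto intro!: derivative_eq_intros der der2)

lemma tub_derivative_cont: "continuous_on UNIV (%t. d t + \<i> * of_real r * dd t)"
	by (intro continuous_intros d_cont dd_cont)

lemma valid_tub: "valid_path (curve (%t. tub t r))"
	by (rule valid_path_curve[OF tub_derivative tub_derivative_cont])

lemma loop_tub: "pathfinish (curve (%t. tub t r)) = pathstart (curve (%t. tub t r))"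
	using tub_per[of 0 r] by simp

lemma path_image_tub: "path_image (curve (%t. tub t r)) = range (%t. tub t r)"
proof -
	have "tub t r \<in> (%t. tub t r) ` {0..2*pi}" for t
	proof -
		obtain n :: int where "0 <= t + 2*pi* of_int n" "t + 2*pi* of_int n < 0 + 2*pi"
			by (rule reduce_mod_2pi)
		then show ?thesis by (intro image_eqI[of _ _ "t + 2*pi* of_int n"]) (auto simp: tub_int)
	qed
	then show ?thesis unfolding path_image_curve by blast
qed

lemma winding_tub_homotopy:
	assumes "!!s x. x \<in> closed_segment r1 r2 ==> w ~= tub s x"
	shows "winding_number (curve (%t. tub t r1)) w = winding_number (curve (%t. tub t r2)) w"
proof (rule winding_number_homotopic_loops)
	define h where "h = (%p. tub (2*pi * snd p) ((1 - fst p) * r1 + fst p * r2))"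
	show "homotopic_loops (- {w}) (curve (%t. tub t r1)) (curve (%t. tub t r2))"
		unfolding homotopic_loops
	proof (intro exI[of _ h] conjI ballI)
		show "continuous_on ({0..1} \<times> {0..1}) h" unfolding h_def by (intro tub_cont continuous_intros)
		have "h p ~= w" if "p \<in> {0..1} \<times> {0..1}" for p
		proof -
			have "(1 - fst p) * r1 + fst p * r2 \<in> closed_segment r1 r2"
				using that by (auto simp: closed_segment_def)
			then show ?thesis using assms[of _ "2*pi * snd p"] by (auto simp: h_def)
		qed
		then show "h \<in> {0..1} \<times> {0..1} \<rightarrow> - {w}" by blast
		show "pathfinish (h \<circ> Pair t) = pathstart (h \<circ> Pair t)" for t
			using tub_per[of 0] by (simp add: pathfinish_def pathstart_def h_def)
	qed (auto simp: h_def curve_def)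
qed

lemma contour_integral_tub:
	assumes "continuous_on (range (%t. tub t r)) f"
	shows "contour_integral (curve (%t. tub t r)) f = integral {0..2*pi} (%t. f (tub t r) * (d t + \<i> * of_real r * dd t))"
	by (rule contour_integral_unique, rule has_contour_integral_curve[OF tub_derivative tub_derivative_cont])
		 (auto intro: continuous_on_subset[OF assms])

text \<open>The integrand is jointly continuous in the relative distance \<open>x\<close> and the
  parameter, down to \<open>x = 0\<close>. The sign of \<open>r0\<close> selects the side, so
  exterior and interior functions are handled alike.\<close>

lemma parallel_limit:
	assumes r0: "r0 ~= 0" and h: "continuous_on {tub s (x*r0) |s x. x \<in> {0..1}} h"
		and z: "!!s x. x \<in> {0..1} ==> z ~= tub s (x*r0)"
	shows "((%x. contour_integral (curve (%t. tub t (x*r0))) (%w. h w / (w - z))) \<longlongrightarrow>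
		integral {0..2*pi} (%t. h (e t) * d t / (e t - z))) (at_right 0)"
proof -
	define F where "F = (%x. integral (cbox 0 (2*pi)) (%t. h (tub t (x*r0)) / (tub t (x*r0) - z) * (d t + \<i> * of_real (x*r0) * dd t)))"
	have "continuous_on ({0..1} \<times> cbox 0 (2*pi)) (%(x,t). h (tub t (x*r0)) / (tub t (x*r0) - z) * (d t + \<i> * of_real (x*r0) * dd t))"
		unfolding case_prod_beta
		by (intro continuous_intros continuous_on_compose2[OF h] tub_cont d_cont' continuous_on_compose2[OF dd_cont])
			 (use z in fastforce)+
	then have cont: "continuous_on {0..1} F" unfolding F_def by (rule integral_continuous_on_param)
	have Fc: "F x = contour_integral (curve (%t. tub t (x*r0))) (%w. h w / (w - z))" if "0 < x" "x <= 1" for x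
	proof -
		have "continuous_on (range (%t. tub t (x*r0))) (%w. h w / (w - z))"
		proof (intro continuous_intros continuous_on_subset[OF h])
			show "range (%t. tub t (x*r0)) <= {tub s (x*r0) |s x. x \<in> {0..1}}" using that by fastforce
			show "\<forall>w\<in>range (%t. tub t (x*r0)). w - z ~= 0" using z[of x] that by auto
		qed
		from contour_integral_tub[OF this] show ?thesis by (simp add: F_def)
	qed
	have "(F \<longlongrightarrow> F 0) (at 0 within {0..1})" using cont by (auto simp: continuous_on_def)
	then have "(F \<longlongrightarrow> F 0) (at_right 0)" by (simp add: at_within_Icc_at_right)
	then have "((%x. contour_integral (curve (%t. tub t (x*r0))) (%w. h w / (w - z))) \<longlongrightarrow> F 0) (at_right 0)"
	proof (rule Lim_transform_eventually)
		show "\<forall>\<^sub>F x in at_right 0. F x = contour_integral (curve (%t. tub t (x*r0))) (%w. h w / (w - z))"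
			unfolding eventually_at_right_field by (rule exI[of _ 1]) (use Fc in auto)
	qed
	then show ?thesis by (simp add: F_def)
qed

end

context region
begin

text \<open>Clockwise curves have \<open>G\<close> on their left; therefore \<open>CI\<close>
  reproduces exterior functions with sign plus (\<open>CI_ext\<close>) and interior ones with sign
  minus (\<open>CI_int\<close>).\<close>

definition CI :: "(nat => real => complex) => complex => complex" where
	"CI \<phi> z = (\<Sum>k<m. integral {0..2*pi} (%t. \<phi> k t * d\<eta> k t / (\<eta> k t - z))) / (2*pi*\<i>)"

lemma ins_outside:
	assumes "k < m" "l < m" "k ~= l"
	shows "ins l <= outside (range (\<eta> k))"
proof -
	interpret K: cw_loop "\<eta> k" "d\<eta> k" "dd\<eta> k" by (rule loops[OF assms(1)])
	interpret L: cw_loop "\<eta> l" "d\<eta> l" "dd\<eta> l" by (rule loops[OF assms(2)])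
	have "ins l \<inter> range (\<eta> k) = {}" using ins_Gm[OF assms(2)] eta_in_Gam[OF assms(1)] by blast
	then consider "ins l <= ins k" | "ins l <= outside (range (\<eta> k))" using K.connected_in_or_out[OF L.connected_inside_e] by blast
	then show ?thesis
	proof cases
		case 1
		have "\<eta> l 0 \<in> closure (ins l)" using L.frontier_inside_e by (metis UnCI closure_Un_frontier rangeI)
		then have "\<eta> l 0 \<in> closure (ins k)" using closure_mono[OF 1] by blast
		then have "\<eta> l 0 \<in> ins k Un range (\<eta> k)" using K.frontier_inside_e by (metis closure_Un_frontier)
		moreover have "\<eta> l 0 \<in> outside (range (\<eta> k))" using eta_outside[OF assms] by blast
		moreover have "\<eta> l 0 ~: range (\<eta> k)" using eta_disj[OF assms] by blast
		ultimately show ?thesis using inside_outside_disj by blast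
	qed
qed

lemma avoid_tube:
	assumes "z ~: Gam m \<eta>"
	obtains r where "0 < r" "r <= RR" "!!k s x. k < m ==> abs x <= r ==> z ~= T k s x"
proof -
	have "\<exists>r>0. \<forall>s x. abs x <= r --> z ~= T k s x" if k: "k < m" for k
	proof -
		interpret K: cw_loop "\<eta> k" "d\<eta> k" "dd\<eta> k" by (rule loops[OF k])
		have "z ~: range (\<eta> k)" using assms k by (auto simp: Gam_def)
		then obtain \<delta> where \<delta>: "\<delta> > 0" "!!y. y \<in> range (\<eta> k) ==> \<delta> <= dist z y"
			using separate_point_closed[OF compact_imp_closed[OF K.compact_range]] by blast
		obtain B where B: "B > 0" "!!t. norm (d\<eta> k t) <= B"
			using periodic_bounded[OF K.d_per K.d_cont] by blast
		have "z ~= T k s x" if x: "abs x <= \<delta> / (2*B)" for s x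
		proof
			assume "z = T k s x"
			then have "dist z (\<eta> k s) = abs x * norm (d\<eta> k s)" by (simp add: K.tub_def dist_norm norm_mult)
			also have "\<dots> <= \<delta> / (2*B) * B" using x B \<delta> by (intro mult_mono) auto
			also have "\<dots> < \<delta>" using B \<delta> by simp
			finally show False using \<delta>(2)[of "\<eta> k s"] by simp
		qed
		then show ?thesis using B \<delta> by (intro exI[of _ "\<delta>/(2*B)"]) auto
	qed
	then have "\<forall>k\<in>{..<m}. \<exists>r. r > 0 & (\<forall>s x. abs x <= r --> z ~= T k s x)" by blast
	from bchoice[OF this] obtain rf where rf: "!!k. k < m ==> rf k > 0 & (\<forall>s x. abs x <= rf k --> z ~= T k s x)" by blast
	define r where "r = Min (insert RR (rf ` {..<m}))"
	show ?thesis
	proof (rule that[of r])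
		show "0 < r" unfolding r_def using rf RR_pos by (subst Min_gr_iff) auto
		show "r <= RR" unfolding r_def by (rule Min_le) auto
		fix k s x assume k: "k < m" and x: "abs x <= r"
		have "r <= rf k" unfolding r_def using k by (intro Min_le) auto
		then show "z ~= T k s x" using rf[OF k] x by auto
	qed
qed

abbreviation GT :: "nat => real => real => complex" where "GT k r \<equiv> curve (%t. T k t r)"

lemma T_in_G_Gam: "[|k < m; 0 <= r; r <= RR|] ==> T k s r \<in> G Un range (\<eta> k)"
	using T_in_G[of k r s] by (cases "r = 0") auto

lemma T_in_ins_Gam: "[|k < m; -RR <= r; r <= 0|] ==> T k s r \<in> ins k Un range (\<eta> k)"
	using T_inside[of k "-r" s] by (cases "r = 0") auto

lemma winding_T_eq:
	assumes "k < m" "!!s x. x \<in> closed_segment 0 r ==> w ~= T k s x"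
	shows "winding_number (GT k r) w = winding_number (curve (\<eta> k)) w"
proof -
	interpret K: cw_loop "\<eta> k" "d\<eta> k" "dd\<eta> k" by (rule loops[OF assms(1)])
	show ?thesis using K.winding_tub_homotopy[of 0 r w] assms(2) by simp
qed

lemma winding_T_other:
	assumes "k < m" "0 <= r" "r <= RR" "w ~: G" "w \<in> outside (range (\<eta> k))"
	shows "winding_number (GT k r) w = 0"
proof -
	interpret K: cw_loop "\<eta> k" "d\<eta> k" "dd\<eta> k" by (rule loops[OF assms(1)])
	have "w ~= T k s x" if "x \<in> closed_segment 0 r" for s x
	proof -
		have "0 <= x" "x <= RR" using that assms by (auto simp: closed_segment_eq_real_ivl)
		moreover have "w ~: range (\<eta> k)" using assms(5) outside_no_overlap by blast
		ultimately show ?thesis using T_in_G_Gam[OF assms(1), of x s] assms(4) by auto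
	qed
	then show ?thesis using winding_T_eq[OF assms(1)] K.winding_out[OF assms(5)] by simp
qed

lemma winding_T_ins:
	assumes "k < m" "0 <= r" "r <= RR" "w \<in> ins k"
	shows "winding_number (GT k r) w = -1"
proof -
	interpret K: cw_loop "\<eta> k" "d\<eta> k" "dd\<eta> k" by (rule loops[OF assms(1)])
	have "w ~= T k s x" if "x \<in> closed_segment 0 r" for s x
	proof -
		have "0 <= x" "x <= RR" using that assms by (auto simp: closed_segment_eq_real_ivl)
		then show ?thesis using T_in_G_Gam[OF assms(1), of x s] assms(4) ins_Gm[OF assms(1)] eta_in_Gam[OF assms(1)] by auto
	qed
	then show ?thesis using winding_T_eq[OF assms(1)] K.cw[OF assms(4)] by simp
qed

lemma winding_T_between:
	assumes "k < m" "abs r <= RR" "abs x <= RR" "abs y <= RR" "r ~: closed_segment x y"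
	shows "winding_number (GT k r) (T k s x) = winding_number (GT k r) (T k s' y)"
proof -
	interpret K: cw_loop "\<eta> k" "d\<eta> k" "dd\<eta> k" by (rule loops[OF assms(1)])
	let ?C = "{T k s u | s u. u \<in> closed_segment x y}"
	show ?thesis
	proof (rule winding_number_eq[of _ _ ?C])
		show "path (GT k r)" using valid_path_imp_path[OF K.valid_tub] .
		show "connected ?C" by (rule K.connected_tube) auto
		show "?C \<inter> path_image (GT k r) = {}"
		proof -
			have "T k t u ~= T k t' r" if "u \<in> closed_segment x y" for t t' u
			proof
				assume eq: "T k t u = T k t' r"
				have "abs u <= RR" using that assms by (auto simp: closed_segment_eq_real_ivl split: if_splits)
				then show False using K.tub_eqD[OF eq] RR_rho[OF assms(1)] assms that by auto
			qed
			then show ?thesis unfolding K.path_image_tub by blast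
		qed
	qed (use K.loop_tub in auto)
qed

lemma winding_T_range:
	assumes "k < m" "0 < r" "r <= RR"
	shows "winding_number (GT k r) (\<eta> k s) = -1"
proof -
	have "winding_number (GT k r) (T k s 0) = winding_number (GT k r) (T k s (-RR))"
		by (rule winding_T_between) (use assms RR_pos in \<open>auto simp: closed_segment_eq_real_ivl\<close>)
	also have "\<dots> = -1" by (rule winding_T_ins) (use assms RR_pos T_inside[of k RR s] in auto)
	finally show ?thesis using assms by simp
qed

text \<open>A point off \<open>G\<close> lies on or inside exactly one curve, so the cycle of outer
  parallel curves winds -1 times around it. Adding a large circle makes the cycle null-homologous in
  \<open>G\<close>.\<close>

lemma winding_T_sum:
	assumes "0 < r" "r <= RR" "w ~: G"
	shows "(\<Sum>k<m. winding_number (GT k r) w) = -1"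
proof -
	have "w \<in> Gam m \<eta> \<or> w \<in> Gm" using assms by blast
	then obtain j where j: "j < m" "w \<in> range (\<eta> j) \<or> w \<in> ins j" unfolding Gm_eq by (auto simp: Gam_def)
	have o: "winding_number (GT k r) w = 0" if "k < m" "k ~= j" for k
	proof (rule winding_T_other)
		show "w \<in> outside (range (\<eta> k))" using j eta_outside[OF that(1) j(1) that(2)] ins_outside[OF that(1) j(1) that(2)] by blast
	qed (use that assms in auto)
	have jj: "winding_number (GT j r) w = -1"
		using j winding_T_range[of j r] winding_T_ins[of j r w] assms by auto
	have "(\<Sum>k<m. winding_number (GT k r) w) = (\<Sum>k<m. if k = j then -1 else 0)"
		by (rule sum.cong) (use o jj in auto)
	then show ?thesis using j by simp
qed

end

context cw_loop
begin

definition cint :: "(real => complex) => complex => complex" where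
	"cint \<phi> z = integral {0..2*pi} (%t. \<phi> t * d t / (e t - z))"

lemma cint_holomorphic:
	assumes \<phi>: "continuous_on {0..2*pi} \<phi>"
	shows "cint \<phi> holomorphic_on - range e"
proof -
	have op: "open (- range e)" using compact_range compact_imp_closed by blast
	have "\<exists>D. (cint \<phi> has_field_derivative D) (at z)" if z: "z \<in> - range e" for z
	proof -
		obtain \<delta> where \<delta>: "\<delta> > 0" "ball z \<delta> <= - range e" using op z by (meson openE)
		have ne: "e t - x ~= 0" if "x \<in> ball z \<delta>" for x t using that \<delta> by auto
		then have ne': "\<forall>p\<in>ball z \<delta> \<times> {0..2*pi}. (e (snd p) - fst p)^2 ~= 0" by (simp add: mem_Times_iff)
		have "((%x. integral (cbox 0 (2*pi)) (%t. \<phi> t * d t / (e t - x))) has_field_derivative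
				integral (cbox 0 (2*pi)) (%t. \<phi> t * d t / (e t - z)^2)) (at z within ball z \<delta>)"
		proof (rule leibniz_rule_field_derivative)
			fix x t assume x: "x \<in> ball z \<delta>"
			show "((%x. \<phi> t * d t / (e t - x)) has_field_derivative \<phi> t * d t / (e t - x)^2) (at x within ball z \<delta>)"
				by (rule derivative_eq_intros refl | use ne[OF x, of t] in \<open>simp add: power2_eq_square\<close>)+
		next
			show "(%t. \<phi> t * d t / (e t - x)) integrable_on cbox 0 (2*pi)" if "x \<in> ball z \<delta>" for x
				unfolding cbox_interval
				by (intro integrable_continuous_real continuous_intros \<phi> d_cont' e_cont') (use ne[OF that] in auto)
			show "continuous_on (ball z \<delta> \<times> cbox 0 (2*pi)) (%(x,t). \<phi> t * d t / (e t - x)^2)"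
				unfolding case_prod_beta cbox_interval
			proof (rule continuous_on_divide[OF continuous_on_mult])
				show "continuous_on (ball z \<delta> \<times> {0..2*pi}) (%p. \<phi> (snd p))"
					by (rule continuous_on_compose2[OF \<phi> continuous_on_snd[OF continuous_on_id]]) auto
				show "continuous_on (ball z \<delta> \<times> {0..2*pi}) (%p. d (snd p))"
					by (rule d_cont'[OF continuous_on_snd[OF continuous_on_id]])
				show "continuous_on (ball z \<delta> \<times> {0..2*pi}) (%p. (e (snd p) - fst p)^2)"
					by (intro continuous_intros e_cont')
				show "\<forall>p\<in>ball z \<delta> \<times> {0..2*pi}. (e (snd p) - fst p)^2 ~= 0" by (rule ne')
			qed
			show "z \<in> ball z \<delta>" "convex (ball z \<delta>)" using \<delta>(1) by simp_all
		qed
		moreover have "at z within ball z \<delta> = at z" using \<delta>(1) by (intro at_within_open) simp_all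
		ultimately show ?thesis unfolding cint_def cbox_interval by metis
	qed
	then show ?thesis unfolding holomorphic_on_def field_differentiable_def
		using has_field_derivative_at_within by blast
qed

lemma cint_at_infinity:
	assumes \<phi>: "continuous_on {0..2*pi} \<phi>"
	shows "(cint \<phi> \<longlongrightarrow> 0) at_infinity"
proof -
	have "bounded ((%t. \<phi> t * d t) ` {0..2*pi})"
		by (intro compact_imp_bounded compact_continuous_image continuous_intros \<phi> d_cont') auto
	then obtain M where "\<forall>x\<in>(%t. \<phi> t * d t) ` {0..2*pi}. norm x <= M" unfolding bounded_iff by blast
	then have M: "norm (\<phi> t * d t) <= M" if "t \<in> {0..2*pi}" for t using that by blast
	obtain B where "\<forall>x\<in>range e. norm x <= B" using compact_imp_bounded[OF compact_range] unfolding bounded_iff by blast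
	then have B: "norm (e t) <= B" for t by blast
	have "norm (\<phi> 0 * d 0) <= M" by (rule M) simp
	then have M0: "M >= 0" using norm_ge_zero order_trans by blast
	show ?thesis
	proof (rule Lim_null_comparison)
		show "\<forall>\<^sub>F z in at_infinity. norm (cint \<phi> z) <= 2*pi*M / (norm z - B)"
			unfolding eventually_at_infinity
		proof (intro exI[of _ "B+1"] allI impI)
			fix z :: complex assume z: "B + 1 <= norm z"
			have dn: "norm (e t - z) >= norm z - B" for t
				using B[of t] norm_triangle_ineq2[of z "e t"] by (simp add: norm_minus_commute)
			have ne: "e t - z ~= 0" for t using dn[of t] z by auto
			have "norm (cint \<phi> z) <= integral {0..2*pi} (%t. M / (norm z - B))"
				unfolding cint_def
			proof (rule Henstock_Kurzweil_Integration.integral_norm_bound_integral)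
				show "(%t. \<phi> t * d t / (e t - z)) integrable_on {0..2*pi}"
					by (intro integrable_continuous_real continuous_intros \<phi> d_cont' e_cont') (use ne in auto)
				show "(%t. M / (norm z - B)) integrable_on {0..2*pi}" by (rule integrable_const_ivl)
				show "norm (\<phi> t * d t / (e t - z)) <= M / (norm z - B)" if "t \<in> {0..2*pi}" for t
					unfolding norm_divide using M[OF that] dn[of t] z M0 by (intro frac_le) auto
			qed
			then show "norm (cint \<phi> z) <= 2*pi*M / (norm z - B)" by simp
		qed
		have "filterlim (%z::complex. - B + norm z) at_top at_infinity"
			by (rule filterlim_tendsto_add_at_top[OF tendsto_const filterlim_norm_at_top])
		then have "filterlim (%z::complex. norm z - B) at_infinity at_infinity"
			by (simp add: filterlim_at_top_imp_at_infinity)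
		then show "((%z::complex. 2*pi*M / (norm z - B)) \<longlongrightarrow> 0) at_infinity"
			by (rule tendsto_divide_0[OF tendsto_const])
	qed
qed

end

context region
begin

abbreviation cI :: "nat => (real => complex) => complex => complex" where
	"cI k \<equiv> cw_loop.cint (\<eta> k) (d\<eta> k)"

lemma cI_def: "k < m ==> cI k \<phi> z = integral {0..2*pi} (%t. \<phi> t * d\<eta> k t / (\<eta> k t - z))"
	using cw_loop.cint_def[OF loops] .

lemma CI_sum: "CI \<phi> z = (\<Sum>k<m. cI k (\<phi> k) z) / (2*pi*\<i>)"
	unfolding CI_def by (auto simp: cI_def intro!: sum.cong arg_cong2[where f="(/)"])

lemma CI_holomorphic:
	assumes "!!k. k < m ==> continuous_on {0..2*pi} (\<phi> k)"
	shows "CI \<phi> holomorphic_on - Gam m \<eta>"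
proof -
	have "cI k (\<phi> k) holomorphic_on - Gam m \<eta>" if "k < m" for k
		by (rule holomorphic_on_subset[OF cw_loop.cint_holomorphic[OF loops[OF that] assms[OF that]]])
			 (use that in \<open>auto simp: Gam_def\<close>)
	then show ?thesis unfolding CI_sum by (intro holomorphic_intros) auto
qed

lemma CI_at_infinity:
	assumes "!!k. k < m ==> continuous_on {0..2*pi} (\<phi> k)"
	shows "(CI \<phi> \<longlongrightarrow> 0) at_infinity"
proof -
	have "((%z. (\<Sum>k<m. cI k (\<phi> k) z) / (2*pi*\<i>)) \<longlongrightarrow> (\<Sum>k<m. 0) / (2*pi*\<i>)) at_infinity"
		by (intro tendsto_intros cw_loop.cint_at_infinity[OF loops] assms) auto
	then show ?thesis unfolding CI_sum by simp
qed

text \<open>As \<open>f\<close> is merely continuous on the boundary, the Cauchy formula is used on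
  parallel curves in \<open>G\<close> completed by a large circle. The circle disappears because
  \<open>f\<close> vanishes at infinity, and then the parallel curves move to the boundary.\<close>

lemma CI_ext:
	assumes f: "analytic_ext G (Gam m \<eta>) f" and z: "z ~: Gam m \<eta>"
	shows "CI (%k t. f (\<eta> k t)) z = (if z \<in> G then f z else 0)"
proof -
	have holf: "f holomorphic_on G" and contf: "continuous_on (G Un Gam m \<eta>) f" and inff: "(f \<longlongrightarrow> 0) at_infinity"
		using f by (auto simp: analytic_ext_def)
	obtain r0 where r0: "0 < r0" "r0 <= RR" "!!k s x. k < m ==> abs x <= r0 ==> z ~= T k s x"
		using avoid_tube[OF z] by blast
	obtain B where B: "B > 0" "- G <= ball 0 B" using bounded_subset_ballD[OF G_bounded, of 0] by blast
	define c where "c = (if z \<in> G then 2*pi*\<i> * f z else 0)"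
	have key: "(\<Sum>k<m. contour_integral (GT k r) (%w. f w / (w - z))) + contour_integral (circlepath 0 R) (%w. f w / (w - z)) = c"
		if r: "0 < r" "r <= r0" and R: "R > B" "R > norm z" for r R
	proof -
		define \<gamma> where "\<gamma> = (%i. if i < m then GT i r else circlepath 0 R)"
		have R0: "R > 0" using R B by linarith
		have p: "valid_path (\<gamma> i) & pathfinish (\<gamma> i) = pathstart (\<gamma> i) & path_image (\<gamma> i) <= G - {z}" if "i < Suc m" for i
		proof (cases "i < m")
			case True
			interpret K: cw_loop "\<eta> i" "d\<eta> i" "dd\<eta> i" by (rule loops[OF True])
			have "T i s r \<in> G - {z}" for s using T_in_G[OF True, of r s] r0(3)[OF True, of r s] r r0(2) by auto
			then show ?thesis using K.valid_tub K.loop_tub True by (auto simp: \<gamma>_def K.path_image_tub)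
		next
			case False
			have "w \<in> G - {z}" if "norm w = R" for w
				using that B R by (auto simp: subset_iff)
			then have "sphere 0 R <= G - {z}" by (intro subsetI) (simp add: dist_norm)
			moreover have "path_image (circlepath 0 R) = sphere 0 R" using R0 by simp
			moreover have "\<gamma> i = circlepath 0 R" using False by (simp add: \<gamma>_def)
			ultimately show ?thesis by simp
		qed
		have sumw: "(\<Sum>i<Suc m. winding_number (\<gamma> i) w) = (\<Sum>k<m. winding_number (GT k r) w) + winding_number (circlepath 0 R) w" for w
			by (simp add: \<gamma>_def)
		have sumc: "(\<Sum>i<Suc m. contour_integral (\<gamma> i) h) = (\<Sum>k<m. contour_integral (GT k r) h) + contour_integral (circlepath 0 R) h" for h
			by (simp add: \<gamma>_def)
		have circ: "winding_number (circlepath 0 R) w = 1" if "norm w < R" for w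
			by (rule winding_number_circlepath) (use that in simp)
		have w0: "(\<Sum>i<Suc m. winding_number (\<gamma> i) w) = 0" if "w ~: G" for w
		proof -
			have "norm w < R" using B(2) that R by (auto simp: subset_iff)
			then show ?thesis unfolding sumw using winding_T_sum[of r w] circ that r r0 by simp
		qed
		show ?thesis
		proof (cases "z \<in> G")
			case True
			have "winding_number (GT k r) z = 0" if "k < m" for k
			proof -
				have "winding_number (GT k r) z = winding_number (curve (\<eta> k)) z"
				proof (rule winding_T_eq[OF that])
					fix s x assume "x \<in> closed_segment 0 r"
					then have "abs x <= r0" using r by (auto simp: closed_segment_eq_real_ivl)
					then show "z ~= T k s x" using r0(3)[OF that] by blast
				qed
				then show ?thesis using cw_loop.winding_out[OF loops[OF that]] G_outside[OF that] True by auto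
			qed
			then have "(\<Sum>i<Suc m. winding_number (\<gamma> i) z) = 1" unfolding sumw using circ[OF R(2)] by simp
			then show ?thesis
				using Cauchy_integral_formula_cycle[OF G_open G_connected True p w0 holf] True unfolding sumc c_def by simp
		next
			case False
			have "(%w. f w / (w - z)) holomorphic_on G" using False by (intro holomorphic_intros holf) auto
			then have "(\<Sum>i<Suc m. contour_integral (\<gamma> i) (%w. f w / (w - z))) = 0"
				using p by (intro Cauchy_theorem_cycle[OF G_open G_connected _ w0]) blast+
			then show ?thesis unfolding sumc c_def using False by simp
		qed
	qed
	have J: "(\<Sum>k<m. contour_integral (GT k r) (%w. f w / (w - z))) = c" if r: "0 < r" "r <= r0" for r
	proof (rule ccontr)
		assume ne: "(\<Sum>k<m. contour_integral (GT k r) (%w. f w / (w - z))) ~= c"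
		\<comment> \<open>The sum over the parallel curves does not depend on \<open>R\<close>, while the
		  circle contributes at most \<open>4*pi*\<epsilon>\<close>; the assumed gap is
		  \<open>8*pi*\<epsilon>\<close>.\<close>
		define \<epsilon> where "\<epsilon> = norm (c - (\<Sum>k<m. contour_integral (GT k r) (%w. f w / (w - z)))) / (8*pi)"
		have eps: "\<epsilon> > 0" using ne by (simp add: \<epsilon>_def)
		obtain b where b: "!!w. norm w >= b ==> norm (f w) < \<epsilon>"
			using inff eps by (auto simp: Lim_at_infinity dist_norm)
		define R where "R = abs b + B + 2 * norm z + 1"
		have R: "R > B" "R > norm z" "R >= b" "R >= 2 * norm z" "R > 0" unfolding R_def using B(1) norm_ge_zero[of z] by linarith+
		have hol: "(%w. f w / (w - z)) holomorphic_on G - {z}"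
			by (intro holomorphic_intros holomorphic_on_subset[OF holf]) auto
		have img: "path_image (circlepath 0 R) <= G - {z}"
		proof -
			have "w \<in> G - {z}" if "norm w = R" for w using that B R by (auto simp: subset_iff)
			then have "sphere 0 R <= G - {z}" by (intro subsetI) (simp add: dist_norm)
			moreover have "path_image (circlepath 0 R) = sphere 0 R" using R(5) by simp
			ultimately show ?thesis by simp
		qed
		have ci: "((%w. f w / (w - z)) has_contour_integral contour_integral (circlepath 0 R) (%w. f w / (w - z))) (circlepath 0 R)"
			by (rule has_contour_integral_integral, rule contour_integrable_holomorphic_simple[OF hol _ _ img]) (auto intro: open_delete G_open)
		have "norm (contour_integral (circlepath 0 R) (%w. f w / (w - z))) <= (2 * \<epsilon> / R) * (2*pi*R)"
		proof (rule has_contour_integral_bound_circlepath[OF ci])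
			fix w :: complex assume w: "norm (w - 0) = R"
			have "norm (w - z) >= R/2" using norm_triangle_ineq2[of w z] w R(4) by simp
			then have "norm (f w / (w - z)) <= \<epsilon> / (R/2)" unfolding norm_divide
				using b[of w] w R eps by (intro frac_le) auto
			then show "norm (f w / (w - z)) <= 2 * \<epsilon> / R" by (simp add: field_simps)
		qed (use eps R in auto)
		also have "(2 * \<epsilon> / R) * (2*pi*R) = 4 * pi * \<epsilon>" using R by simp
		finally have "norm (c - (\<Sum>k<m. contour_integral (GT k r) (%w. f w / (w - z)))) <= 4 * pi * \<epsilon>"
			using key[OF r R(1,2)] by (simp add: algebra_simps flip: key[OF r R(1,2)])
		moreover have "norm (c - (\<Sum>k<m. contour_integral (GT k r) (%w. f w / (w - z)))) = 8 * pi * \<epsilon>" by (simp add: \<epsilon>_def)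
		ultimately show False using eps pi_gt_zero by simp
	qed
	have lim: "((%x. contour_integral (GT k (x*r0)) (%w. f w / (w - z))) \<longlongrightarrow> cI k (%t. f (\<eta> k t)) z) (at_right 0)" if k: "k < m" for k
	proof -
		interpret K: cw_loop "\<eta> k" "d\<eta> k" "dd\<eta> k" by (rule loops[OF k])
		have xr: "0 <= x*r0 & x*r0 <= r0" if "x \<in> {0..1}" for x using that r0 by (auto simp: mult_le_cancel_right1)
		show ?thesis unfolding cI_def[OF k]
		proof (rule K.parallel_limit)
			show "continuous_on {T k s (x*r0) |s x. x \<in> {0..1}} f"
			proof (rule continuous_on_subset[OF contf])
				have "T k s (x*r0) \<in> G Un Gam m \<eta>" if "x \<in> {0..1}" for s x
					using T_in_G_Gam[OF k, of "x*r0" s] xr[OF that] r0(2) eta_in_Gam[OF k] by auto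
				then show "{T k s (x*r0) |s x. x \<in> {0..1}} <= G Un Gam m \<eta>" by blast
			qed
			show "z ~= T k s (x*r0)" if "x \<in> {0..1}" for s x using r0(3)[OF k, of "x*r0" s] xr[OF that] by simp
		qed (use r0 in simp)
	qed
	have "((%x. \<Sum>k<m. contour_integral (GT k (x*r0)) (%w. f w / (w - z))) \<longlongrightarrow> (\<Sum>k<m. cI k (%t. f (\<eta> k t)) z)) (at_right 0)"
		by (intro tendsto_sum lim) simp
	moreover have "((%x. \<Sum>k<m. contour_integral (GT k (x*r0)) (%w. f w / (w - z))) \<longlongrightarrow> c) (at_right 0)"
	proof (rule Lim_transform_eventually[OF tendsto_const])
		show "\<forall>\<^sub>F x in at_right 0. c = (\<Sum>k<m. contour_integral (GT k (x*r0)) (%w. f w / (w - z)))"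
			unfolding eventually_at_right_field
			by (rule exI[of _ 1]) (use J r0 in \<open>auto simp: mult_le_cancel_right1\<close>)
	qed
	ultimately have "(\<Sum>k<m. cI k (%t. f (\<eta> k t)) z) = c"
		using tendsto_unique[OF trivial_limit_at_right_real] by blast
	then show ?thesis unfolding CI_sum c_def by simp
qed

text \<open>The complement splits into the insides of the curves, so each curve is treated alone,
  with inner parallel curves. The sign comes from the clockwise orientation.\<close>

lemma CI_int:
	assumes g: "analytic_int Gm (Gam m \<eta>) g" and z: "z ~: Gam m \<eta>"
	shows "CI (%k t. g (\<eta> k t)) z = (if z \<in> G then 0 else - g z)"
proof -
	have holg: "g holomorphic_on Gm" and contg: "continuous_on (Gm Un Gam m \<eta>) g"
		using g by (auto simp: analytic_int_def)
	obtain r0 where r0: "0 < r0" "r0 <= RR" "!!k s x. k < m ==> abs x <= r0 ==> z ~= T k s x"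
		using avoid_tube[OF z] by blast
	have single: "cI k (%t. g (\<eta> k t)) z = (if z \<in> ins k then - (2*pi*\<i>) * g z else 0)" if k: "k < m" for k
	proof -
		interpret K: cw_loop "\<eta> k" "d\<eta> k" "dd\<eta> k" by (rule loops[OF k])
		define c where "c = (if z \<in> ins k then - (2*pi*\<i>) * g z else 0)"
		have hk: "g holomorphic_on ins k" using holg ins_Gm[OF k] holomorphic_on_subset by blast
		have J: "contour_integral (GT k (-r)) (%w. g w / (w - z)) = c" if r: "0 < r" "r <= r0" for r
		proof -
			have seg: "-RR <= x & x <= 0 & abs x <= r0" if "x \<in> closed_segment 0 (-r)" for x
				using that r r0 by (auto simp: closed_segment_eq_real_ivl)
			have im: "path_image (GT k (-r)) <= ins k - {z}"
				using T_inside[OF k, of r] r0(3)[OF k, of "-r"] r r0(2) by (auto simp: K.path_image_tub)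
			have w0: "winding_number (GT k (-r)) w = 0" if w: "w ~: ins k" for w
			proof (cases "w \<in> range (\<eta> k)")
				case True
				then obtain s where s: "w = \<eta> k s" by blast
				\<comment> \<open>A deformation of the parallel curve to \<open>\<eta> k\<close> would hit the
				  point \<open>w\<close> on the curve itself, so the point is first moved outwards to
				  \<open>T k s RR\<close>.\<close>
				have ow: "winding_number (GT k (-r)) (T k s RR) = 0"
				proof -
					have o: "T k s RR \<in> outside (range (\<eta> k))" using T_outside[OF k RR_pos] by simp
					have "winding_number (GT k (-r)) (T k s RR) = winding_number (curve (\<eta> k)) (T k s RR)"
					proof (rule winding_T_eq[OF k])
						fix t x assume x: "x \<in> closed_segment 0 (-r)"
						show "T k s RR ~= T k t x"
							using K.tub_eqD[of s RR t x] seg[OF x] RR_rho[OF k] RR_pos by auto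
					qed
					then show ?thesis using K.winding_out[OF o] by simp
				qed
				have "winding_number (GT k (-r)) (T k s 0) = winding_number (GT k (-r)) (T k s RR)"
					by (rule winding_T_between[OF k]) (use r r0 RR_pos in \<open>auto simp: closed_segment_eq_real_ivl\<close>)
				then show ?thesis using ow s k by simp
			next
				case False
				then have o: "w \<in> outside (range (\<eta> k))" using K.in_or_out w by blast
				have "winding_number (GT k (-r)) w = winding_number (curve (\<eta> k)) w"
				proof (rule winding_T_eq[OF k])
					fix t x assume x: "x \<in> closed_segment 0 (-r)"
					show "w ~= T k t x" using T_in_ins_Gam[OF k, of x t] seg[OF x] w False by auto
				qed
				then show ?thesis using K.winding_out[OF o] by simp
			qed
			show ?thesis
			proof (cases "z \<in> ins k")
				case True
				have "winding_number (GT k (-r)) z = -1"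
				proof -
					have "winding_number (GT k (-r)) z = winding_number (curve (\<eta> k)) z"
						by (rule winding_T_eq[OF k]) (use r0(3)[OF k] seg in blast)
					then show ?thesis using K.cw[OF True] by simp
				qed
				moreover have "((%w. g w / (w - z)) has_contour_integral (2*pi*\<i> * winding_number (GT k (-r)) z * g z)) (GT k (-r))"
					by (rule Cauchy_integral_formula_global[OF K.open_inside_e hk True K.valid_tub im K.loop_tub w0])
				ultimately show ?thesis using True by (simp add: c_def contour_integral_unique)
			next
				case False
				have "(%w. g w / (w - z)) holomorphic_on ins k" using False by (intro holomorphic_intros hk) auto
				then have "((%w. g w / (w - z)) has_contour_integral 0) (GT k (-r))"
					using im by (intro Cauchy_theorem_global[OF K.open_inside_e _ K.valid_tub K.loop_tub _ w0]) auto
				then show ?thesis using False by (simp add: c_def contour_integral_unique)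
			qed
		qed
		have xr: "0 <= x*r0 & x*r0 <= r0" if "x \<in> {0..1}" for x using that r0 by (auto simp: mult_le_cancel_right1)
		have "((%x. contour_integral (GT k (x*(-r0))) (%w. g w / (w - z))) \<longlongrightarrow> cI k (%t. g (\<eta> k t)) z) (at_right 0)"
			unfolding cI_def[OF k]
		proof (rule K.parallel_limit)
			show "continuous_on {T k s (x*(-r0)) |s x. x \<in> {0..1}} g"
			proof (rule continuous_on_subset[OF contg])
				have "T k s (x*(-r0)) \<in> Gm Un Gam m \<eta>" if "x \<in> {0..1}" for s x
					using T_in_ins_Gam[OF k, of "x*(-r0)" s] xr[OF that] r0(2) eta_in_Gam[OF k] ins_Gm[OF k] by auto
				then show "{T k s (x*(-r0)) |s x. x \<in> {0..1}} <= Gm Un Gam m \<eta>" by blast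
			qed
			show "z ~= T k s (x*(-r0))" if "x \<in> {0..1}" for s x using r0(3)[OF k, of "x*(-r0)" s] xr[OF that] by simp
		qed (use r0 in simp)
		moreover have "((%x. contour_integral (GT k (x*(-r0))) (%w. g w / (w - z))) \<longlongrightarrow> c) (at_right 0)"
		proof (rule Lim_transform_eventually[OF tendsto_const])
			show "\<forall>\<^sub>F x in at_right 0. c = contour_integral (GT k (x*(-r0))) (%w. g w / (w - z))"
				unfolding eventually_at_right_field
				by (rule exI[of _ 1]) (use J r0 in \<open>auto simp: mult_le_cancel_right1\<close>)
		qed
		ultimately show ?thesis unfolding c_def using tendsto_unique[OF trivial_limit_at_right_real] by blast
	qed
	show ?thesis
	proof (cases "z \<in> G")
		case True
		then have "z ~: ins k" if "k < m" for k using ins_Gm[OF that] by blast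
		then show ?thesis using True single unfolding CI_sum by simp
	next
		case False
		then have "z \<in> Gm" using z by blast
		then obtain j where j: "j < m" "z \<in> ins j" unfolding Gm_eq by blast
		have "(\<Sum>k<m. cI k (%t. g (\<eta> k t)) z) = (\<Sum>k<m. if k = j then - (2*pi*\<i>) * g z else 0)"
		proof (rule sum.cong)
			fix k assume "k \<in> {..<m}"
			then have k: "k < m" by simp
			show "cI k (%t. g (\<eta> k t)) z = (if k = j then - (2*pi*\<i>) * g z else 0)"
				using single[OF k] j ins_outside[OF k j(1)] inside_outside_disj by (cases "k = j") auto
		qed simp
		then show ?thesis using False j unfolding CI_sum by simp
	qed
qed

end

section \<open>Boundary values of the Cauchy integral\<close>

context smooth_loop
begin

lemma Phi_per: "(!!t. \<phi> (t + 2*pi) = \<phi> t) ==> Phi \<phi> (s + 2*pi* of_int n) r = Phi \<phi> s r"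
proof -
	assume p: "!!t. \<phi> (t + 2*pi) = \<phi> t"
	have "\<phi> (s + 2*pi* of_int n + u) = \<phi> (s+u)" "d (s + 2*pi* of_int n + u) = d (s+u)" "e (s + 2*pi* of_int n + u) = e (s+u)" for u
		using periodic_int[of \<phi> "s+u" n, OF p] d_int[of "s+u" n] e_int[of "s+u" n] by (simp_all add: algebra_simps)
	then show ?thesis unfolding Phi_def using periodic_int[of \<phi> s n, OF p] by (simp add: tub_int)
qed

end

context region
begin

text \<open>Reduces an arbitrary approach within \<open>D\<close> to convergence of tubular
  coordinates. These are unique only up to periods, so the parameter is taken within
  \<open>pi\<close> of \<open>s0\<close>; then \<open>tub_lower\<close> forces both coordinates to
  converge.\<close>

lemma boundary_tendsto:
	fixes H :: "complex => complex"
	assumes k: "k < m"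
		and H: "!!s r. T k s r \<in> D ==> abs r < RR ==> H (T k s r) = B s r"
		and B: "!!s r. s \<longlonglongrightarrow> s0 ==> r \<longlonglongrightarrow> 0 ==> (!!n. abs (r n) <= RR) ==> (%n. B (s n) (r n)) \<longlonglongrightarrow> B s0 0"
	shows "(H \<longlongrightarrow> B s0 0) (at (\<eta> k s0) within D)"
	unfolding tendsto_at_iff_sequentially
proof (intro allI impI)
	fix X assume X: "\<forall>i. X i \<in> D - {\<eta> k s0}" "X \<longlonglongrightarrow> \<eta> k s0"
	interpret K: cw_loop "\<eta> k" "d\<eta> k" "dd\<eta> k" by (rule loops[OF k])
	obtain \<delta> where \<delta>: "\<delta> > 0" "!!z t. dist z (\<eta> k t) < \<delta> ==> \<exists>s r. z = T k s r & abs r < RR"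
		using near_Gam[OF k] by blast
	obtain N where N: "!!n. n >= N ==> dist (X n) (\<eta> k s0) < \<delta>" using X(2) \<delta>(1) by (auto simp: lim_sequentially)
	have "\<exists>p. X (n+N) = T k (fst p) (snd p) & abs (snd p) < RR & abs (fst p - s0) <= pi" for n
	proof -
		obtain s r where sr: "X (n+N) = T k s r" "abs r < RR" using \<delta>(2)[OF N[of "n+N"]] by auto
		obtain i :: int where i: "s0-pi <= s + 2*pi* of_int i" "s + 2*pi* of_int i < s0-pi + 2*pi"
			by (rule reduce_mod_2pi)
		then have "abs (s + 2*pi* of_int i - s0) <= pi" by linarith
		then show ?thesis using sr K.tub_int[of s i r] by (intro exI[of _ "(s + 2*pi* of_int i, r)"]) simp
	qed
	then obtain p where p: "!!n. X (n+N) = T k (fst (p n)) (snd (p n))" "!!n. abs (snd (p n)) < RR" "!!n. abs (fst (p n) - s0) <= pi"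
		by metis
	have bnd: "K.cst * (abs (fst (p n) - s0) + abs (snd (p n))) <= dist (X (n+N)) (\<eta> k s0)" for n
	proof -
		have "abs (fst (p n) - s0) <= 3*pi/2" using p(3)[of n] pi_gt_zero by linarith
		from K.tub_lower[OF this, of "snd (p n)" 0] p(2)[of n] RR_rho[OF k] K.rho_pos
		show ?thesis by (simp add: p(1) dist_norm)
	qed
	have d0: "(%n. dist (X (n+N)) (\<eta> k s0) / K.cst) \<longlonglongrightarrow> 0"
	proof -
		have "(%n. dist (X (n+N)) (\<eta> k s0)) \<longlonglongrightarrow> 0"
			using LIMSEQ_ignore_initial_segment[OF tendsto_dist_iff[THEN iffD1, OF X(2)], of N] by simp
		from tendsto_divide[OF this tendsto_const[of K.cst]] show ?thesis using K.cst_pos by simp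
	qed
	have le: "abs (fst (p n) - s0) <= dist (X (n+N)) (\<eta> k s0) / K.cst" "abs (snd (p n)) <= dist (X (n+N)) (\<eta> k s0) / K.cst" for n
	proof -
		have "abs (fst (p n) - s0) + abs (snd (p n)) <= dist (X (n+N)) (\<eta> k s0) / K.cst"
			using bnd[of n] K.cst_pos by (simp add: pos_le_divide_eq mult.commute)
		then show "abs (fst (p n) - s0) <= dist (X (n+N)) (\<eta> k s0) / K.cst" "abs (snd (p n)) <= dist (X (n+N)) (\<eta> k s0) / K.cst"
			by linarith+
	qed
	have s: "(%n. fst (p n)) \<longlonglongrightarrow> s0"
	proof -
		have "(%n. fst (p n) - s0) \<longlonglongrightarrow> 0"
			by (rule Lim_null_comparison[OF _ d0]) (use le(1) in simp)
		then show ?thesis by (simp add: LIM_zero_iff)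
	qed
	have r: "(%n. snd (p n)) \<longlonglongrightarrow> 0"
		by (rule Lim_null_comparison[OF _ d0]) (use le(2) in simp)
	have "(%n. B (fst (p n)) (snd (p n))) \<longlonglongrightarrow> B s0 0"
		by (rule B[OF s r]) (use p(2) less_imp_le in blast)
	moreover have "(H \<circ> X) (n+N) = B (fst (p n)) (snd (p n))" for n
		using H[of "fst (p n)" "snd (p n)"] X(1) p(1,2)[of n] by (metis DiffD1 o_apply)
	ultimately have "(%n. (H \<circ> X) (n+N)) \<longlonglongrightarrow> B s0 0" by simp
	then show "(H \<circ> X) \<longlonglongrightarrow> B s0 0" by (rule LIMSEQ_offset)
qed

definition holder_data :: "(nat => real => complex) => bool" where
	"holder_data \<phi> \<longleftrightarrow> (\<forall>k<m. (\<forall>t. \<phi> k (t + 2*pi) = \<phi> k t) & continuous_on UNIV (\<phi> k) &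
		 (\<exists>C \<alpha>. \<alpha> > 0 & (\<forall>s u. abs u <= pi --> norm (\<phi> k (s+u) - \<phi> k s) <= C * abs u powr \<alpha>)))"

lemma continuous_on_boundary_extension:
	fixes H :: "complex => complex"
	assumes "open S" "h holomorphic_on S" "S \<inter> Gam m \<eta> = {}" "!!z. z \<in> S ==> H z = h z"
		and "!!k s. k < m ==> (H \<longlongrightarrow> H (\<eta> k s)) (at (\<eta> k s) within (S Un Gam m \<eta>))"
	shows "continuous_on (S Un Gam m \<eta>) H"
	unfolding continuous_on_eq_continuous_within
proof
	fix x assume "x \<in> S Un Gam m \<eta>"
	then show "continuous (at x within S Un Gam m \<eta>) H"
	proof
		assume x: "x \<in> S"
		have "continuous_on S H" using holomorphic_on_imp_continuous_on[OF assms(2)] assms(4) by (simp cong: continuous_on_cong)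
		then have "isCont H x" using x assms(1) by (simp add: continuous_on_eq_continuous_at)
		then show ?thesis by (rule continuous_at_imp_continuous_at_within)
	next
		assume "x \<in> Gam m \<eta>"
		then obtain k s where "k < m" "x = \<eta> k s" by (auto simp: Gam_def)
		then show ?thesis using assms(5) by (simp add: continuous_within)
	qed
qed

text \<open>Near curve \<open>k\<close> the Cauchy integral is \<open>B\<close> plus
  \<open>\<phi>\<close> times a winding number. \<open>B\<close> collects \<open>Phi\<close> and the
  contributions of the other curves and is continuous up to the curve from both sides; the winding
  number is 0 outside and -1 inside. So the boundary values are \<open>B\<close> and
  \<open>B - \<phi>\<close>.\<close>

lemma CI_boundary:
	assumes \<phi>: "holder_data \<phi>"
	obtains f g where "analytic_ext G (Gam m \<eta>) f" "analytic_int Gm (Gam m \<eta>) g"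
		"!!k t. k < m ==> f (\<eta> k t) - g (\<eta> k t) = \<phi> k t"
proof -
	have per: "\<phi> k (t + 2*pi) = \<phi> k t" and cont: "continuous_on UNIV (\<phi> k)"
		and hol: "\<exists>C \<alpha>. \<alpha> > 0 & (\<forall>s u. abs u <= pi --> norm (\<phi> k (s+u) - \<phi> k s) <= C * abs u powr \<alpha>)" if "k < m" for k t
		using \<phi> that unfolding holder_data_def by blast+
	have ci: "continuous_on {0..2*pi} (\<phi> k)" if "k < m" for k using cont[OF that] continuous_on_subset by blast
	define V where "V = (%k z. (\<Sum>l\<in>{..<m}-{k}. cI l (\<phi> l) z) / (2*pi*\<i>))"
	define B where "B = (%k s r. smooth_loop.Phi (\<eta> k) (d\<eta> k) (\<phi> k) s r / (2*pi*\<i>) + V k (T k s r))"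
	have Bt: "(%n. B k (s n) (r n)) \<longlonglongrightarrow> B k s0 0" if k: "k < m" and s: "s \<longlonglongrightarrow> s0" and r: "r \<longlonglongrightarrow> 0" and rb: "!!n. abs (r n) <= RR" for k s r s0
	proof -
		interpret K: cw_loop "\<eta> k" "d\<eta> k" "dd\<eta> k" by (rule loops[OF k])
		obtain C \<alpha> where C: "\<alpha> > 0" "!!s u. abs u <= pi ==> norm (\<phi> k (s+u) - \<phi> k s) <= C * abs u powr \<alpha>"
			using hol[OF k] by blast
		have 1: "(%n. K.Phi (\<phi> k) (s n) (r n)) \<longlonglongrightarrow> K.Phi (\<phi> k) s0 0"
			by (rule K.Phi_tendsto[OF cont[OF k] C(1) C(2) s r]) (use rb RR_rho[OF k] order_trans in blast)+
		have 2: "(%n. cI l (\<phi> l) (T k (s n) (r n))) \<longlonglongrightarrow> cI l (\<phi> l) (T k s0 0)" if l: "l \<in> {..<m}-{k}" for l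
		proof -
			interpret L: cw_loop "\<eta> l" "d\<eta> l" "dd\<eta> l" by (rule loops) (use l in simp)
			have "T k s0 0 \<in> - range (\<eta> l)" using eta_disj[of k l] k l by auto
			moreover have "open (- range (\<eta> l))" using L.compact_range compact_imp_closed by blast
			moreover have "continuous_on (- range (\<eta> l)) (L.cint (\<phi> l))"
				by (rule holomorphic_on_imp_continuous_on[OF L.cint_holomorphic]) (use ci l in simp)
			ultimately have "isCont (L.cint (\<phi> l)) (T k s0 0)" by (simp add: continuous_on_eq_continuous_at)
			then show ?thesis by (rule isCont_tendsto_compose) (rule K.tub_tendsto[OF s r])
		qed
		show ?thesis unfolding B_def V_def by (intro tendsto_add tendsto_divide tendsto_sum tendsto_const 1 2) auto
	qed
	have Bper: "B k (s + 2*pi* of_int n) r = B k s r" if "k < m" for k s r n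
		using smooth_loop.Phi_per[OF sloops[OF that], of "\<phi> k", OF per[OF that]] smooth_loop.tub_int[OF sloops[OF that]]
		by (simp add: B_def)
	have CIB: "CI \<phi> (T k s r) = B k s r + (if r < 0 then - \<phi> k s else 0)" if k: "k < m" and r: "r ~= 0" "abs r <= RR" for k s r
	proof -
		interpret K: cw_loop "\<eta> k" "d\<eta> k" "dd\<eta> k" by (rule loops[OF k])
		obtain C \<alpha> where C: "\<alpha> > 0" "!!s u. abs u <= pi ==> norm (\<phi> k (s+u) - \<phi> k s) <= C * abs u powr \<alpha>"
			using hol[OF k] by blast
		have rr: "abs r <= K.rho" using r RR_rho[OF k] by linarith
		have nr: "T k s r ~: range (\<eta> k)" using T_notin_Gam[OF k r, of s] eta_in_Gam[OF k] by auto
		have wn: "winding_number (curve (\<eta> k)) (T k s r) = (if r < 0 then -1 else 0)"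
			using r K.winding_out[OF T_outside[OF k, of r s]] K.cw[OF T_inside[OF k, of "-r" s]] by auto
		have "integral {0..2*pi} (%t. d\<eta> k t / (\<eta> k t - T k s r)) = 2*pi*\<i> * winding_number (curve (\<eta> k)) (T k s r)"
			using K.winding_integral[OF nr] by simp
		moreover have "cI k (\<phi> k) (T k s r) = K.Phi (\<phi> k) s r + \<phi> k s * integral {0..2*pi} (%t. d\<eta> k t / (\<eta> k t - T k s r))"
			unfolding cI_def[OF k] by (rule K.Cauchy_split[OF cont[OF k] C(1) C(2) per[OF k] r(1) rr])
		ultimately have "cI k (\<phi> k) (T k s r) = K.Phi (\<phi> k) s r + \<phi> k s * (2*pi*\<i> * (if r < 0 then -1 else 0))"
			unfolding wn by simp
		moreover have "(\<Sum>l<m. cI l (\<phi> l) (T k s r)) = cI k (\<phi> k) (T k s r) + (\<Sum>l\<in>{..<m}-{k}. cI l (\<phi> l) (T k s r))"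
			by (rule sum.remove) (use k in auto)
		moreover have "(p + q * (c * x) + v) / c = p / c + v / c + q * x" if "c ~= 0" for p q c x v :: complex
			using that by (simp add: add_divide_distrib)
		ultimately show ?thesis unfolding CI_sum B_def V_def by simp
	qed
	\<comment> \<open>The boundary data are functions of the parameter, so a parameter is chosen for
	  each boundary point. It is determined up to periods, to which \<open>B\<close> and
	  \<open>\<phi>\<close> are insensitive.\<close>
	define cs where "cs z = (SOME p. fst p < m & z = \<eta> (fst p) (snd p))" for z
	have cs: "fst (cs (\<eta> k s)) = k & (\<exists>n::int. snd (cs (\<eta> k s)) = s + 2*pi* of_int n)" if k: "k < m" for k s
	proof -
		have "\<exists>p. fst p < m & \<eta> k s = \<eta> (fst p) (snd p)" using k by (intro exI[of _ "(k,s)"]) auto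
		from someI_ex[OF this, folded cs_def] have c: "fst (cs (\<eta> k s)) < m" "\<eta> k s = \<eta> (fst (cs (\<eta> k s))) (snd (cs (\<eta> k s)))" by auto
		have "fst (cs (\<eta> k s)) = k"
		proof (rule ccontr)
			assume "fst (cs (\<eta> k s)) ~= k"
			then show False using eta_disj[OF c(1) k] c(2) by (metis disjoint_iff rangeI)
		qed
		then show ?thesis using smooth_loop.e_eqD[OF sloops[OF k]] c(2) by metis
	qed
	define bv where "bv z = B (fst (cs z)) (snd (cs z)) 0" for z
	have bv: "bv (\<eta> k s) = B k s 0" if "k < m" for k s
		using cs[OF that, of s] Bper[OF that] by (auto simp: bv_def)
	define ph where "ph z = \<phi> (fst (cs z)) (snd (cs z))" for z
	have ph: "ph (\<eta> k s) = \<phi> k s" if "k < m" for k s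
		using cs[OF that, of s] periodic_int[of "\<phi> k" s, OF per[OF that]] by (auto simp: ph_def)
	define f where "f z = (if z \<in> Gam m \<eta> then bv z else CI \<phi> z)" for z
	define g where "g z = (if z \<in> Gam m \<eta> then bv z - ph z else CI \<phi> z)" for z
	have fe: "f (\<eta> k s) = B k s 0" "g (\<eta> k s) = B k s 0 - \<phi> k s" if "k < m" for k s
		using eta_in_Gam[OF that] bv[OF that] ph[OF that] by (auto simp: f_def g_def)
	have holC: "CI \<phi> holomorphic_on - Gam m \<eta>" by (rule CI_holomorphic[OF ci])
	have GG: "G <= - Gam m \<eta>" "Gm <= - Gam m \<eta>" using G_Gam_disj by auto
	have fG: "f z = CI \<phi> z" "g z = CI \<phi> z" if "z ~: Gam m \<eta>" for z using that by (auto simp: f_def g_def)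
	have "analytic_ext G (Gam m \<eta>) f"
		unfolding analytic_ext_def
	proof (intro conjI)
		show "f holomorphic_on G"
			by (rule holomorphic_transform[OF holomorphic_on_subset[OF holC GG(1)]]) (use fG GG in auto)
		show "continuous_on (G Un Gam m \<eta>) f"
		proof (rule continuous_on_boundary_extension[OF G_open holomorphic_on_subset[OF holC GG(1)] G_Gam_disj])
			show "f z = CI \<phi> z" if "z \<in> G" for z using fG that GG by blast
			fix k s assume k: "k < m"
			have "(f \<longlongrightarrow> B k s 0) (at (\<eta> k s) within G Un Gam m \<eta>)"
			proof (rule boundary_tendsto[OF k])
				fix s r assume a: "T k s r \<in> G Un Gam m \<eta>" "abs r < RR"
				consider "r = 0" | "r > 0" | "r < 0" by linarith
				then show "f (T k s r) = B k s r"
				proof cases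
					case 1 then show ?thesis using fe[OF k] k by simp
				next
					case 2 then show ?thesis using CIB[OF k, of r s] fG(1) T_notin_Gam[OF k, of r s] a(2) by auto
				next
					case 3 then show ?thesis using a T_inside[OF k, of "-r" s] ins_Gm[OF k] by auto
				qed
			qed (use Bt[OF k] in auto)
			then show "(f \<longlongrightarrow> f (\<eta> k s)) (at (\<eta> k s) within G Un Gam m \<eta>)" using fe[OF k] by simp
		qed
		show "(f \<longlongrightarrow> 0) at_infinity"
		proof (rule Lim_transform_eventually[OF CI_at_infinity[OF ci]])
			obtain b where b: "!!z. z \<in> Gam m \<eta> ==> norm z <= b" using compact_imp_bounded[OF Gam_compact] unfolding bounded_iff by blast
			show "\<forall>\<^sub>F z in at_infinity. CI \<phi> z = f z"
				unfolding eventually_at_infinity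
			proof (intro exI[of _ "b+1"] allI impI)
				fix z :: complex assume "b + 1 <= norm z"
				then have "z ~: Gam m \<eta>" using b[of z] by auto
				then show "CI \<phi> z = f z" using fG by simp
			qed
		qed
	qed
	moreover have "analytic_int Gm (Gam m \<eta>) g"
		unfolding analytic_int_def
	proof (intro conjI)
		show "g holomorphic_on Gm"
			by (rule holomorphic_transform[OF holomorphic_on_subset[OF holC GG(2)]]) (use fG GG in auto)
		show "continuous_on (Gm Un Gam m \<eta>) g"
		proof (rule continuous_on_boundary_extension[OF Gm_open holomorphic_on_subset[OF holC GG(2)]])
			show "g z = CI \<phi> z" if "z \<in> Gm" for z using fG that GG by blast
			fix k s assume k: "k < m"
			interpret K: cw_loop "\<eta> k" "d\<eta> k" "dd\<eta> k" by (rule loops[OF k])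
			have "(g \<longlongrightarrow> B k s 0 - \<phi> k s) (at (\<eta> k s) within Gm Un Gam m \<eta>)"
			proof (rule boundary_tendsto[OF k, where B="%s r. B k s r - \<phi> k s"])
				fix s r assume a: "T k s r \<in> Gm Un Gam m \<eta>" "abs r < RR"
				consider "r = 0" | "r > 0" | "r < 0" by linarith
				then show "g (T k s r) = B k s r - \<phi> k s"
				proof cases
					case 1 then show ?thesis using fe[OF k] k by simp
				next
					case 2 then show ?thesis using a T_in_G[OF k, of r s] G_Gam_disj by auto
				next
					case 3 then show ?thesis using CIB[OF k, of r s] fG(2) T_notin_Gam[OF k, of r s] a(2) by auto
				qed
			next
				fix s' r assume "s' \<longlonglongrightarrow> s" "r \<longlonglongrightarrow> 0" "!!n. abs (r n) <= RR"
				moreover have "isCont (\<phi> k) s" using cont[OF k] by (simp add: continuous_on_eq_continuous_at)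
				ultimately show "(%n. B k (s' n) (r n) - \<phi> k (s' n)) \<longlonglongrightarrow> B k s 0 - \<phi> k s"
					by (intro tendsto_diff Bt[OF k] isCont_tendsto_compose[of s "\<phi> k"])
			qed
			then show "(g \<longlongrightarrow> g (\<eta> k s)) (at (\<eta> k s) within Gm Un Gam m \<eta>)" using fe[OF k] by simp
		qed auto
	qed
	moreover have "f (\<eta> k t) - g (\<eta> k t) = \<phi> k t" if "k < m" for k t using fe[OF that] by simp
	ultimately show ?thesis using that by blast
qed

end

section \<open>The integral operator and its relation to boundary values\<close>

locale rh = region +
	fixes A :: "complex => complex"
	assumes wl: "!!k. k < m ==> weighted_loop (\<eta> k) (d\<eta> k) (dd\<eta> k) (%t. A (\<eta> k t))"
begin

abbreviation Nn :: "(nat => real => real) => nat => real => real" where "Nn \<equiv> Nop m \<eta> d\<eta> A"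

lemma A_nz: "k < m ==> A (\<eta> k t) ~= 0"
	using weighted_loop.a_nz[OF wl] .

abbreviation kn :: "nat => real => real => real" where
	"kn k \<equiv> weighted_loop.kern (\<eta> k) (d\<eta> k) (%t. A (\<eta> k t))"

lemma Nker_diag: assumes "k < m" shows "Nker \<eta> d\<eta> A k s k t = kn k s t / pi"
proof -
	interpret W: weighted_loop "\<eta> k" "d\<eta> k" "dd\<eta> k" "%t. A (\<eta> k t)" by (rule wl[OF assms])
	have "(1 / complex_of_real pi) * (A (\<eta> k s) / A (\<eta> k t)) * (d\<eta> k t / (\<eta> k t - \<eta> k s)) = (W.w s t / (\<eta> k t - \<eta> k s)) / of_real pi"
		by (simp add: W.w_def)
	then show ?thesis unfolding Nker_def W.kern_def by (simp only: Im_divide_of_real)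
qed

lemma Nop_split:
	assumes "j < m"
	shows "Nn x j s = integral {0..2*pi} (%t. kn j s t * x j t) / pi
		 + (\<Sum>k\<in>{..<m}-{j}. integral {0..2*pi} (%t. Nker \<eta> d\<eta> A j s k t * x k t))"
proof -
	have "Nn x j s = integral {0..2*pi} (%t. Nker \<eta> d\<eta> A j s j t * x j t) + (\<Sum>k\<in>{..<m}-{j}. integral {0..2*pi} (%t. Nker \<eta> d\<eta> A j s k t * x k t))"
		unfolding Nop_def by (rule sum.remove) (use assms in auto)
	moreover have "integral {0..2*pi} (%t. Nker \<eta> d\<eta> A j s j t * x j t) = integral {0..2*pi} (%t. kn j s t * x j t) / pi"
		using integral_divide[of "{0..2*pi}" "%t. kn j s t * x j t" pi] by (simp add: Nker_diag[OF assms])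
	ultimately show ?thesis by simp
qed

lemma eta_cont: "k < m ==> continuous_on S (\<eta> k)" and deta_cont: "k < m ==> continuous_on S (d\<eta> k)"
	and A_cont: "k < m ==> continuous_on S (%t. A (\<eta> k t))"
	using smooth_loop.e_cont[OF sloops] smooth_loop.d_cont[OF sloops] weighted_loop.a_cont[OF wl] continuous_on_subset by blast+

lemma off_diag_ne: "[|j < m; k \<in> {..<m}-{j}|] ==> \<eta> k t - \<eta> j s ~= 0"
	using eta_disj[of k j] by fastforce

lemma Nker_off_cont:
	assumes "j < m" "k \<in> {..<m}-{j}"
	shows "continuous_on S (%t. Nker \<eta> d\<eta> A j s k t)"
	unfolding Nker_def using assms off_diag_ne[OF assms] A_nz[of k]
	by (intro continuous_intros eta_cont deta_cont A_cont) auto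

text \<open>The boundary behaviour of the Cauchy integral in terms of \<open>N\<close>: only the sum of the values from both
	sides enters, so that no principal values are needed and continuity of \<open>\<gamma>\<close> suffices.\<close>

lemma Re_boundary_sum:
	fixes \<gamma> :: "nat => real => real"
	assumes f: "analytic_ext G (Gam m \<eta>) f" and g: "analytic_int Gm (Gam m \<eta>) g"
		and gam: "!!k t. k < m ==> A (\<eta> k t) * (f (\<eta> k t) - g (\<eta> k t)) = of_real (\<gamma> k t)"
		and j: "j < m"
	shows "Re (A (\<eta> j s) * (f (\<eta> j s) + g (\<eta> j s))) = Nn \<gamma> j s"
proof -
	interpret W: weighted_loop "\<eta> j" "d\<eta> j" "dd\<eta> j" "%t. A (\<eta> j t)" by (rule wl[OF j])
	interpret K: cw_loop "\<eta> j" "d\<eta> j" "dd\<eta> j" by (rule loops[OF j])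
	have contf: "continuous_on (G Un Gam m \<eta>) f" and contg: "continuous_on (Gm Un Gam m \<eta>) g"
		using f g by (auto simp: analytic_ext_def analytic_int_def)
	have gc: "continuous_on UNIV (\<gamma> k)" if k: "k < m" for k
	proof -
		have "continuous_on UNIV (%t. Re (A (\<eta> k t) * (f (\<eta> k t) - g (\<eta> k t))))"
			by (intro continuous_intros A_cont k continuous_on_compose2[OF contf] continuous_on_compose2[OF contg] eta_cont)
				 (use eta_in_Gam[OF k] in auto)
		then show ?thesis by (simp add: gam[OF k])
	qed
	have gp: "\<gamma> k (t + 2*pi) = \<gamma> k t" if k: "k < m" for k t
		using gam[OF k, of t] gam[OF k, of "t+2*pi"] smooth_loop.per[OF sloops[OF k]] by (metis of_real_eq_iff)
	define \<phi> where "\<phi> = (%k t. complex_of_real (\<gamma> k t) / A (\<eta> k t))"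
	have phe: "\<phi> k t = f (\<eta> k t) - g (\<eta> k t)" if "k < m" for k t
		using gam[OF that, of t] A_nz[OF that, of t] by (simp add: \<phi>_def field_simps)
	have phc: "continuous_on S (\<phi> k)" if k: "k < m" for k S
		unfolding \<phi>_def using A_nz[OF k] by (intro continuous_intros A_cont k continuous_on_subset[OF gc[OF k]]) auto
	have cif: "continuous_on {0..2*pi} (%t. f (\<eta> k t))" "continuous_on {0..2*pi} (%t. g (\<eta> k t))" if k: "k < m" for k
		by (intro continuous_on_compose2[OF contf] continuous_on_compose2[OF contg] eta_cont k; use eta_in_Gam[OF k] in auto)+
	have CIeq: "CI \<phi> z = (if z \<in> G then f z else g z)" if z: "z ~: Gam m \<eta>" for z
	proof -
		have "cI k (\<phi> k) z = cI k (%t. f (\<eta> k t)) z - cI k (%t. g (\<eta> k t)) z" if k: "k < m" for k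
		proof -
			have ne: "\<eta> k t - z ~= 0" for t using z eta_in_Gam[OF k, of t] by auto
			have i: "(%t. f (\<eta> k t) * d\<eta> k t / (\<eta> k t - z)) integrable_on {0..2*pi}" "(%t. g (\<eta> k t) * d\<eta> k t / (\<eta> k t - z)) integrable_on {0..2*pi}"
				using ne by (intro integrable_continuous_real continuous_intros cif k eta_cont deta_cont; auto)+
			show ?thesis unfolding cI_def[OF k] Henstock_Kurzweil_Integration.integral_diff[OF i, symmetric]
				by (simp add: phe[OF k] left_diff_distrib diff_divide_distrib)
		qed
		then have "CI \<phi> z = CI (%k t. f (\<eta> k t)) z - CI (%k t. g (\<eta> k t)) z"
			unfolding CI_sum by (simp add: sum_subtractf diff_divide_distrib)
		then show ?thesis using CI_ext[OF f z] CI_int[OF g z] by simp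
	qed
	define r where "r = (%n. RR / real (Suc n))"
	have r: "0 < r n" "r n <= RR" for n using RR_pos by (auto simp: r_def field_simps)
	have r0: "r \<longlonglongrightarrow> 0" unfolding r_def by (rule lim_const_over_n[THEN LIMSEQ_Suc])
	have rr: "r n <= W.rho" for n using r(2)[of n] RR_rho[OF j] by linarith
	let ?a = "A (\<eta> j s)"
	have lim1: "(%n. Re (?a * (f (T j s (r n)) + g (T j s (- r n))))) \<longlonglongrightarrow> Re (?a * (f (\<eta> j s) + g (\<eta> j s)))"
	proof -
		have t: "(%n. T j s (r n)) \<longlonglongrightarrow> \<eta> j s" "(%n. T j s (- r n)) \<longlonglongrightarrow> \<eta> j s"
			using W.tub_tendsto[OF tendsto_const r0, of s] W.tub_tendsto[OF tendsto_const tendsto_minus[OF r0], of s] by auto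
		have "(%n. f (T j s (r n))) \<longlonglongrightarrow> f (\<eta> j s)"
			by (rule continuous_on_tendsto_compose[OF contf t(1)]) (use T_in_G[OF j r] eta_in_Gam[OF j] in auto)
		moreover have "(%n. g (T j s (- r n))) \<longlonglongrightarrow> g (\<eta> j s)"
		proof (rule continuous_on_tendsto_compose[OF contg t(2)])
			have "T j s (- r n) \<in> Gm Un Gam m \<eta>" for n using T_inside[OF j r] ins_Gm[OF j] by blast
			then show "\<forall>\<^sub>F n in sequentially. T j s (- r n) \<in> Gm Un Gam m \<eta>" by (intro always_eventually allI)
			show "\<eta> j s \<in> Gm Un Gam m \<eta>" using eta_in_Gam[OF j] by blast
		qed
		ultimately show ?thesis by (intro tendsto_intros)
	qed
	define rest where "rest = (%z. \<Sum>k\<in>{..<m}-{j}. cI k (\<phi> k) z)"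
	have eq: "Re (?a * (f (T j s (r n)) + g (T j s (- r n)))) =
			(Im (?a * (cI j (\<phi> j) (T j s (r n)) + cI j (\<phi> j) (T j s (- r n)))) + Im (?a * (rest (T j s (r n)) + rest (T j s (- r n))))) / (2*pi)" for n
	proof -
		have n: "T j s (r n) ~: Gam m \<eta>" "T j s (- r n) ~: Gam m \<eta>"
			using T_notin_Gam[OF j, of "r n" s] T_notin_Gam[OF j, of "- r n" s] r[of n] by auto
		have "T j s (- r n) ~: G" using T_inside[OF j r] ins_Gm[OF j] by blast
		then have "f (T j s (r n)) + g (T j s (- r n)) = CI \<phi> (T j s (r n)) + CI \<phi> (T j s (- r n))"
			using CIeq n T_in_G[OF j r] by simp
		moreover have "(\<Sum>k<m. cI k (\<phi> k) z) = cI j (\<phi> j) z + rest z" for z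
			unfolding rest_def by (rule sum.remove) (use j in auto)
		moreover have "a * ((c1+q1)/k+(c2+q2)/k) = (a*(c1+c2)+a*(q1+q2))/k" for a c1 q1 c2 q2 k :: complex
			by (simp add: add_divide_distrib distrib_left)
		ultimately have "?a * (f (T j s (r n)) + g (T j s (- r n))) =
			 (?a * (cI j (\<phi> j) (T j s (r n)) + cI j (\<phi> j) (T j s (- r n))) + ?a * (rest (T j s (r n)) + rest (T j s (- r n)))) / (2*pi*\<i>)"
			unfolding CI_sum by (simp only:)
		\<comment> \<open>Division by \<open>\<i>\<close> turns the real part wanted here into the
		  imaginary part of the kernel, where the singular term is invisible.\<close>
		moreover have "Re (z / (2*pi*\<i>)) = Im z / (2*pi)" for z
			by (simp add: Re_divide power2_eq_square)
		ultimately show ?thesis by simp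
	qed
	have lim2: "(%n. Im (?a * (cI j (\<phi> j) (T j s (r n)) + cI j (\<phi> j) (T j s (- r n))))) \<longlonglongrightarrow> 2 * integral {0..2*pi} (%t. kn j s t * \<gamma> j t)"
		unfolding cI_def[OF j] \<phi>_def by (rule W.sum_limit[OF gc[OF j] gp[OF j] r(1) rr r0])
	have lim3: "(%n. Im (?a * (rest (T j s (r n)) + rest (T j s (- r n))))) \<longlonglongrightarrow> Im (?a * (rest (\<eta> j s) + rest (\<eta> j s)))"
	proof -
		have t: "(%n. T j s (r n)) \<longlonglongrightarrow> \<eta> j s" "(%n. T j s (- r n)) \<longlonglongrightarrow> \<eta> j s"
			using W.tub_tendsto[OF tendsto_const r0, of s] W.tub_tendsto[OF tendsto_const tendsto_minus[OF r0], of s] by auto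
		have c: "isCont (cI l (\<phi> l)) (\<eta> j s)" if l: "l \<in> {..<m}-{j}" for l
		proof -
			interpret L: cw_loop "\<eta> l" "d\<eta> l" "dd\<eta> l" by (rule loops) (use l in simp)
			have "\<eta> j s \<in> - range (\<eta> l)" using eta_disj[of j l] j l by auto
			moreover have "open (- range (\<eta> l))" using L.compact_range compact_imp_closed by blast
			moreover have "continuous_on (- range (\<eta> l)) (L.cint (\<phi> l))"
				by (rule holomorphic_on_imp_continuous_on[OF L.cint_holomorphic]) (use phc l in simp)
			ultimately show ?thesis by (simp add: continuous_on_eq_continuous_at)
		qed
		show ?thesis unfolding rest_def
			by (intro tendsto_intros tendsto_sum isCont_tendsto_compose[OF c] t)
	qed
	have "(%n. Re (?a * (f (T j s (r n)) + g (T j s (- r n))))) \<longlonglongrightarrow>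
		 (2 * integral {0..2*pi} (%t. kn j s t * \<gamma> j t) + Im (?a * (rest (\<eta> j s) + rest (\<eta> j s)))) / (2*pi)"
		unfolding eq by (intro tendsto_intros lim2 lim3) simp
	note eq2 = LIMSEQ_unique[OF lim1 this]
	have "Im (a * (q + q)) = 2 * Im (a * q)" for a q by (simp add: algebra_simps)
	moreover have "(2 * x + 2 * y) / (2*pi) = x / pi + y / pi" for x y :: real by (simp add: field_simps)
	ultimately
	have "Re (?a * (f (\<eta> j s) + g (\<eta> j s))) = integral {0..2*pi} (%t. kn j s t * \<gamma> j t) / pi + Im (?a * rest (\<eta> j s)) / pi"
		using eq2 by (simp only:)
	also have "Im (?a * rest (\<eta> j s)) / pi = (\<Sum>k\<in>{..<m}-{j}. integral {0..2*pi} (%t. Nker \<eta> d\<eta> A j s k t * \<gamma> k t))"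
	proof -
		have "integral {0..2*pi} (%t. Nker \<eta> d\<eta> A j s k t * \<gamma> k t) = Im (?a * cI k (\<phi> k) (\<eta> j s)) / pi" if k: "k \<in> {..<m}-{j}" for k
		proof -
			have km: "k < m" using k by simp
			have ne: "\<eta> k t - \<eta> j s ~= 0" for t using off_diag_ne[OF j k] .
			have "(%t. \<phi> k t * d\<eta> k t / (\<eta> k t - \<eta> j s)) integrable_on {0..2*pi}"
				using ne by (intro integrable_continuous_real continuous_intros phc km eta_cont deta_cont) auto
			then have "((%t. \<phi> k t * d\<eta> k t / (\<eta> k t - \<eta> j s)) has_integral cI k (\<phi> k) (\<eta> j s)) {0..2*pi}"
				unfolding cI_def[OF km] by (rule integrable_integral)
			then have "((%t. Im (?a * (\<phi> k t * d\<eta> k t / (\<eta> k t - \<eta> j s))) / pi) has_integral (Im (?a * cI k (\<phi> k) (\<eta> j s)) / pi)) {0..2*pi}"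
				by (intro has_integral_divide has_integral_Im has_integral_mult_right)
			moreover have "Im (?a * (\<phi> k t * d\<eta> k t / (\<eta> k t - \<eta> j s))) / pi = Nker \<eta> d\<eta> A j s k t * \<gamma> k t" for t
			proof -
				have "?a * (\<phi> k t * d\<eta> k t / (\<eta> k t - \<eta> j s)) = of_real (\<gamma> k t) * (?a / A (\<eta> k t) * (d\<eta> k t / (\<eta> k t - \<eta> j s)))"
					by (simp add: \<phi>_def)
				moreover have "Nker \<eta> d\<eta> A j s k t = Im (?a / A (\<eta> k t) * (d\<eta> k t / (\<eta> k t - \<eta> j s))) / pi"
				proof -
					have "(1 / complex_of_real pi) * x * y = (x * y) / of_real pi" for x y by simp
					then show ?thesis unfolding Nker_def by (simp only: Im_divide_of_real)
				qed
				ultimately obtain Z where Z: "?a * (\<phi> k t * d\<eta> k t / (\<eta> k t - \<eta> j s)) = of_real (\<gamma> k t) * Z" "Nker \<eta> d\<eta> A j s k t = Im Z / pi"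
					by blast
				show ?thesis unfolding Z by simp
			qed
			ultimately show ?thesis by (simp add: integral_unique)
		qed
		then show ?thesis unfolding rest_def by (simp add: sum_distrib_left sum_divide_distrib)
	qed
	finally show ?thesis unfolding Nop_split[OF j] .
qed

end

section \<open>Compactness of the integral operator\<close>

text \<open>Injectivity keeps a basis of \<open>span W\<close> independent, and an independent set
  of that size inside \<open>span W\<close> already spans it.\<close>

lemma inj_linear_surj_finite_span:
	fixes S :: "'a::real_vector => 'a"
	assumes S: "linear S" and fin: "finite W" and maps: "!!x. x \<in> span W ==> S x \<in> span W"
		and inj: "!!x. S x = 0 ==> x = 0" and u: "u \<in> span W"
	obtains x where "x \<in> span W" "S x = u"
proof -
	obtain B where B: "B <= span W" "independent B" "span W <= span B" "card B = dim (span W)"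
		using basis_exists by blast
	have finB: "finite B" using independent_span_bound[OF fin B(2,1)] by simp
	have spB: "span B = span W" using B span_minimal[OF B(1) subspace_span] by blast
	have injS: "inj S" using inj linear_injective_0[OF S] by blast
	have ind: "independent (S ` B)"
		using linear_independent_injective_image[OF S B(2)] injS by (simp add: inj_on_subset)
	have cardS: "card (S ` B) = card B" by (rule card_image) (rule inj_on_subset[OF injS subset_UNIV])
	have "u \<in> span (S ` B)"
	proof (rule ccontr)
		assume nu: "u ~: span (S ` B)"
		then have i: "independent (insert u (S ` B))" using ind by (rule independent_insertI)
		have "insert u (S ` B) <= span B" using u maps B(1) spB by auto
		from independent_span_bound[OF finB i this] have "card (insert u (S ` B)) <= card B" by simp
		moreover have "u ~: S ` B"
		proof
			assume "u \<in> S ` B"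
			then have "u \<in> span (S ` B)" by (rule span_base)
			then show False using nu by contradiction
		qed
		ultimately show False using finB cardS by simp
	qed
	then have "u \<in> S ` span B" using linear_span_image[OF S] by blast
	then show ?thesis using that spB by blast
qed

text \<open>For \<open>L\<close> bijective and \<open>F\<close> of finite rank, \<open>L - F\<close> behaves like an endomorphism of a finite
	dimensional space; completing it by a projection onto its kernel makes it injective, hence surjective.\<close>

lemma finite_rank_fredholm:
	fixes L F :: "'a::real_vector => 'a"
	assumes L: "linear L" "inj L" "surj L" and F: "linear F" and fin: "finite B" and rg: "!!x. F x \<in> span B"
	shows "\<exists>W. finite W & {x. L x = F x} <= span W"
		and "(!!x y. L x = F x ==> x = L y - F y ==> x = 0) ==> \<exists>y z. x = L y - F y + z & L z = F z"
proof -
	define M where "M = inv L"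
	have Minv: "M (L x) = x" "L (M x) = x" for x using L by (auto simp: M_def surj_f_inv_f)
	have linM: "linear M"
	proof (rule linearI)
		show "M (x + y) = M x + M y" for x y
			using Minv(1)[of "M x + M y"] by (simp add: linear_add[OF L(1)] Minv(2))
		show "M (c *\<^sub>R x) = c *\<^sub>R M x" for c x
			using Minv(1)[of "c *\<^sub>R M x"] by (simp add: linear_scale[OF L(1)] Minv(2))
	qed
	have fW: "finite (M ` B)" using fin by simp
	have nullW: "{x. L x = F x} <= span (M ` B)"
	proof
		fix x assume "x \<in> {x. L x = F x}"
		then have "x = M (F x)" using Minv(1)[of x] by simp
		moreover have "M (F x) \<in> span (M ` B)" using rg[of x] linear_span_image[OF linM] by blast
		ultimately show "x \<in> span (M ` B)" by simp
	qed
	then show "\<exists>W. finite W & {x. L x = F x} <= span W" using fW by blast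
	assume triv: "!!x y. L x = F x ==> x = L y - F y ==> x = 0"
	define Nul where "Nul = {x. L x = F x}"
	have subN: "subspace Nul"
		unfolding Nul_def subspace_def using L(1) F by (auto simp: linear_0 linear_add linear_scale)
	obtain b where b: "b <= Nul" "independent b" "Nul <= span b" "card b = dim Nul"
		using basis_exists by blast
	have spb: "span b = Nul" using b span_minimal[OF b(1) subN] by blast
	have finb: "finite b" using independent_span_bound[OF fW b(2)] b(1) nullW unfolding Nul_def by blast
	obtain P where P: "linear P" "!!x. x \<in> b ==> P x = x" "range P = span b"
		using linear_independent_extend_subspace[OF b(2), of id] by auto
	have PN: "P x = x" if "x \<in> Nul" for x
		using linear_eq_on_span[OF P(1) linear_id, of b] P(2) that spb by auto
	have PNul: "P x \<in> Nul" for x using P(3) spb by blast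
	\<comment> \<open>\<open>L - F'\<close> is injective: if it kills \<open>x\<close>, then
	  \<open>L x - F x = - P x\<close> lies in the range and in the null space of \<open>L - F\<close>,
	  hence is 0 by assumption; so \<open>x\<close> is in the null space and
	  \<open>x = P x = 0\<close>.\<close>
	define F' where "F' = (%x. F x - P x)"
	have linF': "linear F'" unfolding F'_def by (intro linear_compose_sub F P)
	define W where "W = M ` (B Un b)"
	have finW: "finite W" using fin finb by (simp add: W_def)
	have rgF': "F' x \<in> span (B Un b)" for x
		unfolding F'_def using rg[of x] PNul[of x] spb span_mono[of B "B Un b"] span_mono[of b "B Un b"] by (intro span_diff) auto
	have MF: "M (F' x) \<in> span W" for x
		using rgF'[of x] linear_span_image[OF linM] unfolding W_def by blast
	\<comment> \<open>\<open>S\<close> is the inverse of \<open>L\<close> applied to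
	  \<open>L - F'\<close>. It is the identity up to values in \<open>span W\<close>, so it maps this
	  finite dimensional space into itself.\<close>
	define S where "S = (%x. x - M (F' x))"
	have linS: "linear S" unfolding S_def
		by (intro linear_compose_sub linear_ident) (use linear_compose[OF linF' linM] in \<open>simp add: o_def\<close>)
	have LS: "L (S x) = L x - F' x" for x
		unfolding S_def using linear_diff[OF L(1)] Minv(2) by simp
	have injS: "x = 0" if "S x = 0" for x
	proof -
		have "L x - F' x = 0" using LS[of x] that linear_0[OF L(1)] by simp
		then have e: "L x - F x = - P x" by (simp add: F'_def algebra_simps)
		have nl: "- P x \<in> Nul" using PNul[of x] subN by (simp add: subspace_neg)
		then have "L (- P x) = F (- P x)" by (simp only: Nul_def mem_Collect_eq)
		then have "- P x = 0" using e[symmetric] by (rule triv)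
		then have P0: "P x = 0" by simp
		then have "x \<in> Nul" using e by (simp add: Nul_def)
		then show "x = 0" using PN[of x] P0 by simp
	qed
	have "S y \<in> span W" if "y \<in> span W" for y unfolding S_def using that MF by (intro span_diff)
	\<comment> \<open>\<open>M x\<close> is a first guess for the solution with error
	  \<open>M (F' (M x))\<close> in \<open>span W\<close>; there \<open>S\<close> is surjective and
	  \<open>u\<close> corrects the error.\<close>
	then obtain u where u: "S u = M (F' (M x))"
		using inj_linear_surj_finite_span[OF linS finW _ injS MF] by blast
	define y where "y = M x + u"
	have "S y = M x"
		unfolding y_def linear_add[OF linS] u by (simp add: S_def)
	then have "x = L y - F' y" using LS[of y] Minv by simp
	then have "x = L y - F y + P y" by (simp add: F'_def)
	then show "\<exists>y z. x = L y - F y + z & L z = F z" using PNul[of y] unfolding Nul_def by blast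
qed

text \<open>Normalised cosine bumps at \<open>n\<close> equally spaced nodes on the circle, each
  supported within one mesh of its node modulo periods. For \<open>n >= 2\<close> the mesh
  \<open>h\<close> is at most \<open>pi\<close>, where the cosine is monotone.\<close>

lemma partition_weights:
	assumes "n >= 2"
	obtains v :: "nat => real => real" where
		"!!i. continuous_on UNIV (v i)" "!!i s. v i s >= 0" "!!s. (\<Sum>i<n. v i s) = 1"
		"!!i s. v i s ~= 0 ==> \<exists>p::int. abs (s - (real i * (2*pi/n) + 2*pi* of_int p)) <= 2*pi/n"
proof -
	define h where "h = 2*pi/n"
	have h: "0 < h" "h <= pi" using assms by (auto simp: h_def field_simps)
	define w where "w = (%i s. max 0 (cos (s - real i * h) - cos h))"
	have wc: "continuous_on UNIV (w i)" for i unfolding w_def by (intro continuous_intros)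
	have w0: "w i s >= 0" for i s by (simp add: w_def)
	define S where "S = (%s. \<Sum>i<n. w i s)"
	have pos: "S s > 0" for s
	proof -
		obtain p :: int where p: "0 <= s + 2*pi* of_int p" "s + 2*pi* of_int p < 0 + 2*pi" by (rule reduce_mod_2pi)
		define t where "t = s + 2*pi* of_int p"
		define i where "i = nat \<lfloor>t/h\<rfloor>"
		have t0: "0 <= t" "t < 2*pi" using p by (auto simp: t_def)
		have th: "0 <= t/h" "t/h < n"
		proof -
			show "0 <= t/h" using t0 h by simp
			have "real n * h = 2*pi" using assms by (simp add: h_def)
			then show "t/h < n" using t0 h by (simp add: pos_divide_less_eq)
		qed
		have ii: "real i <= t/h" "t/h < real i + 1" using th by (auto simp: i_def)
		then have "i < n" using th by linarith
		have b: "0 <= t - real i * h" "t - real i * h < h"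
			using ii h by (simp_all add: pos_le_divide_eq pos_divide_less_eq algebra_simps)
		have "cos (t - real i * h) > cos h" using cos_monotone_0_pi[of "t - real i * h" h] b h by auto
		moreover have "cos (t - real i * h) = cos (s - real i * h)"
		proof -
			have "t - real i * h = (s - real i * h) + 2*pi* of_int p" by (simp add: t_def)
			then show ?thesis by (simp only: periodic_int[of cos, OF cos_periodic])
		qed
		ultimately have "w i s > 0" by (simp add: w_def)
		moreover have "w i s <= S s" unfolding S_def using \<open>i < n\<close> w0 by (intro member_le_sum) auto
		ultimately show ?thesis by linarith
	qed
	show ?thesis
	proof (rule that[of "%i s. w i s / S s"])
		show "continuous_on UNIV (%s. w i s / S s)" for i
		proof (intro continuous_on_divide wc)
			show "continuous_on UNIV S" unfolding S_def by (intro continuous_on_sum wc)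
			show "\<forall>s\<in>UNIV. S s ~= 0" using pos by (metis less_numeral_extra(3))
		qed
		show "w i s / S s >= 0" for i s using w0[of i s] pos[of s] by simp
		show "(\<Sum>i<n. w i s / S s) = 1" for s
		proof -
			have "(\<Sum>i<n. w i s / S s) = S s / S s" unfolding sum_divide_distrib[symmetric] by (simp add: S_def)
			then show ?thesis using pos[of s] by simp
		qed
		show "\<exists>p::int. abs (s - (real i * (2*pi/n) + 2*pi* of_int p)) <= 2*pi/n" if "w i s / S s ~= 0" for i s
		proof -
			have c: "cos (s - real i * h) > cos h" using that by (auto simp: w_def max_def split: if_splits)
			obtain p :: int where p: "-pi <= (s - real i * h) + 2*pi* of_int p" "(s - real i * h) + 2*pi* of_int p < -pi + 2*pi" by (rule reduce_mod_2pi)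
			define y where "y = (s - real i * h) + 2*pi* of_int p"
			have "cos y = cos (s - real i * h)" unfolding y_def using periodic_int[of cos "s - real i * h" p] by simp
			then have c': "cos (abs y) > cos h" using c by simp
			have "abs y <= pi" using p by (auto simp: y_def)
			then have "abs y <= h" using c' cos_monotone_0_pi_le[of h "abs y"] h by (smt (verit))
			then show ?thesis by (intro exI[of _ "-p"]) (simp add: y_def h_def algebra_simps)
		qed
	qed
qed

context rh
begin

text \<open>Between different curves the denominator stays away from 0 and the kernel is Lipschitz
  in \<open>s\<close>. It is stated with the modulus \<open>sqrt\<close> to match the diagonal
  kernel; for large gaps boundedness gives it.\<close>

lemma off_diag_bound:
	assumes j: "j < m" and k: "k \<in> {..<m}-{j}"
	obtains C where "C > 0" "!!s t. abs (Nker \<eta> d\<eta> A j s k t) <= C" "!!s s' t. abs (Nker \<eta> d\<eta> A j s k t - Nker \<eta> d\<eta> A j s' k t) <= C * sqrt (abs (s-s'))"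
proof -
	have km: "k < m" "j ~= k" using k by auto
	interpret J: weighted_loop "\<eta> j" "d\<eta> j" "dd\<eta> j" "%t. A (\<eta> j t)" by (rule wl[OF j])
	interpret K: weighted_loop "\<eta> k" "d\<eta> k" "dd\<eta> k" "%t. A (\<eta> k t)" by (rule wl[OF km(1)])
	obtain \<delta> where \<delta>: "\<delta> > 0" "!!x y. x \<in> range (\<eta> k) ==> y \<in> range (\<eta> j) ==> \<delta> <= dist x y"
		using separate_compact_closed[OF cw_loop.compact_range[OF loops[OF km(1)]] compact_imp_closed[OF cw_loop.compact_range[OF loops[OF j]]] eta_disj[OF km(1) j]] km by blast
	obtain L1 where L1: "L1 > 0" "!!t. norm (d\<eta> j t) <= L1" "!!s t. norm (d\<eta> j t - d\<eta> j s) <= L1 * abs (t-s)"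
		"!!s t. norm (\<eta> j t - \<eta> j s) <= L1 * abs (t-s)"
		"!!s t. norm (\<eta> j t - \<eta> j s - of_real (t-s) * d\<eta> j s) <= L1 * (t-s)^2"
		"!!s t. norm (J.w s t - d\<eta> j s) <= L1 * abs (t-s)"
		"!!s t. norm (A (\<eta> j t) - A (\<eta> j s)) <= L1 * abs (t-s)" "!!t. norm (d\<eta> j t / A (\<eta> j t)) <= L1"
		using J.kernel_consts by blast
	obtain L2 where L2: "L2 > 0" "!!t. norm (d\<eta> k t) <= L2" "!!s t. norm (d\<eta> k t - d\<eta> k s) <= L2 * abs (t-s)"
		"!!s t. norm (\<eta> k t - \<eta> k s) <= L2 * abs (t-s)"
		"!!s t. norm (\<eta> k t - \<eta> k s - of_real (t-s) * d\<eta> k s) <= L2 * (t-s)^2"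
		"!!s t. norm (K.w s t - d\<eta> k s) <= L2 * abs (t-s)"
		"!!s t. norm (A (\<eta> k t) - A (\<eta> k s)) <= L2 * abs (t-s)" "!!t. norm (d\<eta> k t / A (\<eta> k t)) <= L2"
		using K.kernel_consts by blast
	obtain M where M: "M > 0" "!!t. norm (A (\<eta> j t)) <= M"
		using periodic_bounded[OF J.a_per J.a_cont] by blast
	define Z where "Z = (%s t. A (\<eta> j s) / (\<eta> k t - \<eta> j s))"
	have dn: "norm (\<eta> k t - \<eta> j s) >= \<delta>" for s t using \<delta>(2)[of "\<eta> k t" "\<eta> j s"] by (simp add: dist_norm)
	have ne: "\<eta> k t - \<eta> j s ~= 0" for s t using dn[of t s] \<delta>(1) by auto
	have Nk: "Nker \<eta> d\<eta> A j s k t = Im ((d\<eta> k t / A (\<eta> k t)) * Z s t / of_real pi)" for s t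
		unfolding Nker_def Z_def by (rule arg_cong[where f=Im]) (simp add: mult_ac)
	define C1 where "C1 = M / \<delta>"
	define C2 where "C2 = L1 / \<delta> + M * L1 / \<delta>^2"
	have Z1: "norm (Z s t) <= C1" for s t
		unfolding Z_def C1_def norm_divide using M dn \<delta>(1) by (intro frac_le) auto
	have Z2: "norm (Z s t - Z s' t) <= C2 * abs (s-s')" for s s' t
	proof -
		have "Z s t - Z s' t = (A (\<eta> j s) - A (\<eta> j s')) / (\<eta> k t - \<eta> j s) + A (\<eta> j s') * (\<eta> j s - \<eta> j s') / ((\<eta> k t - \<eta> j s) * (\<eta> k t - \<eta> j s'))"
		proof -
			have "a / y - a' / y' = (a - a') / y + a' * (y' - y) / (y * y')" if "y ~= 0" "y' ~= 0" for a a' y y' :: complex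
				using that by (simp add: field_simps)
			from this[OF ne ne, of "A (\<eta> j s)" t s "A (\<eta> j s')" t s'] show ?thesis unfolding Z_def by simp
		qed
		also have "norm \<dots> <= L1 * abs (s-s') / \<delta> + M * (L1 * abs (s-s')) / (\<delta> * \<delta>)"
		proof (intro order_trans[OF norm_triangle_ineq] add_mono)
			show "norm ((A (\<eta> j s) - A (\<eta> j s')) / (\<eta> k t - \<eta> j s)) <= L1 * abs (s-s') / \<delta>"
				unfolding norm_divide using L1(1) L1(7)[of s s'] dn[of t s] \<delta>(1) by (intro frac_le) auto
			have "norm (A (\<eta> j s') * (\<eta> j s - \<eta> j s')) <= M * (L1 * abs (s-s'))"
				unfolding norm_mult using M L1(4)[of s s'] by (intro mult_mono) auto
			moreover have "norm ((\<eta> k t - \<eta> j s) * (\<eta> k t - \<eta> j s')) >= \<delta> * \<delta>"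
				unfolding norm_mult using dn \<delta>(1) by (intro mult_mono) auto
			ultimately show "norm (A (\<eta> j s') * (\<eta> j s - \<eta> j s') / ((\<eta> k t - \<eta> j s) * (\<eta> k t - \<eta> j s'))) <= M * (L1 * abs (s-s')) / (\<delta> * \<delta>)"
				unfolding norm_divide using \<delta>(1) M(1) L1(1) by (intro frac_le) auto
		qed
		also have "\<dots> = C2 * abs (s-s')" by (simp add: C2_def power2_eq_square distrib_right)
		finally show ?thesis .
	qed
	define C where "C = L2 * (2 * C1 + C2)"
	have C12: "C1 > 0" "C2 > 0" using M \<delta>(1) L1(1) by (auto simp: C1_def C2_def add_pos_pos)
	have ImB: "abs (Im (q * z / of_real pi)) <= L2 * b" if "norm q <= L2" "norm z <= b" for q z b
	proof -
		have "abs (Im (q * z / of_real pi)) <= norm (q * z / of_real pi)" by (rule abs_Im_le_cmod)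
		also have "\<dots> = norm q * norm z / pi" by (simp add: norm_mult norm_divide)
		also have "\<dots> <= L2 * b / 1" using that L2(1) pi_ge_two norm_ge_zero[of z] by (intro frac_le mult_mono) (auto simp del: norm_ge_zero)
		finally show ?thesis by simp
	qed
	show ?thesis
	proof (rule that[of C])
		show "C > 0" using L2(1) C12 by (simp add: C_def add_pos_pos)
		show b: "abs (Nker \<eta> d\<eta> A j s k t) <= C" for s t
		proof -
			have "abs (Nker \<eta> d\<eta> A j s k t) <= L2 * C1" unfolding Nk by (rule ImB[OF L2(8) Z1])
			also have "\<dots> <= C" unfolding C_def using L2(1) C12 by (intro mult_left_mono) auto
			finally show ?thesis .
		qed
		fix s s' t
		have diff: "Nker \<eta> d\<eta> A j s k t - Nker \<eta> d\<eta> A j s' k t = Im ((d\<eta> k t / A (\<eta> k t)) * (Z s t - Z s' t) / of_real pi)"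
			unfolding Nk by (simp add: right_diff_distrib diff_divide_distrib)
		have nz: "norm (Z s t - Z s' t) <= (2 * C1 + C2) * sqrt (abs (s-s'))"
		proof (cases "abs (s-s') <= 1")
			case True
			then have "abs (s-s') = sqrt (abs (s-s')) * sqrt (abs (s-s'))" by simp
			also have "\<dots> <= 1 * sqrt (abs (s-s'))" using True by (intro mult_right_mono) auto
			finally have q: "abs (s-s') <= sqrt (abs (s-s'))" by simp
			have "norm (Z s t - Z s' t) <= C2 * abs (s-s')" by (rule Z2)
			also have "\<dots> <= (2 * C1 + C2) * sqrt (abs (s-s'))" using q C12 by (intro mult_mono) auto
			finally show ?thesis .
		next
			case False
			then have "sqrt (abs (s-s')) >= 1" by simp
			then have a: "(2 * C1 + C2) * sqrt (abs (s-s')) >= (2 * C1 + C2) * 1" using C12 by (intro mult_left_mono) auto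
			have b: "norm (Z s t - Z s' t) <= C1 + C1" by (rule order_trans[OF norm_triangle_ineq4 add_mono[OF Z1 Z1]])
			have "C1 + C1 <= (2 * C1 + C2) * 1" using C12 by simp
			from order_trans[OF order_trans[OF b this] a] show ?thesis .
		qed
		have "abs (Nker \<eta> d\<eta> A j s k t - Nker \<eta> d\<eta> A j s' k t) <= L2 * ((2 * C1 + C2) * sqrt (abs (s-s')))"
			unfolding diff by (rule ImB[OF L2(8) nz])
		then show "abs (Nker \<eta> d\<eta> A j s k t - Nker \<eta> d\<eta> A j s' k t) <= C * sqrt (abs (s-s'))" by (simp add: C_def mult.assoc)
	qed
qed

lemma Nop_bound_component:
	assumes j: "j < m"
	obtains C where "C > 0"
		"!!x B s. [|!!k. k < m ==> continuous_on {0..2*pi} (x k); !!k t. k < m ==> t \<in> {0..2*pi} ==> abs (x k t) <= B|] ==> abs (Nn x j s) <= C * B"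
		"!!x B s s'. [|!!k. k < m ==> continuous_on {0..2*pi} (x k); !!k t. k < m ==> t \<in> {0..2*pi} ==> abs (x k t) <= B|] ==> abs (Nn x j s - Nn x j s') <= C * B * sqrt (abs (s-s'))"
proof -
	interpret W: weighted_loop "\<eta> j" "d\<eta> j" "dd\<eta> j" "%t. A (\<eta> j t)" by (rule wl[OF j])
	obtain C0 where C0: "C0 > 0"
		"!!x B s. [|continuous_on {0..2*pi} x; !!t. t \<in> {0..2*pi} ==> abs (x t) <= B|] ==>
				abs (integral {0..2*pi} (%t. kn j s t * x t)) <= C0 * B"
		"!!x B s s'. [|continuous_on {0..2*pi} x; !!t. t \<in> {0..2*pi} ==> abs (x t) <= B|] ==>
				abs (integral {0..2*pi} (%t. kn j s t * x t) - integral {0..2*pi} (%t. kn j s' t * x t)) <= C0 * B * sqrt (abs (s-s'))"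
		using W.kern_op_bound by blast
	have "\<forall>k\<in>{..<m}-{j}. \<exists>C. C > 0 & (\<forall>s t. abs (Nker \<eta> d\<eta> A j s k t) <= C) & (\<forall>s s' t. abs (Nker \<eta> d\<eta> A j s k t - Nker \<eta> d\<eta> A j s' k t) <= C * sqrt (abs (s-s')))"
	proof
		fix k assume k: "k \<in> {..<m}-{j}"
		show "\<exists>C. C > 0 & (\<forall>s t. abs (Nker \<eta> d\<eta> A j s k t) <= C) & (\<forall>s s' t. abs (Nker \<eta> d\<eta> A j s k t - Nker \<eta> d\<eta> A j s' k t) <= C * sqrt (abs (s-s')))"
		proof (rule off_diag_bound[OF j k])
			fix C assume C: "C > 0" "!!s t. abs (Nker \<eta> d\<eta> A j s k t) <= C" "!!s s' t. abs (Nker \<eta> d\<eta> A j s k t - Nker \<eta> d\<eta> A j s' k t) <= C * sqrt (abs (s-s'))"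
			show ?thesis by (intro exI[of _ C] conjI allI C)
		qed
	qed
	from bchoice[OF this] obtain Cf where Cf: "!!k. k \<in> {..<m}-{j} ==> Cf k > 0"
		"!!k s t. k \<in> {..<m}-{j} ==> abs (Nker \<eta> d\<eta> A j s k t) <= Cf k"
		"!!k s s' t. k \<in> {..<m}-{j} ==> abs (Nker \<eta> d\<eta> A j s k t - Nker \<eta> d\<eta> A j s' k t) <= Cf k * sqrt (abs (s-s'))"
		by blast
	define C where "C = C0 + (\<Sum>k\<in>{..<m}-{j}. 2*pi * Cf k)"
	have sum0: "(\<Sum>k\<in>{..<m}-{j}. 2*pi * Cf k) >= 0" using Cf(1) by (intro sum_nonneg) (simp add: less_imp_le)
	have C0pi: "abs (y / pi) <= b" if "abs y <= b" for y b :: real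
	proof -
		have "abs (y / pi) = abs y / pi" by simp
		also have "\<dots> <= abs y / 1" using pi_ge_two by (intro frac_le) auto
		finally show ?thesis using that by simp
	qed
	show ?thesis
	proof (rule that[of C])
		show "C > 0" using C0(1) sum0 by (simp add: C_def add_pos_nonneg)
		fix x :: "nat => real => real" and B s s' :: real
		assume x: "!!k. k < m ==> continuous_on {0..2*pi} (x k)" "!!k t. k < m ==> t \<in> {0..2*pi} ==> abs (x k t) <= B"
		have B: "B >= 0" using x(2)[OF j, of 0] by auto
		have int: "(%t. Nker \<eta> d\<eta> A j s k t * x k t) integrable_on {0..2*pi}" if "k \<in> {..<m}-{j}" for k s
			using that by (intro integrable_continuous_real continuous_intros Nker_off_cont[OF j that] x) auto
		have off1: "abs (integral {0..2*pi} (%t. Nker \<eta> d\<eta> A j s k t * x k t)) <= 2*pi * Cf k * B" if k: "k \<in> {..<m}-{j}" for k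
		proof -
			have "norm (integral {0..2*pi} (%t. Nker \<eta> d\<eta> A j s k t * x k t)) <= integral {0..2*pi} (%t. Cf k * B)"
			proof (rule Henstock_Kurzweil_Integration.integral_norm_bound_integral[OF int[OF k] integrable_const_ivl])
				fix t assume t: "t \<in> {0..2*pi}"
				show "norm (Nker \<eta> d\<eta> A j s k t * x k t) <= Cf k * B"
					unfolding real_norm_def abs_mult using k by (intro mult_mono Cf(2)[OF k] x(2) t) (use Cf(1)[OF k] in auto)
			qed
			then show ?thesis by (simp add: mult_ac)
		qed
		have "abs (Nn x j s) <= C0 * B + (\<Sum>k\<in>{..<m}-{j}. 2*pi * Cf k * B)"
			unfolding Nop_split[OF j]
			by (intro order_trans[OF abs_triangle_ineq] add_mono C0pi C0(2) x j order_trans[OF sum_abs] sum_mono off1)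
		then show "abs (Nn x j s) <= C * B" by (simp add: C_def distrib_right sum_distrib_right)
		have off2: "abs (integral {0..2*pi} (%t. Nker \<eta> d\<eta> A j s k t * x k t) - integral {0..2*pi} (%t. Nker \<eta> d\<eta> A j s' k t * x k t)) <= 2*pi * Cf k * (B * sqrt (abs (s-s')))"
			if k: "k \<in> {..<m}-{j}" for k
		proof -
			have eq: "integral {0..2*pi} (%t. Nker \<eta> d\<eta> A j s k t * x k t) - integral {0..2*pi} (%t. Nker \<eta> d\<eta> A j s' k t * x k t)
				 = integral {0..2*pi} (%t. (Nker \<eta> d\<eta> A j s k t - Nker \<eta> d\<eta> A j s' k t) * x k t)"
				unfolding Henstock_Kurzweil_Integration.integral_diff[OF int[OF k] int[OF k], symmetric] by (simp add: left_diff_distrib)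
			have i2: "(%t. (Nker \<eta> d\<eta> A j s k t - Nker \<eta> d\<eta> A j s' k t) * x k t) integrable_on {0..2*pi}"
				using integrable_diff[OF int[OF k] int[OF k], of s s'] by (simp add: left_diff_distrib)
			have "norm (integral {0..2*pi} (%t. (Nker \<eta> d\<eta> A j s k t - Nker \<eta> d\<eta> A j s' k t) * x k t)) <= integral {0..2*pi} (%t. Cf k * sqrt (abs (s-s')) * B)"
			proof (rule Henstock_Kurzweil_Integration.integral_norm_bound_integral[OF i2 integrable_const_ivl])
				fix t assume t: "t \<in> {0..2*pi}"
				show "norm ((Nker \<eta> d\<eta> A j s k t - Nker \<eta> d\<eta> A j s' k t) * x k t) <= Cf k * sqrt (abs (s-s')) * B"
					unfolding real_norm_def abs_mult using k by (intro mult_mono Cf(3)[OF k] x(2) t) (use Cf(1)[OF k] in auto)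
			qed
			then show ?thesis unfolding eq by (simp add: mult_ac)
		qed
		have "Nn x j s - Nn x j s' = (integral {0..2*pi} (%t. kn j s t * x j t) - integral {0..2*pi} (%t. kn j s' t * x j t)) / pi
			 + (\<Sum>k\<in>{..<m}-{j}. integral {0..2*pi} (%t. Nker \<eta> d\<eta> A j s k t * x k t) - integral {0..2*pi} (%t. Nker \<eta> d\<eta> A j s' k t * x k t))"
			unfolding Nop_split[OF j] by (simp add: sum_subtractf diff_divide_distrib)
		then have "abs (Nn x j s - Nn x j s') <= C0 * B * sqrt (abs (s-s')) + (\<Sum>k\<in>{..<m}-{j}. 2*pi * Cf k * (B * sqrt (abs (s-s'))))"
			by (simp only:) (intro order_trans[OF abs_triangle_ineq] add_mono C0pi C0(3) x j order_trans[OF sum_abs] sum_mono off2)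
		then show "abs (Nn x j s - Nn x j s') <= C * B * sqrt (abs (s-s'))" by (simp add: C_def distrib_right sum_distrib_right mult.assoc)
	qed
qed

text \<open>Smoothing from sup norm bounds to Hoelder exponent 1/2. It yields the finite rank
  approximation in \<open>Tb_approx\<close> and the Hoelder continuity of null vectors.\<close>

lemma Nop_bound:
	obtains C where "C > 0"
		"!!x B j s. [|j < m; !!k. k < m ==> continuous_on {0..2*pi} (x k); !!k t. k < m ==> t \<in> {0..2*pi} ==> abs (x k t) <= B|] ==> abs (Nn x j s) <= C * B"
		"!!x B j s s'. [|j < m; !!k. k < m ==> continuous_on {0..2*pi} (x k); !!k t. k < m ==> t \<in> {0..2*pi} ==> abs (x k t) <= B|] ==> abs (Nn x j s - Nn x j s') <= C * B * sqrt (abs (s-s'))"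
proof -
	define P where "P = (%j C. C > 0 &
		(\<forall>x B s. (\<forall>k<m. continuous_on {0..2*pi} (x k)) --> (\<forall>k<m. \<forall>t\<in>{0..2*pi}. abs (x k t) <= B) --> abs (Nn x j s) <= C * B) &
		(\<forall>x B s s'. (\<forall>k<m. continuous_on {0..2*pi} (x k)) --> (\<forall>k<m. \<forall>t\<in>{0..2*pi}. abs (x k t) <= B) --> abs (Nn x j s - Nn x j s') <= C * B * sqrt (abs (s-s'))))"
	have "\<forall>j\<in>{..<m}. \<exists>C. P j C"
	proof
		fix j assume "j \<in> {..<m}"
		then have j: "j < m" by simp
		show "\<exists>C. P j C"
		proof (rule Nop_bound_component[OF j])
			fix C assume C: "C > 0"
				"!!x B s. [|!!k. k < m ==> continuous_on {0..2*pi} (x k); !!k t. k < m ==> t \<in> {0..2*pi} ==> abs (x k t) <= B|] ==> abs (Nn x j s) <= C * B"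
				"!!x B s s'. [|!!k. k < m ==> continuous_on {0..2*pi} (x k); !!k t. k < m ==> t \<in> {0..2*pi} ==> abs (x k t) <= B|] ==> abs (Nn x j s - Nn x j s') <= C * B * sqrt (abs (s-s'))"
			show ?thesis unfolding P_def
				by (intro exI[of _ C] conjI allI impI C) simp_all
		qed
	qed
	from bchoice[OF this] obtain Cf where Cf: "!!j. j < m ==> P j (Cf j)" by blast
	define C where "C = 1 + (\<Sum>j<m. Cf j)"
	have Cp: "Cf j > 0" if "j < m" for j using Cf[OF that] by (simp add: P_def)
	have le: "Cf j <= C" if "j < m" for j
	proof -
		have "Cf j <= (\<Sum>j<m. Cf j)" using that Cp by (intro member_le_sum) (auto intro: less_imp_le)
		then show ?thesis by (simp add: C_def)
	qed
	show ?thesis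
	proof (rule that[of C])
		have "(\<Sum>j<m. Cf j) >= 0" using Cp by (intro sum_nonneg) (simp add: less_imp_le)
		then show "C > 0" by (simp add: C_def)
		fix x :: "nat => real => real" and B s s' :: real and j
		assume j: "j < m" and x: "!!k. k < m ==> continuous_on {0..2*pi} (x k)" "!!k t. k < m ==> t \<in> {0..2*pi} ==> abs (x k t) <= B"
		have B: "B >= 0" using x(2)[OF j, of 0] by auto
		have "abs (Nn x j s) <= Cf j * B" using Cf[OF j] x unfolding P_def by blast
		also have "\<dots> <= C * B" using le[OF j] B by (rule mult_right_mono)
		finally show "abs (Nn x j s) <= C * B" .
		have "abs (Nn x j s - Nn x j s') <= Cf j * B * sqrt (abs (s-s'))" using Cf[OF j] x unfolding P_def by blast
		also have "\<dots> <= C * B * sqrt (abs (s-s'))" using le[OF j] B by (intro mult_right_mono) auto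
		finally show "abs (Nn x j s - Nn x j s') <= C * B * sqrt (abs (s-s'))" .
	qed
qed

lemma Nop_per: "j < m ==> Nn x j (s + 2*pi) = Nn x j s"
	unfolding Nop_def Nker_def using smooth_loop.per[OF sloops] by simp

lemma Nop_integrable:
	assumes "j < m" "k < m" "continuous_on {0..2*pi} x"
	shows "(%t. Nker \<eta> d\<eta> A j s k t * x t) integrable_on {0..2*pi}"
proof (cases "k = j")
	case True
	interpret W: weighted_loop "\<eta> j" "d\<eta> j" "dd\<eta> j" "%t. A (\<eta> j t)" by (rule wl[OF assms(1)])
	have "(%t. kn j s t * x t) integrable_on {0..2*pi}" by (rule W.kern_integrable[OF assms(3)])
	then show ?thesis using True integrable_on_divide[of _ "{0..2*pi}" pi] by (simp add: Nker_diag[OF assms(1)])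
next
	case False
	then show ?thesis using assms by (intro integrable_continuous_real continuous_intros Nker_off_cont) auto
qed

lemma Nop_linear:
	assumes j: "j < m" and x: "!!k. k < m ==> continuous_on {0..2*pi} (x k)" and y: "!!k. k < m ==> continuous_on {0..2*pi} (y k)"
	shows "Nn (%k t. a * x k t + b * y k t) j s = a * Nn x j s + b * Nn y j s"
proof -
	have "integral {0..2*pi} (%t. Nker \<eta> d\<eta> A j s k t * (a * x k t + b * y k t)) =
		 a * integral {0..2*pi} (%t. Nker \<eta> d\<eta> A j s k t * x k t) + b * integral {0..2*pi} (%t. Nker \<eta> d\<eta> A j s k t * y k t)" if k: "k < m" for k
	proof -
		note i = Nop_integrable[OF j k x[OF k], of s] Nop_integrable[OF j k y[OF k], of s]
		have "((%t. a * (Nker \<eta> d\<eta> A j s k t * x k t) + b * (Nker \<eta> d\<eta> A j s k t * y k t)) has_integral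
			(a * integral {0..2*pi} (%t. Nker \<eta> d\<eta> A j s k t * x k t) + b * integral {0..2*pi} (%t. Nker \<eta> d\<eta> A j s k t * y k t))) {0..2*pi}"
			by (intro has_integral_add has_integral_mult_right integrable_integral i)
		then show ?thesis by (simp add: algebra_simps integral_unique)
	qed
	then show ?thesis unfolding Nop_def by (simp add: sum.distrib sum_distrib_left)
qed

end

section \<open>The operator on a Banach space of bounded continuous functions\<close>

lemma continuous_on_nat_prod:
	fixes h :: "nat discrete \<times> real => real"
	assumes "!!k. continuous_on UNIV (%t. h (k,t))"
	shows "continuous_on UNIV h"
proof -
	have "continuous_on (\<Union>k\<in>UNIV. {k} \<times> (UNIV::real set)) h"
	proof (rule continuous_on_open_UN)
		fix k :: "nat discrete"
		show "open ({k} \<times> (UNIV::real set))" by (intro open_Times open_UNIV Discrete_Topology.open_discrete)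
		have "continuous_on ({k} \<times> (UNIV::real set)) (%p. h (k, snd p))"
			by (rule continuous_on_compose2[OF assms continuous_on_snd[OF continuous_on_id]]) auto
		then show "continuous_on ({k} \<times> (UNIV::real set)) h" by (rule continuous_on_eq) auto
	qed
	moreover have "(\<Union>k\<in>(UNIV::nat discrete set). {k} \<times> (UNIV::real set)) = UNIV" by auto
	ultimately show ?thesis by simp
qed

lemma apply_bcontfun_sum: "finite I ==> apply_bcontfun (sum f I) p = (\<Sum>i\<in>I. apply_bcontfun (f i) p)"
	for f :: "'i => ('a::topological_space, 'b::real_normed_vector) bcontfun"
	by (induction I rule: finite_induct) auto

lemma holder_imp_continuous:
	assumes "holder_continuous f" shows "continuous_on UNIV f"
proof -
	obtain C \<alpha> where C: "0 < \<alpha>" "!!s t. abs (f s - f t) <= C * abs (s - t) powr \<alpha>"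
		using assms unfolding holder_continuous_def by blast
	have "isCont f t" for t
	proof -
		have z: "((%s. abs (s - t)) \<longlongrightarrow> 0) (at t)" by (intro tendsto_rabs_zero LIM_zero tendsto_ident_at)
		have "((%s. abs (s - t) powr \<alpha>) \<longlongrightarrow> 0) (at t)"
			by (rule tendsto_zero_powrI[OF z tendsto_const _ C(1)]) (simp add: always_eventually)
		then have "((%s. C * abs (s - t) powr \<alpha>) \<longlongrightarrow> 0) (at t)" by (rule tendsto_mult_right_zero)
		then have "((%s. f s - f t) \<longlongrightarrow> 0) (at t)"
			by (rule Lim_null_comparison[rotated]) (simp only: real_norm_def C(2) eventually_True)
		then show ?thesis by (simp add: isCont_def LIM_zero_iff)
	qed
	then show ?thesis by (simp add: continuous_on_eq_continuous_at)
qed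

text \<open>Different functions come with different Hoelder exponents; lowering both to a common one
  makes \<open>Hsp m\<close> closed under linear combinations.\<close>

lemma holder_weaken:
	assumes per: "!!t. f (t + 2*pi) = f t" and f: "!!s t. abs (f s - f t) <= C * abs (s - t) powr \<alpha>" and al: "0 < \<beta>" "\<beta> <= \<alpha>"
		and cont: "continuous_on UNIV f"
	obtains C' where "C' >= 0" "!!s t. abs (f s - f t) <= C' * abs (s - t) powr \<beta>"
proof -
	obtain M where M: "M > 0" "!!t. norm (f t) <= M" using periodic_bounded[OF per cont] by blast
	show ?thesis
	proof (rule that[of "abs C + 2*M"])
		show "abs C + 2*M >= 0" using M(1) by simp
		fix s t
		show "abs (f s - f t) <= (abs C + 2*M) * abs (s - t) powr \<beta>"
		proof (cases "abs (s-t) <= 1")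
			case True
			have "abs (s-t) powr \<alpha> <= abs (s-t) powr \<beta>" using al True by (intro powr_mono') auto
			then have "C * abs (s-t) powr \<alpha> <= abs C * abs (s-t) powr \<beta>" by (intro mult_mono) auto
			also have "\<dots> <= (abs C + 2*M) * abs (s - t) powr \<beta>" using M(1) by (intro mult_right_mono) auto
			finally show ?thesis using f[of s t] by linarith
		next
			case False
			then have "abs (s-t) powr \<beta> >= 1" using al by (intro ge_one_powr_ge_zero) auto
			then have "(abs C + 2*M) * 1 <= (abs C + 2*M) * abs (s - t) powr \<beta>" using M(1) by (intro mult_left_mono) auto
			moreover have "abs (f s - f t) <= 2 * M" using M(2)[of s] M(2)[of t] by simp
			ultimately show ?thesis by simp
		qed
	qed
qed

lemma HspD:
	assumes "\<mu> \<in> Hsp m"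
	shows "k < m ==> \<mu> k (t + 2*pi) = \<mu> k t" "k < m ==> holder_continuous (\<mu> k)" "k >= m ==> \<mu> k t = 0"
		"continuous_on S (\<mu> k)"
proof -
	show "k < m ==> \<mu> k (t + 2*pi) = \<mu> k t" and h: "k < m ==> holder_continuous (\<mu> k)" and z: "!!t. k >= m ==> \<mu> k t = 0"
		using assms unfolding Hsp_def by auto
	show "continuous_on S (\<mu> k)"
	proof (cases "k < m")
		case True
		then show ?thesis using holder_imp_continuous[OF h] continuous_on_subset by blast
	next
		case False
		then have "\<mu> k = (%_. 0)" using z by (intro ext) auto
		then show ?thesis by simp
	qed
qed

lemma Hsp_comb:
	assumes x: "x \<in> Hsp m" and y: "y \<in> Hsp m"
	shows "(%k t. a * x k t + b * y k t) \<in> Hsp m"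
	unfolding Hsp_def
proof (intro CollectI conjI allI impI)
	fix k assume k: "k < m"
	show "a * x k (t + 2*pi) + b * y k (t + 2*pi) = a * x k t + b * y k t" for t using HspD(1)[OF x k] HspD(1)[OF y k] by simp
	obtain C1 \<alpha>1 where 1: "0 < \<alpha>1" "\<alpha>1 <= 1" "!!s t. abs (x k s - x k t) <= C1 * abs (s - t) powr \<alpha>1"
		using HspD(2)[OF x k] unfolding holder_continuous_def by blast
	obtain C2 \<alpha>2 where 2: "0 < \<alpha>2" "\<alpha>2 <= 1" "!!s t. abs (y k s - y k t) <= C2 * abs (s - t) powr \<alpha>2"
		using HspD(2)[OF y k] unfolding holder_continuous_def by blast
	define \<beta> where "\<beta> = min \<alpha>1 \<alpha>2"
	have be: "0 < \<beta>" "\<beta> <= \<alpha>1" "\<beta> <= \<alpha>2" "\<beta> <= 1" using 1 2 by (auto simp: \<beta>_def)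
	obtain D1 where D1: "D1 >= 0" "!!s t. abs (x k s - x k t) <= D1 * abs (s - t) powr \<beta>"
		using holder_weaken[OF HspD(1)[OF x k] 1(3) be(1,2) HspD(4)[OF x]] by blast
	obtain D2 where D2: "D2 >= 0" "!!s t. abs (y k s - y k t) <= D2 * abs (s - t) powr \<beta>"
		using holder_weaken[OF HspD(1)[OF y k] 2(3) be(1,3) HspD(4)[OF y]] by blast
	have "abs ((a * x k s + b * y k s) - (a * x k t + b * y k t)) <= (abs a * D1 + abs b * D2) * abs (s - t) powr \<beta>" for s t
	proof -
		have "(a * x k s + b * y k s) - (a * x k t + b * y k t) = a * (x k s - x k t) + b * (y k s - y k t)" by (simp add: algebra_simps)
		also have "abs \<dots> <= abs a * abs (x k s - x k t) + abs b * abs (y k s - y k t)"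
			by (intro order_trans[OF abs_triangle_ineq]) (simp add: abs_mult)
		also have "\<dots> <= abs a * (D1 * abs (s - t) powr \<beta>) + abs b * (D2 * abs (s - t) powr \<beta>)"
			by (intro add_mono mult_left_mono D1 D2) auto
		finally show ?thesis by (simp add: algebra_simps)
	qed
	then show "holder_continuous (%t. a * x k t + b * y k t)" unfolding holder_continuous_def using be by blast
next
	fix k t assume "m <= k"
	then show "a * x k t + b * y k t = 0" using HspD(3)[OF x] HspD(3)[OF y] by simp
qed

interpretation fs: vector_space fscale
	by unfold_locales (auto simp: fscale_def plus_fun_def fun_eq_iff algebra_simps)

context rh
begin

text \<open>Elements of this space need be neither periodic nor zero for \<open>k >= m\<close>. The
  operator reads them only for \<open>k < m\<close> on one period and returns an element of
  \<open>Hsp m\<close>, so null vectors lie in \<open>Hsp m\<close> automatically.\<close>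

definition Xf :: "(nat discrete \<times> real, real) bcontfun => nat => real => real" where
	"Xf x k t = apply_bcontfun x (discrete k,t)"

lemma Xf_cont: "continuous_on S (Xf x k)"
	unfolding Xf_def by (rule continuous_on_compose2[OF continuous_on_apply_bcontfun[of UNIV]]) (auto intro!: continuous_intros)

lemma Xf_bound: "abs (Xf x k t) <= norm x"
	unfolding Xf_def using norm_bounded[of x "(discrete k,t)"] by simp

lemma Xf_eqI: "(!!k t. Xf x k t = Xf y k t) ==> x = y"
	unfolding Xf_def by (rule bcontfun_eqI) (metis surj_pair of_discrete_inverse)

lemma Xf_simps [simp]: "Xf (x + y) k t = Xf x k t + Xf y k t" "Xf (x - y) k t = Xf x k t - Xf y k t"
	"Xf (c *\<^sub>R x) k t = c * Xf x k t" "Xf 0 k t = 0"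
	by (auto simp: Xf_def)

lemma holder_Nop:
	assumes "!!k. k < m ==> continuous_on {0..2*pi} (x k)" "!!k t. k < m ==> t \<in> {0..2*pi} ==> abs (x k t) <= B"
	shows "(%k t. if k < m then Nn x k t else 0) \<in> Hsp m"
	unfolding Hsp_def
proof (intro CollectI conjI allI impI)
	fix k assume k: "k < m"
	show "(if k < m then Nn x k (t + 2*pi) else 0) = (if k < m then Nn x k t else 0)" for t using Nop_per[OF k] by simp
	show "holder_continuous (%t. if k < m then Nn x k t else 0)"
	proof (rule Nop_bound)
		fix C assume C: "C > 0" "!!x B j s. [|j < m; !!k. k < m ==> continuous_on {0..2*pi} (x k); !!k t. k < m ==> t \<in> {0..2*pi} ==> abs (x k t) <= B|] ==> abs (Nn x j s) <= C * B"
			"!!x B j s s'. [|j < m; !!k. k < m ==> continuous_on {0..2*pi} (x k); !!k t. k < m ==> t \<in> {0..2*pi} ==> abs (x k t) <= B|] ==> abs (Nn x j s - Nn x j s') <= C * B * sqrt (abs (s-s'))"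
		have "abs (Nn x k s - Nn x k t) <= C * B * abs (s - t) powr (1/2)" for s t
		proof -
			have "abs (Nn x k s - Nn x k t) <= C * B * sqrt (abs (s - t))" by (rule C(3)[OF k assms])
			then show ?thesis by (simp add: powr_half_sqrt)
		qed
		then show ?thesis unfolding holder_continuous_def using k by (intro exI[of _ "C*B"] exI[of _ "1/2"]) auto
	qed
qed auto

lemma holder_Nop_Xf: "(%k t. if k < m then Nn (Xf x) k t else 0) \<in> Hsp m"
	by (rule holder_Nop[OF Xf_cont Xf_bound])

definition emb :: "(nat => real => real) => (nat discrete \<times> real, real) bcontfun" where
	"emb \<mu> = Bcontfun (%p. \<mu> (of_discrete (fst p)) (snd p))"

lemma Hsp_bounded: assumes "\<mu> \<in> Hsp m" obtains B where "!!k t. abs (\<mu> k t) <= B"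
proof -
	have "\<forall>k\<in>{..<m}. \<exists>B. B > 0 & (\<forall>t. abs (\<mu> k t) <= B)"
		using periodic_bounded[OF HspD(1)[OF assms] HspD(4)[OF assms]] by (metis lessThan_iff real_norm_def)
	from bchoice[OF this] obtain Bf where Bf: "!!k. k < m ==> Bf k > 0" "!!k t. k < m ==> abs (\<mu> k t) <= Bf k" by blast
	have "abs (\<mu> k t) <= (\<Sum>k<m. Bf k)" for k t
	proof (cases "k < m")
		case True
		have "Bf k <= (\<Sum>k<m. Bf k)" using True Bf(1) by (intro member_le_sum) (auto intro: less_imp_le)
		then show ?thesis using Bf(2)[OF True, of t] by linarith
	next
		case False
		have "(\<Sum>k<m. Bf k) >= 0" using Bf(1) by (intro sum_nonneg) (simp add: less_imp_le)
		then show ?thesis using HspD(3)[OF assms, of k t] False by simp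
	qed
	then show ?thesis using that by blast
qed

lemma Xf_emb: assumes "\<mu> \<in> Hsp m" shows "Xf (emb \<mu>) = \<mu>"
proof -
	obtain B where B: "!!k t. abs (\<mu> k t) <= B" using Hsp_bounded[OF assms] by blast
	have "(%p. \<mu> (of_discrete (fst p)) (snd p)) \<in> bcontfun"
		by (rule bcontfun_normI[OF continuous_on_nat_prod]) (use HspD(4)[OF assms] B in auto)
	then show ?thesis unfolding emb_def by (intro ext) (simp add: Xf_def Bcontfun_inverse discrete_inverse)
qed

definition Tb :: "(nat discrete \<times> real, real) bcontfun => (nat discrete \<times> real, real) bcontfun" where
	"Tb x = emb (%k t. if k < m then Nn (Xf x) k t else 0)"

lemma Xf_Tb: "Xf (Tb x) k t = (if k < m then Nn (Xf x) k t else 0)"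
	unfolding Tb_def Xf_emb[OF holder_Nop_Xf] ..

lemma Tb_linear: "linear Tb"
proof (rule linearI)
	have c: "Nn (%k t. a * Xf x k t + b * Xf y k t) k s = a * Nn (Xf x) k s + b * Nn (Xf y) k s" if "k < m" for a b x y k s
		by (rule Nop_linear[OF that Xf_cont Xf_cont])
	show "Tb (x + y) = Tb x + Tb y" for x y
	proof (rule Xf_eqI)
		have "Xf (x + y) = (%k t. 1 * Xf x k t + 1 * Xf y k t)" by (intro ext) simp
		then show "Xf (Tb (x + y)) k t = Xf (Tb x + Tb y) k t" for k t using c[of k 1 x 1 y t] by (simp add: Xf_Tb)
	qed
	show "Tb (r *\<^sub>R x) = r *\<^sub>R Tb x" for r x
	proof (rule Xf_eqI)
		have "Xf (r *\<^sub>R x) = (%k t. r * Xf x k t + 0 * Xf x k t)" by (intro ext) simp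
		then show "Xf (Tb (r *\<^sub>R x)) k t = Xf (r *\<^sub>R Tb x) k t" for k t using c[of k r x 0 x t] by (simp add: Xf_Tb)
	qed
qed

text \<open>\<open>N x\<close> is interpolated from its values at equally spaced nodes by a
  partition of unity on each curve. Its Hoelder modulus bounds the error by
  \<open>C * sqrt h * norm x\<close>.\<close>

lemma Tb_approx:
	obtains Fb B where "linear Fb" "finite B" "!!x. Fb x \<in> span B" "!!x. norm (Tb x - Fb x) <= 1/2 * norm x"
proof (rule Nop_bound)
	fix C assume C: "C > 0" "!!x B j s. [|j < m; !!k. k < m ==> continuous_on {0..2*pi} (x k); !!k t. k < m ==> t \<in> {0..2*pi} ==> abs (x k t) <= B|] ==> abs (Nn x j s) <= C * B"
		"!!x B j s s'. [|j < m; !!k. k < m ==> continuous_on {0..2*pi} (x k); !!k t. k < m ==> t \<in> {0..2*pi} ==> abs (x k t) <= B|] ==> abs (Nn x j s - Nn x j s') <= C * B * sqrt (abs (s-s'))"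
	\<comment> \<open>Chosen so that \<open>C * sqrt (2*pi/n) <= 1/2\<close>; adding 2 meets the
	  requirement of \<open>partition_weights\<close>.\<close>
	obtain n0 :: nat where n0: "real n0 > 2*pi * (2*C)^2" using reals_Archimedean2 by blast
	define n where "n = n0 + 2"
	have n: "n >= 2" "real n > 2*pi * (2*C)^2" using n0 by (auto simp: n_def)
	define h where "h = 2*pi/n"
	have Ch: "C * sqrt h <= 1/2"
	proof -
		have "(2*C)^2 > 0" using C(1) by simp
		then have "h <= 1 / (2*C)^2" unfolding h_def using n by (simp add: field_simps)
		then have "sqrt h <= sqrt (1 / (2*C)^2)" by (rule real_sqrt_le_mono)
		also have "\<dots> = 1 / (2*C)" using C(1) by (simp only: real_sqrt_divide real_sqrt_one real_sqrt_abs)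
		finally have "C * sqrt h <= C * (1 / (2*C))" using C(1) by (intro mult_left_mono) auto
		then show ?thesis using C(1) by simp
	qed
	obtain v :: "nat => real => real" where v: "!!i. continuous_on UNIV (v i)" "!!i s. v i s >= 0" "!!s. (\<Sum>i<n. v i s) = 1"
		"!!i s. v i s ~= 0 ==> \<exists>p::int. abs (s - (real i * (2*pi/n) + 2*pi* of_int p)) <= 2*pi/n"
		using partition_weights[OF n(1)] by blast
	have v1: "v i s <= 1" if "i < n" for i s
	proof -
		have "v i s <= (\<Sum>i<n. v i s)" using that v(2) by (intro member_le_sum) auto
		then show ?thesis using v(3) by simp
	qed
	define u :: "nat \<times> nat => (nat discrete \<times> real, real) bcontfun"
		where "u = (%q. Bcontfun (%p. if of_discrete (fst p) = fst q then v (snd q) (snd p) else 0))"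
	have ub: "(%p. if of_discrete (fst p) = fst q then v (snd q) (snd p) else 0) \<in> bcontfun" if "snd q < n" for q :: "nat \<times> nat"
	proof (rule bcontfun_normI[OF continuous_on_nat_prod])
		show "continuous_on UNIV (%t. if of_discrete (fst (k,t)) = fst q then v (snd q) (snd (k,t)) else 0)" for k
			using v(1) by (cases "of_discrete k = fst q") auto
		show "norm (if of_discrete (fst p) = fst q then v (snd q) (snd p) else 0) <= 1" for p using v1[OF that] v(2) by auto
	qed
	have Xu: "Xf (u q) k t = (if k = fst q then v (snd q) t else 0)" if "snd q < n" for q k t
		unfolding u_def Xf_def Bcontfun_inverse[OF ub[OF that]] by (simp add: discrete_inverse)
	define Fb where "Fb = (%x. \<Sum>q\<in>{..<m}\<times>{..<n}. Xf (Tb x) (fst q) (real (snd q) * h) *\<^sub>R u q)"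
	have XF: "Xf (Fb x) k t = (if k < m then \<Sum>i<n. Nn (Xf x) k (real i * h) * v i t else 0)" for x k t
	proof -
		have "Xf (Fb x) k t = (\<Sum>q\<in>{..<m}\<times>{..<n}. Xf (Tb x) (fst q) (real (snd q) * h) * Xf (u q) k t)"
			unfolding Fb_def Xf_def by (subst apply_bcontfun_sum) auto
		also have "\<dots> = (\<Sum>j<m. \<Sum>i<n. Xf (Tb x) j (real i * h) * Xf (u (j,i)) k t)"
			by (subst sum.cartesian_product) (auto intro!: sum.cong)
		also have "\<dots> = (\<Sum>j<m. if j = k then (\<Sum>i<n. Nn (Xf x) k (real i * h) * v i t) else 0)"
		proof (rule sum.cong)
			fix j assume "j \<in> {..<m}"
			then show "(\<Sum>i<n. Xf (Tb x) j (real i * h) * Xf (u (j,i)) k t) = (if j = k then (\<Sum>i<n. Nn (Xf x) k (real i * h) * v i t) else 0)"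
				by (auto simp: Xu Xf_Tb intro!: sum.cong)
		qed simp
		finally show ?thesis by simp
	qed
	have linF: "linear Fb"
		using linear_add[OF Tb_linear] linear_scale[OF Tb_linear] unfolding Fb_def
		by (intro linearI) (simp_all add: scaleR_left_distrib sum.distrib scaleR_right.sum)
	have fin: "finite (u ` ({..<m}\<times>{..<n}))" by simp
	have sp: "Fb x \<in> span (u ` ({..<m}\<times>{..<n}))" for x
		unfolding Fb_def by (intro span_sum span_scale span_base) auto
	have nb: "norm (Tb x - Fb x) <= 1/2 * norm x" for x
	proof (rule norm_bound)
		fix p :: "nat discrete \<times> real"
		obtain k s where p: "p = (discrete k,s)" by (metis surj_pair of_discrete_inverse)
		have "abs (Xf (Tb x - Fb x) k s) <= 1/2 * norm x"
		proof (cases "k < m")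
			case True
			have "Xf (Tb x - Fb x) k s = Nn (Xf x) k s * (\<Sum>i<n. v i s) - (\<Sum>i<n. Nn (Xf x) k (real i * h) * v i s)"
				using True by (simp add: Xf_Tb XF v(3))
			also have "\<dots> = (\<Sum>i<n. (Nn (Xf x) k s - Nn (Xf x) k (real i * h)) * v i s)"
				by (simp add: sum_distrib_left sum_subtractf left_diff_distrib)
			also have "abs \<dots> <= (\<Sum>i<n. (1/2 * norm x) * v i s)"
			proof (intro order_trans[OF sum_abs] sum_mono)
				fix i assume "i \<in> {..<n}"
				show "abs ((Nn (Xf x) k s - Nn (Xf x) k (real i * h)) * v i s) <= (1/2 * norm x) * v i s"
				proof (cases "v i s = 0")
					case False
					then obtain q :: int where q: "abs (s - (real i * h + 2*pi* of_int q)) <= h" using v(4) unfolding h_def by blast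
					have per: "Nn (Xf x) k (real i * h) = Nn (Xf x) k (real i * h + 2*pi* of_int q)"
						using periodic_int[of "Nn (Xf x) k" "real i * h" q] Nop_per[OF True] by simp
					have "abs (Nn (Xf x) k s - Nn (Xf x) k (real i * h)) <= C * norm x * sqrt (abs (s - (real i * h + 2*pi* of_int q)))"
						unfolding per by (rule C(3)[OF True Xf_cont Xf_bound])
					also have "\<dots> <= C * norm x * sqrt h" using C(1) q by (intro mult_left_mono real_sqrt_le_mono) auto
					also have "\<dots> <= 1/2 * norm x" using mult_right_mono[OF Ch, of "norm x"] by (simp add: mult_ac)
					finally show ?thesis unfolding abs_mult abs_of_nonneg[OF v(2)] by (rule mult_right_mono[OF _ v(2)])
				qed simp
			qed
			also have "\<dots> = 1/2 * norm x" unfolding sum_distrib_left[symmetric] v(3) by simp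
			finally show ?thesis .
		qed (simp add: Xf_Tb XF)
		then show "norm (apply_bcontfun (Tb x - Fb x) p) <= 1/2 * norm x" by (simp add: Xf_def p)
	qed
	show ?thesis by (rule that[OF linF fin sp nb])
qed

text \<open>Write \<open>I - \<sigma> T\<close> as \<open>L - F'\<close>, where \<open>F'\<close>
  has finite rank and \<open>L\<close> is the identity minus a map of norm at most 1/2. The
  contraction principle makes \<open>L\<close> surjective, and \<open>finite_rank_fredholm\<close>
  applies.\<close>

lemma Tb_fredholm:
	assumes sig: "abs \<sigma> = 1"
	shows "\<exists>W. finite W & {x. x = \<sigma> *\<^sub>R Tb x} <= span W"
		and "(!!x y. x = \<sigma> *\<^sub>R Tb x ==> x = y - \<sigma> *\<^sub>R Tb y ==> x = 0) ==> \<exists>y z. x = y - \<sigma> *\<^sub>R Tb y + z & z = \<sigma> *\<^sub>R Tb z"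
proof -
	obtain Fb B where F: "linear Fb" "finite B" "!!x. Fb x \<in> span B" "!!x. norm (Tb x - Fb x) <= 1/2 * norm x"
		using Tb_approx by blast
	define Sb where "Sb = (%x. \<sigma> *\<^sub>R (Tb x - Fb x))"
	have linSb: "linear Sb" unfolding Sb_def by (intro linear_compose_scale_right linear_compose_sub Tb_linear F)
	have nS: "norm (Sb x) <= 1/2 * norm x" for x unfolding Sb_def using F(4)[of x] sig by simp
	define L where "L = (%x. x - Sb x)"
	define F' where "F' = (%x. \<sigma> *\<^sub>R Fb x)"
	have linL: "linear L" unfolding L_def by (intro linear_compose_sub linear_ident linSb)
	have linF': "linear F'" unfolding F'_def by (intro linear_compose_scale_right F)
	have injL: "inj L"
		unfolding linear_injective_0[OF linL]
	proof (intro allI impI)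
		fix x assume "L x = 0"
		then have "x = Sb x" by (simp add: L_def)
		then have "norm x <= 1/2 * norm x" using nS[of x] by simp
		then show "x = 0" by simp
	qed
	have surjL: "surj L"
		unfolding surj_def
	proof
		fix y
		have "\<exists>!x. y + Sb x = x"
		proof (rule banach_fix_type[of "1/2" "%x. y + Sb x"])
			show "\<forall>a b. dist (y + Sb a) (y + Sb b) <= 1/2 * dist a b"
			proof (intro allI)
				fix a b
				have "dist (y + Sb a) (y + Sb b) = norm (Sb (a - b))" by (simp add: dist_norm linear_diff[OF linSb])
				then show "dist (y + Sb a) (y + Sb b) <= 1/2 * dist a b" using nS[of "a - b"] by (simp add: dist_norm)
			qed
		qed auto
		then obtain x where "y + Sb x = x" by blast
		then have "y = L x" by (simp add: L_def algebra_simps)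
		then show "\<exists>x. y = L x" by blast
	qed
	have rg: "F' x \<in> span B" for x unfolding F'_def by (rule span_scale[OF F(3)])
	have diff: "L x - F' x = x - \<sigma> *\<^sub>R Tb x" for x
		by (simp add: L_def F'_def Sb_def scaleR_diff_right)
	have eq: "L x = F' x \<longleftrightarrow> x = \<sigma> *\<^sub>R Tb x" for x using diff[of x] by (metis eq_iff_diff_eq_0)
	note FR = finite_rank_fredholm[OF linL injL surjL linF' F(2) rg]
	show "\<exists>W. finite W & {x. x = \<sigma> *\<^sub>R Tb x} <= span W" using FR(1) unfolding eq .
	assume "!!x y. x = \<sigma> *\<^sub>R Tb x ==> x = y - \<sigma> *\<^sub>R Tb y ==> x = 0"
	then have "\<exists>y z. x = L y - F' y + z & L z = F' z" by (intro FR(2)) (simp only: eq diff)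
	then show "\<exists>y z. x = y - \<sigma> *\<^sub>R Tb y + z & z = \<sigma> *\<^sub>R Tb z" unfolding eq diff .
qed

lemma null_vector_Hsp:
	assumes "x = \<sigma> *\<^sub>R Tb x" shows "Xf x \<in> Hsp m"
proof -
	have "Xf x = (%k t. \<sigma> * (if k < m then Nn (Xf x) k t else 0) + 0 * (if k < m then Nn (Xf x) k t else 0))"
	proof (intro ext)
		fix k t
		have "Xf x k t = Xf (\<sigma> *\<^sub>R Tb x) k t" using assms by metis
		then show "Xf x k t = \<sigma> * (if k < m then Nn (Xf x) k t else 0) + 0 * (if k < m then Nn (Xf x) k t else 0)" by (simp add: Xf_Tb)
	qed
	then show ?thesis using Hsp_comb[OF holder_Nop_Xf[of x] holder_Nop_Xf[of x], of \<sigma> 0] by simp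
qed

text \<open>Transfers \<open>Tb_fredholm\<close> from the sup norm space to \<open>Hsp m\<close>:
  the vectors found there differ from elements of \<open>Hsp m\<close> by multiples of values of
  \<open>N\<close>, which are Hoelder continuous.\<close>

lemma range_plus_null:
	assumes sig: "abs \<sigma> = 1" and psi: "\<psi> \<in> Hsp m"
		and triv: "!!x y. [|x \<in> Hsp m; y \<in> Hsp m; !!j s. j < m ==> x j s = \<sigma> * Nn x j s; !!j s. j < m ==> x j s = y j s - \<sigma> * Nn y j s|] ==> \<forall>j<m. \<forall>s. x j s = 0"
	obtains y z where "y \<in> Hsp m" "z \<in> Hsp m" "!!j s. j < m ==> \<psi> j s = y j s - \<sigma> * Nn y j s + z j s" "!!j s. j < m ==> z j s = \<sigma> * Nn z j s"
proof -
	have t: "x = 0" if x: "x = \<sigma> *\<^sub>R Tb x" and y: "x = y - \<sigma> *\<^sub>R Tb y" for x y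
	proof -
		have xH: "Xf x \<in> Hsp m" by (rule null_vector_Hsp[OF x])
		have ye: "Xf y k t = Xf x k t + \<sigma> * (if k < m then Nn (Xf y) k t else 0)" for k t
		proof -
			have "y = x + \<sigma> *\<^sub>R Tb y" using y by simp
			then have "Xf y k t = Xf (x + \<sigma> *\<^sub>R Tb y) k t" by metis
			then show ?thesis by (simp add: Xf_Tb)
		qed
		have "Xf y = (%k t. 1 * Xf x k t + \<sigma> * (if k < m then Nn (Xf y) k t else 0))" by (intro ext) (simp add: ye)
		then have yH: "Xf y \<in> Hsp m" using Hsp_comb[OF xH holder_Nop_Xf[of y], of 1 \<sigma>] by simp
		have "Xf x j s = \<sigma> * Nn (Xf x) j s" if "j < m" for j s
		proof -
			have "Xf x j s = Xf (\<sigma> *\<^sub>R Tb x) j s" using x by metis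
			then show ?thesis using that by (simp add: Xf_Tb)
		qed
		then have "\<forall>j<m. \<forall>s. Xf x j s = 0" by (rule triv[OF xH yH]) (use ye in \<open>auto simp: algebra_simps\<close>)
		then show "x = 0" using HspD(3)[OF xH] by (intro Xf_eqI) (metis Xf_simps(4) not_le)
	qed
	have "\<exists>y z. emb \<psi> = y - \<sigma> *\<^sub>R Tb y + z & z = \<sigma> *\<^sub>R Tb z" by (rule Tb_fredholm(2)[OF sig]) (rule t)
	then obtain y z where yz: "emb \<psi> = y - \<sigma> *\<^sub>R Tb y + z" "z = \<sigma> *\<^sub>R Tb z" by blast
	have pe: "\<psi> k t = Xf y k t - \<sigma> * (if k < m then Nn (Xf y) k t else 0) + Xf z k t" for k t
	proof -
		have "\<psi> k t = Xf (y - \<sigma> *\<^sub>R Tb y + z) k t" using yz(1) Xf_emb[OF psi] by metis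
		then show ?thesis by (simp add: Xf_Tb)
	qed
	have zH: "Xf z \<in> Hsp m" by (rule null_vector_Hsp[OF yz(2)])
	have "Xf y = (%k t. 1 * (1 * \<psi> k t + (-1) * Xf z k t) + \<sigma> * (if k < m then Nn (Xf y) k t else 0))" by (intro ext) (simp add: pe)
	then have yH: "Xf y \<in> Hsp m" using Hsp_comb[OF Hsp_comb[OF psi zH, of 1 "-1"] holder_Nop_Xf[of y], of 1 \<sigma>] by simp
	have ze: "Xf z j s = \<sigma> * Nn (Xf z) j s" if "j < m" for j s
	proof -
		have "Xf z j s = Xf (\<sigma> *\<^sub>R Tb z) j s" using yz(2) by metis
		then show ?thesis using that by (simp add: Xf_Tb)
	qed
	show ?thesis by (rule that[OF yH zH _ ze]) (use pe in auto)
qed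

text \<open>Finite dimension is what gives the dimension hypothesis its force, since
  \<open>fdim\<close> of an infinite dimensional space is 0.\<close>

lemma NullIN_finite: "\<exists>W. finite W & NullIN m \<eta> d\<eta> A <= fs.span W"
proof -
	obtain W where W: "finite W" "{x. x = 1 *\<^sub>R Tb x} <= span W" using Tb_fredholm(1)[of 1] by auto
	have lin: "Xf x \<in> fs.span (Xf ` W)" if "x \<in> span W" for x
		using that
	proof (induction rule: span_induct_alt)
		case base
		have "Xf 0 = 0" by (intro ext) simp
		then show ?case by (metis fs.span_zero)
	next
		case (step c x y)
		have "Xf (c *\<^sub>R x + y) = fscale c (Xf x) + Xf y" by (intro ext) (simp add: fscale_def)
		then show ?case using step by (metis fs.span_add fs.span_base fs.span_scale imageI)
	qed
	have "NullIN m \<eta> d\<eta> A <= fs.span (Xf ` W)"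
	proof
		fix \<mu> assume "\<mu> \<in> NullIN m \<eta> d\<eta> A"
		then have mu: "\<mu> \<in> Hsp m" "!!j s. j < m ==> \<mu> j s = Nn \<mu> j s" by (auto simp: NullIN_def)
		have "emb \<mu> = 1 *\<^sub>R Tb (emb \<mu>)"
		proof (rule Xf_eqI)
			fix k t
			show "Xf (emb \<mu>) k t = Xf (1 *\<^sub>R Tb (emb \<mu>)) k t"
				using mu(2)[of k t] HspD(3)[OF mu(1), of k t] by (simp add: Xf_Tb Xf_emb[OF mu(1)])
		qed
		then have "Xf (emb \<mu>) \<in> fs.span (Xf ` W)" using W(2) lin by blast
		then show "\<mu> \<in> fs.span (Xf ` W)" using Xf_emb[OF mu(1)] by simp
	qed
	then show ?thesis using W(1) by blast
qed

end

section \<open>The Dirichlet problem for a single curve\<close>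

text \<open>Otherwise the image is a bounded open set whose boundary lies in a line and a point; some ray leaves it without meeting either.\<close>

lemma holomorphic_constant_if_boundary_Im_constant:
	fixes f :: "complex => complex"
	assumes D: "open D" "connected D" "D ~= {}" and holf: "f holomorphic_on D" and contf: "continuous_on (closure D) f"
		and bd: "!!z. z \<in> frontier D ==> Im (f z) = b"
		and inf: "!!\<epsilon>. \<epsilon> > 0 ==> \<exists>R. \<forall>z\<in>D. norm z > R --> norm (f z) < \<epsilon>"
	obtains c where "!!z. z \<in> closure D ==> f z = c"
proof -
	have "f constant_on D"
	proof (rule ccontr)
		assume nc: "\<not> f constant_on D"
		have op: "open (f ` D)" by (rule open_mapping_thm[OF holf D(1,2) D(1) order_refl nc])
		have comp: "compact (f ` (closure D \<inter> cball 0 R))" for R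
			by (intro compact_continuous_image closed_Int_compact compact_cball closed_closure continuous_on_subset[OF contf]) auto
		have split: "f ` D <= f ` (closure D \<inter> cball 0 R) Un cball 0 \<epsilon>" if "\<forall>z\<in>D. norm z > R --> norm (f z) < \<epsilon>" for R \<epsilon>
		proof
			fix y assume "y \<in> f ` D"
			then obtain z where z: "z \<in> D" "y = f z" by blast
			show "y \<in> f ` (closure D \<inter> cball 0 R) Un cball 0 \<epsilon>"
			proof (cases "norm z > R")
				case True
				then have "norm y < \<epsilon>" using that z by blast
				then show ?thesis by simp
			next
				case False
				then have "z \<in> closure D \<inter> cball 0 R" using z closure_subset by auto
				then show ?thesis using z by blast
			qed
		qed
		obtain R1 where R1: "\<forall>z\<in>D. norm z > R1 --> norm (f z) < 1" using inf[of 1] by auto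
		have "bounded (f ` (closure D \<inter> cball 0 R1) Un cball 0 1)" using comp compact_imp_bounded by auto
		then have bdd: "bounded (f ` D)" using split[OF R1] bounded_subset by blast
		\<comment> \<open>Limits of image points come from bounded sequences in \<open>D\<close>, giving
		  values on \<open>closure D\<close>, or from sequences tending to infinity, giving 0.\<close>
		have cl: "y \<in> f ` closure D Un {0}" if y: "y \<in> closure (f ` D)" for y
		proof (rule ccontr)
			assume ny: "\<not> ?thesis"
			then have "norm y / 2 > 0" by simp
			then obtain R where R: "\<forall>z\<in>D. norm z > R --> norm (f z) < norm y / 2" using inf by blast
			have "closed (f ` (closure D \<inter> cball 0 R) Un cball 0 (norm y / 2))" using comp compact_imp_closed by auto
			then have "y \<in> f ` (closure D \<inter> cball 0 R) Un cball 0 (norm y / 2)"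
				using closure_minimal[OF split[OF R]] y by blast
			then show False using ny \<open>norm y / 2 > 0\<close> by auto
		qed
		obtain z where z: "z \<in> D" using D(3) by blast
		obtain r where r: "r > 0" "ball (f z) r <= f ` D" using op z by (metis imageI open_contains_ball)
		\<comment> \<open>A shift by less than \<open>r\<close> moves the image point off the line
		  \<open>Im = b\<close> and off the imaginary axis. The vertical ray leading away from that line
		  then meets neither the line nor 0.\<close>
		define p where "p = (if Re (f z) = 0 then r/3 else 0)"
		define q where "q = (if Im (f z) = b then r/3 else 0)"
		define v where "v = f z + Complex p q"
		have "norm (Complex p q) <= abs p + abs q" using cmod_le[of "Complex p q"] by simp
		then have "norm (Complex p q) < r" using r(1) by (auto simp: p_def q_def split: if_splits)
		then have vD: "v \<in> f ` D" using r(2) by (auto simp: v_def dist_norm)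
		have vr: "Re v ~= 0" and vi: "Im v ~= b" using r(1) by (auto simp: v_def p_def q_def)
		define sg where "sg = sgn (Im v - b)"
		have sg: "sg = 1 & Im v > b \<or> sg = -1 & Im v < b" using vi by (auto simp: sg_def sgn_if)
		define ray where "ray = (%s. v + of_real (s * sg) * \<i>) ` {0..}"
		have con: "connected ray" unfolding ray_def by (intro connected_continuous_image continuous_intros) auto
		have "v \<in> ray" unfolding ray_def by (rule image_eqI[of _ _ 0]) auto
		then have i1: "ray \<inter> f ` D ~= {}" using vD by blast
		obtain B where B: "!!y. y \<in> f ` D ==> norm y <= B" using bdd unfolding bounded_iff by blast
		have i2: "ray - f ` D ~= {}"
		proof -
			let ?s = "abs B + norm v + 1"
			let ?y = "v + of_real (?s * sg) * \<i>"
			have "norm (of_real (?s * sg) * \<i> :: complex) = ?s" unfolding norm_mult norm_of_real norm_ii abs_mult using sg by auto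
			then have "norm ?y >= ?s - norm v" using norm_triangle_ineq2[of "of_real (?s * sg) * \<i>" "- v"] by (simp add: add.commute)
			then have "?y ~: f ` D" using B[of ?y] by auto
			moreover have "?y \<in> ray" unfolding ray_def by (rule imageI) simp
			ultimately show ?thesis by blast
		qed
		obtain w where w: "w \<in> ray" "w \<in> frontier (f ` D)" using connected_Int_frontier[OF con i1 i2] by blast
		have "w \<in> closure (f ` D)" "w ~: f ` D" using w(2) op by (auto simp: frontier_def interior_open)
		then obtain "w = 0 \<or> (\<exists>x. x \<in> frontier D & w = f x)" using cl[of w] D(1) by (auto simp: frontier_def interior_open)
		then have "w = 0 \<or> Im w = b" using bd by auto
		then show False using w(1) vr sg by (auto simp: ray_def complex_eq_iff mult_less_0_iff)
	qed
	then obtain c where c: "!!z. z \<in> D ==> f z = c" unfolding constant_on_def by blast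
	show ?thesis by (rule that[of c], rule continuous_constant_on_closure[OF contf c])
qed

context rh
begin

lemma plemelj:
	assumes mu: "\<mu> \<in> Hsp m"
	obtains f g where "analytic_ext G (Gam m \<eta>) f" "analytic_int Gm (Gam m \<eta>) g"
		"!!k t. k < m ==> A (\<eta> k t) * (f (\<eta> k t) - g (\<eta> k t)) = of_real (\<mu> k t)"
		"!!k t. k < m ==> Re (A (\<eta> k t) * (f (\<eta> k t) + g (\<eta> k t))) = Nn \<mu> k t"
proof -
	obtain B where B: "!!k t. abs (\<mu> k t) <= B" using Hsp_bounded[OF mu] by blast
	define \<phi> where "\<phi> = (%k t. of_real (\<mu> k t) / A (\<eta> k t))"
	have "holder_data \<phi>"
		unfolding holder_data_def
	proof (intro allI impI conjI)
		fix k assume k: "k < m"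
		interpret W: weighted_loop "\<eta> k" "d\<eta> k" "dd\<eta> k" "%t. A (\<eta> k t)" by (rule wl[OF k])
		show "\<phi> k (t + 2*pi) = \<phi> k t" for t unfolding \<phi>_def using HspD(1)[OF mu k] W.a_per by simp
		show "continuous_on UNIV (\<phi> k)" unfolding \<phi>_def
			by (intro continuous_intros HspD(4)[OF mu] W.a_cont) (simp add: A_nz[OF k])
		obtain C \<alpha> where C: "0 < \<alpha>" "\<alpha> <= 1" "!!s t. abs (\<mu> k s - \<mu> k t) <= C * abs (s - t) powr \<alpha>"
			using HspD(2)[OF mu k] unfolding holder_continuous_def by blast
		obtain L where L: "!!s t. norm (A (\<eta> k s) - A (\<eta> k t)) <= L * abs (s - t)" using W.a_lip by blast
		have L0: "L >= 0" using order_trans[OF norm_ge_zero L[of 1 0]] by simp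
		have C0: "C >= 0" using order_trans[OF abs_ge_zero C(3)[of 1 0]] by simp
		have B0: "B >= 0" using order_trans[OF abs_ge_zero B] by blast
		obtain c0 where c0: "c0 > 0" "!!t. norm (A (\<eta> k t)) >= c0"
			using periodic_bounded_below[of "%t. A (\<eta> k t)"] W.a_per W.a_cont A_nz[OF k] by metis
		have "norm (\<phi> k (s+u) - \<phi> k s) <= (C/c0 + B*L*pi/(c0*c0)) * abs u powr \<alpha>" if "abs u <= pi" for s u
		proof -
			let ?a = "A (\<eta> k s)" and ?b = "A (\<eta> k (s+u))"
			\<comment> \<open>On one period the Lipschitz modulus of \<open>A\<close> is absorbed into the
			  Hoelder modulus of \<open>\<mu>\<close>; the constant \<open>pi\<close> covers
			  \<open>abs u > 1\<close>.\<close>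
			have up: "abs u <= pi * abs u powr \<alpha>"
			proof (cases "abs u <= 1")
				case True
				have "abs u = abs u powr 1" by simp
				also have "\<dots> <= abs u powr \<alpha>" by (intro powr_mono') (use True C in auto)
				also have "1 * abs u powr \<alpha> <= pi * abs u powr \<alpha>" by (intro mult_right_mono) (use pi_gt3 in auto)
				finally show ?thesis by simp
			next
				case False
				then have "pi * 1 <= pi * abs u powr \<alpha>" using C by (intro mult_left_mono ge_one_powr_ge_zero) auto
				then show ?thesis using that by linarith
			qed
			have "\<phi> k (s+u) - \<phi> k s = of_real (\<mu> k (s+u) - \<mu> k s) / ?b + of_real (\<mu> k s) * (?a - ?b) / (?a * ?b)"
				unfolding \<phi>_def using A_nz[OF k, of s] A_nz[OF k, of "s+u"] by (simp add: field_simps)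
			then have "norm (\<phi> k (s+u) - \<phi> k s) <= abs (\<mu> k (s+u) - \<mu> k s) / norm ?b + abs (\<mu> k s) * norm (?a - ?b) / (norm ?a * norm ?b)"
				by (simp only: norm_triangle_ineq norm_divide norm_mult norm_of_real order_trans[OF norm_triangle_ineq])
			also have "\<dots> <= (C * abs u powr \<alpha>) / c0 + B * (L * abs u) / (c0*c0)"
				using C(3)[of "s+u" s] L[of s "s+u"] B[of k s] c0 C0 B0 L0
				by (intro add_mono frac_le mult_mono mult_nonneg_nonneg mult_pos_pos) auto
			also have "\<dots> <= (C * abs u powr \<alpha>) / c0 + B * (L * (pi * abs u powr \<alpha>)) / (c0*c0)"
				using up L0 B0 c0(1) by (intro add_left_mono divide_right_mono mult_left_mono) auto
			also have "\<dots> = (C/c0 + B*L*pi/(c0*c0)) * abs u powr \<alpha>" by (simp add: field_simps)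
			finally show ?thesis .
		qed
		then show "\<exists>C \<alpha>. \<alpha> > 0 & (\<forall>s u. abs u <= pi --> norm (\<phi> k (s+u) - \<phi> k s) <= C * abs u powr \<alpha>)" using C(1) by blast
	qed
	then obtain f g where fg: "analytic_ext G (Gam m \<eta>) f" "analytic_int Gm (Gam m \<eta>) g"
		"!!k t. k < m ==> f (\<eta> k t) - g (\<eta> k t) = \<phi> k t" using CI_boundary by blast
	have d: "A (\<eta> k t) * (f (\<eta> k t) - g (\<eta> k t)) = of_real (\<mu> k t)" if "k < m" for k t
		using fg(3)[OF that] A_nz[OF that] by (simp add: \<phi>_def)
	show ?thesis by (rule that[OF fg(1,2) d Re_boundary_sum[OF fg(1,2) d]])
qed

end

context cw_loop
begin

text \<open>A single curve with \<open>A = 1\<close> and its exterior as \<open>G\<close> is an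
  instance of the general setting, so the theory developed so far solves its own Dirichlet
  problems.\<close>

lemma rh_loop: "rh 1 (%_. e) (%_. d) (%_. dd) Out (%_. 1)"
proof (intro rh.intro region.intro rh_axioms.intro)
	show "cw_loop e d dd" by (rule cw_loop_axioms)
	show "weighted_loop e d dd (%t. 1)" by unfold_locales (auto intro: exI[of _ 0])
	have "Gam 1 (%_. e) = range e" by (auto simp: Gam_def)
	then show "frontier Out = Gam 1 (%_. e)" using frontier_outside_e by simp
	have "- Out <= Ins Un range e" using in_or_out by auto
	then show "bounded (- Out)" using bounded_inside_e compact_range compact_imp_bounded
		by (meson bounded_Un bounded_subset)
qed (auto simp: open_outside_e connected_outside_e)

lemma Gam_loop: "Gam 1 (%_. e) = range e" "- (Out Un Gam 1 (%_. e)) = Ins"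
proof -
	show g: "Gam 1 (%_. e) = range e" by (auto simp: Gam_def)
	show "- (Out Un Gam 1 (%_. e)) = Ins"
		unfolding g using union_with_inside[of "range e"] inside_no_overlap[of "range e"] by blast
qed

lemma interior_constant:
	assumes "g holomorphic_on Ins" "continuous_on (Ins Un range e) g" "!!t. Im (g (e t)) = b"
	obtains c where "!!z. z \<in> Ins Un range e ==> g z = c"
proof -
	have cl: "closure Ins = Ins Un range e" using closure_Un_frontier[of "Ins"] frontier_inside_e by simp
	obtain R0 where R0: "!!z. z \<in> Ins ==> norm z <= R0" using bounded_inside_e unfolding bounded_iff by blast
	show ?thesis
	proof (rule holomorphic_constant_if_boundary_Im_constant[OF open_inside_e connected_inside_e inside_ne assms(1)])
		show "continuous_on (closure Ins) g" using assms(2) cl by simp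
		show "Im (g z) = b" if "z \<in> frontier Ins" for z using that frontier_inside_e assms(3) by auto
		show "\<exists>R. \<forall>z\<in>Ins. R < norm z --> norm (g z) < \<epsilon>" for \<epsilon> by (metis R0 not_less)
	qed (use that cl in blast)
qed

lemma exterior_zero:
	assumes "f holomorphic_on Out" "continuous_on (Out Un range e) f" "(f \<longlongrightarrow> 0) at_infinity"
		"!!t. Im (f (e t)) = b"
	shows "f (e t) = 0"
proof -
	have cl: "closure Out = Out Un range e" using closure_Un_frontier[of "Out"] frontier_outside_e by simp
	have ne: "Out ~= {}" using outside_bounded_nonempty[OF compact_imp_bounded[OF compact_range]] .
	have inf: "\<exists>R. \<forall>z\<in>Out. R < norm z --> norm (f z) < \<epsilon>" if "\<epsilon> > 0" for \<epsilon>
		using assms(3) that unfolding Lim_at_infinity by (metis dist_0_norm dist_commute less_imp_le)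
	show ?thesis
	proof (rule holomorphic_constant_if_boundary_Im_constant[OF open_outside_e connected_outside_e ne assms(1)])
		show "continuous_on (closure Out) f" using assms(2) cl by simp
		show "Im (f z) = b" if "z \<in> frontier Out" for z using that frontier_outside_e assms(4) by auto
		show "\<exists>R. \<forall>z\<in>Out. R < norm z --> norm (f z) < \<epsilon>" if "\<epsilon> > 0" for \<epsilon> using inf[OF that] .
		fix c assume c: "!!z. z \<in> closure Out ==> f z = c"
		have "\<forall>\<^sub>F z in at_infinity. f z = c"
		proof -
			obtain B where B: "!!z. z \<in> Ins Un range e ==> norm z <= B"
				using bounded_inside_e compact_range compact_imp_bounded by (metis bounded_Un bounded_iff)
			have "f z = c" if "norm z >= B + 1" for z
			proof -
				have "z \<in> Out" using B[of z] in_or_out[of z] that by force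
				then show ?thesis using c cl by blast
			qed
			then show ?thesis unfolding eventually_at_infinity by blast
		qed
		then have "((%_. c) \<longlongrightarrow> 0) (at_infinity :: complex filter)"
			using assms(3) by (simp add: tendsto_cong)
		then have "c = 0" using tendsto_unique[OF trivial_limit_at_infinity tendsto_const] by blast
		then show "f (e t) = 0" using c cl by blast
	qed
qed

lemma loop_plemelj:
	assumes "\<mu> \<in> Hsp 1"
	obtains f g where "f holomorphic_on Out" "continuous_on (Out Un range e) f" "(f \<longlongrightarrow> 0) at_infinity"
		"g holomorphic_on Ins" "continuous_on (Ins Un range e) g"
		"!!t. f (e t) = g (e t) + of_real (\<mu> 0 t)" "!!t. Re (f (e t)) + Re (g (e t)) = Nop 1 (%_. e) (%_. d) (%_. 1) \<mu> 0 t"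
proof (rule rh.plemelj[OF rh_loop assms])
	fix f g
	assume "analytic_ext Out (Gam 1 (%_. e)) f" "analytic_int (- (Out Un Gam 1 (%_. e))) (Gam 1 (%_. e)) g"
		and 1: "!!k t. k < 1 ==> 1 * (f (e t) - g (e t)) = of_real (\<mu> k t)"
		and 2: "!!k t. k < 1 ==> Re (1 * (f (e t) + g (e t))) = Nop 1 (%_. e) (%_. d) (%_. 1) \<mu> k t"
	then have a: "f holomorphic_on Out" "continuous_on (Out Un range e) f" "(f \<longlongrightarrow> 0) at_infinity"
		"g holomorphic_on Ins" "continuous_on (Ins Un range e) g"
		unfolding analytic_ext_def analytic_int_def Gam_loop(2) unfolding Gam_loop(1) by blast+
	have "f (e t) = g (e t) + of_real (\<mu> 0 t)" for t using 1[of 0 t] by (simp add: algebra_simps)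
	moreover have "Re (f (e t)) + Re (g (e t)) = Nop 1 (%_. e) (%_. d) (%_. 1) \<mu> 0 t" for t using 2[of 0 t] by simp
	ultimately show ?thesis using that a by blast
qed

text \<open>For \<open>A = 1\<close> the solution is \<open>-2 g\<close>, where
  \<open>y - N y = \<phi>\<close> and \<open>g\<close> is the interior Cauchy integral of
  \<open>y\<close>. \<open>I - N\<close> is injective: for a null vector \<open>Re g = 0\<close> on
  the curve, so \<open>g\<close> is constant, then \<open>Im f\<close> is constant on the curve and
  \<open>f\<close> vanishes there.\<close>

lemma dirichlet_interior:
	assumes "!!t. \<phi> (t + 2*pi) = \<phi> t" "holder_continuous \<phi>"
	obtains l where "l holomorphic_on Ins" "continuous_on (Ins Un range e) l" "!!t. Re (l (e t)) = \<phi> t"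
proof -
	let ?N = "Nop 1 (%_. e) (%_. d) (%_. 1)"
	have uniq: "x 0 s = 0" if x: "x \<in> Hsp 1" and xN: "!!s. x 0 s = ?N x 0 s" for x s
	proof (rule loop_plemelj[OF x])
		fix f g assume f: "f holomorphic_on Out" "continuous_on (Out Un range e) f" "(f \<longlongrightarrow> 0) at_infinity"
			and g: "g holomorphic_on Ins" "continuous_on (Ins Un range e) g"
			and fg: "!!t. f (e t) = g (e t) + of_real (x 0 t)" "!!t. Re (f (e t)) + Re (g (e t)) = ?N x 0 t"
		have Rg: "Re (g (e t)) = 0" for t using fg(2)[of t] arg_cong[OF fg(1)[of t], of Re] xN[of t] by simp
		have "(%z. \<i> * g z) holomorphic_on Ins" "continuous_on (Ins Un range e) (%z. \<i> * g z)"
			by (intro holomorphic_intros g) (intro continuous_intros g)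
		then obtain c where c: "!!z. z \<in> Ins Un range e ==> \<i> * g z = c"
			by (rule interior_constant[where b=0]) (use Rg in auto)
		have "Im (f (e t)) = - Re c" for t
		proof -
			have "Re (\<i> * g (e t)) = Re c" using c[of "e t"] by simp
			then show ?thesis using arg_cong[OF fg(1)[of t], of Im] by simp
		qed
		then have "f (e s) = 0" by (rule exterior_zero[OF f])
		then show "x 0 s = 0" using Rg[of s] arg_cong[OF fg(1)[of s], of Re] by simp
	qed
	define \<psi> :: "nat => real => real" where "\<psi> = (%k t. if k < 1 then \<phi> t else 0)"
	have psi: "\<psi> \<in> Hsp 1" unfolding Hsp_def \<psi>_def using assms by simp
	show ?thesis
	proof (rule rh.range_plus_null[OF rh_loop, of 1 \<psi>])
		show "abs (1::real) = 1" "\<psi> \<in> Hsp 1" using psi by auto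
		show "\<forall>j<1. \<forall>s. x j s = 0" if "x \<in> Hsp 1" "!!j s. j < 1 ==> x j s = 1 * ?N x j s" for x
			using uniq[OF that(1)] that(2)[of 0] by simp
		fix y z assume y: "y \<in> Hsp 1" and z: "z \<in> Hsp 1" and yz: "!!j s. j < 1 ==> \<psi> j s = y j s - 1 * ?N y j s + z j s"
			and zN: "!!j s. j < 1 ==> z j s = 1 * ?N z j s"
		have z0: "z 0 s = 0" for s using uniq[OF z] zN[of 0] by simp
		show ?thesis
		proof (rule loop_plemelj[OF y])
			fix f g assume g: "g holomorphic_on Ins" "continuous_on (Ins Un range e) g"
				and fg: "!!t. f (e t) = g (e t) + of_real (y 0 t)" "!!t. Re (f (e t)) + Re (g (e t)) = ?N y 0 t"
			show ?thesis
			proof (rule that[of "%z. -2 * g z"])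
				show "(%z. -2 * g z) holomorphic_on Ins" by (intro holomorphic_intros g)
				show "continuous_on (Ins Un range e) (%z. -2 * g z)" by (intro continuous_intros g)
				show "Re (-2 * g (e t)) = \<phi> t" for t
					using yz[of 0 t] z0[of t] fg(2)[of t] arg_cong[OF fg(1)[of t], of Re] by (simp add: \<psi>_def)
			qed
		qed
	qed
qed

text \<open>Here null vectors of \<open>I + N\<close> are constants. A constant in the range would
  equal \<open>2 * Re f\<close> on the curve with \<open>f\<close> vanishing at infinity, hence be
  0. So \<open>\<phi> = y + N y + c\<close>, and \<open>2 f + c\<close> is the solution, which need
  not vanish at infinity.\<close>

lemma dirichlet_exterior:
	assumes "!!t. \<phi> (t + 2*pi) = \<phi> t" "holder_continuous \<phi>"
	obtains l where "l holomorphic_on Out" "continuous_on (Out Un range e) l" "!!t. Re (l (e t)) = \<phi> t"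
proof -
	let ?N = "Nop 1 (%_. e) (%_. d) (%_. 1)"
	have const: "\<exists>c. \<forall>s. x 0 s = c" if x: "x \<in> Hsp 1" and xN: "!!s. x 0 s = - ?N x 0 s" for x
	proof (rule loop_plemelj[OF x])
		fix f g assume f: "f holomorphic_on Out" "continuous_on (Out Un range e) f" "(f \<longlongrightarrow> 0) at_infinity"
			and g: "g holomorphic_on Ins" "continuous_on (Ins Un range e) g"
			and fg: "!!t. f (e t) = g (e t) + of_real (x 0 t)" "!!t. Re (f (e t)) + Re (g (e t)) = ?N x 0 t"
		have Rf: "Re (f (e t)) = 0" for t using fg(2)[of t] arg_cong[OF fg(1)[of t], of Re] xN[of t] by simp
		have "(%z. \<i> * f z) holomorphic_on Out" "continuous_on (Out Un range e) (%z. \<i> * f z)"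
			"((%z. \<i> * f z) \<longlongrightarrow> 0) at_infinity"
			by (intro holomorphic_intros f, intro continuous_intros f) (intro tendsto_mult_right_zero f)
		then have "\<i> * f (e t) = 0" for t by (rule exterior_zero[where b=0]) (use Rf in auto)
		then have f0: "f (e t) = 0" for t by simp
		then have "Im (g (e t)) = 0" for t using arg_cong[OF fg(1)[of t], of Im] by simp
		then obtain c where c: "!!z. z \<in> Ins Un range e ==> g z = c" using interior_constant[OF g] by blast
		have "x 0 s = - Re c" for s using arg_cong[OF fg(1)[of s], of Re] c[of "e s"] f0[of s] by simp
		then show ?thesis by blast
	qed
	define \<psi> :: "nat => real => real" where "\<psi> = (%k t. if k < 1 then \<phi> t else 0)"
	have psi: "\<psi> \<in> Hsp 1" unfolding Hsp_def \<psi>_def using assms by simp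
	show ?thesis
	proof (rule rh.range_plus_null[OF rh_loop, of "-1" \<psi>])
		show "abs (-1::real) = 1" "\<psi> \<in> Hsp 1" using psi by auto
		show "\<forall>j<1. \<forall>s. x j s = 0" if x: "x \<in> Hsp 1" and y: "y \<in> Hsp 1" and xN: "!!j s. j < 1 ==> x j s = -1 * ?N x j s"
			and xy: "!!j s. j < 1 ==> x j s = y j s - -1 * ?N y j s" for x y
		proof (rule loop_plemelj[OF y])
			fix f g assume f: "f holomorphic_on Out" "continuous_on (Out Un range e) f" "(f \<longlongrightarrow> 0) at_infinity"
				and fg: "!!t. f (e t) = g (e t) + of_real (y 0 t)" "!!t. Re (f (e t)) + Re (g (e t)) = ?N y 0 t"
			obtain c where c: "!!s. x 0 s = c" using const[OF x] xN[of 0] by auto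
			have Rf: "2 * Re (f (e t)) = c" for t using fg(2)[of t] arg_cong[OF fg(1)[of t], of Re] xy[of 0 t] c[of t] by simp
			have "(%z. \<i> * f z) holomorphic_on Out" "continuous_on (Out Un range e) (%z. \<i> * f z)"
				"((%z. \<i> * f z) \<longlongrightarrow> 0) at_infinity"
				by (intro holomorphic_intros f, intro continuous_intros f) (intro tendsto_mult_right_zero f)
			then have "\<i> * f (e 0) = 0" by (rule exterior_zero[where b="c/2"]) (use Rf in \<open>auto simp: field_simps\<close>)
			then have "c = 0" using Rf[of 0] by simp
			then show ?thesis using c by simp
		qed
		fix y z assume y: "y \<in> Hsp 1" and z: "z \<in> Hsp 1" and yz: "!!j s. j < 1 ==> \<psi> j s = y j s - -1 * ?N y j s + z j s"
			and zN: "!!j s. j < 1 ==> z j s = -1 * ?N z j s"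
		obtain c where c: "!!s. z 0 s = c" using const[OF z] zN[of 0] by auto
		show ?thesis
		proof (rule loop_plemelj[OF y])
			fix f g assume f: "f holomorphic_on Out" "continuous_on (Out Un range e) f" "(f \<longlongrightarrow> 0) at_infinity"
				and fg: "!!t. f (e t) = g (e t) + of_real (y 0 t)" "!!t. Re (f (e t)) + Re (g (e t)) = ?N y 0 t"
			show ?thesis
			proof (rule that[of "%z. 2 * f z + of_real c"])
				show "(%z. 2 * f z + of_real c) holomorphic_on Out" by (intro holomorphic_intros f)
				show "continuous_on (Out Un range e) (%z. 2 * f z + of_real c)" by (intro continuous_intros f)
				show "Re (2 * f (e t) + of_real c) = \<phi> t" for t
					using yz[of 0 t] c[of t] fg(2)[of t] arg_cong[OF fg(1)[of t], of Re] by (simp add: \<psi>_def)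
			qed
		qed
	qed
qed

end

section \<open>The index of a closed curve\<close>

definition nonzero_loop :: "(real => complex) => bool" where
	"nonzero_loop c \<longleftrightarrow> continuous_on UNIV c & (\<forall>t. c (t + 2*pi) = c t) & (\<forall>t. c t ~= 0)"

text \<open>Complex valued like \<open>winding_number\<close>; that it is an integer for a nonzero
  loop is \<open>ind_int\<close>. Estimates are stated for its real part.\<close>

definition ind :: "(real => complex) => complex" where
	"ind c = winding_number (curve c) 0"

lemma exp_eq_1_constant_on:
	fixes f :: "'a::topological_space => complex"
	assumes "connected S" "continuous_on S f" "!!x. x \<in> S ==> exp (f x) = 1"
	shows "f constant_on S"
proof (rule continuous_discrete_range_constant[OF assms(1,2)])
	fix x assume x: "x \<in> S"
	have "2*pi <= norm (f y - f x)" if y: "y \<in> S" "f y ~= f x" for y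
	proof -
		have "exp (f y - f x) = 1" using assms(3)[OF x] assms(3)[OF y(1)] by (simp add: exp_diff)
		then obtain n :: int where n: "Re (f y - f x) = 0" "Im (f y - f x) = of_int (2*n) * pi" by (auto simp: exp_eq_1)
		have "n ~= 0" using n y(2) by (auto simp: complex_eq_iff)
		then have "abs (real_of_int n) >= 1" by linarith
		then have "abs (real_of_int n) * (2*pi) >= 1 * (2*pi)" by (intro mult_right_mono) auto
		then have "abs (Im (f y - f x)) >= 2*pi" using n(2) by (simp add: abs_mult mult_ac)
		then show ?thesis using abs_Im_le_cmod[of "f y - f x"] by linarith
	qed
	then show "\<exists>e>0. \<forall>y. y \<in> S & f y ~= f x --> e <= norm (f y - f x)" by (intro exI[of _ "2*pi"]) auto
qed

lemma ind_eqI: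
	assumes L: "continuous_on UNIV L" "!!t. c t = exp (L t)" and n: "L (2*pi) = L 0 + 2*pi*\<i>*n"
	shows "ind c = n"
proof -
	have cc: "continuous_on UNIV (%u. exp (L (2*pi*u)))"
		by (intro continuous_intros continuous_on_compose2[OF L(1)]) auto
	have "path (curve c)" unfolding path_def curve_def L(2) by (rule continuous_on_subset[OF cc]) auto
	moreover have "0 ~: path_image (curve c)" by (auto simp: path_image_curve L(2))
	ultimately obtain q where q: "path q" "pathfinish q - pathstart q = 2 * of_real pi * \<i> * winding_number (curve c) 0"
		"!!t. t \<in> {0..1} ==> curve c t = 0 + exp (q t)" using winding_number_as_continuous_log by blast
	have "(%u. L (2*pi*u) - q u) constant_on {0..1::real}"
	proof (rule exp_eq_1_constant_on)
		show "continuous_on {0..1} (%u. L (2*pi*u) - q u)"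
			using q(1) by (intro continuous_intros continuous_on_compose2[OF L(1)]) (auto simp: path_def)
		show "exp (L (2*pi*x) - q x) = 1" if "x \<in> {0..1}" for x
			using q(3)[OF that] by (simp add: exp_diff curve_def L(2))
	qed auto
	then obtain y where y: "!!u. u \<in> {0..1} ==> L (2*pi*u) - q u = y" unfolding constant_on_def by blast
	have "L (2*pi) - q 1 = L 0 - q 0" using y[of 0] y[of 1] by simp
	then have "q 1 - q 0 = L (2*pi) - L 0" by (simp add: algebra_simps)
	then have "2*pi*\<i>*n = 2*pi*\<i>*winding_number (curve c) 0" using q(2) n unfolding pathfinish_def pathstart_def by simp
	then show ?thesis unfolding ind_def by simp
qed

lemma log_lift:
	assumes "nonzero_loop c"
	obtains L n where "continuous_on UNIV L" "!!t. c t = exp (L t)" "!!t. L (t + 2*pi) = L t + 2*pi*\<i>* of_int n" "ind c = of_int n"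
proof -
	have c: "continuous_on UNIV c" "!!t. c (t + 2*pi) = c t" "!!t. c t ~= 0" using assms by (auto simp: nonzero_loop_def)
	obtain L where L: "continuous_on UNIV L" "!!t. c t = exp (L t)"
		using continuous_logarithm_on_contractible[OF c(1) convex_imp_contractible[OF convex_UNIV]] c(3) by auto
	have D1: "exp (L (t + 2*pi) - L t) = 1" for t using c(2)[of t] c(3)[of t] by (simp add: exp_diff L(2))
	have "(%t. L (t + 2*pi) - L t) constant_on UNIV"
		by (rule exp_eq_1_constant_on) (use D1 in \<open>auto intro!: continuous_intros continuous_on_compose2[OF L(1)]\<close>)
	then obtain w where w: "!!t. L (t + 2*pi) - L t = w" unfolding constant_on_def by blast
	obtain n :: int where "Re w = 0" "Im w = of_int (2*n) * pi" using D1[of 0] unfolding w by (auto simp: exp_eq_1)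
	then have wn: "w = 2*pi*\<i>* of_int n" by (auto simp: complex_eq_iff)
	have p: "L (t + 2*pi) = L t + 2*pi*\<i>* of_int n" for t using w[of t] wn by (metis diff_add_cancel add.commute)
	have "ind c = of_int n" by (rule ind_eqI[OF L]) (use p[of 0] in simp)
	then show ?thesis using that L p by blast
qed

lemma ind_int: "nonzero_loop c ==> \<exists>n::int. ind c = of_int n"
	by (rule log_lift) auto

lemma nonzero_loop_mult: "nonzero_loop c ==> nonzero_loop c' ==> nonzero_loop (%t. c t * c' t)"
	unfolding nonzero_loop_def by (auto intro!: continuous_intros)

lemma ind_mult:
	assumes "nonzero_loop c" "nonzero_loop c'" shows "ind (%t. c t * c' t) = ind c + ind c'"
proof (rule log_lift[OF assms(1)])
	fix L n assume L: "continuous_on UNIV L" "!!t. c t = exp (L t)" "!!t. L (t + 2*pi) = L t + 2*pi*\<i>* of_int n" "ind c = of_int n"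
	show ?thesis
	proof (rule log_lift[OF assms(2)])
		fix L' n' assume L': "continuous_on UNIV L'" "!!t. c' t = exp (L' t)" "!!t. L' (t + 2*pi) = L' t + 2*pi*\<i>* of_int n'" "ind c' = of_int n'"
		show ?thesis
			by (rule ind_eqI[of "%t. L t + L' t"])
				 (use L L' L(3)[of 0] L'(3)[of 0] in \<open>auto intro!: continuous_intros simp: exp_add algebra_simps\<close>)
	qed
qed

lemma nonzero_loop_powi: "nonzero_loop c ==> nonzero_loop (%t. c t powi k)"
	unfolding nonzero_loop_def by (auto intro!: continuous_intros)

lemma ind_powi:
	assumes "nonzero_loop c" shows "ind (%t. c t powi k) = of_int k * ind c"
proof (rule log_lift[OF assms(1)])
	fix L n assume L: "continuous_on UNIV L" "!!t. c t = exp (L t)" "!!t. L (t + 2*pi) = L t + 2*pi*\<i>* of_int n" "ind c = of_int n"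
	show ?thesis
		by (rule ind_eqI[of "%t. of_int k * L t"])
			 (use L L(3)[of 0] in \<open>auto intro!: continuous_intros simp: exp_power_int algebra_simps\<close>)
qed

lemma nonzero_loop_exp: "continuous_on UNIV L ==> (!!t. L (t + 2*pi) = L t) ==> nonzero_loop (%t. exp (L t))"
	unfolding nonzero_loop_def by (auto intro!: continuous_intros)

lemma ind_exp:
	assumes "continuous_on UNIV L" "!!t. L (t + 2*pi) = L t" shows "ind (%t. exp (L t)) = 0"
	by (rule ind_eqI[of L]) (use assms assms(2)[of 0] in auto)

text \<open>The Rouche argument: the quotient stays in the right half plane, so its principal
  logarithm is continuous and periodic and contributes no turn.\<close>

lemma ind_close:
	assumes c: "nonzero_loop c" and c': "continuous_on UNIV c'" "!!t. c' (t + 2*pi) = c' t"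
		and close: "!!t. norm (c' t - c t) < norm (c t)"
	shows "nonzero_loop c'" "ind c' = ind c"
proof -
	have nz: "c t ~= 0" and cc: "continuous_on UNIV c" and cp: "c (t + 2*pi) = c t" for t using c by (auto simp: nonzero_loop_def)
	have nz': "c' t ~= 0" for t using close[of t] by auto
	show c'0: "nonzero_loop c'" using c' nz' by (auto simp: nonzero_loop_def)
	have q: "c' t / c t ~: \<real>\<^sub>\<le>\<^sub>0" for t
	proof -
		have "norm (c' t / c t - 1) = norm (c' t - c t) / norm (c t)" using nz[of t] by (simp add: field_simps flip: norm_divide)
		also have "\<dots> < 1" using close[of t] nz[of t] by simp
		finally have "abs (Re (c' t / c t - 1)) < 1" using abs_Re_le_cmod order_le_less_trans by blast
		then have "Re (c' t / c t) > 0" by simp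
		then show ?thesis by (auto simp: complex_nonpos_Reals_iff)
	qed
	have L: "continuous_on UNIV (%t. Ln (c' t / c t))" "!!t. Ln (c' (t + 2*pi) / c (t + 2*pi)) = Ln (c' t / c t)"
		using q nz by (auto intro!: continuous_intros c' cc simp: c' cp)
	have "c' = (%t. c t * exp (Ln (c' t / c t)))" using nz nz' by (intro ext) simp
	then show "ind c' = ind c" using ind_mult[OF c nonzero_loop_exp[OF L]] ind_exp[OF L] by simp
qed

lemma ind_homotopy:
	fixes h :: "real => real => complex"
	assumes "continuous_on (closed_segment u1 u2 \<times> UNIV) (%p. h (fst p) (snd p))"
		"!!u t. u \<in> closed_segment u1 u2 ==> h u (t + 2*pi) = h u t" "!!u t. u \<in> closed_segment u1 u2 ==> h u t ~= 0"
	shows "ind (h u1) = ind (h u2)"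
	unfolding ind_def
proof (rule winding_number_homotopic_loops)
	define H where "H = (%p. h ((1 - fst p) * u1 + fst p * u2) (2*pi * snd p))"
	have seg: "(1 - x) * u1 + x * u2 \<in> closed_segment u1 u2" if "x \<in> {0..1}" for x :: real
		using that by (auto simp: closed_segment_def)
	show "homotopic_loops (- {0}) (curve (h u1)) (curve (h u2))"
		unfolding homotopic_loops
	proof (intro exI[of _ H] conjI ballI)
		show "continuous_on ({0..1} \<times> {0..1}) H" unfolding H_def
			by (rule continuous_on_compose2[OF assms(1), of _ "%p. ((1 - fst p) * u1 + fst p * u2, 2*pi * snd p)", simplified])
				 (use seg in \<open>auto intro!: continuous_intros\<close>)
		show "H \<in> {0..1} \<times> {0..1} \<rightarrow> - {0}" using assms(3) seg by (auto simp: H_def)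
		show "pathfinish (H \<circ> Pair t) = pathstart (H \<circ> Pair t)" if "t \<in> {0..1}" for t
			using assms(2)[OF seg[OF that], of 0] by (simp add: H_def pathfinish_def pathstart_def)
	qed (auto simp: H_def curve_def)
qed

lemma ind_winding: "ind (%t. c t - a) = winding_number (curve c) a"
	unfolding ind_def curve_def by (subst (2) winding_number_offset) simp

lemma ind_holomorphic:
	assumes "open S" "f holomorphic_on S" "valid_path (curve c)" "path_image (curve c) <= S"
		"!!z. z \<in> path_image (curve c) ==> f z ~= 0"
	shows "2*pi*\<i> * ind (%t. f (c t)) = contour_integral (curve c) (%z. deriv f z / f z)"
proof -
	have e: "curve (%t. f (c t)) = f \<circ> curve c" by (auto simp: curve_def)
	have v: "valid_path (f \<circ> curve c)" by (rule valid_path_compose_holomorphic[OF assms(3,2,1,4)])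
	have n: "0 ~: path_image (f \<circ> curve c)" using assms(5) by (auto simp: path_image_compose)
	have "contour_integral (f \<circ> curve c) (%w. 1 / (w - 0)) = contour_integral (curve c) (%w. deriv f w * (1 / (f w - 0)))"
		by (rule contour_integral_comp_analyticW[OF _ assms(3,4)]) (use assms(1,2) in \<open>simp add: analytic_on_open\<close>)
	then show ?thesis unfolding ind_def e winding_number_valid_path[OF v n] by simp
qed

text \<open>A larger change of the argument would take it through an odd multiple of
  \<open>pi/2\<close> at an inner point, where the real part vanishes.\<close>

lemma Im_log_variation:
	fixes x y :: real
	assumes L: "continuous_on {x..y} L" and xy: "x <= y" and nz: "!!t. x < t ==> t < y ==> Re (exp (L t)) ~= 0"
	shows "abs (Im (L y) - Im (L x)) <= pi"
proof (rule ccontr)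
	assume gt: "\<not> ?thesis"
	define p where "p = min (Im (L x)) (Im (L y))"
	define q where "q = max (Im (L x)) (Im (L y))"
	\<comment> \<open>\<open>v\<close> is the smallest zero of the cosine above \<open>p\<close>; being
	  at most \<open>p + pi\<close>, it lies below \<open>q\<close>.\<close>
	define k :: int where "k = \<lfloor>(p - pi/2) / pi\<rfloor> + 1"
	define v where "v = pi/2 + of_int k * pi"
	have pq: "q - p > pi" using gt by (auto simp: p_def q_def)
	have k1: "(p - pi/2) / pi < of_int k" and k2: "of_int k <= (p - pi/2) / pi + 1" unfolding k_def by linarith+
	have v1: "p < v" using k1 by (simp add: v_def field_simps)
	have "of_int k * pi <= ((p - pi/2) / pi + 1) * pi" using k2 by (intro mult_right_mono) auto
	also have "\<dots> = p + pi/2" by (simp add: field_simps)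
	finally have v2: "v < q" using pq unfolding v_def by linarith
	have cI: "continuous_on {x..y} (%t. Im (L t))" by (intro continuous_intros L)
	have "\<exists>t. x <= t & t <= y & Im (L t) = v"
	proof (cases "Im (L x) <= Im (L y)")
		case True
		then show ?thesis using IVT'[of "%t. Im (L t)" x v y] v1 v2 xy cI by (auto simp: p_def q_def)
	next
		case False
		then show ?thesis using IVT2'[of "%t. Im (L t)" y v x] v1 v2 xy cI by (auto simp: p_def q_def)
	qed
	then obtain t where t: "x <= t" "t <= y" "Im (L t) = v" by blast
	have "t ~= x" "t ~= y" using t(3) v1 v2 by (auto simp: p_def q_def)
	then have "cos v ~= 0" using nz[of t] t by (auto simp: Re_exp)
	moreover have "cos v = 0" unfolding v_def cos_zero_iff_int by (intro exI[of _ "2*k+1"]) (simp add: field_simps)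
	ultimately show False by simp
qed

text \<open>Rotated by \<open>\<i>\<close>, the path stays off the imaginary axis and
  \<open>Im_log_variation\<close> bounds the turn by \<open>pi\<close>. The end points make it an
  odd multiple of \<open>pi\<close>, and \<open>+pi\<close> would force a passage through the upper
  half plane.\<close>

lemma Im_log_half_turn:
	fixes x y :: real
	assumes L: "continuous_on {x..y} L" and xy: "x <= y" and neg: "!!t. x < t ==> t < y ==> Im (exp (L t)) < 0"
		and x: "Im (exp (L x)) = 0" "Re (exp (L x)) > 0" and y: "Im (exp (L y)) = 0" "Re (exp (L y)) < 0"
	shows "Im (L y) - Im (L x) = - pi"
proof -
	have s: "sin (Im (L x)) = 0" "cos (Im (L x)) > 0" "sin (Im (L y)) = 0" "cos (Im (L y)) < 0"
		using x y by (auto simp: Im_exp Re_exp zero_less_mult_iff mult_less_0_iff)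
	have "abs (Im (L y + \<i> * (pi/2)) - Im (L x + \<i> * (pi/2))) <= pi"
	proof (rule Im_log_variation[OF _ xy])
		show "continuous_on {x..y} (%t. L t + \<i> * (pi/2))" by (intro continuous_intros L)
		show "Re (exp (L t + \<i> * (pi/2))) ~= 0" if "x < t" "t < y" for t
			using neg[OF that] by (auto simp: Re_exp Im_exp cos_add)
	qed
	then have le: "abs (Im (L y) - Im (L x)) <= pi" by simp
	have "sin (Im (L y) - Im (L x)) = 0" "cos (Im (L y) - Im (L x)) < 0" using s by (auto simp: sin_diff cos_diff mult_neg_pos mult.commute mult_less_0_iff)
	then obtain i :: int where i: "Im (L y) - Im (L x) = of_int i * pi" by (auto simp: sin_zero_iff_int2)
	have "abs (real_of_int i) * pi <= 1 * pi" using le unfolding i by (simp add: abs_mult)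
	then have "abs (real_of_int i) <= 1" using mult_le_cancel_right_pos[OF pi_gt_zero] by blast
	moreover have "i ~= 0" using \<open>cos (Im (L y) - Im (L x)) < 0\<close> unfolding i by auto
	ultimately have "i = 1 \<or> i = -1" by linarith
	moreover have "i ~= 1"
	proof
		assume "i = 1"
		then have d: "Im (L y) = Im (L x) + pi" using i by simp
		have cI: "continuous_on {x..y} (%t. Im (L t))" by (intro continuous_intros L)
		obtain t where t: "x <= t" "t <= y" "Im (L t) = Im (L x) + pi/2"
			using IVT'[of "%t. Im (L t)" x "Im (L x) + pi/2" y] d xy cI by auto
		have "t ~= x" "t ~= y" using t(3) d by auto
		then have "Im (exp (L t)) < 0" using neg t by auto
		then have "sin (Im (L t)) < 0" by (simp add: Im_exp mult_less_0_iff)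
		then show False using s t(3) by (simp add: sin_add)
	qed
	ultimately show ?thesis using i by auto
qed

text \<open>Even arcs lead through the lower half plane from the positive to the negative real axis,
  odd arcs back through the upper one. Every arc is a clockwise half turn, and \<open>2*n\<close> of
  them make index \<open>-n\<close>.\<close>

lemma ind_chain:
	assumes V: "nonzero_loop V" and inc: "!!i. i < 2*n ==> t i < t (Suc i)" and per: "t (2*n) = t 0 + 2*pi"
		and nodes: "!!i. i <= 2*n ==> Im (V (t i)) = 0" "!!i. i <= 2*n ==> (-1)^i * Re (V (t i)) > 0"
		and arcs: "!!i s. i < 2*n ==> t i < s ==> s < t (Suc i) ==> (-1)^i * Im (V s) < 0"
	shows "ind V = - of_nat n"
proof (rule log_lift[OF V])
	fix L k assume L: "continuous_on UNIV L" "!!t. V t = exp (L t)" "!!t. L (t + 2*pi) = L t + 2*pi*\<i>* of_int k" "ind V = of_int k"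
	have step: "Im (L (t (Suc i))) - Im (L (t i)) = - pi" if i: "i < 2*n" for i
	proof -
		\<comment> \<open>Adding \<open>\<i> * pi\<close> to the logarithm reverses the sign and reduces
		  odd arcs to even ones.\<close>
		let ?L = "%s. L s + (if even i then 0 else \<i> * pi)"
		have e: "exp (?L s) = (-1)^i * V s" for s by (simp add: L(2) exp_add)
		have "Im (?L (t (Suc i))) - Im (?L (t i)) = - pi"
		proof (rule Im_log_half_turn[of "t i" "t (Suc i)" ?L])
			show "continuous_on {t i..t (Suc i)} ?L" by (intro continuous_intros continuous_on_subset[OF L(1)]) auto
			show "t i <= t (Suc i)" using inc[OF i] by simp
			show "Im (exp (?L s)) < 0" if "t i < s" "s < t (Suc i)" for s using arcs[OF i that] unfolding e by (cases "even i") auto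
			show "Im (exp (?L (t i))) = 0" "Im (exp (?L (t (Suc i)))) = 0" using nodes(1)[of i] nodes(1)[of "Suc i"] i unfolding e by (cases "even i"; simp)+
			show "Re (exp (?L (t i))) > 0" "Re (exp (?L (t (Suc i)))) < 0" using nodes(2)[of i] nodes(2)[of "Suc i"] i unfolding e by (cases "even i"; simp)+
		qed
		then show ?thesis by simp
	qed
	have "Im (L (t j)) - Im (L (t 0)) = - pi * real j" if "j <= 2*n" for j
		using that
	proof (induction j)
		case (Suc j)
		then show ?case using step[of j] by (simp add: algebra_simps)
	qed simp
	from this[of "2*n"] have "2*pi* of_int k = - pi * real (2*n)" using L(3)[of "t 0"] per by simp
	then have "pi * real_of_int k = pi * - real n" by simp
	then have "real_of_int k = - real n" using mult_left_cancel[OF pi_neq_zero] by blast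
	then show ?thesis using L(4) by (metis of_int_minus of_int_of_nat_eq of_real_of_int_eq of_real_of_nat_eq of_real_minus)
qed

lemma Im_log_variation_finite:
	fixes x y :: real
	assumes "finite Z" "continuous_on {x..y} L" "x <= y" "!!t. x < t ==> t < y ==> t ~: Z ==> Re (exp (L t)) ~= 0"
	shows "abs (Im (L y) - Im (L x)) <= (card Z + 1) * pi"
	using assms
proof (induction "card Z" arbitrary: Z x y rule: less_induct)
	case less
	show ?case
	proof (cases "\<exists>z\<in>Z. x < z & z < y")
		case False
		have "abs (Im (L y) - Im (L x)) <= pi" by (rule Im_log_variation) (use less.prems False in auto)
		also have "pi <= (card Z + 1) * pi" by simp
		finally show ?thesis .
	next
		case True
		then obtain z where z: "z \<in> Z" "x < z" "z < y" by blast
		have c: "card {t\<in>Z. t < z} + card {t\<in>Z. t > z} + 1 <= card Z"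
		proof -
			have "Z = insert z ({t\<in>Z. t < z} Un {t\<in>Z. t > z})" using z(1) by auto
			moreover have "card (insert z ({t\<in>Z. t < z} Un {t\<in>Z. t > z})) = Suc (card ({t\<in>Z. t < z} Un {t\<in>Z. t > z}))"
				using less.prems(1) by (intro card_insert_disjoint) auto
			moreover have "card ({t\<in>Z. t < z} Un {t\<in>Z. t > z}) = card {t\<in>Z. t < z} + card {t\<in>Z. t > z}"
				using less.prems(1) by (intro card_Un_disjoint) auto
			ultimately show ?thesis by simp
		qed
		have nz: "Re (exp (L t)) ~= 0" if "x < t" "t < y" "t ~: Z" for t by (rule less.prems(4)[OF that])
		have "abs (Im (L z) - Im (L x)) <= (card {t\<in>Z. t < z} + 1) * pi"
		proof (rule less.hyps)
			show "continuous_on {x..z} L" by (rule continuous_on_subset[OF less.prems(2)]) (use z in auto)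
			show "Re (exp (L t)) ~= 0" if "x < t" "t < z" "t ~: {t\<in>Z. t < z}" for t by (rule nz) (use that z in auto)
		qed (use c less.prems(1) z in auto)
		moreover have "abs (Im (L y) - Im (L z)) <= (card {t\<in>Z. t > z} + 1) * pi"
		proof (rule less.hyps)
			show "continuous_on {z..y} L" by (rule continuous_on_subset[OF less.prems(2)]) (use z in auto)
			show "Re (exp (L t)) ~= 0" if "z < t" "t < y" "t ~: {t\<in>Z. t > z}" for t by (rule nz) (use that z in auto)
		qed (use c less.prems(1) z in auto)
		ultimately have "abs (Im (L y) - Im (L x)) <= (card {t\<in>Z. t < z} + card {t\<in>Z. t > z} + 2) * pi"
			by (simp add: algebra_simps)
		also have "\<dots> <= (card Z + 1) * pi" by (intro mult_right_mono) (use c in \<open>auto simp flip: of_nat_add\<close>)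
		finally show ?thesis .
	qed
qed

text \<open>Between consecutive points of \<open>Z\<close> the argument changes by at most
  \<open>pi\<close>. Cutting one period at \<open>card Z\<close> inner points gives
  \<open>card Z + 1\<close> pieces; the real part may also vanish at the cut
  \<open>x\<close>.\<close>

lemma ind_bound:
	assumes W: "nonzero_loop W" and Z: "finite Z" "!!t. x < t ==> t < x + 2*pi ==> t ~: Z ==> Re (W t) ~= 0"
	shows "2 * abs (Re (ind W)) <= card Z + 1"
proof (rule log_lift[OF W])
	fix L k assume L: "continuous_on UNIV L" "!!t. W t = exp (L t)" "!!t. L (t + 2*pi) = L t + 2*pi*\<i>* of_int k" "ind W = of_int k"
	have "abs (Im (L (x + 2*pi)) - Im (L x)) <= (card Z + 1) * pi"
		by (rule Im_log_variation_finite[OF Z(1)]) (use Z(2) L in \<open>auto intro: continuous_on_subset\<close>)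
	then have "(2 * abs (real_of_int k)) * pi <= (card Z + 1) * pi" unfolding L(3) by (simp add: abs_mult)
	then have "2 * abs (real_of_int k) <= card Z + 1" using mult_le_cancel_right_pos[OF pi_gt_zero] by blast
	then show ?thesis using L(4) by simp
qed

section \<open>Dividing out finitely many zeros\<close>

lemma nonzero_loop_prod_list:
	assumes "!!a. a \<in> set zs ==> nonzero_loop (%t. c t - a)"
	shows "nonzero_loop (%t. \<Prod>a\<leftarrow>zs. c t - a)" "ind (%t. \<Prod>a\<leftarrow>zs. c t - a) = (\<Sum>a\<leftarrow>zs. winding_number (curve c) a)"
proof -
	have "nonzero_loop (%t. \<Prod>a\<leftarrow>zs. c t - a) & ind (%t. \<Prod>a\<leftarrow>zs. c t - a) = (\<Sum>a\<leftarrow>zs. winding_number (curve c) a)"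
		using assms
	proof (induction zs)
		case Nil
		show ?case using ind_exp[of "%_. 0"] by (simp add: nonzero_loop_def)
	next
		case (Cons a zs)
		then have *: "nonzero_loop (%t. c t - a)" "nonzero_loop (%t. \<Prod>a\<leftarrow>zs. c t - a)" "ind (%t. \<Prod>a\<leftarrow>zs. c t - a) = (\<Sum>a\<leftarrow>zs. winding_number (curve c) a)" by auto
		show ?case using nonzero_loop_mult[OF *(1,2)] ind_mult[OF *(1,2)] *(3) ind_winding[of c a] by simp
	qed
	then show "nonzero_loop (%t. \<Prod>a\<leftarrow>zs. c t - a)" "ind (%t. \<Prod>a\<leftarrow>zs. c t - a) = (\<Sum>a\<leftarrow>zs. winding_number (curve c) a)" by auto
qed

lemma holomorphic_prod_list: "(%z. \<Prod>a\<leftarrow>zs. z - a) holomorphic_on S" for S :: "complex set"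
	by (induction zs) (auto intro!: holomorphic_intros)

lemma prod_list_diff_eq_0_iff: "(\<Prod>a\<leftarrow>zs. z - a) = 0 \<longleftrightarrow> z \<in> set zs" for z :: complex
	by (induction zs) auto

text \<open>\<open>zs\<close> lists the points of \<open>Z\<close> with multiplicity. Zeros of
  \<open>f\<close> outside \<open>Z\<close> remain zeros of \<open>E\<close>; this matters because
  the full zero set need not be finite.\<close>

lemma holomorphic_factor_zeros:
	assumes S: "open S" "connected S" and f: "f holomorphic_on S" and Z: "finite Z" "Z <= S" "!!z. z \<in> Z ==> f z = 0"
		and w: "w \<in> S" "f w ~= 0"
	shows "\<exists>zs E. set zs = Z & E holomorphic_on S & (\<forall>z\<in>S. f z = (\<Prod>a\<leftarrow>zs. z - a) * E z) & (\<forall>z\<in>Z. E z ~= 0)"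
	using Z
proof (induction Z rule: finite_induct)
	case empty
	show ?case using f by (intro exI[of _ "[]"] exI[of _ f]) auto
next
	case (insert a Z)
	then obtain zs E where E: "set zs = Z" "E holomorphic_on S" "!!z. z \<in> S ==> f z = (\<Prod>a\<leftarrow>zs. z - a) * E z" "!!z. z \<in> Z ==> E z ~= 0"
		by auto
	have a: "a \<in> S" "f a = 0" using insert.prems by auto
	have "(\<Prod>x\<leftarrow>zs. a - x) ~= 0" using insert.hyps(2) E(1) by (simp only: prod_list_diff_eq_0_iff) simp
	then have Ea: "E a = 0" using E(3)[OF a(1)] a(2) by simp
	have "E w ~= 0" using E(3)[OF w(1)] w(2) by auto
	then have nc: "\<not> E constant_on S" using Ea a(1) w(1) unfolding constant_on_def by metis
	obtain g r n where g: "0 < n" "0 < r" "ball a r <= S" "g holomorphic_on ball a r"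
		"!!w. w \<in> ball a r ==> E w = (w - a)^n * g w" "!!w. w \<in> ball a r ==> g w ~= 0"
		by (rule holomorphic_factor_zero_nonconstant[OF E(2) S a(1) Ea nc]) (rule that, assumption+)
	define E' where "E' = (%z. if z \<in> ball a r then g z else E z / (z - a)^n)"
	have e1: "E' z = E z / (z - a)^n" if "z ~= a" for z using g(5)[of z] that by (auto simp: E'_def)
	have "E' holomorphic_on (ball a r Un (S - {a}))"
	proof (rule holomorphic_on_Un)
		show "E' holomorphic_on ball a r" by (rule holomorphic_transform[OF g(4)]) (auto simp: E'_def)
		have "(%z. E z / (z - a)^n) holomorphic_on (S - {a})"
			by (intro holomorphic_intros holomorphic_on_subset[OF E(2)]) auto
		then show "E' holomorphic_on (S - {a})" by (rule holomorphic_transform) (auto simp: e1)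
	qed (use S in \<open>auto intro: open_delete\<close>)
	moreover have "ball a r Un (S - {a}) = S" using g(2,3) by auto
	ultimately have hol: "E' holomorphic_on S" by simp
	have eq: "f z = (\<Prod>x\<leftarrow>replicate n a @ zs. z - x) * E' z" if z: "z \<in> S" for z
	proof (cases "z = a")
		case True
		then show ?thesis using a g(1) by (simp add: power_0_left)
	next
		case False
		have "(\<Prod>x\<leftarrow>replicate n a @ zs. z - x) = (z - a)^n * (\<Prod>x\<leftarrow>zs. z - x)" by simp
		then show ?thesis using E(3)[OF z] e1[OF False] False by simp
	qed
	have "set (replicate n a @ zs) = insert a Z" using E(1) g(1) by simp
	moreover have "E' z ~= 0" if "z \<in> insert a Z" for z
	proof (cases "z = a")
		case True
		then show ?thesis using g(2,6) by (simp add: E'_def)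
	next
		case False
		then show ?thesis using E(4) that e1[OF False] by simp
	qed
	ultimately show ?case using hol eq by blast
qed

section \<open>Index and zeros near a boundary curve\<close>

context cw_loop
begin

text \<open>Without crossing the parallel curve at \<open>u\<close>, the point is moved to the edge
  of the collar at \<open>rho\<close> or \<open>-rho\<close>. From there the parallel curve can be
  deformed to \<open>e\<close>, whose winding numbers are known.\<close>

lemma winding_tub:
	assumes u: "abs u < rho" and v: "abs v <= rho" "u ~= v"
	shows "winding_number (curve (%t. tub t u)) (tub s v) = (if v < u then -1 else 0)"
proof -
	let ?c = "curve (%t. tub t u)"
	have main: "winding_number ?c (tub s v) = winding_number (curve e) (tub s x)"
		if x: "abs x = rho" and I: "convex I" "v \<in> I" "x \<in> I" "u ~: I" "!!y. y \<in> I ==> abs y <= rho" for x I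
	proof -
		have "winding_number ?c (tub s v) = winding_number ?c (tub s x)"
		proof (rule winding_number_eq[where S="{tub s r | s r. r \<in> I}"])
			show "path ?c" by (rule valid_path_imp_path[OF valid_tub])
			show "pathfinish ?c = pathstart ?c" by (rule loop_tub)
			show "connected {tub s r | s r. r \<in> I}" by (rule connected_tube[OF I(1)])
			have "tub t u ~= tub s r" if "r \<in> I" for t s r using tub_eqD[of t u s r] u I(4) I(5)[OF that] that by auto
			then show "{tub s r | s r. r \<in> I} \<inter> path_image ?c = {}" unfolding path_image_tub by fastforce
		qed (use I in auto)
		also have "\<dots> = winding_number (curve (%t. tub t 0)) (tub s x)"
		proof (rule winding_tub_homotopy)
			fix s' y assume y: "y \<in> closed_segment u 0"
			then have "abs y < rho" using u rho_pos by (auto simp: closed_segment_eq_real_ivl split: if_splits)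
			then show "tub s x ~= tub s' y" using tub_eqD[of s x s' y] x by auto
		qed
		finally show ?thesis by (simp add: tub_0)
	qed
	show ?thesis
	proof (cases "v < u")
		case True
		have "winding_number ?c (tub s v) = winding_number (curve e) (tub s (-rho))"
			by (rule main[of _ "{-rho..<u}"]) (use True u v rho_pos in auto)
		then show ?thesis using True cw tub_sides(2)[of rho s] rho_pos by simp
	next
		case False
		have "winding_number ?c (tub s v) = winding_number (curve e) (tub s rho)"
			by (rule main[of _ "{u<..rho}"]) (use False u v rho_pos in auto)
		then show ?thesis using False winding_out tub_sides(1)[of rho s] rho_pos by simp
	qed
qed

text \<open>\<open>tub\<close> is injective only up to periods, so invariance of domain is applied
  to strips of parameter length 2, which is less than \<open>2*pi\<close>.\<close>

lemma open_tube:
	assumes "-rho <= u1" "u2 <= rho"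
	shows "open {tub s x | s x. x \<in> {u1<..<u2}}"
proof -
	let ?f = "%p. tub (fst p) (snd p)"
	have "open (?f ` ({s0-1<..<s0+1} \<times> {u1<..<u2}))" for s0
	proof (rule invariance_of_domain_gen)
		show "open ({s0-1<..<s0+1} \<times> {u1<..<u2})" by (intro open_Times) auto
		show "continuous_on ({s0-1<..<s0+1} \<times> {u1<..<u2}) ?f" by (intro tub_cont continuous_intros)
		show "inj_on ?f ({s0-1<..<s0+1} \<times> {u1<..<u2})"
		proof (rule inj_onI)
			fix p q assume p: "p \<in> {s0-1<..<s0+1} \<times> {u1<..<u2}" and q: "q \<in> {s0-1<..<s0+1} \<times> {u1<..<u2}" and eq: "?f p = ?f q"
			have b: "abs (snd p) <= rho" "abs (snd q) <= rho" using p q assms by auto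
			obtain n :: int where n: "snd p = snd q" "fst p = fst q + 2*pi* of_int n" using tub_eqD[OF eq b] by blast
			have "abs (2*pi* of_int n) < 2" using p q n(2) by auto
			then have "abs (real_of_int n) * (2*pi) < 2" by (simp add: abs_mult mult_ac)
			moreover have "abs (real_of_int n) * (2*pi) >= abs (real_of_int n) * 2" using pi_gt3 by (intro mult_left_mono) auto
			ultimately have "n = 0" by linarith
			then show "p = q" using n by (simp add: prod_eq_iff)
		qed
	qed simp
	then have "open (\<Union>s0. ?f ` ({s0-1<..<s0+1} \<times> {u1<..<u2}))" by blast
	moreover have "(\<Union>s0. ?f ` ({s0-1<..<s0+1} \<times> {u1<..<u2})) = {tub s x | s x. x \<in> {u1<..<u2}}"
	proof (intro set_eqI iffI)
		fix z assume "z \<in> {tub s x | s x. x \<in> {u1<..<u2}}"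
		then obtain s x where "z = tub s x" "x \<in> {u1<..<u2}" by blast
		then have "z \<in> ?f ` ({s-1<..<s+1} \<times> {u1<..<u2})" by (intro image_eqI[of _ _ "(s,x)"]) auto
		then show "z \<in> (\<Union>s0. ?f ` ({s0-1<..<s0+1} \<times> {u1<..<u2}))" by blast
	qed (auto, blast)
	ultimately show ?thesis by simp
qed

lemma compact_tube: "compact {tub s x | s x. x \<in> {u1..u2}}"
proof -
	have "compact ((%p. tub (fst p) (snd p)) ` ({0..2*pi} \<times> {u1..u2}))"
		by (intro compact_continuous_image tub_cont continuous_intros compact_Times) auto
	moreover have "(%p. tub (fst p) (snd p)) ` ({0..2*pi} \<times> {u1..u2}) = {tub s x | s x. x \<in> {u1..u2}}"
	proof (intro set_eqI iffI)
		fix z assume "z \<in> {tub s x | s x. x \<in> {u1..u2}}"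
		then obtain s x where z: "z = tub s x" "x \<in> {u1..u2}" by blast
		obtain n :: int where "0 <= s + 2*pi* of_int n" "s + 2*pi* of_int n < 0 + 2*pi" by (rule reduce_mod_2pi)
		then show "z \<in> (%p. tub (fst p) (snd p)) ` ({0..2*pi} \<times> {u1..u2})"
			using z tub_int by (intro image_eqI[of _ _ "(s + 2*pi* of_int n, x)"]) auto
	qed (auto, blast)
	ultimately show ?thesis by simp
qed

text \<open>Every zero in the collar lies inside the outer and outside the inner parallel curve, hence lowers the index by one.\<close>

lemma ind_collar:
	assumes u: "-rho < u1" "u1 < u2" "u2 < rho"
		and hol: "V holomorphic_on {tub s x | s x. x \<in> {u1<..<u2}}" and cont: "continuous_on {tub s x | s x. x \<in> {u1..u2}} V"
		and nz: "!!t. V (tub t u1) ~= 0" "!!t. V (tub t u2) ~= 0"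
	shows "Re (ind (%t. V (tub t u2))) <= Re (ind (%t. V (tub t u1)))"
proof -
	define S where "S = {tub s x | s x. x \<in> {u1<..<u2}}"
	define K where "K = {tub s x | s x. x \<in> {u1..u2}}"
	define Z where "Z = {z\<in>K. V z = 0}"
	have S: "open S" "connected S" unfolding S_def using open_tube[of u1 u2] connected_tube[of "{u1<..<u2}"] u by auto
	have K: "compact K" unfolding K_def by (rule compact_tube)
	have SK: "S <= K" by (force simp: S_def K_def)
	have ZS: "Z <= S"
	proof
		fix z assume "z \<in> Z"
		then obtain s x where z: "z = tub s x" "x \<in> {u1..u2}" "V z = 0" by (auto simp: Z_def K_def)
		have "x ~= u1" "x ~= u2" using z nz by auto
		then have "x \<in> {u1<..<u2}" using z(2) by auto
		then show "z \<in> S" unfolding S_def using z(1) by blast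
	qed
	have cV: "continuous_on K V" using cont by (simp add: K_def)
	have "closedin (top_of_set K) (K \<inter> V -` {0})" by (rule continuous_closedin_preimage[OF cV]) simp
	moreover have "K \<inter> V -` {0} = Z" by (auto simp: Z_def)
	ultimately have Zc: "compact Z" using closedin_compact[OF K] by simp
	\<comment> \<open>A point of the open collar where \<open>V\<close> is not 0, found by continuity
	  near the inner edge; it rules out a constant zero function and makes the zeros isolated.\<close>
	obtain w where w: "w \<in> S" "V w ~= 0"
	proof -
		have "continuous_on {u1..u2} (%x. V (tub 0 x))"
		proof (rule continuous_on_compose2[OF cV])
			show "continuous_on {u1..u2} (tub 0)" by (intro tub_cont continuous_intros)
			show "tub 0 ` {u1..u2} <= K" unfolding K_def by blast
		qed
		then have "((%x. V (tub 0 x)) \<longlongrightarrow> V (tub 0 u1)) (at u1 within {u1..u2})" using u by (auto simp: continuous_on_def)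
		then have "\<forall>\<^sub>F x in at u1 within {u1..u2}. V (tub 0 x) ~= 0" using nz(1) by (rule tendsto_imp_eventually_ne)
		then obtain \<delta> where d: "\<delta> > 0" "!!x. x \<in> {u1..u2} ==> x ~= u1 ==> dist x u1 < \<delta> ==> V (tub 0 x) ~= 0"
			unfolding eventually_at by blast
		define x where "x = min (u1 + \<delta>/2) ((u1+u2)/2)"
		have x: "x \<in> {u1<..<u2}" "dist x u1 < \<delta>" using d(1) u by (auto simp: x_def dist_real_def min_def)
		have "V (tub 0 x) ~= 0" using d(2)[of x] x by auto
		moreover have "tub 0 x \<in> S" unfolding S_def using x(1) by blast
		ultimately have "V (tub 0 x) ~= 0" "tub 0 x \<in> S" by auto
		then show ?thesis using that by blast
	qed
	have Zf: "finite Z"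
	proof (cases "Z = {}")
		case False
		then obtain z where "z \<in> S" "V z = 0" using ZS by (auto simp: Z_def)
		then have "\<not> V constant_on S" using w unfolding constant_on_def by metis
		then have "finite {z\<in>Z. V z = 0}" using holomorphic_compact_finite_zeros[OF _ S Zc ZS] hol by (auto simp: S_def)
		moreover have "{z\<in>Z. V z = 0} = Z" by (auto simp: Z_def)
		ultimately show ?thesis by simp
	qed simp
	have "\<exists>zs E. set zs = Z & E holomorphic_on S & (\<forall>z\<in>S. V z = (\<Prod>a\<leftarrow>zs. z - a) * E z) & (\<forall>z\<in>Z. E z ~= 0)"
		by (rule holomorphic_factor_zeros[where f=V and w=w, OF S _ Zf ZS _ w]) (use hol in \<open>auto simp: S_def Z_def\<close>)
	then obtain zs E where E: "set zs = Z" "E holomorphic_on S" "!!z. z \<in> S ==> V z = (\<Prod>a\<leftarrow>zs. z - a) * E z" "!!z. z \<in> Z ==> E z ~= 0"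
		by blast
	define P where "P = (%z. \<Prod>a\<leftarrow>zs. z - a)"
	have P0: "P z = 0 \<longleftrightarrow> z \<in> Z" for z unfolding P_def prod_list_diff_eq_0_iff E(1) ..
	have VE: "V z = P z * E z" if "z \<in> S" for z using E(3)[OF that] by (simp add: P_def)
	\<comment> \<open>\<open>V\<close> with its zeros divided out: \<open>E\<close> takes care of the
	  zeros, the quotient of the edges, where \<open>V\<close> is merely continuous. \<open>F\<close>
	  has no zero on the closed collar, so its indices on both edges agree.\<close>
	define F where "F = (%z. if z \<in> S then E z else V z / P z)"
	have FV: "F z = V z / P z" if "z \<in> K - Z" for z using that VE[of z] P0[of z] by (auto simp: F_def)
	have VF: "V z = P z * F z" if "z \<in> K" for z
		using FV[of z] VE[of z] ZS P0[of z] that by (cases "z \<in> Z") (auto simp: F_def)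
	have Fnz: "F z ~= 0" if "z \<in> K" for z
	proof (cases "z \<in> Z")
		case True
		then show ?thesis using E(4) ZS by (auto simp: F_def)
	next
		case False
		then show ?thesis using VF[OF that] that by (auto simp: Z_def)
	qed
	have KS: "K = S Un (K - Z)" using SK ZS by auto
	have "continuous_on (S Un (K - Z)) F"
	proof (rule continuous_on_Un_local_open)
		show "openin (top_of_set (S Un (K - Z))) S" unfolding KS[symmetric] using S(1) SK by (simp add: open_subset)
		have "K - Z = K \<inter> - Z" by auto
		then show "openin (top_of_set (S Un (K - Z))) (K - Z)" unfolding KS[symmetric]
			using openin_open_Int[of "- Z" K] Zf by (simp add: open_Compl finite_imp_closed)
		show "continuous_on S F" using holomorphic_on_imp_continuous_on[OF E(2)] by (rule continuous_on_eq) (simp add: F_def)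
		have "continuous_on UNIV P" unfolding P_def using holomorphic_prod_list holomorphic_on_imp_continuous_on by blast
		then have "continuous_on (K - Z) P" using continuous_on_subset by blast
		then have "continuous_on (K - Z) (%z. V z / P z)"
			using cV P0 by (intro continuous_intros) (auto intro: continuous_on_subset)
		then show "continuous_on (K - Z) F" by (rule continuous_on_eq) (simp add: FV)
	qed
	then have Fc: "continuous_on K F" using KS by simp
	have tK: "tub t x \<in> K" if "x \<in> {u1..u2}" for t x using that by (auto simp: K_def)
	have idx: "ind (%t. V (tub t x)) = (\<Sum>a\<leftarrow>zs. winding_number (curve (%t. tub t x)) a) + ind (%t. F (tub t x))"
		if x: "x \<in> {u1..u2}" "!!t. V (tub t x) ~= 0" for x
	proof -
		have "nonzero_loop (%t. tub t x - a)" if "a \<in> set zs" for a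
		proof -
			have "tub t x ~= a" for t using x(2)[of t] that E(1) by (auto simp: Z_def)
			then show ?thesis unfolding nonzero_loop_def by (auto intro!: continuous_intros tub_cont simp: tub_per)
		qed
		note pl = nonzero_loop_prod_list[OF this]
		have l2: "nonzero_loop (%t. F (tub t x))" unfolding nonzero_loop_def
		proof (intro conjI allI)
			show "continuous_on UNIV (%t. F (tub t x))"
				by (rule continuous_on_compose2[OF Fc]) (use tK[OF x(1)] in \<open>auto intro!: tub_cont continuous_intros\<close>)
		qed (use Fnz tK[OF x(1)] in \<open>auto simp: tub_per\<close>)
		have "(%t. V (tub t x)) = (%t. (\<Prod>a\<leftarrow>zs. tub t x - a) * F (tub t x))" using VF[OF tK[OF x(1)]] by (simp add: P_def)
		then show ?thesis using ind_mult[OF pl(1) l2] pl(2) by simp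
	qed
	have "ind (%t. F (tub t u1)) = ind (%t. F (tub t u2))"
	proof (rule ind_homotopy)
		show "continuous_on (closed_segment u1 u2 \<times> UNIV) (%p. F (tub (snd p) (fst p)))"
			by (rule continuous_on_compose2[OF Fc]) (use tK u in \<open>auto intro!: tub_cont continuous_intros simp: closed_segment_eq_real_ivl\<close>)
	qed (use Fnz tK u in \<open>auto simp: tub_per closed_segment_eq_real_ivl\<close>)
	moreover have "winding_number (curve (%t. tub t x)) a = (if x = u1 then 0 else -1)" if a: "a \<in> set zs" and x: "x = u1 \<or> x = u2" for a x
	proof -
		obtain s v where v: "a = tub s v" "v \<in> {u1<..<u2}" using a E(1) ZS by (auto simp: S_def)
		show ?thesis unfolding v(1) using winding_tub[of x v s] v(2) x u by auto
	qed
	then have w: "(\<Sum>a\<leftarrow>zs. winding_number (curve (%t. tub t x)) a) = (\<Sum>a\<leftarrow>zs. if x = u1 then 0 else -1)" if "x = u1 \<or> x = u2" for x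
		using that by (intro arg_cong[where f=sum_list] map_cong) auto
	ultimately have "ind (%t. V (tub t u2)) = ind (%t. V (tub t u1)) - of_nat (length zs)"
		using idx[of u1] idx[of u2] nz u w[of u1] w[of u2] by (simp add: sum_list_triv map_replicate_const sum_list_replicate)
	then show ?thesis by simp
qed

end

text \<open>\<open>n\<close> counts sign changes, so there are \<open>n + 1\<close> points;
  \<open>\<sigma>\<close> is the sign at the first one.\<close>

definition alt_chain :: "(real => real) => nat => real => real => bool" where
	"alt_chain \<gamma> n a b \<longleftrightarrow> (\<exists>t \<sigma>. abs \<sigma> = 1 & (\<forall>i<n. t i < t (Suc i)) & (\<forall>i\<le>n. a <= t i & t i <= b & \<sigma> * (-1)^i * \<gamma> (t i) > 0))"

lemma alt_chain_extend:
	assumes "alt_chain \<gamma> n a x" "x < y1" "x < y2" "y1 <= b" "y2 <= b" "\<gamma> y1 > 0" "\<gamma> y2 < 0"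
	shows "alt_chain \<gamma> (Suc n) a b"
proof -
	obtain t \<sigma> where t: "abs \<sigma> = 1" "!!i. i < n ==> t i < t (Suc i)" "!!i. i <= n ==> a <= t i & t i <= x & \<sigma> * (-1)^i * \<gamma> (t i) > 0"
		using assms(1) unfolding alt_chain_def by blast
	have "\<sigma> * (-1)^Suc n = 1 \<or> \<sigma> * (-1)^Suc n = -1" using t(1) by (cases "even n") auto
	then obtain y where y: "x < y" "y <= b" "\<sigma> * (-1)^Suc n * \<gamma> y > 0"
		using assms by (metis minus_mult_minus mult.left_neutral mult_minus1 neg_0_less_iff_less)
	show ?thesis unfolding alt_chain_def
	proof (intro exI[of _ "%i. if i <= n then t i else y"] exI[of _ \<sigma>] conjI allI impI)
		fix i assume i: "i < Suc n"
		show "(if i <= n then t i else y) < (if Suc i <= n then t (Suc i) else y)" using t(2)[of i] t(3)[of i] i y by auto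
	next
		fix i assume i: "i <= Suc n"
		show "a <= (if i <= n then t i else y)" using t(3)[of i] t(3)[of 0] y i by auto
		show "(if i <= n then t i else y) <= b" using t(3)[of i] y i by auto
		show "0 < \<sigma> * (-1)^i * \<gamma> (if i <= n then t i else y)" using t(3)[of i] y(3) i by (cases "i <= n") (auto simp: le_Suc_eq)
	qed (rule t(1))
qed

lemma alt_chain_mono: "alt_chain \<gamma> n a x ==> x <= y ==> alt_chain \<gamma> n a y"
	unfolding alt_chain_def by (meson order_trans)

lemma continuous_sign_nhd:
	fixes \<gamma> :: "real => real"
	assumes "continuous_on {a..b} \<gamma>" "x \<in> {a..b}" "\<gamma> x ~= 0"
	obtains \<delta> where "\<delta> > 0" "!!y. y \<in> {a..b} ==> abs (y - x) < \<delta> ==> \<gamma> x * \<gamma> y > 0"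
proof -
	obtain \<delta> where d: "\<delta> > 0" "!!y. y \<in> {a..b} ==> dist y x < \<delta> ==> dist (\<gamma> y) (\<gamma> x) < abs (\<gamma> x)"
		using assms unfolding continuous_on_iff by (metis zero_less_abs_iff)
	show ?thesis
	proof (rule that[OF d(1)])
		fix y assume "y \<in> {a..b}" "abs (y - x) < \<delta>"
		then have "abs (\<gamma> y - \<gamma> x) < abs (\<gamma> x)" using d(2) by (simp add: dist_real_def)
		then have "\<gamma> x > 0 & \<gamma> y > 0 \<or> \<gamma> x < 0 & \<gamma> y < 0" by linarith
		then show "\<gamma> x * \<gamma> y > 0" by (auto simp: mult_pos_pos mult_neg_neg)
	qed
qed

lemma prod_list_pos: "(!!x. x \<in> set xs ==> f x > 0) ==> (\<Prod>x\<leftarrow>xs. f x) > (0::real)"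
	by (induction xs) auto

text \<open>\<open>\<gamma>\<close> may vanish on large sets, so its sign is described only weakly
  by the points \<open>ss\<close>. In the induction step \<open>s\<close> is the supremum of those
  \<open>x\<close> for which \<open>{a..x}\<close> carries no chain with \<open>Suc k\<close>
  changes. To the right of \<open>s\<close> both strict signs would prolong a chain, so one weak
  sign persists there, and \<open>s\<close> joins the list exactly if this sign does not continue
  the pattern on the left.\<close>

lemma sign_pattern:
	fixes \<gamma> :: "real => real"
	assumes "continuous_on {a..b} \<gamma>" "a <= b" "\<gamma> a ~= 0" "\<not> alt_chain \<gamma> (Suc k) a b"
	shows "\<exists>ss \<sigma>. length ss <= k & set ss <= {a<..<b} & abs \<sigma> = 1 & (\<forall>t\<in>{a..b}. \<sigma> * \<gamma> t * (\<Prod>s\<leftarrow>ss. t - s) >= 0)"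
	using assms
proof (induction k arbitrary: b)
	case 0
	have "sgn (\<gamma> a) * \<gamma> t >= 0" if t: "t \<in> {a..b}" for t
	proof (rule ccontr)
		assume n: "\<not> sgn (\<gamma> a) * \<gamma> t >= 0"
		then have "t ~= a" by (auto simp: sgn_if split: if_splits)
		have "alt_chain \<gamma> (Suc 0) a b" unfolding alt_chain_def
		proof (intro exI[of _ "%i. if i = 0 then a else t"] exI[of _ "sgn (\<gamma> a)"] conjI allI impI)
			fix i :: nat assume "i <= Suc 0"
			then have "i = 0 \<or> i = 1" by auto
			then show "0 < sgn (\<gamma> a) * (-1)^i * \<gamma> (if i = 0 then a else t)" using 0(3) n by (auto simp: sgn_if split: if_splits)
		qed (use 0 t \<open>t ~= a\<close> in \<open>auto simp: sgn_if\<close>)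
		then show False using 0 by blast
	qed
	then show ?case using 0 by (intro exI[of _ "[]"] exI[of _ "sgn (\<gamma> a)"]) (auto simp: sgn_if)
next
	case (Suc k)
	show ?case
	proof (cases "alt_chain \<gamma> (Suc k) a b")
		case False
		then show ?thesis using Suc.IH[OF Suc.prems(1-3) False] by (meson le_SucI)
	next
		case True
		define B where "B = {x\<in>{a..b}. \<not> alt_chain \<gamma> (Suc k) a x}"
		define s where "s = Sup B"
		have aB: "a \<in> B"
		proof -
			have "\<not> alt_chain \<gamma> (Suc k) a a"
			proof
				assume "alt_chain \<gamma> (Suc k) a a"
				then obtain t where t: "\<forall>i<Suc k. t i < (t (Suc i)::real)" "\<forall>i\<le>Suc k. a <= t i & t i <= a" unfolding alt_chain_def by blast
				have "t 0 < t 1" using t(1) by simp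
				moreover have "a <= t 0" "t 1 <= a" using t(2) by (simp_all add: Suc_leI)
				ultimately show False by linarith
			qed
			then show ?thesis using Suc.prems(2) by (simp add: B_def)
		qed
		have bdd: "bdd_above B" unfolding B_def by (intro bdd_aboveI[of _ b]) auto
		have Bs: "x <= s" if "x \<in> B" for x unfolding s_def by (rule cSup_upper[OF that bdd])
		have sb: "s <= b" unfolding s_def using aB by (intro cSup_least) (auto simp: B_def)
		have sa0: "a <= s" by (rule Bs[OF aB])
		\<comment> \<open>By continuity the last point of a chain can be moved slightly to the left, so a
		  chain up to \<open>s\<close> would already exist below some element of \<open>B\<close>.\<close>
		have nos: "\<not> alt_chain \<gamma> (Suc k) a s"
		proof
			assume "alt_chain \<gamma> (Suc k) a s"
			then obtain t \<sigma> where t: "abs \<sigma> = 1" "!!i. i < Suc k ==> t i < t (Suc i)" "!!i. i <= Suc k ==> a <= t i & t i <= s & \<sigma> * (-1)^i * \<gamma> (t i) > 0"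
				unfolding alt_chain_def by blast
			let ?T = "t (Suc k)"
			have T: "?T \<in> {a..b}" "\<gamma> ?T ~= 0" "?T <= s" "t k < ?T" using t(3)[of "Suc k"] t(2)[of k] sb by auto
			obtain \<delta> where d: "\<delta> > 0" "!!y. y \<in> {a..b} ==> abs (y - ?T) < \<delta> ==> \<gamma> ?T * \<gamma> y > 0"
				using continuous_sign_nhd[OF Suc.prems(1) T(1,2)] by blast
			define T' where "T' = max ((t k + ?T)/2) (?T - \<delta>/2)"
			have T': "t k < T'" "T' < ?T" "abs (T' - ?T) < \<delta>"
			proof -
				show "T' < ?T" unfolding T'_def using T(4) d(1) by auto
				have "(t k + ?T)/2 <= T'" by (simp add: T'_def)
				then show "t k < T'" using T(4) by simp
				have "T' >= ?T - \<delta>/2" by (simp add: T'_def)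
				then show "abs (T' - ?T) < \<delta>" using d(1) \<open>T' < ?T\<close> by linarith
			qed
			have ak: "a <= t k" using t(3)[of k] by simp
			then have pos: "\<gamma> ?T * \<gamma> T' > 0" using d(2)[of T'] T' T(1) by auto
			have "alt_chain \<gamma> (Suc k) a T'" unfolding alt_chain_def
			proof (intro exI[of _ "%i. if i <= k then t i else T'"] exI[of _ \<sigma>] conjI allI impI)
				fix i assume i: "i < Suc k"
				show "(if i <= k then t i else T') < (if Suc i <= k then t (Suc i) else T')" using t(2)[of i] i T'(1) by (auto simp: not_le less_Suc_eq)
			next
				fix i assume i: "i <= Suc k"
				have mono: "t i <= t k" if "i <= k" for i using that
				proof (induction rule: inc_induct)
					case (step n)
					then show ?case using t(2)[of n] by simp
				qed simp
				show "a <= (if i <= k then t i else T')" using t(3)[of i] ak T'(1) i by auto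
				show "(if i <= k then t i else T') <= T'" using mono[of i] T'(1) by auto
				have "0 < \<sigma> * (-1)^Suc k * \<gamma> T'"
					using pos t(3)[of "Suc k"] by (auto simp: zero_less_mult_iff mult_less_0_iff)
				then show "0 < \<sigma> * (-1)^i * \<gamma> (if i <= k then t i else T')" using t(3)[of i] i by (cases "i <= k") (auto simp: le_Suc_eq)
			qed (rule t(1))
			moreover obtain x where "x \<in> B" "T' < x" using less_cSup_iff[of B T'] aB bdd T'(2) T(3) unfolding s_def by auto
			ultimately show False using alt_chain_mono[of \<gamma> "Suc k" a T' x] by (auto simp: B_def)
		qed
		have sltb: "s < b" using nos True sb by (cases "s = b") auto
		have sa: "a < s"
		proof -
			obtain \<delta> where d: "\<delta> > 0" "!!y. y \<in> {a..b} ==> abs (y - a) < \<delta> ==> \<gamma> a * \<gamma> y > 0"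
				using continuous_sign_nhd[OF Suc.prems(1) _ Suc.prems(3)] Suc.prems(2) by auto
			let ?x = "min b (a + \<delta>/2)"
			have "\<not> alt_chain \<gamma> (Suc k) a ?x"
			proof
				assume "alt_chain \<gamma> (Suc k) a ?x"
				then obtain t \<sigma> where t: "!!i. i <= Suc k ==> a <= t i & t i <= ?x & \<sigma> * (-1)^i * \<gamma> (t i) > 0" unfolding alt_chain_def by blast
				have "\<gamma> a * \<gamma> (t 0) > 0" "\<gamma> a * \<gamma> (t 1) > 0" using d(2)[of "t 0"] d(2)[of "t 1"] t[of 0] t[of 1] d(1) by auto
				then show False using t[of 0] t[of 1] by (auto simp: zero_less_mult_iff mult_less_0_iff)
			qed
			then have "?x \<in> B" using Suc.prems(2) d(1) by (auto simp: B_def)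
			then show ?thesis using Bs[of ?x] d(1) sltb sa0 by (auto simp: min_def split: if_splits)
		qed
		have ch: "alt_chain \<gamma> (Suc k) a x" if "s < x" "x <= b" for x
			using Bs[of x] that sa by (force simp: B_def)
		have "\<exists>\<rho>. abs \<rho> = 1 & (\<forall>y. s < y --> y <= b --> \<rho> * \<gamma> y >= (0::real))"
		proof (rule ccontr)
			assume n: "\<not> ?thesis"
			obtain y1 where y1: "s < y1" "y1 <= b" "\<gamma> y1 > 0" using n[simplified, rule_format, of "-1"] by (auto simp: not_le)
			obtain y2 where y2: "s < y2" "y2 <= b" "\<gamma> y2 < 0" using n[simplified, rule_format, of "1"] by (auto simp: not_le)
			let ?x = "(s + min y1 y2)/2"
			have "alt_chain \<gamma> (Suc (Suc k)) a b"
				by (rule alt_chain_extend[OF ch[of ?x] _ _ y1(2) y2(2) y1(3) y2(3)]) (use y1 y2 in \<open>auto simp: min_def\<close>)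
			then show False using Suc.prems by blast
		qed
		then obtain \<rho> where rho: "abs \<rho> = 1" "!!y. s < y ==> y <= b ==> \<rho> * \<gamma> y >= 0" by blast
		have "continuous_on {a..s} \<gamma>" by (rule continuous_on_subset[OF Suc.prems(1)]) (use sb in auto)
		then obtain ss \<sigma> where ss: "length ss <= k" "set ss <= {a<..<s}" "abs \<sigma> = 1" "!!t. t \<in> {a..s} ==> \<sigma> * \<gamma> t * (\<Prod>s\<leftarrow>ss. t - s) >= 0"
			using Suc.IH[OF _ sa0 Suc.prems(3) nos] by blast
		have pos: "(\<Prod>x\<leftarrow>ss. t - x) > 0" if "s < t" for t by (rule prod_list_pos) (use ss(2) that in auto)
		show ?thesis
		proof (cases "\<rho> = \<sigma>")
			case True
			have "\<sigma> * \<gamma> t * (\<Prod>s\<leftarrow>ss. t - s) >= 0" if t: "t \<in> {a..b}" for t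
			proof (cases "t <= s")
				case False
				then have "0 <= \<sigma> * \<gamma> t" using rho(2)[of t] t True by simp
				then show ?thesis by (rule mult_nonneg_nonneg) (use pos[of t] False in simp)
			qed (use ss(4) t in auto)
			then show ?thesis using ss(1,2,3) sb by (intro exI[of _ ss] exI[of _ \<sigma>]) auto
		next
			case False
			then have rs: "\<rho> = - \<sigma>" using rho(1) ss(3) by linarith
			have "- \<sigma> * \<gamma> t * (\<Prod>x\<leftarrow>s # ss. t - x) >= 0" if t: "t \<in> {a..b}" for t
			proof (cases "t <= s")
				case True
				have "- \<sigma> * \<gamma> t * (\<Prod>x\<leftarrow>s # ss. t - x) = (s - t) * (\<sigma> * \<gamma> t * (\<Prod>x\<leftarrow>ss. t - x))" by (simp add: algebra_simps)
				then show ?thesis using True ss(4)[of t] t by simp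
			next
				case False
				have "0 <= - \<sigma> * \<gamma> t" using rho(2)[of t] t rs False by simp
				moreover have "(\<Prod>x\<leftarrow>s # ss. t - x) >= 0" using pos[of t] False by simp
				ultimately show ?thesis by (rule mult_nonneg_nonneg)
			qed
			then show ?thesis using ss sa sltb by (intro exI[of _ "s # ss"] exI[of _ "- \<sigma>"]) auto
		qed
	qed
qed

text \<open>Phases will serve as Dirichlet data, which must be Hoelder continuous; locally the
  logarithm is \<open>Ln\<close> of a quotient close to 1, so it inherits the Lipschitz
  bound.\<close>

lemma log_lipschitz:
	assumes c: "nonzero_loop c" and K: "!!s t. norm (c s - c t) <= K * abs (s - t)"
		and L: "continuous_on UNIV L" "!!t. c t = exp (L t)"
	obtains \<delta> C where "\<delta> > 0" "!!s t. abs (s - t) < \<delta> ==> norm (L s - L t) <= C * abs (s - t)"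
proof -
	have cc: "continuous_on UNIV c" and cp: "!!t. c (t + 2*pi) = c t" and nz: "!!t. c t ~= 0" using c by (auto simp: nonzero_loop_def)
	obtain c0 where c0: "c0 > 0" "!!t. norm (c t) >= c0" using periodic_bounded_below[OF cp cc nz] by blast
	have K0: "K >= 0" using order_trans[OF norm_ge_zero K[of 1 0]] by simp
	define \<delta> where "\<delta> = c0 / (2*(K+1))"
	have dp: "\<delta> > 0" using c0 K0 by (simp add: \<delta>_def)
	have small: "norm (c s / c t - 1) <= K / c0 * abs (s - t) & norm (c s / c t - 1) < 1/2" if st: "abs (s - t) < \<delta>" for s t
	proof -
		have "norm (c s / c t - 1) = norm (c s - c t) / norm (c t)" using nz[of t] by (simp add: field_simps flip: norm_divide)
		also have "\<dots> <= (K * abs (s - t)) / c0" using K[of s t] c0 K0 by (intro frac_le) auto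
		finally have 1: "norm (c s / c t - 1) <= K / c0 * abs (s - t)" by simp
		also have "\<dots> <= K / c0 * \<delta>" using K0 c0(1) st by (intro mult_left_mono) auto
		also have "\<dots> < 1/2" using K0 c0(1) by (simp add: \<delta>_def field_simps)
		finally show ?thesis using 1 by simp
	qed
	show ?thesis
	proof (rule that[OF dp, of "2*(K/c0)"])
		fix s t :: real assume st: "abs (s - t) < \<delta>"
		let ?I = "{t-\<delta><..<t+\<delta>}"
		have pos: "c x / c t ~: \<real>\<^sub>\<le>\<^sub>0" if "x \<in> ?I" for x
		proof -
			have "norm (c x / c t - 1) < 1/2" using small[of x t] that by auto
			then have "abs (Re (c x / c t - 1)) < 1/2" using abs_Re_le_cmod order_le_less_trans by blast
			then have "abs (Re (c x / c t) - 1) < 1/2" by (simp only: minus_complex.simps one_complex.simps)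
			then have "Re (c x / c t) > 0" by linarith
			then show ?thesis by (auto simp: complex_nonpos_Reals_iff)
		qed
		have "(%x. L x - L t - Ln (c x / c t)) constant_on ?I"
		proof (rule exp_eq_1_constant_on)
			show "continuous_on ?I (%x. L x - L t - Ln (c x / c t))"
				using pos by (intro continuous_intros continuous_on_subset[OF L(1)] continuous_on_subset[OF cc]) (auto simp: nz)
			show "exp (L x - L t - Ln (c x / c t)) = 1" for x using nz[of x] nz[of t] by (simp add: exp_diff L(2)[symmetric])
		qed auto
		then obtain y where y: "!!x. x \<in> ?I ==> L x - L t - Ln (c x / c t) = y" unfolding constant_on_def by blast
		have "y = 0" using y[of t] dp nz[of t] by simp
		then have "L s - L t = Ln (1 + (c s / c t - 1))" using y[of s] st unfolding abs_less_iff by auto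
		also have "norm \<dots> <= 2 * norm (c s / c t - 1)" by (rule norm_Ln_le) (use small[OF st] in blast)
		also have "\<dots> <= 2*(K/c0) * abs (s - t)" using small[OF st] by simp
		finally show "norm (L s - L t) <= 2*(K/c0) * abs (s - t)" .
	qed
qed

lemma holder_local_lipschitz:
	assumes per: "!!t. f (t + 2*pi) = f t" and "continuous_on UNIV f" "\<delta> > 0" "!!s t. abs (s - t) < \<delta> ==> abs (f s - f t) <= C * abs (s - t)"
	shows "holder_continuous f"
proof -
	obtain M where M: "M > 0" "!!t. norm (f t) <= M" using periodic_bounded[OF per assms(2)] by blast
	have "abs (f s - f t) <= (abs C + 2*M/\<delta>) * abs (s - t) powr 1" for s t
	proof (cases "abs (s - t) < \<delta>")
		case True
		have "abs (f s - f t) <= C * abs (s - t)" by (rule assms(4)[OF True])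
		also have "\<dots> <= (abs C + 2*M/\<delta>) * abs (s - t)" using M(1) assms(3) by (intro mult_right_mono) (auto intro: add_increasing2)
		finally show ?thesis by simp
	next
		case False
		have "abs (f s - f t) <= 2*M/\<delta> * \<delta>" using M(2)[of s] M(2)[of t] assms(3) by simp
		also have "\<dots> <= 2*M/\<delta> * abs (s - t)" using M(1) assms(3) False by (intro mult_left_mono) auto
		also have "\<dots> <= (abs C + 2*M/\<delta>) * abs (s - t)" by (intro mult_right_mono) auto
		finally show ?thesis by simp
	qed
	then show ?thesis unfolding holder_continuous_def by (intro exI[of _ "abs C + 2*M/\<delta>"] exI[of _ 1]) auto
qed

text \<open>As \<open>ind c = -1\<close>, the exponent \<open>\<kappa> = - ind a\<close> gives the
  quotient index 0, so its argument \<open>- \<Lambda>\<close> is periodic and can be prescribed as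
  real part in a Dirichlet problem.\<close>

lemma periodic_phase:
	assumes a: "nonzero_loop a" "!!s t. norm (a s - a t) <= K * abs (s - t)"
		and c: "nonzero_loop c" "!!s t. norm (c s - c t) <= K' * abs (s - t)" "ind c = -1"
	obtains \<kappa> :: int and \<Lambda> \<rho> :: "real => real" where "!!t. \<Lambda> (t + 2*pi) = \<Lambda> t" "holder_continuous \<Lambda>"
		"!!t. \<rho> t > 0" "!!t. c t powi \<kappa> / a t = of_real (\<rho> t) * exp (- \<i> * of_real (\<Lambda> t))"
proof (rule log_lift[OF a(1)])
	fix L n assume L: "continuous_on UNIV L" "!!t. a t = exp (L t)" "!!t. L (t + 2*pi) = L t + 2*pi*\<i>* of_int n" "ind a = of_int n"
	show ?thesis
	proof (rule log_lift[OF c(1)])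
		fix L' n' assume L': "continuous_on UNIV L'" "!!t. c t = exp (L' t)" "!!t. L' (t + 2*pi) = L' t + 2*pi*\<i>* of_int n'" "ind c = of_int n'"
		have n': "n' = -1" using L'(4) c(3) by (metis of_int_1 of_int_eq_iff of_int_minus)
		define \<Lambda> where "\<Lambda> = (%t. Im (L t) + of_int n * Im (L' t))"
		obtain \<delta> C where d: "\<delta> > 0" "!!s t. abs (s - t) < \<delta> ==> norm (L s - L t) <= C * abs (s - t)" using log_lipschitz[OF a L(1,2)] by blast
		obtain \<delta>' C' where d': "\<delta>' > 0" "!!s t. abs (s - t) < \<delta>' ==> norm (L' s - L' t) <= C' * abs (s - t)" using log_lipschitz[OF c(1,2) L'(1,2)] by blast
		have per: "\<Lambda> (t + 2*pi) = \<Lambda> t" for t unfolding \<Lambda>_def L(3) L'(3) n' by (simp add: algebra_simps)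
		have cL: "continuous_on UNIV \<Lambda>" unfolding \<Lambda>_def by (intro continuous_intros L L')
		have lip: "abs (\<Lambda> s - \<Lambda> t) <= (C + abs (of_int n) * C') * abs (s - t)" if "abs (s - t) < min \<delta> \<delta>'" for s t
		proof -
			have "abs (\<Lambda> s - \<Lambda> t) = abs (Im (L s - L t) + of_int n * Im (L' s - L' t))" by (simp add: \<Lambda>_def algebra_simps)
			also have "\<dots> <= abs (Im (L s - L t)) + abs (of_int n) * abs (Im (L' s - L' t))" by (metis abs_mult abs_triangle_ineq)
			also have "\<dots> <= C * abs (s - t) + abs (of_int n) * (C' * abs (s - t))"
				using d(2)[of s t] d'(2)[of s t] that abs_Im_le_cmod[of "L s - L t"] abs_Im_le_cmod[of "L' s - L' t"]
				by (intro add_mono mult_left_mono) auto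
			finally show ?thesis by (simp add: algebra_simps)
		qed
		have hol: "holder_continuous \<Lambda>" by (rule holder_local_lipschitz[where \<delta>="min \<delta> \<delta>'", OF per cL _ lip]) (use d(1) d'(1) in auto)
		define M where "M = (%t. of_int (-n) * L' t - L t)"
		have M: "c t powi (-n) / a t = of_real (exp (Re (M t))) * exp (- \<i> * of_real (\<Lambda> t))" for t
		proof -
			have "c t powi (-n) / a t = exp (M t)" unfolding M_def L(2) L'(2) exp_power_int by (simp add: exp_diff)
			also have "M t = of_real (Re (M t)) + - \<i> * of_real (\<Lambda> t)" by (simp add: complex_eq_iff M_def \<Lambda>_def)
			finally show ?thesis by (simp only: exp_add exp_of_real)
		qed
		show ?thesis by (rule that[OF per hol _ M]) simp
	qed
qed

section \<open>Periodic functions with prescribed sign changes\<close>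

lemma abs_sin_diff_le: "abs (sin x - sin y) <= abs (x - y)" for x y :: real
proof -
	have "abs (sin x - sin y) = 2 * abs (sin ((x-y)/2)) * abs (cos ((x+y)/2))" unfolding sin_diff_sin by (simp add: abs_mult)
	also have "\<dots> <= 2 * abs ((x-y)/2) * 1" by (intro mult_mono abs_sin_x_le_abs_x) auto
	finally show ?thesis by simp
qed

text \<open>A periodic substitute for the polynomial with zeros \<open>ss\<close>, with the same
  signs within one period (\<open>trig_sign_list\<close>). The half angles make it periodic for an
  even and antiperiodic for an odd number of factors.\<close>

definition trig :: "real list => real => real" where "trig ss t = (\<Prod>s\<leftarrow>ss. sin ((t - s)/2))"

lemma trig_le_1: "abs (trig ss t) <= 1"
proof (induction ss)
	case (Cons s ss)
	have "abs (sin ((t - s)/2)) * abs (trig ss t) <= 1 * 1" by (intro mult_mono Cons) auto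
	then show ?case by (simp add: trig_def abs_mult)
qed (simp add: trig_def)

lemma trig_lipschitz: "abs (trig ss s - trig ss t) <= real (length ss) * abs (s - t)"
proof (induction ss)
	case (Cons a ss)
	have "trig (a#ss) s - trig (a#ss) t = (sin ((s-a)/2) - sin ((t-a)/2)) * trig ss s + sin ((t-a)/2) * (trig ss s - trig ss t)"
		by (simp add: trig_def algebra_simps)
	also have "abs \<dots> <= abs (sin ((s-a)/2) - sin ((t-a)/2)) * abs (trig ss s) + abs (sin ((t-a)/2)) * abs (trig ss s - trig ss t)"
		by (metis abs_mult abs_triangle_ineq)
	also have "\<dots> <= abs (s - t) * 1 + 1 * (real (length ss) * abs (s - t))"
	proof (intro add_mono mult_mono trig_le_1 Cons)
		show "abs (sin ((s-a)/2) - sin ((t-a)/2)) <= abs (s - t)" 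
		proof -
			have "abs (sin ((s-a)/2) - sin ((t-a)/2)) <= abs ((s-a)/2 - (t-a)/2)" by (rule abs_sin_diff_le)
			also have "(s-a)/2 - (t-a)/2 = (s-t)/2" by (simp add: field_simps)
			also have "abs ((s-t)/2) <= abs (s-t)" by simp
			finally show ?thesis .
		qed
	qed (use Cons in auto)
	finally show ?case by (simp add: algebra_simps)
qed (simp add: trig_def)

lemma holder_trig: "holder_continuous (%t. \<sigma> * trig ss t)"
proof -
	have "abs (\<sigma> * trig ss s - \<sigma> * trig ss t) <= (abs \<sigma> * length ss) * abs (s - t) powr 1" for s t
	proof -
		have "abs (\<sigma> * trig ss s - \<sigma> * trig ss t) = abs \<sigma> * abs (trig ss s - trig ss t)" by (simp flip: abs_mult right_diff_distrib)
		also have "\<dots> <= abs \<sigma> * (length ss * abs (s - t))" by (intro mult_left_mono trig_lipschitz) auto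
		finally show ?thesis by simp
	qed
	then show ?thesis unfolding holder_continuous_def by (intro exI[of _ "abs \<sigma> * length ss"] exI[of _ 1]) auto
qed

lemma trig_shift: "trig ss (t + 2*pi) = (-1)^length ss * trig ss t"
proof (induction ss)
	case (Cons s ss)
	have "(t + 2*pi - s)/2 = (t - s)/2 + pi" by (simp add: field_simps)
	then have "sin ((t + 2*pi - s)/2) = - sin ((t - s)/2)" by (simp only: sin_periodic_pi)
	then show ?case using Cons by (simp add: trig_def)
qed (simp add: trig_def)

lemma trig_sign_list:
	assumes "set ss <= {a<..<a+2*pi}" "t \<in> {a..a+2*pi}"
	shows "\<exists>Q>0. trig ss t = Q * (\<Prod>s\<leftarrow>ss. t - s)"
	using assms(1)
proof (induction ss)
	case (Cons s ss)
	then obtain Q where Q: "Q > 0" "trig ss t = Q * (\<Prod>s\<leftarrow>ss. t - s)" by auto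
	have b: "abs (t - s) < 2*pi" using Cons.prems assms(2) by auto
	have "\<exists>q>0. sin ((t - s)/2) = q * (t - s)"
	proof -
		consider "t = s" | "t > s" | "t < s" by linarith
		then show ?thesis
		proof cases
			case 2
			then have "sin ((t - s)/2) > 0" using b by (intro sin_gt_zero) auto
			then show ?thesis using 2 by (intro exI[of _ "sin ((t-s)/2)/(t-s)"]) auto
		next
			case 3
			then have "sin ((s - t)/2) > 0" using b by (intro sin_gt_zero) auto
			moreover have "sin ((t - s)/2) = - sin ((s - t)/2)" using sin_minus[of "(s-t)/2"] by (simp add: minus_divide_left)
			ultimately show ?thesis using 3 by (intro exI[of _ "sin ((t-s)/2)/(t-s)"]) (auto simp: divide_neg_neg divide_pos_neg)
		qed (auto intro: exI[of _ 1])
	qed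
	then obtain q where "q > 0" "sin ((t - s)/2) = q * (t - s)" by blast
	then show ?case using Q by (intro exI[of _ "q*Q"]) (auto simp: trig_def)
qed (auto simp: trig_def intro: exI[of _ 1])

text \<open>Exactly \<open>N - Suc i\<close> nodes lie to the right of \<open>s\<close>; their
  factors are negative and all others positive.\<close>

lemma trig_arc_sign:
	assumes lo: "!!j. j <= i ==> t j < s & s < t j + 2*pi" and hi: "!!j. i < j ==> j < N ==> s < t j & t j < s + 2*pi" and i: "i < N"
	shows "(-1)^(N - Suc i) * trig (map t [0..<N]) s > 0"
proof -
	have e: "trig (map t [0..<N]) s = (\<Prod>j<N. sin ((s - t j)/2))"
		by (simp add: trig_def o_def atLeast0LessThan flip: prod.list_conv_set_nth prod.distinct_set_conv_list)
	have "(\<Prod>j<N. sin ((s - t j)/2)) = (\<Prod>j\<in>{..i}. sin ((s - t j)/2)) * (\<Prod>j\<in>{i<..<N}. sin ((s - t j)/2))"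
	proof -
		have "{..<N} = {..i} Un {i<..<N}" using i by auto
		then show ?thesis by (simp add: prod.union_disjoint disjoint_iff)
	qed
	also have "(\<Prod>j\<in>{i<..<N}. sin ((s - t j)/2)) = (\<Prod>j\<in>{i<..<N}. (-1) * sin ((t j - s)/2))"
	proof (rule prod.cong)
		fix j show "sin ((s - t j)/2) = (-1) * sin ((t j - s)/2)" using sin_minus[of "(t j - s)/2"] by (simp add: minus_divide_left)
	qed simp
	also have "\<dots> = (-1)^(N - Suc i) * (\<Prod>j\<in>{i<..<N}. sin ((t j - s)/2))" by (simp only: prod.distrib prod_constant card_greaterThanLessThan)
	finally have "(-1)^(N - Suc i) * trig (map t [0..<N]) s
		= ((-1)^(N - Suc i) * (-1)^(N - Suc i)) * ((\<Prod>j\<in>{..i}. sin ((s - t j)/2)) * (\<Prod>j\<in>{i<..<N}. sin ((t j - s)/2)))" unfolding e by (simp only: mult_ac)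
	also have "(-1)^(N - Suc i) * (-1)^(N - Suc i) = (1::real)" by (simp flip: power_add)
	finally have "(-1)^(N - Suc i) * trig (map t [0..<N]) s = (\<Prod>j\<in>{..i}. sin ((s - t j)/2)) * (\<Prod>j\<in>{i<..<N}. sin ((t j - s)/2))" by simp
	moreover have "(\<Prod>j\<in>{..i}. sin ((s - t j)/2)) > 0" 
	proof (intro prod_pos ballI sin_gt_zero)
		fix j assume "j \<in> {..i}"
		then show "0 < (s - t j)/2" "(s - t j)/2 < pi" using lo[of j] by auto
	qed
	moreover have "(\<Prod>j\<in>{i<..<N}. sin ((t j - s)/2)) > 0"
	proof (intro prod_pos ballI sin_gt_zero)
		fix j assume "j \<in> {i<..<N}"
		then show "0 < (t j - s)/2" "(t j - s)/2 < pi" using hi[of j] by auto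
	qed
	ultimately show ?thesis by simp
qed

lemma trig_node: "i < N ==> trig (map t [0..<N]) (t i) = 0"
	unfolding trig_def by (auto simp: prod_list_zero_iff intro: image_eqI[of _ _ i])

context smooth_loop
begin

text \<open>By \<open>tub_eqD\<close> each point lies on at most one parallel curve, so countably
  many zeros spoil only countably many radii and a good radius always exists.\<close>

lemma countable_tub_radii:
	assumes "countable Z" shows "countable {r. abs r <= rho & (\<exists>t. tub t r \<in> Z)}"
proof -
	have "{r. abs r <= rho & (\<exists>t. tub t r \<in> Z)} <= (%z. SOME r. abs r <= rho & (\<exists>t. tub t r = z)) ` Z"
	proof
		fix r assume "r \<in> {r. abs r <= rho & (\<exists>t. tub t r \<in> Z)}"
		then obtain t where t: "abs r <= rho" "tub t r \<in> Z" by blast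
		have "(SOME r'. abs r' <= rho & (\<exists>s. tub s r' = tub t r)) = r"
		proof (rule some_equality)
			show "abs r <= rho & (\<exists>s. tub s r = tub t r)" using t(1) by blast
			show "r' = r" if "abs r' <= rho & (\<exists>s. tub s r' = tub t r)" for r' using tub_eqD[of _ r' t r] that t(1) by auto
		qed
		then show "r \<in> (%z. SOME r. abs r <= rho & (\<exists>t. tub t r = z)) ` Z" using t(2) by (intro image_eqI[of _ _ "tub t r"]) auto
	qed
	then show ?thesis by (rule countable_subset[OF _ countable_image[OF assms]])
qed

end

lemma holomorphic_zeros_countable:
	assumes "f holomorphic_on S" "open S" "connected S" "w \<in> S" "f w ~= 0"
	shows "countable {z\<in>S. f z = 0}"
proof (cases "\<exists>z\<in>S. f z = 0")
	case True
	then have "\<not> f constant_on S" using assms(4,5) unfolding constant_on_def by metis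
	moreover have "fsigma S"
	proof -
		obtain C where "!!n. compact (C n)" "!!n. C n <= S" "!!n. C n <= interior (C (Suc n))" "\<Union> (range C) = S"
			"!!K. [|compact K; K <= S|] ==> \<exists>N. \<forall>n\<ge>N. K <= C n" by (rule open_Union_compact_subsets[OF assms(2)]) (rule that, assumption+)
		then show ?thesis unfolding fsigma_Union_compact by (intro exI[of _ C]) auto
	qed
	ultimately show ?thesis by (intro holomorphic_countable_zeros assms)
next
	case False
	then have "{z\<in>S. f z = 0} = {}" by blast
	then show ?thesis by (metis countable_empty)
qed

context cw_loop
begin

text \<open>The index is minus the number of zeros enclosed by the parallel curve. Zeros may
  accumulate at \<open>e\<close>, so only those in the compact set \<open>K\<close> are divided out;
  the remaining ones lie between the parallel curve and \<open>e\<close>, where the winding number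
  is 0.\<close>

lemma ind_interior:
	assumes r: "0 < r" "r < rho" and h: "h holomorphic_on Ins" "!!t. h (tub t (-r)) ~= 0"
	shows "Re (ind (%t. h (tub t (-r)))) <= 0"
proof -
	let ?c = "curve (%t. tub t (-r))"
	define K where "K = (Ins Un range e) - {tub s x | s x. x \<in> {-r<..<rho}}"
	have cl: "closure Ins = Ins Un range e" using closure_Un_frontier[of "Ins"] frontier_inside_e by simp
	have "bounded K" using bounded_closure[OF bounded_inside_e] unfolding cl K_def by (rule bounded_subset) auto
	moreover have "closed K" unfolding K_def cl[symmetric] using open_tube[of "-r" rho] r by (intro closed_Diff) auto
	ultimately have Kc: "compact K" using compact_eq_bounded_closed by blast
	have et: "e t \<in> {tub s x | s x. x \<in> {-r<..<rho}}" for t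
	proof -
		have "e t = tub t 0 & 0 \<in> {-r<..<rho}" using r by (simp add: tub_0)
		then show ?thesis by blast
	qed
	have KS: "K <= Ins" using et by (auto simp: K_def)
	have cin: "tub t (-r) \<in> Ins" for t using tub_sides(2)[of r t] r by simp
	have w: "tub 0 (-r) \<in> Ins" "h (tub 0 (-r)) ~= 0" using cin h(2) by auto
	have fin: "finite {z\<in>K. h z = 0}"
	proof (cases "{z\<in>K. h z = 0} = {}")
		case False
		then obtain z where "z \<in> Ins" "h z = 0" using KS by blast
		then have "\<not> h constant_on Ins" using w unfolding constant_on_def by metis
		then show ?thesis by (rule holomorphic_compact_finite_zeros[OF h(1) open_inside_e connected_inside_e Kc KS])
	next
		case True
		then show ?thesis by (metis finite.emptyI)
	qed
	have "\<exists>zs E. set zs = {z\<in>K. h z = 0} & E holomorphic_on Ins & (\<forall>z\<in>Ins. h z = (\<Prod>a\<leftarrow>zs. z - a) * E z) & (\<forall>z\<in>{z\<in>K. h z = 0}. E z ~= 0)"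
		by (rule holomorphic_factor_zeros[where f=h and w="tub 0 (-r)", OF open_inside_e connected_inside_e h(1) fin _ _ w]) (use KS in auto)
	then obtain zs E where E: "set zs = {z\<in>K. h z = 0}" "E holomorphic_on Ins"
		"!!z. z \<in> Ins ==> h z = (\<Prod>a\<leftarrow>zs. z - a) * E z" "!!z. z \<in> {z\<in>K. h z = 0} ==> E z ~= 0" by blast
	have EK: "E z ~= 0" if "z \<in> K" for z
		using E(4)[of z] E(3)[of z] that KS by (cases "h z = 0") auto
	define S where "S = Ins \<inter> E -` (- {0})"
	have So: "open S" unfolding S_def by (rule continuous_open_preimage[OF holomorphic_on_imp_continuous_on[OF E(2)] open_inside_e]) auto
	have ES: "E holomorphic_on S" "!!z. z \<in> S ==> E z ~= 0" using E(2) holomorphic_on_subset by (auto simp: S_def)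
	have Ec: "E (tub t (-r)) ~= 0" for t using h(2)[of t] E(3)[OF cin[of t]] by auto
	have cS: "path_image ?c <= S" unfolding path_image_tub S_def using cin Ec by auto
	have wz: "winding_number ?c (tub s x) = 0" if "-r < x" "x <= rho" for s x using winding_tub[of "-r" x s] that r by simp
	have hom: "winding_number ?c z = winding_number (curve e) z" if "!!s x. x \<in> {-r..0} ==> z ~= tub s x" for z
		using winding_tub_homotopy[of "-r" 0 z] that r by (simp add: tub_0 closed_segment_eq_real_ivl)
	have "((%z. deriv E z / E z) has_contour_integral 0) ?c"
	proof (rule Cauchy_theorem_global[OF So _ valid_tub loop_tub cS])
		show "(%z. deriv E z / E z) holomorphic_on S" by (intro holomorphic_intros holomorphic_deriv ES So)
		fix z assume z: "z ~: S"
		show "winding_number ?c z = 0"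
		proof (cases "\<exists>s x. -r < x & x <= rho & z = tub s x")
			case True
			then show ?thesis using wz by blast
		next
			case False
			have "z ~: Ins"
			proof
				assume zi: "z \<in> Ins"
				have "z ~: {tub s x | s x. x \<in> {-r<..<rho}}"
				proof
					assume "z \<in> {tub s x | s x. x \<in> {-r<..<rho}}"
					then obtain s x where "z = tub s x" "-r < x" "x <= rho" by auto
					then show False using False by blast
				qed
				then have "z \<in> K" using zi by (simp add: K_def)
				then show False using z zi EK by (auto simp: S_def)
			qed
			moreover have "z ~: range e" using False et by fastforce
			ultimately have zo: "z \<in> Out" using in_or_out by blast
			have "z ~= tub s x" if "x \<in> {-r..0}" for s x
			proof (cases "x = -r")
				case True
				then show ?thesis using cin[of s] \<open>z ~: Ins\<close> by auto
			next
				case False': False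
				then have "-r < x" "x <= rho" using that rho_pos by auto
				then show ?thesis using False by blast
			qed
			then show ?thesis using hom winding_out[OF zo] by simp
		qed
	qed
	then have "2*pi*\<i> * ind (%t. E (tub t (-r))) = 0"
		using ind_holomorphic[OF So ES(1) valid_tub cS] ES(2) cS contour_integral_unique by fastforce
	then have iE: "ind (%t. E (tub t (-r))) = 0" by simp
	have nl: "nonzero_loop (%t. tub t (-r) - a)" if "a \<in> set zs" for a
	proof -
		have "tub t (-r) ~= a" for t using h(2)[of t] that E(1) by auto
		then show ?thesis unfolding nonzero_loop_def by (auto intro!: continuous_intros tub_cont simp: tub_per)
	qed
	have nE: "nonzero_loop (%t. E (tub t (-r)))" unfolding nonzero_loop_def
	proof (intro conjI allI)
		show "continuous_on UNIV (%t. E (tub t (-r)))"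
			by (rule continuous_on_compose2[OF holomorphic_on_imp_continuous_on[OF E(2)]]) (use cin in \<open>auto intro!: tub_cont continuous_intros\<close>)
	qed (use Ec in \<open>auto simp: tub_per\<close>)
	have "winding_number ?c a = -1" if a: "a \<in> set zs" for a
	proof -
		have aK: "a \<in> K" "h a = 0" using a E(1) by auto
		have "a ~= tub s x" if "x \<in> {-r..0}" for s x
		proof (cases "x = -r")
			case True
			then show ?thesis using h(2)[of s] aK(2) by auto
		next
			case False
			then have "x \<in> {-r<..<rho}" using that rho_pos by auto
			then show ?thesis using aK(1) unfolding K_def by blast
		qed
		then show ?thesis using hom cw aK(1) KS by auto
	qed
	then have "(\<Sum>a\<leftarrow>zs. winding_number ?c a) = (\<Sum>a\<leftarrow>zs. -1)" by (intro arg_cong[where f=sum_list] map_cong) auto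
	moreover have "(%t. h (tub t (-r))) = (%t. (\<Prod>a\<leftarrow>zs. tub t (-r) - a) * E (tub t (-r)))" using E(3)[OF cin] by simp
	ultimately have "ind (%t. h (tub t (-r))) = - of_nat (length zs)"
		using ind_mult[OF nonzero_loop_prod_list(1)[OF nl] nE] nonzero_loop_prod_list(2)[OF nl] iE
		by (simp add: sum_list_triv map_replicate_const sum_list_replicate)
	then show ?thesis by simp
qed

end

lemma ind_const_mult:
	assumes "nonzero_loop V" "z ~= 0" shows "nonzero_loop (%t. z * V t)" "ind (%t. z * V t) = ind V"
proof -
	have "nonzero_loop (%t. exp (Ln z))" "ind (%t. exp (Ln z)) = 0" by (rule nonzero_loop_exp ind_exp; simp)+
	then show "nonzero_loop (%t. z * V t)" "ind (%t. z * V t) = ind V"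
		using nonzero_loop_mult[of "%_. z" V] ind_mult[of "%_. z" V] assms by auto
qed

lemma nonzero_loop_cong_mod:
	assumes "!!t. V (t + 2*pi) = V t" "!!s. s \<in> {a..<a+2*pi} ==> V s ~= (0::complex)" shows "V t ~= 0"
proof -
	obtain n :: int where "a <= t + 2*pi* of_int n" "t + 2*pi* of_int n < a + 2*pi" by (rule reduce_mod_2pi)
	then show ?thesis using assms(2)[of "t + 2*pi* of_int n"] periodic_int[of V t n, OF assms(1)] by simp
qed

section \<open>Index estimates from boundary values\<close>

context cw_loop
begin

text \<open>A small perturbation with imaginary part \<^term>\<open>\<omega>\<close> on the curve removes the boundary zeros of a function that is
	real there, without changing its index on the outer parallel curve.\<close>

lemma ind_perturb:
	assumes r: "0 < r" "r < rho" and F: "F holomorphic_on {tub s x | s x. x \<in> {0<..<r}}" "continuous_on {tub s x | s x. x \<in> {0..r}} F"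
		"!!t. F (tub t r) ~= 0"
		and om: "!!t. \<omega> (t + 2*pi) = \<omega> t" "holder_continuous \<omega>"
	obtains h \<epsilon>0 where "!!t. h (t + 2*pi) = h t" "\<epsilon>0 > 0" "!!\<epsilon>. 0 < \<epsilon> ==> \<epsilon> < \<epsilon>0 ==> (!!t. F (e t) + of_real \<epsilon> * Complex (h t) (\<omega> t) ~= 0) ==>
			nonzero_loop (%t. F (e t) + of_real \<epsilon> * Complex (h t) (\<omega> t)) &
			Re (ind (%t. F (tub t r))) <= Re (ind (%t. F (e t) + of_real \<epsilon> * Complex (h t) (\<omega> t)))"
proof (rule dirichlet_exterior[OF om])
	fix l assume l: "l holomorphic_on Out" "continuous_on (Out Un range e) l" "!!t. Re (l (e t)) = \<omega> t"
	let ?C = "{tub s x | s x. x \<in> {0..r}}" and ?O = "{tub s x | s x. x \<in> {0<..<r}}"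
	have Osub: "?O <= Out" using tub_sides(1) r by auto
	have tC: "tub s x \<in> Out Un range e" if "x \<in> {0..r}" for s x
		using tub_sides(1)[of x s] that r by (cases "x = 0") (auto simp: tub_0)
	then have Csub: "?C <= Out Un range e" by auto
	have "r \<in> {0..r}" using r by simp
	then have tr: "tub t r \<in> ?C" for t by blast
	have cr: "continuous_on UNIV (%t. g (tub t r))" if "continuous_on ?C g" for g :: "complex => complex"
		by (rule continuous_on_compose2[OF that]) (use tr in \<open>auto intro!: tub_cont continuous_intros\<close>)
	have ce: "continuous_on UNIV (%t. g (e t))" if "continuous_on ?C g" for g :: "complex => complex"
	proof (rule continuous_on_compose2[OF that e_cont])
		have "e t = tub t 0" "0 \<in> {0..r}" for t using r by (simp_all add: tub_0)
		then show "e ` UNIV <= ?C" by blast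
	qed
	have lC: "continuous_on ?C l" by (rule continuous_on_subset[OF l(2) Csub])
	have cl: "continuous_on UNIV (%t. l (tub t r))" by (rule cr[OF lC])
	obtain B where B: "B > 0" "!!t. norm (l (tub t r)) <= B" using periodic_bounded[of "%t. l (tub t r)"] cl tub_per by metis
	obtain b where b: "b > 0" "!!t. norm (F (tub t r)) >= b"
		using periodic_bounded_below[of "%t. F (tub t r)"] cr[OF F(2)] F(3) tub_per by metis
	define h where "h = (%t. - Im (l (e t)))"
	have he: "Complex (h t) (\<omega> t) = \<i> * l (e t)" for t using l(3)[of t] by (simp add: h_def complex_eq_iff)
	show ?thesis
	\<comment> \<open>Below \<open>b/B\<close> the perturbation is smaller than \<open>F\<close> on the
	  outer curve, so \<open>ind_close\<close> keeps the index there.\<close>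
	proof (rule that[of h "b/B"])
		show "h (t + 2*pi) = h t" for t by (simp add: h_def per)
		show "b/B > 0" using b B by simp
		fix \<epsilon> :: real assume ep: "0 < \<epsilon>" "\<epsilon> < b/B" and nz: "!!t. F (e t) + of_real \<epsilon> * Complex (h t) (\<omega> t) ~= 0"
		define V where "V = (%z. F z + \<epsilon> * (\<i> * l z))"
		have Ve: "(%t. F (e t) + of_real \<epsilon> * Complex (h t) (\<omega> t)) = (%t. V (e t))" by (simp add: V_def he)
		have nzV: "V (e t) ~= 0" for t using nz[of t] fun_cong[OF Ve, of t] by simp
		have VC: "continuous_on ?C V" unfolding V_def by (intro continuous_intros F lC)
		have VO: "V holomorphic_on ?O" unfolding V_def by (intro holomorphic_intros F holomorphic_on_subset[OF l(1) Osub])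
		have cl: "norm (V (tub t r) - F (tub t r)) < norm (F (tub t r))" for t
		proof -
			have "norm (V (tub t r) - F (tub t r)) = \<epsilon> * norm (l (tub t r))" using ep by (simp add: V_def norm_mult)
			also have "\<dots> <= \<epsilon> * B" using ep B by (intro mult_left_mono) auto
			also have "\<dots> < b" using ep B by (simp add: field_simps)
			finally show ?thesis using b(2)[of t] by simp
		qed
		have nF: "nonzero_loop (%t. F (tub t r))" unfolding nonzero_loop_def using cr[OF F(2)] F(3) by (simp add: tub_per)
		have i: "nonzero_loop (%t. V (tub t r))" "ind (%t. V (tub t r)) = ind (%t. F (tub t r))"
			using ind_close[OF nF cr[OF VC] _ cl] tub_per by auto
		have "Re (ind (%t. V (tub t r))) <= Re (ind (%t. V (tub t 0)))"
			by (rule ind_collar) (use r VO VC nzV i(1) in \<open>auto simp: tub_0 nonzero_loop_def\<close>)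
		moreover have "nonzero_loop (%t. V (e t))" unfolding nonzero_loop_def using ce[OF VC] nzV by (simp add: per)
		ultimately show "nonzero_loop (%t. F (e t) + of_real \<epsilon> * Complex (h t) (\<omega> t)) &
			Re (ind (%t. F (tub t r))) <= Re (ind (%t. F (e t) + of_real \<epsilon> * Complex (h t) (\<omega> t)))"
			unfolding Ve using i(2) by (simp add: tub_0)
	qed
qed

text \<open>A perturbation with constant imaginary part 1 pushes the real boundary values into the
  upper half plane. There the index is 0, and \<open>ind_perturb\<close> compares it with the outer
  parallel curve.\<close>

lemma ind_real_boundary:
	assumes r: "0 < r" "r < rho" and F: "F holomorphic_on {tub s x | s x. x \<in> {0<..<r}}" "continuous_on {tub s x | s x. x \<in> {0..r}} F"
		"!!t. F (tub t r) ~= 0" and real: "!!t. F (e t) = of_real (p t)"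
	shows "Re (ind (%t. F (tub t r))) <= 0"
proof (rule ind_perturb[OF r F, of "%_. 1"])
	show "holder_continuous (%_. 1)" unfolding holder_continuous_def by (intro exI[of _ 0] exI[of _ 1]) auto
	fix h \<epsilon>0 assume e0: "\<epsilon>0 > 0" and H: "!!\<epsilon>. 0 < \<epsilon> ==> \<epsilon> < \<epsilon>0 ==> (!!t. F (e t) + of_real \<epsilon> * Complex (h t) 1 ~= 0) ==>
			nonzero_loop (%t. F (e t) + of_real \<epsilon> * Complex (h t) 1) & Re (ind (%t. F (tub t r))) <= Re (ind (%t. F (e t) + of_real \<epsilon> * Complex (h t) 1))"
	define V where "V = (%t. F (e t) + of_real (\<epsilon>0/2) * Complex (h t) 1)"
	have Im: "Im (V t) > 0" for t using e0 by (simp add: V_def real)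
	have V: "nonzero_loop V" "Re (ind (%t. F (tub t r))) <= Re (ind V)"
	proof -
		have "F (e t) + complex_of_real (\<epsilon>0/2) * Complex (h t) 1 ~= 0" for t using Im[of t] unfolding V_def by (metis less_irrefl zero_complex.sel(2) of_real_divide of_real_numeral)
		from H[of "\<epsilon>0/2", OF _ _ this] show "nonzero_loop V" "Re (ind (%t. F (tub t r))) <= Re (ind V)"
			using e0 unfolding V_def by auto
	qed
	have "2 * abs (Re (ind (%t. -\<i> * V t))) <= card ({} :: real set) + 1"
		by (rule ind_bound[where x=0]) (use ind_const_mult(1)[OF V(1), of "-\<i>"] Im less_imp_neq in fastforce)+
	then have "2 * abs (Re (ind V)) <= 1" using ind_const_mult(2)[OF V(1), of "-\<i>"] by simp
	moreover obtain n :: int where "ind V = of_int n" using ind_int[OF V(1)] by blast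
	ultimately have "ind V = 0" by simp
	then show ?thesis using V(2) by simp
qed auto

text \<open>\<open>2*n - 1\<close> changes mean \<open>2*n\<close> nodes, and closing the period
  adds one more change. The perturbation gets an imaginary part that changes sign exactly at the
  nodes, with signs such that the boundary loop runs clockwise from node to node through alternating
  half planes; \<open>ind_chain\<close> counts the half turns.\<close>

lemma ind_real_boundary_chain:
	assumes r: "0 < r" "r < rho" and F: "F holomorphic_on {tub s x | s x. x \<in> {0<..<r}}" "continuous_on {tub s x | s x. x \<in> {0..r}} F"
		"!!t. F (tub t r) ~= 0" and real: "!!t. F (e t) = of_real (p t)"
		and n: "n >= 1" and ch: "alt_chain p (2*n - 1) a (a + 2*pi)"
	shows "Re (ind (%t. F (tub t r))) <= - real n"
proof -
	obtain t \<sigma> where t: "abs \<sigma> = 1" "!!i. i < 2*n - 1 ==> t i < t (Suc i)" "!!i. i <= 2*n - 1 ==> a <= t i & t i <= a + 2*pi & \<sigma> * (-1)^i * p (t i) > 0"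
		using ch unfolding alt_chain_def by blast
	have sg: "\<sigma> * \<sigma> = 1" "\<sigma> ~= 0" using t(1) by (auto simp: abs_if split: if_splits)
	have pp: "p (s + 2*pi) = p s" for s using real[of s] real[of "s + 2*pi"] per[of s] by (metis of_real_eq_iff)
	have mono: "t i < t j" if "i < j" "j < 2*n" for i j
		using that
	proof (induction j)
		case (Suc j)
		then have "j < 2*n - 1" by linarith
		then show ?case using t(2)[of j] Suc by (cases "i = j") auto
	qed simp
	\<comment> \<open>Equality would, by periodicity, give \<open>p\<close> the same value at two nodes
	  where it has opposite signs, \<open>2*n - 1\<close> being odd.\<close>
	have last: "t (2*n - 1) < t 0 + 2*pi"
	proof (rule ccontr)
		assume "\<not> ?thesis"
		then have "t (2*n - 1) = t 0 + 2*pi" using t(3)[of 0] t(3)[of "2*n - 1"] by auto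
		then have "p (t (2*n - 1)) = p (t 0)" using pp by simp
		moreover have "(-1::real)^(2*n - 1) = -1" using n by (intro neg_one_odd_power) presburger
		ultimately show False using t(3)[of 0] t(3)[of "2*n - 1"] by simp
	qed
	have tb: "t 0 <= t i & t i < t 0 + 2*pi" if "i < 2*n" for i

	proof
		show "t 0 <= t i" using mono[of 0 i] that by (cases "i = 0") auto
		show "t i < t 0 + 2*pi"
		proof (cases "i < 2*n - 1")
			case True
			then show ?thesis using mono[OF True] last n by simp
		next
			case False
			then have "i = 2*n - 1" using that by linarith
			then show ?thesis using last by simp
		qed
	qed
	\<comment> \<open>The first node shifted by a period closes the cycle and ends the last of the
	  \<open>2*n\<close> arcs.\<close>
	define \<tau> where "\<tau> i = (if i < 2*n then t i else t 0 + 2*pi)" for i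
	have tinc: "\<tau> i < \<tau> (Suc i)" if "i < 2*n" for i using that mono[of i "Suc i"] tb[of i] by (auto simp: \<tau>_def)
	define \<omega> where "\<omega> = trig (map t [0..<2*n])"
	have omp: "\<omega> (s + 2*pi) = \<omega> s" for s unfolding \<omega>_def trig_shift by simp
	have node: "\<omega> (\<tau> i) = 0" if "i <= 2*n" for i
	proof (cases "i < 2*n")
		case True
		then show ?thesis by (simp add: \<tau>_def \<omega>_def trig_node)
	next
		case False
		then show ?thesis using omp[of "t 0"] trig_node[of 0 "2*n" t] n by (simp add: \<tau>_def \<omega>_def)
	qed
	have pnode: "\<sigma> * (-1)^i * p (\<tau> i) > 0" if "i <= 2*n" for i
	proof (cases "i < 2*n")
		case True
		then show ?thesis using t(3)[of i] by (simp add: \<tau>_def)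
	next
		case False
		then have "i = 2*n" using that by simp
		then show ?thesis using t(3)[of 0] pp[of "t 0"] by (simp add: \<tau>_def)
	qed
	have arc: "(-1)^i * \<omega> s < 0" if i: "i < 2*n" and s: "\<tau> i < s" "s < \<tau> (Suc i)" for i s
	proof -
		have s2: "t i < s" "s < t 0 + 2*pi" "!!j. i < j ==> j < 2*n ==> s < t j"
		proof -
			show "t i < s" using s(1) i by (simp add: \<tau>_def)
			show 1: "s < t j" if "i < j" "j < 2*n" for j
				using s(2) mono[of "Suc i" j] that by (cases "j = Suc i") (auto simp: \<tau>_def)
			show "s < t 0 + 2*pi" using s(2) 1[of "Suc i"] tb[of "Suc i"] by (auto simp: \<tau>_def split: if_splits)
		qed
		have "(-1)^(2*n - Suc i) * \<omega> s > 0" unfolding \<omega>_def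
		proof (rule trig_arc_sign[OF _ _ i])
			fix j assume j: "j <= i"
			have "t j <= t i" using mono[of j i] j i by (cases "j = i") auto
			then show "t j < s & s < t j + 2*pi" using s2(1,2) tb[of j] j i by auto
		next
			fix j assume j: "i < j" "j < 2*n"
			then show "s < t j & t j < s + 2*pi" using s2(3)[OF j] tb[of j] tb[of i] s2(1) i by auto
		qed
		moreover have "(-1::real)^(2*n - Suc i) = - ((-1)^i)"
		proof -
			have "(-1::real)^(2*n - Suc i) * (-1)^Suc i = (-1)^(2*n)" using i by (simp flip: power_add)
			then show ?thesis by (cases "even i") (auto simp: power_minus_even)
		qed
		ultimately show ?thesis by simp
	qed
	have per': "\<sigma> * \<omega> (s + 2*pi) = \<sigma> * \<omega> s" for s using omp by simp
	have hol: "holder_continuous (%s. \<sigma> * \<omega> s)" unfolding \<omega>_def by (rule holder_trig)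
	show ?thesis
	proof (rule ind_perturb[OF r F per' hol])
		fix h \<epsilon>0 assume hp: "!!t. h (t + 2*pi) = h t" and e0: "\<epsilon>0 > 0"
			and H: "!!\<epsilon>. 0 < \<epsilon> ==> \<epsilon> < \<epsilon>0 ==> (!!t. F (e t) + of_real \<epsilon> * Complex (h t) (\<sigma> * \<omega> t) ~= 0) ==>
			nonzero_loop (%t. F (e t) + of_real \<epsilon> * Complex (h t) (\<sigma> * \<omega> t)) &
			Re (ind (%t. F (tub t r))) <= Re (ind (%t. F (e t) + of_real \<epsilon> * Complex (h t) (\<sigma> * \<omega> t)))"
		have "\<forall>\<^sub>F \<epsilon> in at_right 0. \<forall>i\<in>{..2*n}. \<sigma> * (-1)^i * (p (\<tau> i) + \<epsilon> * h (\<tau> i)) > 0"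
		proof (intro eventually_ball_finite ballI)
			fix i assume "i \<in> {..2*n}"
			then have "\<sigma> * (-1)^i * (p (\<tau> i) + 0 * h (\<tau> i)) > 0" using pnode by simp
			moreover have "((%\<epsilon>. \<sigma> * (-1)^i * (p (\<tau> i) + \<epsilon> * h (\<tau> i))) \<longlongrightarrow> \<sigma> * (-1)^i * (p (\<tau> i) + 0 * h (\<tau> i))) (at_right 0)"
				by (intro tendsto_intros)
			ultimately show "\<forall>\<^sub>F \<epsilon> in at_right 0. \<sigma> * (-1)^i * (p (\<tau> i) + \<epsilon> * h (\<tau> i)) > 0" by (simp only: order_tendstoD(1))
		qed simp
		moreover have "\<forall>\<^sub>F \<epsilon> in at_right 0. \<epsilon> \<in> {0<..<\<epsilon>0}" by (rule eventually_at_right_real[OF e0])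
		ultimately have "\<forall>\<^sub>F \<epsilon> in at_right 0. \<epsilon> \<in> {0<..<\<epsilon>0} & (\<forall>i\<in>{..2*n}. \<sigma> * (-1)^i * (p (\<tau> i) + \<epsilon> * h (\<tau> i)) > 0)" by eventually_elim auto
		then have "\<exists>\<epsilon>. \<epsilon> \<in> {0<..<\<epsilon>0} & (\<forall>i\<in>{..2*n}. \<sigma> * (-1)^i * (p (\<tau> i) + \<epsilon> * h (\<tau> i)) > 0)"
			by (rule eventually_happens'[OF trivial_limit_at_right_real])
		\<comment> \<open>\<open>\<epsilon>\<close> is so small that the real part keeps its sign at the
		  finitely many nodes.\<close>
		then obtain \<epsilon> where ep: "0 < \<epsilon>" "\<epsilon> < \<epsilon>0" "!!i. i <= 2*n ==> \<sigma> * (-1)^i * (p (\<tau> i) + \<epsilon> * h (\<tau> i)) > 0"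
			unfolding greaterThanLessThan_iff Ball_def atMost_iff by blast
		define V where "V = (%t. F (e t) + of_real \<epsilon> * Complex (h t) (\<sigma> * \<omega> t))"
		have Vr: "Re (\<sigma> * V s) = \<sigma> * (p s + \<epsilon> * h s)" and Vi: "Im (\<sigma> * V s) = \<epsilon> * \<omega> s" for s
			using sg(1) by (auto simp: V_def real algebra_simps)
		have nodes: "Im (\<sigma> * V (\<tau> i)) = 0" "(-1)^i * Re (\<sigma> * V (\<tau> i)) > 0" if "i <= 2*n" for i
			unfolding Vr Vi using node[OF that] ep(3)[OF that] by (simp_all add: mult_ac)
		have arcs: "(-1)^i * Im (\<sigma> * V s) < 0" if "i < 2*n" "\<tau> i < s" "s < \<tau> (Suc i)" for i s
		proof -
			have eq: "(-1)^i * Im (\<sigma> * V s) = \<epsilon> * ((-1)^i * \<omega> s)" unfolding Vi by (simp only: mult_ac)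
			show ?thesis unfolding eq by (rule mult_pos_neg[OF ep(1) arc[OF that]])
		qed
		have Vp: "V (s + 2*pi) = V s" for s using omp hp by (simp add: V_def per)
		have nz0: "V s ~= 0" if s: "s \<in> {t 0..<t 0 + 2*pi}" for s
		proof -
			define i where "i = Max {i. i < 2*n & \<tau> i <= s}"
			have fin: "finite {i. i < 2*n & \<tau> i <= s}" by simp
			have "0 \<in> {i. i < 2*n & \<tau> i <= s}" using s n by (auto simp: \<tau>_def)
			then have i: "i < 2*n" "\<tau> i <= s" using Max_in[OF fin] unfolding i_def by blast+
			have "s < \<tau> (Suc i)"
			proof (rule ccontr)
				assume "\<not> ?thesis"
				then have "Suc i < 2*n" "\<tau> (Suc i) <= s" using s i by (auto simp: \<tau>_def split: if_splits)
				then have "Suc i <= i" using Max_ge[OF fin, of "Suc i"] unfolding i_def by blast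
				then show False by simp
			qed
			then show ?thesis using arcs[OF i(1), of s] nodes(2)[of i] i by (cases "\<tau> i = s") auto
		qed
		have nz: "V s ~= 0" for s by (rule nonzero_loop_cong_mod[where a="t 0" and V=V, OF Vp nz0])
		have VV: "nonzero_loop V" "Re (ind (%t. F (tub t r))) <= Re (ind V)"
			using H[OF ep(1,2)] nz unfolding V_def by blast+
		have "ind (%s. \<sigma> * V s) = - of_nat n"
			by (rule ind_chain[where t=\<tau>]) (use ind_const_mult(1)[OF VV(1)] sg tinc nodes arcs n in \<open>auto simp: \<tau>_def[of 0] \<tau>_def[of "2*n"]\<close>)
		then show ?thesis using ind_const_mult(2)[OF VV(1), of \<sigma>] sg VV(2) by simp
	qed
qed

text \<open>The factor \<open>(z - z0)^n\<close> forces index at most \<open>-n\<close> on an inner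
  parallel curve. With fewer sign changes, \<open>q\<close> would weakly have the sign pattern of a
  product \<open>trig ss\<close> with at most \<open>2*n - 2\<close> factors; adding a small
  interior function with that real part leaves too few zeros of the real part for so many
  turns.\<close>

lemma interior_alternation:
	assumes h: "h holomorphic_on Ins" "continuous_on (Ins Un range e) h" and n: "n >= 1"
		and q: "!!t. Re (h (e t) * (e t - tub 0 (-rho))^n) = q t" and a0: "q a0 ~= 0"
	shows "alt_chain q (2*n - 1) a0 (a0 + 2*pi)"
proof (rule ccontr)
	assume nch: "\<not> ?thesis"
	let ?I = "Ins"
	define z0 where "z0 = tub 0 (-rho)"
	define H where "H = (%z. h z * (z - z0)^n)"
	have cl: "closure ?I = ?I Un range e" using closure_Un_frontier[of ?I] frontier_inside_e by simp
	have H1: "H holomorphic_on ?I" unfolding H_def by (intro holomorphic_intros h)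
	have H2: "continuous_on (?I Un range e) H" unfolding H_def by (intro continuous_intros h)
	have Hq: "Re (H (e t)) = q t" for t using q by (simp add: H_def z0_def)
	have qp: "q (t + 2*pi) = q t" for t using Hq[of t] Hq[of "t + 2*pi"] per[of t] by simp
	have He: "continuous_on UNIV (%t. H (e t))" by (rule continuous_on_compose2[OF H2 e_cont]) auto
	have "continuous_on UNIV (%t. Re (H (e t)))" by (intro continuous_intros He)
	then have qc: "continuous_on S q" for S unfolding Hq using continuous_on_subset by blast
	have "Suc (2*n - 2) = 2*n - 1" using n by simp
	then have "\<exists>ss \<sigma>. length ss <= 2*n - 2 & set ss <= {a0<..<a0 + 2*pi} & abs \<sigma> = 1 & (\<forall>t\<in>{a0..a0 + 2*pi}. \<sigma> * q t * (\<Prod>s\<leftarrow>ss. t - s) >= 0)"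
		using nch by (intro sign_pattern[OF qc _ a0]) auto
	then obtain ss \<sigma> where ss: "length ss <= 2*n - 2" "set ss <= {a0<..<a0 + 2*pi}" "abs \<sigma> = 1" "!!t. t \<in> {a0..a0 + 2*pi} ==> \<sigma> * q t * (\<Prod>s\<leftarrow>ss. t - s) >= 0"
		by blast
	have tq: "\<sigma> * q t * trig ss t >= 0" and t0: "trig ss t = 0 ==> t \<in> set ss" if t: "t \<in> {a0..a0 + 2*pi}" for t
	proof -
		obtain Q where Q: "Q > 0" "trig ss t = Q * (\<Prod>s\<leftarrow>ss. t - s)" using trig_sign_list[OF ss(2) t] by blast
		have eq: "\<sigma> * q t * trig ss t = Q * (\<sigma> * q t * (\<Prod>s\<leftarrow>ss. t - s))" unfolding Q(2) by (simp only: mult_ac)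
		show "\<sigma> * q t * trig ss t >= 0" unfolding eq by (rule mult_nonneg_nonneg[OF less_imp_le[OF Q(1)] ss(4)[OF t]])
		show "t \<in> set ss" if "trig ss t = 0" using that Q by (auto simp: prod_list_zero_iff)
	qed
	\<comment> \<open>An odd number of factors would make \<open>trig ss\<close> antiperiodic while
	  \<open>q\<close> is periodic. This contradicts the common weak sign at the two ends of the
	  period, where neither factor vanishes.\<close>
	have even: "even (length ss)"
	proof (rule ccontr)
		assume o: "odd (length ss)"
		then have sh: "trig ss (a0 + 2*pi) = - trig ss a0" unfolding trig_shift by simp
		have "trig ss a0 ~= 0" using t0[of a0] ss(2) by auto
		then have "\<sigma> * q a0 * trig ss a0 ~= 0" using a0 ss(3) by auto
		moreover have "\<sigma> * q a0 * trig ss a0 >= 0" "\<sigma> * q (a0 + 2*pi) * trig ss (a0 + 2*pi) >= 0" by (rule tq; simp)+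
		ultimately show False unfolding sh qp by simp
	qed
	have tp: "\<sigma> * trig ss (t + 2*pi) = \<sigma> * trig ss t" for t unfolding trig_shift using even by simp
	show False
	proof (rule dirichlet_interior[OF tp holder_trig])
		fix l assume l: "l holomorphic_on ?I" "continuous_on (?I Un range e) l" "!!t. Re (l (e t)) = \<sigma> * trig ss t"
		obtain w where w: "w \<in> ?I" "H w ~= 0"
		proof (rule ccontr)
			assume "\<not> thesis"
			then have "!!z. z \<in> ?I ==> H z = 0" using that by blast
			then have "H (e a0) = 0" by (rule continuous_constant_on_closure[of ?I H 0 "e a0", rotated]) (use H2 cl in auto)
			then show False using Hq[of a0] a0 by simp
		qed
		define Z where "Z = {z\<in>?I. H z = 0}"
		have "countable Z" unfolding Z_def by (rule holomorphic_zeros_countable[OF H1 open_inside_e connected_inside_e w])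
		then have "countable {r. abs r <= rho & (\<exists>t. tub t r \<in> Z)}" by (rule countable_tub_radii)
		moreover have "uncountable {-rho<..<0}" using rho_pos by (simp add: uncountable_open_interval)
		ultimately have "\<not> {-rho<..<0} <= {r. abs r <= rho & (\<exists>t. tub t r \<in> Z)}"
			by (meson countable_subset)
		\<comment> \<open>The zeros of \<open>H\<close> are countable, so some inner parallel curve avoids
		  them; \<open>u > -rho\<close> keeps \<open>z0\<close> inside that curve.\<close>
		then obtain u where u: "u \<in> {-rho<..<0}" "u ~: {r. abs r <= rho & (\<exists>t. tub t r \<in> Z)}" by blast
		have uI: "tub t x \<in> ?I" if "x \<in> {u..<0}" for t x using tub_sides(2)[of "-x" t] u(1) that by auto
		have Hnz: "H (tub t u) ~= 0" for t using u uI[of u t] by (auto simp: Z_def)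
		have hnz: "h (tub t u) ~= 0" for t using Hnz[of t] by (auto simp: H_def)
		have cu: "continuous_on UNIV (%t. k (tub t u))" if "continuous_on (?I Un range e) k" for k :: "complex => complex"
			by (rule continuous_on_compose2[OF that]) (use uI[of u] u in \<open>auto intro!: tub_cont continuous_intros\<close>)
		have nH: "nonzero_loop (%t. H (tub t u))" and nh: "nonzero_loop (%t. h (tub t u))"
			unfolding nonzero_loop_def using cu[OF H2] cu[OF h(2)] Hnz hnz by (simp_all add: tub_per)
		have nz0: "nonzero_loop (%t. tub t u - z0)"
			unfolding nonzero_loop_def z0_def using tub_eqD[of _ u 0 "-rho"] u(1) rho_pos
			by (fastforce intro!: continuous_intros tub_cont simp: tub_per)
		have i0: "ind (%t. tub t u - z0) = -1" unfolding ind_winding z0_def using winding_tub[of u "-rho" 0] u(1) rho_pos by simp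
		have "ind (%t. H (tub t u)) = ind (%t. h (tub t u)) + ind (%t. (tub t u - z0) powi int n)"
			unfolding H_def power_int_of_nat[symmetric] by (rule ind_mult[OF nh nonzero_loop_powi[OF nz0]])
		also have "ind (%t. (tub t u - z0) powi int n) = - of_nat n" unfolding ind_powi[OF nz0] i0 by simp
		finally have iH: "Re (ind (%t. H (tub t u))) <= - real n" using ind_interior[of "-u" h] h(1) hnz u(1) by simp
		obtain B where B: "B > 0" "!!t. norm (l (tub t u)) <= B" using periodic_bounded[of "%t. l (tub t u)"] cu[OF l(2)] tub_per by metis
		obtain b where b: "b > 0" "!!t. norm (H (tub t u)) >= b"
			using periodic_bounded_below[of "%t. H (tub t u)"] cu[OF H2] Hnz tub_per by metis
		define \<epsilon> where "\<epsilon> = b/(2*B)"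
		have ep: "\<epsilon> > 0" "\<epsilon> * B = b/2" using b B by (auto simp: \<epsilon>_def)
		have "finite ((%s. - Im (H (e s) + \<epsilon> * l (e s))) ` set ss)" by simp
		moreover have "infinite {0<..<b/2}" using b by (simp add: infinite_Ioo)
		ultimately have "\<not> {0<..<b/2} <= (%s. - Im (H (e s) + \<epsilon> * l (e s))) ` set ss" by (meson finite_subset)
		\<comment> \<open>At the points of \<open>ss\<close> the real part of \<open>W\<close> may vanish;
		  there the imaginary shift \<open>\<delta>\<close> keeps \<open>W\<close> away from 0. Both
		  perturbations together stay below \<open>b\<close>, the lower bound of \<open>H\<close> on the
		  inner curve.\<close>
		then obtain \<delta> where de: "\<delta> \<in> {0<..<b/2}" "\<delta> ~: (%s. - Im (H (e s) + \<epsilon> * l (e s))) ` set ss" by blast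
		define W where "W = (%z. H z + \<epsilon> * l z + \<i> * \<delta>)"
		have W1: "W holomorphic_on ?I" unfolding W_def by (intro holomorphic_intros H1 l)
		have W2: "continuous_on (?I Un range e) W" unfolding W_def by (intro continuous_intros H2 l)
		have cl': "norm (W (tub t u) - H (tub t u)) < norm (H (tub t u))" for t
		proof -
			have "norm (W (tub t u) - H (tub t u)) <= norm (\<epsilon> * l (tub t u)) + norm (\<i> * \<delta>)"
				unfolding W_def by (rule order_trans[OF _ norm_triangle_ineq]) simp
			also have "\<dots> = \<epsilon> * norm (l (tub t u)) + \<delta>" using ep de by (simp add: norm_mult)
			also have "\<dots> <= \<epsilon> * B + \<delta>" using ep B by (intro add_mono mult_left_mono) auto
			also have "\<dots> < b" using ep de by simp
			finally show ?thesis using b(2)[of t] by simp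
		qed
		have nWu: "nonzero_loop (%t. W (tub t u))" "ind (%t. W (tub t u)) = ind (%t. H (tub t u))"
			using ind_close[OF nH cu[OF W2] _ cl'] tub_per by auto
		have ReW: "Re (W (e t)) = q t + \<epsilon> * (\<sigma> * trig ss t)" for t using Hq l(3) by (simp add: W_def)
		have ReW0: "Re (W (e t)) ~= 0" if t: "t \<in> {a0..a0 + 2*pi}" "t ~: set ss" for t
		proof -
			have "trig ss t ~= 0" using t0 t by blast
			then have "\<epsilon> * (\<sigma> * trig ss t)^2 > 0" using ep ss(3) by auto
			moreover have "(\<sigma> * trig ss t) * Re (W (e t)) = \<sigma> * q t * trig ss t + \<epsilon> * (\<sigma> * trig ss t)^2"
				unfolding ReW by (simp add: algebra_simps power2_eq_square)
			ultimately have "(\<sigma> * trig ss t) * Re (W (e t)) > 0" using tq[OF t(1)] by linarith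
			then show ?thesis by auto
		qed
		have Wnz: "W (e t) ~= 0" for t
		proof (rule nonzero_loop_cong_mod[where a=a0 and V="%t. W (e t)"])
			fix s assume s: "s \<in> {a0..<a0 + 2*pi}"
			show "W (e s) ~= 0"
			proof (cases "s \<in> set ss")
				case True
				then have "\<delta> ~= - Im (H (e s) + \<epsilon> * l (e s))" using de(2) by blast
				then have "Im (W (e s)) ~= 0" by (simp add: W_def)
				then show ?thesis by auto
			next
				case False
				then show ?thesis using ReW0[of s] s by auto
			qed
		qed (simp add: per)
		have "continuous_on UNIV (%t. W (e t))" by (rule continuous_on_compose2[OF W2 e_cont]) auto
		then have nW: "nonzero_loop (%t. W (e t))" unfolding nonzero_loop_def using Wnz by (simp add: per)
		have "Re (ind (%t. W (tub t 0))) <= Re (ind (%t. W (tub t u)))"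
		proof (rule ind_collar)
			show "W holomorphic_on {tub s x | s x. x \<in> {u<..<0}}" by (rule holomorphic_on_subset[OF W1]) (use uI in auto)
			have "tub s x \<in> ?I Un range e" if "x \<in> {u..0}" for s x using uI[of x s] that by (cases "x = 0") (auto simp: tub_0)
			then show "continuous_on {tub s x | s x. x \<in> {u..0}} W" by (intro continuous_on_subset[OF W2]) auto
		qed (use u(1) rho_pos Wnz nWu(1) in \<open>auto simp: tub_0 nonzero_loop_def\<close>)
		then have "Re (ind (%t. W (e t))) <= - real n" using nWu(2) iH by (simp add: tub_0)
		moreover have "2 * abs (Re (ind (%t. W (e t)))) <= card (set ss) + 1"
			by (rule ind_bound[OF nW, where x=a0]) (use ReW0 in auto)
		\<comment> \<open>Twice the absolute index would be at least \<open>2*n\<close> and at most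
		  \<open>2*n - 1\<close>.\<close>
		moreover have "real (card (set ss)) + 1 <= 2 * real n - 1" using card_length[of ss] ss(1) n by linarith
		ultimately show False by linarith
	qed
qed

text \<open>Multiplication by \<open>(z - z0) powi \<kappa> * exp (\<i> * l z)\<close> with
  \<open>Re l = \<Lambda>\<close> on the curve replaces the phase of \<open>A\<close> and makes the
  boundary values real. It lowers the index by \<open>\<kappa>\<close>, so the claim becomes index
  at most \<open>- \<kappa>\<close> for the product \<open>F\<close>.\<close>

lemma component_index:
	assumes a: "nonzero_loop a" "!!s t. norm (a s - a t) <= K * abs (s - t)"
		and r: "0 < r" "r < rho" and f: "f holomorphic_on {tub s x | s x. x \<in> {0<..<r}}" "continuous_on {tub s x | s x. x \<in> {0..r}} f"
		"!!t. f (tub t r) ~= 0"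
		and g: "g holomorphic_on Ins" "continuous_on (Ins Un range e) g"
		and bc: "!!t. a t * f (e t) = of_real (Re (a t * g (e t)))" and ne: "f (e a0) ~= 0"
	shows "Re (ind (%t. f (tub t r))) <= 0"
proof -
	define z0 where "z0 = tub 0 (-rho)"
	have z0: "z0 \<in> Ins" using tub_sides(2)[of rho 0] rho_pos by (simp add: z0_def)
	define c where "c = (%t. e t - z0)"
	have ez: "e t ~= z0" for t using z0 inside_no_overlap[of "range e"] by blast
	have c1: "nonzero_loop c" unfolding nonzero_loop_def c_def using ez by (auto intro!: continuous_intros e_cont simp: per)
	obtain Kd where Kd: "!!t. norm (d t) <= Kd" using periodic_bounded[of d] d_per d_cont by metis
	have c2: "norm (c s - c t) <= Kd * abs (s - t)" for s t unfolding c_def using vector_derivative_bound[OF der Kd, of s t] by simp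
	have c3: "ind c = -1" unfolding c_def ind_winding by (rule cw[OF z0])
	have anz: "a t ~= 0" for t using a(1) by (simp add: nonzero_loop_def)
	define p where "p = (%t. Re (a t * g (e t)))"
	have fp: "f (e t) = of_real (p t) / a t" for t using bc[of t] anz[of t] by (simp add: p_def field_simps)
	have pa: "p a0 ~= 0" using fp[of a0] ne by auto
	let ?C = "{tub s x | s x. x \<in> {0..r}}" and ?O = "{tub s x | s x. x \<in> {0<..<r}}"
	have Osub: "?O <= Out" using tub_sides(1) r by auto
	have tC: "tub s x \<in> Out Un range e" if "x \<in> {0..r}" for s x
		using tub_sides(1)[of x s] that r by (cases "x = 0") (auto simp: tub_0)
	then have Csub: "?C <= Out Un range e" by auto
	have tz: "tub s x ~= z0" if "x \<in> {0..r}" for s x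
		using tC[OF that, of s] z0 in_out_disj inside_no_overlap[of "range e"] by blast
	have "r \<in> {0..r}" using r by simp
	then have tr: "tub t r \<in> ?C" for t by blast
	have cr: "continuous_on UNIV (%t. k (tub t r))" if "continuous_on ?C k" for k :: "complex => complex"
		by (rule continuous_on_compose2[OF that]) (use tr in \<open>auto intro!: tub_cont continuous_intros\<close>)
	show ?thesis
	proof (rule periodic_phase[OF a c1 c2 c3])
		fix \<kappa> :: int and \<Lambda> \<rho> :: "real => real"
		assume L: "!!t. \<Lambda> (t + 2*pi) = \<Lambda> t" "holder_continuous \<Lambda>" and rho': "!!t. \<rho> t > 0"
			and ph0: "!!t. c t powi \<kappa> / a t = of_real (\<rho> t) * exp (- \<i> * of_real (\<Lambda> t))"
		have ph: "c t powi \<kappa> / a t * exp (\<i> * x) = of_real (\<rho> t * exp (- Im x))" if "Re x = \<Lambda> t" for t x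
		proof -
			have "\<i> * x = of_real (- Im x) + \<i> * of_real (\<Lambda> t)" using that by (simp add: complex_eq_iff)
			then have "exp (\<i> * x) = of_real (exp (- Im x)) * exp (\<i> * of_real (\<Lambda> t))" by (simp only: exp_add exp_of_real)
			moreover have "exp (- \<i> * of_real (\<Lambda> t)) * exp (\<i> * of_real (\<Lambda> t)) = 1" by (simp flip: exp_add)
			ultimately show ?thesis unfolding ph0 by (simp add: mult_ac)
		qed
		show ?thesis
		proof (rule dirichlet_exterior[OF L])
			fix l assume l: "l holomorphic_on Out" "continuous_on (Out Un range e) l" "!!t. Re (l (e t)) = \<Lambda> t"
			define F where "F = (%z. f z * (z - z0) powi \<kappa> * exp (\<i> * l z))"
			have F1: "F holomorphic_on ?O" unfolding F_def
				by (intro holomorphic_intros f(1) holomorphic_on_subset[OF l(1) Osub]) (use tz in force)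
			have lC: "continuous_on ?C l" by (rule continuous_on_subset[OF l(2) Csub])
			have F2: "continuous_on ?C F" unfolding F_def
				by (intro continuous_intros f(2) lC) (use tz in force)
			have tz': "tub t r - z0 ~= 0" for t using tz[of r t] r by simp
			have F3: "F (tub t r) ~= 0" for t unfolding F_def using f(3)[of t] tz'[of t] by simp
			define q where "q = (%t. p t * (\<rho> t * exp (- Im (l (e t)))))"
			have Fq: "F (e t) = of_real (q t)" for t
			proof -
				have "F (e t) = of_real (p t) * (c t powi \<kappa> / a t * exp (\<i> * l (e t)))" by (simp add: F_def fp c_def)
				then show ?thesis unfolding ph[OF l(3)] q_def by simp
			qed
			have nf: "nonzero_loop (%t. f (tub t r))" unfolding nonzero_loop_def using cr[OF f(2)] f(3) by (simp add: tub_per)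
			have n0: "nonzero_loop (%t. tub t r - z0)" unfolding nonzero_loop_def using tz' by (auto intro!: continuous_intros tub_cont simp: tub_per)
			have i0: "ind (%t. tub t r - z0) = -1" unfolding ind_winding z0_def using winding_tub[of r "-rho" 0] r rho_pos by simp
			have el: "continuous_on UNIV (%t. \<i> * l (tub t r))" "!!t. \<i> * l (tub (t + 2*pi) r) = \<i> * l (tub t r)"
				by (intro continuous_intros cr[OF lC]) (simp add: tub_per)
			have "ind (%t. F (tub t r)) = ind (%t. f (tub t r) * (tub t r - z0) powi \<kappa>) + ind (%t. exp (\<i> * l (tub t r)))"
				unfolding F_def by (rule ind_mult[OF nonzero_loop_mult[OF nf nonzero_loop_powi[OF n0]] nonzero_loop_exp[OF el]])
			also have "\<dots> = ind (%t. f (tub t r)) - of_int \<kappa>"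
				unfolding ind_mult[OF nf nonzero_loop_powi[OF n0]] ind_powi[OF n0] i0 ind_exp[OF el] by simp
			finally have iF: "Re (ind (%t. F (tub t r))) = Re (ind (%t. f (tub t r))) - of_int \<kappa>" by simp
			\<comment> \<open>For \<open>\<kappa> <= 0\<close> the bound by 0 for real boundary values is
			  enough; for \<open>\<kappa> > 0\<close> the sign changes have to be supplied by
			  \<open>g\<close>.\<close>
			have "Re (ind (%t. F (tub t r))) <= - of_int \<kappa>"
			proof (cases "\<kappa> <= 0")
				case True
				then show ?thesis using ind_real_boundary[OF r F1 F2 F3 Fq] by linarith
			next
				case False
				define n where "n = nat \<kappa>"
				have n: "n >= 1" "\<kappa> = int n" using False by (auto simp: n_def)
				have ch: "alt_chain p (2*n - 1) a0 (a0 + 2*pi)"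
				proof (rule dirichlet_interior[OF L])
					fix l2 assume l2: "l2 holomorphic_on Ins" "continuous_on (Ins Un range e) l2" "!!t. Re (l2 (e t)) = \<Lambda> t"
					\<comment> \<open>\<open>q\<close> uses the exterior and \<open>q2\<close> the interior
					  solution of the same Dirichlet problem. Both are \<open>p\<close> times positive factors, so
					  the three functions have the same alternation chains.\<close>
					define q2 where "q2 = (%t. p t * (\<rho> t * exp (- Im (l2 (e t)))))"
					have "alt_chain q2 (2*n - 1) a0 (a0 + 2*pi)"
					proof (rule interior_alternation[where h="%z. g z * exp (\<i> * l2 z)"])
						show "(%z. g z * exp (\<i> * l2 z)) holomorphic_on Ins" by (intro holomorphic_intros g l2)
						show "continuous_on (Ins Un range e) (%z. g z * exp (\<i> * l2 z))" by (intro continuous_intros g l2)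
						show "q2 a0 ~= 0" unfolding q2_def using pa rho'[of a0] by simp
						fix t
						have "g (e t) * exp (\<i> * l2 (e t)) * (e t - tub 0 (-rho))^n = (a t * g (e t)) * (c t powi \<kappa> / a t * exp (\<i> * l2 (e t)))"
							using anz[of t] unfolding n(2) power_int_of_nat c_def z0_def by simp
						also have "\<dots> = (a t * g (e t)) * of_real (\<rho> t * exp (- Im (l2 (e t))))" unfolding ph[OF l2(3)] ..
						finally have eq: "g (e t) * exp (\<i> * l2 (e t)) * (e t - tub 0 (-rho))^n = (a t * g (e t)) * of_real (\<rho> t * exp (- Im (l2 (e t))))" .
						have "Re (x * of_real y) = Re x * y" for x y by simp
						then show "Re (g (e t) * exp (\<i> * l2 (e t)) * (e t - tub 0 (-rho))^n) = q2 t" unfolding eq q2_def p_def by blast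
					qed (rule n(1))
					moreover have "\<sigma> * (-1)^i * q2 s > 0 \<longleftrightarrow> \<sigma> * (-1)^i * p s > 0" for \<sigma> i s
						unfolding q2_def mult.assoc[symmetric] using rho'[of s] by (simp add: zero_less_mult_iff)
					ultimately show ?thesis unfolding alt_chain_def by simp
				qed
				moreover have "\<sigma> * (-1)^i * q s > 0 \<longleftrightarrow> \<sigma> * (-1)^i * p s > 0" for \<sigma> i s
					unfolding q_def mult.assoc[symmetric] using rho'[of s] by (simp add: zero_less_mult_iff)
				ultimately have "alt_chain q (2*n - 1) a0 (a0 + 2*pi)" unfolding alt_chain_def by simp
				then show ?thesis using ind_real_boundary_chain[OF r F1 F2 F3 Fq n(1)] n(2) by simp
			qed
			then show ?thesis using iF by simp
		qed
	qed
qed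

end

section \<open>The index of an exterior function\<close>

text \<open>\<open>f (1/w)\<close> has a removable singularity at 0 with a zero of some order
  \<open>n > 0\<close>, and it is not identically 0 by analytic continuation. So on large circles
  \<open>f z\<close> is \<open>(1/z)^n\<close> times a function with a continuous logarithm, and the
  index is \<open>-n\<close>.\<close>

lemma ind_circle_at_infinity:
	assumes f: "f holomorphic_on G" "(f \<longlongrightarrow> 0) at_infinity" and G: "open G" "bounded (- G)" "connected G" and w: "w \<in> G" "f w ~= 0"
	obtains R where "R > 0" "!!z. norm z >= R ==> f z ~= 0 & z \<in> G"
		"!!\<rho>. \<rho> >= R ==> Re (ind (%t. f (of_real \<rho> * exp (\<i> * of_real t)))) <= -1"
proof -
	obtain B where B: "B > 0" "!!z. z ~: G ==> norm z <= B" using G(2) unfolding bounded_pos by blast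
	define F where "F = (%w. if w = 0 then 0 else f (1/w))"
	define D where "D = ball (0::complex) (1/(B+1))"
	have inG: "1/w \<in> G" if "w \<in> D" "w ~= 0" for w
	proof -
		have "norm (1/w) > B + 1" using that B(1) by (simp add: D_def norm_divide field_simps)
		then show ?thesis using B(2)[of "1/w"] by linarith
	qed
	have hol: "F holomorphic_on (D - {0})"
	proof -
		have "(%w. f (1/w)) holomorphic_on (D - {0})"
			by (rule holomorphic_on_compose_gen[OF _ f(1), of "%w. 1/w", unfolded o_def]) (use inG in \<open>auto intro!: holomorphic_intros\<close>)
		then show ?thesis by (rule holomorphic_transform) (auto simp: F_def)
	qed
	have cont: "continuous_on D F"
		unfolding continuous_on_eq_continuous_within
	proof
		fix x assume x: "x \<in> D"
		show "continuous (at x within D) F"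
		proof (cases "x = 0")
			case True
			have "((%w. f (1/w)) \<longlongrightarrow> 0) (at 0)"
				using f(2) unfolding lim_at_infinity_0 o_def by (simp add: inverse_eq_divide)
			then have "(F \<longlongrightarrow> 0) (at 0)" by (rule Lim_transform_eventually) (auto simp: F_def eventually_at_filter)
			then have "(F \<longlongrightarrow> F 0) (at 0)" by (simp add: F_def)
			then show ?thesis using True by (simp add: continuous_at_imp_continuous_at_within isCont_def)
		next
			case False
			have "open (D - {0})" by (simp add: D_def open_delete)
			then have "isCont F x" using holomorphic_on_imp_continuous_on[OF hol] False x by (simp add: continuous_on_eq_continuous_at)
			then show ?thesis by (rule continuous_at_imp_continuous_at_within)
		qed
	qed
	have FD: "F holomorphic_on D" by (rule no_isolated_singularity[OF cont hol]) (auto simp: D_def)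
	have D0: "0 \<in> D" using B(1) by (simp add: D_def)
	have nc: "\<not> F constant_on D"
	proof
		assume "F constant_on D"
		then have F0: "F z = 0" if "z \<in> D" for z using that D0 unfolding constant_on_def by (metis F_def)
		have fz: "f z = 0" if "norm z > B + 1" for z
		proof -
			have nz: "norm z > 0" using that B(1) by linarith
			have "norm (1/z) < 1/(B+1)" using that B(1) nz by (simp add: norm_divide frac_less2)
			then have "z ~= 0" "1/z \<in> D" using nz by (auto simp: D_def)
			then show ?thesis using F0[of "1/z"] by (simp add: F_def)
		qed
		let ?U = "- cball (0::complex) (B+1)"
		have "of_real (B + 2) \<in> ?U" using B(1) by simp
		then have ne: "?U ~= {}" by blast
		have "f w = 0"
		proof (rule analytic_continuation_open[of ?U G f "%_. 0" w])
			show "?U <= G" using B(2) by force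
		qed (use ne G f w fz in \<open>auto intro!: holomorphic_intros\<close>)
		then show False using w by simp
	qed
	have "open D" "connected D" "F 0 = 0" by (auto simp: D_def F_def)
	then obtain g r n where g: "0 < n" "0 < r" "ball 0 r <= D" "g holomorphic_on ball 0 r"
		"!!w. w \<in> ball 0 r ==> F w = (w - 0)^n * g w" "!!w. w \<in> ball 0 r ==> g w ~= 0"
		using holomorphic_factor_zero_nonconstant[OF FD _ _ D0 _ nc] by (metis (no_types, lifting))
	obtain l where l: "continuous_on (ball 0 r) l" "!!z. z \<in> ball 0 r ==> g z = exp (l z)"
		using continuous_logarithm_on_ball[OF holomorphic_on_imp_continuous_on[OF g(4)]] g(6) by metis
	have inv: "f z = (1/z)^n * g (1/z) & 1/z \<in> ball 0 r & z ~= 0" if "norm z >= 2/r" for z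
	proof -
		have "norm z > 0" using that g(2) by (smt (verit) divide_pos_pos)
		then have "z ~= 0" by auto
		moreover have "1/norm z < r" using that g(2) \<open>norm z > 0\<close> by (simp add: field_simps)
		then have "1/z \<in> ball 0 r" by (simp add: norm_divide)
		ultimately show ?thesis using g(5)[of "1/z"] by (simp add: F_def)
	qed
	show ?thesis
	proof (rule that[of "2/r + B + 1"])
		show "2/r + B + 1 > 0" using g(2) B(1) by (simp add: add_pos_pos)
		show "f z ~= 0 & z \<in> G" if "norm z >= 2/r + B + 1" for z
		proof -
			have "norm z >= 2/r" "norm z > B" using that B(1) g(2) divide_pos_pos[of 2 r] by linarith+
			then show ?thesis using inv[of z] g(6)[of "1/z"] B(2)[of z] by force
		qed
		fix \<rho> assume rho: "\<rho> >= 2/r + B + 1"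
		let ?c = "%t. of_real \<rho> * exp (\<i> * of_real t)"
		have rp: "\<rho> > 0" "\<rho> >= 2/r" using rho B(1) g(2) divide_pos_pos[of 2 r] by linarith+
		have nc: "norm (?c t) = \<rho>" for t using rp by (simp add: norm_mult)
		have per: "?c (t + 2*pi) = ?c t" for t by (simp add: distrib_left exp_add exp_two_pi_i' mult.commute)
		have cb: "1 / ?c t \<in> ball 0 r" for t using inv[of "?c t"] nc rp by simp
		have lp: "continuous_on UNIV (%t. l (1 / ?c t))"
			by (rule continuous_on_compose2[OF l(1)]) (use cb rp in \<open>auto intro!: continuous_intros\<close>)
		define L where "L = (%t. of_nat n * (- \<i> * of_real t - of_real (ln \<rho>)) + l (1 / ?c t))"
		have Lc: "continuous_on UNIV L" unfolding L_def by (intro continuous_intros lp)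
		have fL: "f (?c t) = exp (L t)" for t
		proof -
			have "1 / ?c t = exp (- \<i> * of_real t - of_real (ln \<rho>))" using rp by (simp add: exp_diff exp_minus exp_of_real field_simps)
			then have "(1 / ?c t)^n = exp (of_nat n * (- \<i> * of_real t - of_real (ln \<rho>)))" by (simp add: exp_of_nat_mult)
			then show ?thesis using inv[of "?c t"] nc rp l(2)[OF cb] by (simp add: L_def exp_add)
		qed
		have "?c (2*pi) = ?c 0" using per[of 0] by simp
		then have L2: "L (2*pi) = L 0 - 2 * of_real pi * \<i> * of_nat n" unfolding L_def by (simp add: algebra_simps)
		have "ind (%t. f (?c t)) = - of_nat n" by (rule ind_eqI[OF Lc fL]) (simp add: L2)
		then show "Re (ind (%t. f (?c t))) <= -1" using g(1) by simp
	qed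
qed

context region
begin

text \<open>The Cauchy integral over the remaining curves is holomorphic across curve
  \<open>j\<close>. It agrees with \<open>f\<close> on \<open>G\<close> and is 0 inside curve
  \<open>j\<close>, so the identity theorem applies.\<close>

lemma ext_zero_on_component:
	assumes f: "analytic_ext G (Gam m \<eta>) f" and j: "j < m" and z: "!!t. f (\<eta> j t) = 0"
	shows "z \<in> G ==> f z = 0"
proof -
	interpret J: cw_loop "\<eta> j" "d\<eta> j" "dd\<eta> j" by (rule loops[OF j])
	define h where "h = (%z. (\<Sum>k\<in>{..<m}-{j}. cI k (%t. f (\<eta> k t)) z) / (2*pi*\<i>))"
	define W where "W = - (\<Union>k\<in>{..<m}-{j}. range (\<eta> k))"
	have fc: "continuous_on (G Un Gam m \<eta>) f" using f by (simp add: analytic_ext_def)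
	have fk: "continuous_on S (%t. f (\<eta> k t))" if "k < m" for k S
		by (rule continuous_on_compose2[OF fc smooth_loop.e_cont'[OF sloops[OF that]]]) (use eta_in_Gam[OF that] in auto)
	have hW: "h holomorphic_on W" unfolding h_def
	proof (intro holomorphic_intros)
		fix k assume k: "k \<in> {..<m}-{j}"
		then have km: "k < m" by simp
		show "cI k (%t. f (\<eta> k t)) holomorphic_on W"
			by (rule holomorphic_on_subset[OF cw_loop.cint_holomorphic[OF loops[OF km] fk[OF km]]]) (use k in \<open>auto simp: W_def\<close>)
	qed auto
	have Wo: "open W" unfolding W_def
		by (intro open_Compl closed_UN) (auto intro!: compact_imp_closed cw_loop.compact_range loops)
	have hC: "h z = CI (%k t. f (\<eta> k t)) z" for z
	proof -
		have "cI j (%t. f (\<eta> j t)) z = 0" using j z by (simp add: cI_def)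
		then show ?thesis unfolding h_def CI_sum using j by (simp add: sum.remove[of "{..<m}" j])
	qed
	have hG: "h z = f z" if "z \<in> G" for z using CI_ext[OF f, of z] that G_Gam_disj by (auto simp: hC)
	have hI: "h z = 0" if "z \<in> ins j" for z
	proof -
		have "z ~: G" "z ~: Gam m \<eta>" using ins_Gm[OF j] that by auto
		then show ?thesis using CI_ext[OF f, of z] by (simp add: hC)
	qed
	define U where "U = (G Un range (\<eta> j)) Un (ins j Un range (\<eta> j))"
	have conG: "connected (G Un range (\<eta> j))"
	proof (rule connected_intermediate_closure[OF G_connected])
		have "range (\<eta> j) <= frontier G" using G_frontier j by (auto simp: Gam_def)
		then show "G Un range (\<eta> j) <= closure G" using closure_subset by (auto simp: frontier_def)
	qed auto
	have "closure (ins j) = ins j Un range (\<eta> j)" using closure_Un_frontier[of "ins j"] J.frontier_inside_e by simp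
	then have conI: "connected (ins j Un range (\<eta> j))" using connected_imp_connected_closure[OF J.connected_inside_e] by simp
	have Uc: "connected U" unfolding U_def by (rule connected_Un[OF conG conI]) auto
	have UW: "U <= W"
	proof
		fix x assume x: "x \<in> U"
		show "x \<in> W"
		proof (rule ccontr)
			assume "x ~: W"
			then obtain k where k: "k < m" "k ~= j" "x \<in> range (\<eta> k)" by (auto simp: W_def)
			then have xg: "x \<in> Gam m \<eta>" by (auto simp: Gam_def)
			then have "x ~: G" "x ~: ins j" using G_Gam_disj ins_Gm[OF j] by auto
			then show False using x k eta_disj[OF k(1) j k(2)] by (auto simp: U_def)
		qed
	qed
	obtain x0 where x0: "x0 \<in> ins j" using J.inside_ne by blast
	\<comment> \<open>\<open>W\<close> may be disconnected, so the continuation takes place in the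
	  component that contains the inside of curve \<open>j\<close> together with
	  \<open>G\<close>.\<close>
	define C where "C = connected_component_set W x0"
	have UC: "U <= C" unfolding C_def by (rule connected_component_maximal[OF _ Uc UW]) (use x0 in \<open>simp add: U_def\<close>)
	show "z \<in> G ==> f z = 0"
	proof -
		assume zG: "z \<in> G"
		have "h z = 0"
		proof (rule analytic_continuation_open[of "ins j" C h "%_. 0" z])
			show "open (ins j)" by (rule J.open_inside_e)
			show "open C" unfolding C_def by (rule open_connected_component[OF Wo])
			show "ins j ~= {}" by (rule J.inside_ne)
			show "connected C" unfolding C_def by (rule connected_connected_component)
			show "ins j <= C" using UC by (auto simp: U_def)
			show "h holomorphic_on C" by (rule holomorphic_on_subset[OF hW]) (auto simp: C_def connected_component_subset connected_component_in)
			show "z \<in> C" using UC zG by (auto simp: U_def)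
		qed (use hI in auto)
		then show "f z = 0" using hG[OF zG] by simp
	qed
qed

text \<open>The argument principle between the parallel curves and a large circle. Zeros of
  \<open>f\<close> may accumulate at the boundary, so only those in the compact set \<open>K\<close>
  are divided out. For the quotient \<open>E\<close> the indices cancel, and on the circle
  \<open>E\<close> has index at most -1, the divided zeros only lowering it further.\<close>

lemma ext_index_sum:
	assumes f: "analytic_ext G (Gam m \<eta>) f" and w: "w \<in> G" "f w ~= 0" and r: "0 < r" "r < RR"
		and nz: "!!k t. k < m ==> f (T k t r) ~= 0"
	shows "(\<Sum>k<m. Re (ind (%t. f (T k t r)))) >= 1"
proof -
	have fh: "f holomorphic_on G" "(f \<longlongrightarrow> 0) at_infinity" using f by (auto simp: analytic_ext_def)
	show ?thesis
	proof (rule ind_circle_at_infinity[OF fh G_open G_bounded G_connected w])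
		fix R0 assume R0: "R0 > 0" "!!z. norm z >= R0 ==> f z ~= 0 & z \<in> G"
			"!!\<rho>. \<rho> >= R0 ==> Re (ind (%t. f (of_real \<rho> * exp (\<i> * of_real t)))) <= -1"
		\<comment> \<open>An open neighbourhood of the boundary reaching up to the parallel curves;
		  removing it leaves the compact subset \<open>K\<close> of \<open>G\<close>.\<close>
		define Tb where "Tb = (\<Union>k<m. {T k s x | s x. x \<in> {-RR<..<r}})"
		have Tbo: "open Tb" unfolding Tb_def
			using cw_loop.open_tube[OF loops] RR_rho r by (intro open_UN ballI) (fastforce simp: less_imp_le)
		define \<rho> where "\<rho> = R0"
		let ?c = "%t. of_real \<rho> * exp (\<i> * of_real t) :: complex"
		have rp: "\<rho> > 0" using R0 by (simp add: \<rho>_def)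
		have big: "f z ~= 0" "z \<in> G" if "norm z >= \<rho>" for z using R0(2) that by (auto simp: \<rho>_def)
		define K where "K = (cball 0 \<rho> \<inter> (G Un Gam m \<eta>)) - Tb"
		have Kc: "compact K" unfolding K_def using G_Gam_closed Tbo by (intro compact_diff compact_Int_closed compact_cball)
		have GamTb: "Gam m \<eta> <= Tb"
		proof
			fix z assume "z \<in> Gam m \<eta>"
			then obtain k t where "k < m" "z = T k t 0" by (auto simp: Gam_def)
			moreover have "(0::real) \<in> {-RR<..<r}" using r by auto
			ultimately show "z \<in> Tb" unfolding Tb_def by blast
		qed
		have KG: "K <= G" using GamTb by (auto simp: K_def)
		have fin: "finite {z\<in>K. f z = 0}"
		proof (cases "{z\<in>K. f z = 0} = {}")
			case False
			then obtain z where "z \<in> G" "f z = 0" using KG by blast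
			then have "\<not> f constant_on G" using w unfolding constant_on_def by metis
			then show ?thesis by (rule holomorphic_compact_finite_zeros[OF fh(1) G_open G_connected Kc KG])
		next
			case True
			then show ?thesis by (metis finite.emptyI)
		qed
		have "\<exists>zs E. set zs = {z\<in>K. f z = 0} & E holomorphic_on G & (\<forall>z\<in>G. f z = (\<Prod>a\<leftarrow>zs. z - a) * E z) & (\<forall>z\<in>{z\<in>K. f z = 0}. E z ~= 0)"
			by (rule holomorphic_factor_zeros[where f=f and w=w, OF G_open G_connected fh(1) fin _ _ w]) (use KG in auto)
		then obtain zs E where E: "set zs = {z\<in>K. f z = 0}" "E holomorphic_on G"
			"!!z. z \<in> G ==> f z = (\<Prod>a\<leftarrow>zs. z - a) * E z" "!!z. z \<in> {z\<in>K. f z = 0} ==> E z ~= 0" by blast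
		have EK: "E z ~= 0" if "z \<in> K" for z using E(4)[of z] E(3)[of z] that KG by (cases "f z = 0") auto
		have Ef: "E z ~= 0" if "z \<in> G" "f z ~= 0" for z using E(3)[OF that(1)] that(2) by auto
		define S where "S = G - {z\<in>G. E z = 0}"
		have "S = G \<inter> E -` (- {0})" by (auto simp: S_def)
		then have So: "open S" using continuous_open_preimage[OF holomorphic_on_imp_continuous_on[OF E(2)] G_open open_Compl[OF closed_singleton[of 0]]] by simp
		have Sc: "connected S" unfolding S_def
			by (rule connected_open_diff_countable[OF _ G_open G_connected holomorphic_zeros_countable[OF E(2) G_open G_connected w(1) Ef[OF w]]]) simp
		have ES: "E holomorphic_on S" "!!z. z \<in> S ==> E z ~= 0" using E(2) holomorphic_on_subset by (auto simp: S_def)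
		have cc: "curve ?c = circlepath 0 \<rho>" by (auto simp: curve_def circlepath mult_ac)
		define \<gamma> where "\<gamma> i = (if i < m then GT i r else curve ?c)" for i
		have TG: "T k t r \<in> G" if "k < m" for k t using T_in_G[OF that r(1)] r(2) by simp
		have TS: "T k t r \<in> S" if "k < m" for k t using TG[OF that] Ef[OF _ nz[OF that]] by (simp add: S_def)
		have cS: "?c t \<in> S" for t using big[of "?c t"] Ef[of "?c t"] rp by (simp add: S_def norm_mult)
		have pim: "path_image (GT k r) = range (%t. T k t r)" if "k < m" for k using smooth_loop.path_image_tub[OF sloops[OF that]] .
		have wc: "winding_number (curve ?c) a = 1" if "norm a < \<rho>" for a
			unfolding cc using winding_number_circlepath[of a 0 \<rho>] that by simp
		have vT: "valid_path (GT k r)" if "k < m" for k using smooth_loop.valid_tub[OF sloops[OF that]] .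
		have wT0: "winding_number (GT k r) a = 0" if k: "k < m" and a: "a \<in> G" "!!s x. x \<in> {0..r} ==> a ~= T k s x" for k a
		proof -
			have "winding_number (GT k r) a = winding_number (curve (\<eta> k)) a"
				by (rule winding_T_eq[OF k]) (use a r in \<open>auto simp: closed_segment_eq_real_ivl\<close>)
			also have "\<dots> = 0" using cw_loop.winding_out[OF loops[OF k]] G_outside[OF k] a(1) by blast
			finally show ?thesis .
		qed
		have "(\<Sum>i<Suc m. contour_integral (\<gamma> i) (%z. deriv E z / E z)) = 0"
		proof (rule Cauchy_theorem_cycle[OF So Sc])
			show "(%z. deriv E z / E z) holomorphic_on S" by (intro holomorphic_intros holomorphic_deriv ES So)
			show "valid_path (\<gamma> i) & pathfinish (\<gamma> i) = pathstart (\<gamma> i) & path_image (\<gamma> i) <= S" if "i < Suc m" for i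
			proof (cases "i < m")
				case True
				then show ?thesis unfolding \<gamma>_def using vT[OF True] smooth_loop.loop_tub[OF sloops[OF True]] pim[OF True] TS[OF True] by auto
			next
				case False
				have "path_image (curve ?c) <= S" unfolding path_image_curve using cS by auto
				then show ?thesis using False unfolding \<gamma>_def cc by simp
			qed
			fix x assume x: "x ~: S"
			\<comment> \<open>Points off \<open>S\<close> are points off \<open>G\<close> or zeros of
			  \<open>E\<close>. The latter lie between the boundary and the parallel curves, hence inside
			  exactly one of these. In both cases the total -1 cancels the winding number of the
			  circle.\<close>
			have "(\<Sum>k<m. winding_number (GT k r) x) = -1 & norm x < \<rho>"
			proof (cases "x \<in> G")
				case False
				have "norm x < \<rho>" using big(2)[of x] False by force
				then show ?thesis using winding_T_sum[of r x] r False by simp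
			next
				case True
				then have Ex: "E x = 0" using x by (simp add: S_def)
				then have "f x = 0" using E(3)[OF True] by simp
				then have nx: "norm x < \<rho>" using big(1)[of x] by force
				then have "x \<in> Tb" using EK[of x] Ex True by (auto simp: K_def)
				then obtain k s y where k: "k < m" "x = T k s y" "-RR < y" "y < r" unfolding Tb_def by auto
				have rr: "abs r < smooth_loop.rho (\<eta> k) (d\<eta> k)" "abs y <= smooth_loop.rho (\<eta> k) (d\<eta> k)" using RR_rho[OF k(1)] r k by auto
				have one: "winding_number (GT k r) x = -1" using cw_loop.winding_tub[OF loops[OF k(1)] rr, of s] k by simp
				have oth: "winding_number (GT l r) x = 0" if l: "l \<in> {..<m} - {k}" for l
					by (rule wT0) (use l True T_disj[of k l y _ s] k r in \<open>auto simp: abs_if\<close>)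
				have "(\<Sum>l<m. winding_number (GT l r) x) = winding_number (GT k r) x + (\<Sum>l\<in>{..<m} - {k}. winding_number (GT l r) x)"
					using k(1) by (simp add: sum.remove[of "{..<m}" k])
				also have "\<dots> = -1" using oth one by simp
				finally show ?thesis using nx by simp
			qed
			then show "(\<Sum>i<Suc m. winding_number (\<gamma> i) x) = 0" using wc[of x] by (simp add: \<gamma>_def)
		qed
		moreover have gi: "contour_integral (GT k r) (%z. deriv E z / E z) = 2*pi*\<i> * ind (%t. E (T k t r))" if "k < m" for k
			by (rule ind_holomorphic[OF So ES(1) vT[OF that], symmetric]) (use pim[OF that] TS[OF that] ES(2) in auto)
		moreover have ci: "contour_integral (curve ?c) (%z. deriv E z / E z) = 2*pi*\<i> * ind (%t. E (?c t))"
		proof -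
			have v: "valid_path (curve ?c)" unfolding cc by simp
			have p: "path_image (curve ?c) <= S" unfolding path_image_curve using cS by auto
			show ?thesis by (rule ind_holomorphic[OF So ES(1) v p, symmetric]) (use ES(2) p in blast)
		qed
		ultimately have "2*pi*\<i> * ((\<Sum>k<m. ind (%t. E (T k t r))) + ind (%t. E (?c t))) = 0"
			by (simp add: \<gamma>_def distrib_left sum_distrib_left)
		then have sumE: "(\<Sum>k<m. ind (%t. E (T k t r))) + ind (%t. E (?c t)) = 0" by simp
		have Ec: "continuous_on S E" by (rule holomorphic_on_imp_continuous_on[OF ES(1)])
		have fT: "ind (%t. f (T k t r)) = ind (%t. E (T k t r))" if k: "k < m" for k
		proof -
			interpret Kk: cw_loop "\<eta> k" "d\<eta> k" "dd\<eta> k" by (rule loops[OF k])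
			have nl: "nonzero_loop (%t. T k t r - a)" if "a \<in> set zs" for a
			proof -
				have "T k t r ~= a" for t using nz[OF k, of t] that E(1) by auto
				then show ?thesis unfolding nonzero_loop_def by (auto intro!: continuous_intros Kk.tub_cont simp: Kk.tub_per)
			qed
			have nE: "nonzero_loop (%t. E (T k t r))" unfolding nonzero_loop_def
			proof (intro conjI allI)
				show "continuous_on UNIV (%t. E (T k t r))"
					by (rule continuous_on_compose2[OF Ec]) (use TS[OF k] in \<open>auto intro!: Kk.tub_cont continuous_intros\<close>)
			qed (use TS[OF k] ES(2) in \<open>auto simp: Kk.tub_per\<close>)
			have "winding_number (GT k r) a = 0" if a: "a \<in> set zs" for a
			proof (rule wT0[OF k])
				show "a \<in> G" using a E(1) KG by auto
				fix s x assume x: "x \<in> {0..r}"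
				show "a ~= T k s x"
				proof (cases "x = r")
					case True
					then show ?thesis using nz[OF k, of s] a E(1) by auto
				next
					case False
					then have "x \<in> {-RR<..<r}" using x RR_pos by auto
					then have "T k s x \<in> Tb" unfolding Tb_def using k by blast
					then show ?thesis using a E(1) by (auto simp: K_def)
				qed
			qed
			then have "(\<Sum>a\<leftarrow>zs. winding_number (GT k r) a) = (\<Sum>a\<leftarrow>zs. 0)" by (intro arg_cong[where f=sum_list] map_cong) auto
			moreover have "(%t. f (T k t r)) = (%t. (\<Prod>a\<leftarrow>zs. T k t r - a) * E (T k t r))" using E(3)[OF TG[OF k]] by simp
			ultimately show ?thesis using ind_mult[OF nonzero_loop_prod_list(1)[OF nl] nE] nonzero_loop_prod_list(2)[OF nl] by simp
		qed
		have "ind (%t. f (?c t)) = of_nat (length zs) + ind (%t. E (?c t))"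
		proof -
			have per: "?c (t + 2*pi) = ?c t" for t by (simp add: distrib_left exp_add exp_two_pi_i' mult.commute)
			have ccont: "continuous_on UNIV ?c" by (intro continuous_intros)
			have zn: "norm a < \<rho>" if "a \<in> set zs" for a using that E(1) big(1)[of a] by force
			have nl: "nonzero_loop (%t. ?c t - a)" if "a \<in> set zs" for a
			proof -
				have "?c t ~= a" for t using zn[OF that] rp by (auto simp: norm_mult)
				then show ?thesis unfolding nonzero_loop_def using per ccont by (auto intro!: continuous_intros)
			qed
			have nE: "nonzero_loop (%t. E (?c t))" unfolding nonzero_loop_def
			proof (intro conjI allI)
				show "continuous_on UNIV (%t. E (?c t))" by (rule continuous_on_compose2[OF Ec ccont]) (use cS in auto)
				show "E (?c t) ~= 0" for t by (rule ES(2)[OF cS])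
				show "E (?c (t + 2*pi)) = E (?c t)" for t unfolding per ..
			qed
			have "(\<Sum>a\<leftarrow>zs. winding_number (curve ?c) a) = (\<Sum>a\<leftarrow>zs. 1)" using wc zn by (intro arg_cong[where f=sum_list] map_cong) auto
			moreover have "(%t. f (?c t)) = (%t. (\<Prod>a\<leftarrow>zs. ?c t - a) * E (?c t))" using E(3) cS by (auto simp: S_def)
			ultimately show ?thesis using ind_mult[OF nonzero_loop_prod_list(1)[OF nl] nE] nonzero_loop_prod_list(2)[OF nl]
				by (simp add: sum_list_triv map_replicate_const sum_list_replicate)
		qed
		moreover have "Re (ind (%t. f (?c t))) <= -1" by (rule R0(3)) (simp add: \<rho>_def)
		ultimately have c1: "Re (ind (%t. E (?c t))) <= -1" by simp
		have "(\<Sum>k<m. Re (ind (%t. f (T k t r)))) = Re (\<Sum>k<m. ind (%t. E (T k t r)))" using fT by simp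
		also have "(\<Sum>k<m. ind (%t. E (T k t r))) = - ind (%t. E (?c t))" using sumE by (simp add: eq_neg_iff_add_eq_0)
		finally show ?thesis using c1 by simp
	qed
qed

end

context rh
begin

lemma ext_real_int_zero:
	assumes f: "analytic_ext G (Gam m \<eta>) f" and g: "analytic_int Gm (Gam m \<eta>) g"
		and bc: "!!k t. k < m ==> A (\<eta> k t) * f (\<eta> k t) = of_real (Re (A (\<eta> k t) * g (\<eta> k t)))"
	shows "z \<in> G ==> f z = 0"
proof (rule ccontr)
	assume z: "z \<in> G" "f z ~= 0"
	have fh: "f holomorphic_on G" "continuous_on (G Un Gam m \<eta>) f" using f by (auto simp: analytic_ext_def)
	have gh: "g holomorphic_on Gm" "continuous_on (Gm Un Gam m \<eta>) g" using g by (auto simp: analytic_int_def)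
	define Z where "Z = {z\<in>G. f z = 0}"
	have Zc: "countable Z" unfolding Z_def by (rule holomorphic_zeros_countable[OF fh(1) G_open G_connected z])
	have "countable (\<Union>k<m. {r. abs r <= smooth_loop.rho (\<eta> k) (d\<eta> k) & (\<exists>t. T k t r \<in> Z)})"
		using smooth_loop.countable_tub_radii[OF sloops Zc] by (intro countable_UN) auto
	moreover have "uncountable {0<..<RR}" using RR_pos by (simp add: uncountable_open_interval)
	ultimately have "\<not> {0<..<RR} <= (\<Union>k<m. {r. abs r <= smooth_loop.rho (\<eta> k) (d\<eta> k) & (\<exists>t. T k t r \<in> Z)})" by (meson countable_subset)
	then obtain r where r0: "r \<in> {0<..<RR}" "r ~: (\<Union>k<m. {r. abs r <= smooth_loop.rho (\<eta> k) (d\<eta> k) & (\<exists>t. T k t r \<in> Z)})" by blast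
	have r: "0 < r" "r < RR" "!!k. k < m ==> r ~: {r. abs r <= smooth_loop.rho (\<eta> k) (d\<eta> k) & (\<exists>t. T k t r \<in> Z)}" using r0 by auto
	have nz: "f (T k t r) ~= 0" if "k < m" for k t
		using r(3)[OF that] T_in_G[OF that r(1), of t] r RR_rho[OF that] by (auto simp: Z_def)
	have "Re (ind (%t. f (T k t r))) <= 0" if k: "k < m" for k
	proof -
		interpret W: weighted_loop "\<eta> k" "d\<eta> k" "dd\<eta> k" "%t. A (\<eta> k t)" by (rule wl[OF k])
		obtain L where L: "!!s t. norm (A (\<eta> k s) - A (\<eta> k t)) <= L * abs (s - t)" using W.a_lip by blast
		\<comment> \<open>\<open>component_index\<close> requires a nonzero boundary value on each curve;
		  if one curve had none, \<open>f\<close> would vanish identically.\<close>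
		have "\<not> (\<forall>t. f (\<eta> k t) = 0)" using ext_zero_on_component[OF f k _ z(1)] z(2) by blast
		then obtain a0 where a0: "f (\<eta> k a0) ~= 0" by blast
		have rr: "r < smooth_loop.rho (\<eta> k) (d\<eta> k)" using RR_rho[OF k] r by simp
		have rg: "range (\<eta> k) <= Gam m \<eta>" using k by (auto simp: Gam_def)
		show ?thesis
		proof (rule cw_loop.component_index[OF loops[OF k] _ L r(1) rr])
			show "nonzero_loop (%t. A (\<eta> k t))" unfolding nonzero_loop_def using W.a_cont W.a_per A_nz[OF k] by auto
			have "T k s x \<in> G" if "x \<in> {0<..<r}" for s x using T_in_G[OF k, of x s] that r by auto
			then show "f holomorphic_on {T k s x | s x. x \<in> {0<..<r}}" by (intro holomorphic_on_subset[OF fh(1)]) auto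
			have "T k s x \<in> G Un Gam m \<eta>" if "x \<in> {0..r}" for s x using T_in_G_Gam[OF k, of x s] that r rg by auto
			then show "continuous_on {T k s x | s x. x \<in> {0..r}} f" by (intro continuous_on_subset[OF fh(2)]) auto
			show "g holomorphic_on ins k" by (rule holomorphic_on_subset[OF gh(1) ins_Gm[OF k]])
			show "continuous_on (ins k Un range (\<eta> k)) g" by (rule continuous_on_subset[OF gh(2)]) (use ins_Gm[OF k] rg in auto)
		qed (use nz[OF k] bc[OF k] a0 in auto)
	qed
	then have "(\<Sum>k<m. Re (ind (%t. f (T k t r)))) <= 0" by (intro sum_nonpos) auto
	then show False using ext_index_sum[OF f z r(1,2) nz] by simp
qed

end

section \<open>The direct sum decomposition\<close>

lemma (in vector_space) subspace_eq_of_dim_eq: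
	assumes V: "subspace V" and VU: "V <= U" and fin: "finite W" "U <= span W" and dim: "dim V = dim U"
	shows "V = U"
proof (rule ccontr)
	assume "V ~= U"
	then obtain u where u: "u \<in> U" "u ~: V" using VU by blast
	obtain B where B: "B <= V" "independent B" "V <= span B" "card B = dim V" using basis_exists[of V] by blast
	obtain B' where B': "B' <= U" "independent B'" "U <= span B'" "card B' = dim U" using basis_exists[of U] by blast
	have "finite B'" using independent_span_bound[OF fin(1) B'(2)] B'(1) fin(2) by blast
	have "finite B" using independent_span_bound[OF fin(1) B(2)] B(1) VU fin(2) by blast
	have nu: "u ~: span B" using span_minimal[OF B(1) V] u(2) by blast
	then have "independent (insert u B)" using B(2) by (simp add: independent_insert)
	moreover have "insert u B <= span B'" using u(1) B(1) VU B'(3) by blast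
	ultimately have "card (insert u B) <= card B'" using independent_span_bound[OF \<open>finite B'\<close>] by blast
	moreover have "u ~: B" using nu span_base by blast
	ultimately show False using \<open>finite B\<close> B(4) B'(4) dim by simp
qed

context rh
begin

lemma ext_zero_boundary:
	assumes f: "analytic_ext G (Gam m \<eta>) f" and z: "!!z. z \<in> G ==> f z = 0" and k: "k < m"
	shows "f (\<eta> k t) = 0"
proof (rule continuous_constant_on_closure[of G f 0 "\<eta> k t"])
	have cl: "closure G = G Un Gam m \<eta>" using closure_Un_frontier[of G] G_frontier by simp
	show "continuous_on (closure G) f" unfolding cl using f by (simp add: analytic_ext_def)
	show "\<eta> k t \<in> closure G" unfolding cl using eta_in_Gam[OF k] by simp
qed (rule z)

text \<open>The same Cauchy integral, evaluated in \<open>G\<close>, is \<open>f z\<close> by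
  \<open>CI_ext\<close> and 0 by \<open>CI_int\<close>.\<close>

lemma ext_eq_int_zero:
	assumes f: "analytic_ext G (Gam m \<eta>) f" and g: "analytic_int Gm (Gam m \<eta>) g"
		and eq: "!!k t. k < m ==> f (\<eta> k t) = g (\<eta> k t)" and k: "k < m"
	shows "f (\<eta> k t) = 0"
proof (rule ext_zero_boundary[OF f _ k])
	fix z assume z: "z \<in> G"
	then have nz: "z ~: Gam m \<eta>" using G_Gam_disj by blast
	have "CI (%k t. f (\<eta> k t)) z = CI (%k t. g (\<eta> k t)) z" unfolding CI_def using eq by simp
	then show "f z = 0" using CI_ext[OF f nz] CI_int[OF g nz] z by simp
qed

lemma analytic_ext_scale: "analytic_ext G (Gam m \<eta>) f ==> analytic_ext G (Gam m \<eta>) (%z. c * f z)"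
	unfolding analytic_ext_def by (auto intro!: holomorphic_intros continuous_intros tendsto_mult_right_zero)

lemma analytic_ext_diff: "analytic_ext G (Gam m \<eta>) f ==> analytic_ext G (Gam m \<eta>) h ==> analytic_ext G (Gam m \<eta>) (%z. f z - h z)"
	unfolding analytic_ext_def using tendsto_diff[of f 0 at_infinity h 0] by (auto intro!: holomorphic_intros continuous_intros)

lemma analytic_int_scale: "analytic_int S (Gam m \<eta>) g ==> analytic_int S (Gam m \<eta>) (%z. c * g z)"
	unfolding analytic_int_def by (auto intro!: holomorphic_intros continuous_intros)

text \<open>The pair of \<open>f\<close> outside and 0 inside has jump \<open>\<gamma>\<close>, and
  its boundary sum is again \<open>\<gamma>\<close>.\<close>

lemma Splus_subset_NullIN: "Splus m \<eta> A G <= NullIN m \<eta> d\<eta> A"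
proof
	fix \<gamma> assume "\<gamma> \<in> Splus m \<eta> A G"
	then obtain f where f: "\<gamma> \<in> Hsp m" "analytic_ext G (Gam m \<eta>) f" "!!k t. k < m ==> complex_of_real (\<gamma> k t) = A (\<eta> k t) * f (\<eta> k t)"
		unfolding Splus_def by blast
	have z: "analytic_int Gm (Gam m \<eta>) (%_. 0)" by (simp add: analytic_int_def)
	have "\<gamma> j s = Nn \<gamma> j s" if j: "j < m" for j s
	proof -
		have "Re (A (\<eta> j s) * (f (\<eta> j s) + 0)) = Nn \<gamma> j s" by (rule Re_boundary_sum[OF f(2) z _ j]) (simp add: f(3))
		moreover have "Re (A (\<eta> j s) * (f (\<eta> j s) + 0)) = \<gamma> j s" using f(3)[OF j, of s] by (metis Re_complex_of_real add.right_neutral)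
		ultimately show ?thesis by simp
	qed
	then show "\<gamma> \<in> NullIN m \<eta> d\<eta> A" using f(1) by (simp add: NullIN_def)
qed

lemma Splus_subspace: "fs.subspace (Splus m \<eta> A G)"
proof (rule fs.subspaceI)
	have "(%k t. 0) \<in> Hsp m" by (auto simp: Hsp_def holder_continuous_def intro!: exI[of _ 0] exI[of _ 1])
	moreover have "analytic_ext G (Gam m \<eta>) (%_. 0)" by (simp add: analytic_ext_def)
	ultimately show "0 \<in> Splus m \<eta> A G" unfolding Splus_def zero_fun_def by (auto intro!: exI[of _ "%_. 0"])
next
	fix x y assume "x \<in> Splus m \<eta> A G" "y \<in> Splus m \<eta> A G"
	then obtain f h where x: "x \<in> Hsp m" "analytic_ext G (Gam m \<eta>) f" "!!k t. k < m ==> complex_of_real (x k t) = A (\<eta> k t) * f (\<eta> k t)"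
		and y: "y \<in> Hsp m" "analytic_ext G (Gam m \<eta>) h" "!!k t. k < m ==> complex_of_real (y k t) = A (\<eta> k t) * h (\<eta> k t)"
		unfolding Splus_def by blast
	have "x + y = (%k t. 1 * x k t + 1 * y k t)" by (simp add: plus_fun_def)
	then have "x + y \<in> Hsp m" using Hsp_comb[OF x(1) y(1), of 1 1] by simp
	moreover have "analytic_ext G (Gam m \<eta>) (%z. f z - (-1) * h z)" by (rule analytic_ext_diff[OF x(2) analytic_ext_scale[OF y(2)]])
	moreover have "complex_of_real ((x + y) k t) = A (\<eta> k t) * (f (\<eta> k t) - (-1) * h (\<eta> k t))" if "k < m" for k t
		using x(3)[OF that, of t] y(3)[OF that, of t] by (simp add: distrib_left)
	ultimately show "x + y \<in> Splus m \<eta> A G" unfolding Splus_def by blast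
next
	fix c x assume "x \<in> Splus m \<eta> A G"
	then obtain f where x: "x \<in> Hsp m" "analytic_ext G (Gam m \<eta>) f" "!!k t. k < m ==> complex_of_real (x k t) = A (\<eta> k t) * f (\<eta> k t)"
		unfolding Splus_def by blast
	have "fscale c x \<in> Hsp m" using Hsp_comb[OF x(1) x(1), of c 0] by (simp add: fscale_def)
	moreover have "analytic_ext G (Gam m \<eta>) (%z. of_real c * f z)" by (rule analytic_ext_scale[OF x(2)])
	moreover have "complex_of_real (fscale c x k t) = A (\<eta> k t) * (of_real c * f (\<eta> k t))" if "k < m" for k t
		using x(3)[OF that, of t] by (simp add: fscale_def)
	ultimately show "fscale c x \<in> Splus m \<eta> A G" unfolding Splus_def by blast
qed

lemma Splus_eq_NullIN:
	assumes "fdim (Splus m \<eta> A G) = fdim (NullIN m \<eta> d\<eta> A)"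
	shows "Splus m \<eta> A G = NullIN m \<eta> d\<eta> A"
proof -
	obtain W where "finite W" "NullIN m \<eta> d\<eta> A <= fs.span W" using NullIN_finite by blast
	then show ?thesis using fs.subspace_eq_of_dim_eq[OF Splus_subspace Splus_subset_NullIN] assms by (simp add: fdim_def)
qed

lemma boundary_data_bounded:
	assumes "!!k. k < m ==> continuous_on UNIV (x k)" "!!k t. k < m ==> x k (t + 2*pi) = (x k t :: real)"
	obtains B where "!!k t. k < m ==> abs (x k t) <= B"
proof -
	have "\<forall>k\<in>{..<m}. \<exists>B. B > 0 & (\<forall>t. abs (x k t) <= B)"
		using periodic_bounded[OF assms(2,1)] by (metis lessThan_iff real_norm_def)
	from bchoice[OF this] obtain Bf where Bf: "!!k. k < m ==> Bf k > 0" "!!k t. k < m ==> abs (x k t) <= Bf k" by blast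
	have "abs (x k t) <= (\<Sum>k<m. Bf k)" if k: "k < m" for k t
	proof -
		have "Bf k <= (\<Sum>k<m. Bf k)" using k Bf(1) by (intro member_le_sum) (auto intro: less_imp_le)
		then show ?thesis using Bf(2)[OF k, of t] by linarith
	qed
	then show ?thesis using that by blast
qed

text \<open>For the pair \<open>\<i> f\<close>, \<open>\<i> g\<close> both the jump and the real
  part of the boundary sum, each multiplied by \<open>A\<close>, equal \<open>- Im (A f)\<close>,
  because \<open>A g\<close> is real and coincides with \<open>Re (A f)\<close>. This gives a null
  vector of \<open>I - N\<close>.\<close>

lemma Rplus_Int_Sminus:
	assumes N: "NullIN m \<eta> d\<eta> A <= Splus m \<eta> A G" and R: "\<sigma> \<in> Rplus m \<eta> A G" and S: "\<sigma> \<in> Sminus m \<eta> A G"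
	shows "\<sigma> k t = 0"
proof -
	obtain f where f: "\<sigma> \<in> Hsp m" "analytic_ext G (Gam m \<eta>) f" "!!k t. k < m ==> \<sigma> k t = Re (A (\<eta> k t) * f (\<eta> k t))"
		using R unfolding Rplus_def by blast
	obtain g where g: "analytic_int Gm (Gam m \<eta>) g" "!!k t. k < m ==> complex_of_real (\<sigma> k t) = A (\<eta> k t) * g (\<eta> k t)"
		using S unfolding Sminus_def by blast
	define \<gamma> where "\<gamma> = (%k t. if k < m then - Im (A (\<eta> k t) * f (\<eta> k t)) else 0)"
	note f1 = analytic_ext_scale[OF f(2), of \<i>] and g1 = analytic_int_scale[OF g(1), of \<i>]
	have d: "A (\<eta> k t) * (\<i> * f (\<eta> k t) - \<i> * g (\<eta> k t)) = of_real (\<gamma> k t)" if "k < m" for k t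
	proof -
		have "A (\<eta> k t) * (\<i> * f (\<eta> k t) - \<i> * g (\<eta> k t)) = \<i> * (A (\<eta> k t) * f (\<eta> k t) - A (\<eta> k t) * g (\<eta> k t))" by (simp add: algebra_simps)
		also have "\<dots> = \<i> * (A (\<eta> k t) * f (\<eta> k t) - of_real (Re (A (\<eta> k t) * f (\<eta> k t))))" using g(2)[OF that, of t] f(3)[OF that, of t] by simp
		also have "\<dots> = of_real (\<gamma> k t)" using that by (simp add: \<gamma>_def complex_eq_iff)
		finally show ?thesis .
	qed
	have gN: "Nn \<gamma> k t = \<gamma> k t" if "k < m" for k t
	proof -
		have "Nn \<gamma> k t = Re (A (\<eta> k t) * (\<i> * f (\<eta> k t) + \<i> * g (\<eta> k t)))" by (rule Re_boundary_sum[OF f1 g1 d that, symmetric])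
		also have "A (\<eta> k t) * (\<i> * f (\<eta> k t) + \<i> * g (\<eta> k t)) = \<i> * (A (\<eta> k t) * f (\<eta> k t)) + \<i> * (A (\<eta> k t) * g (\<eta> k t))" by (simp add: algebra_simps)
		also have "Re \<dots> = \<gamma> k t" unfolding g(2)[OF that, symmetric] using that by (simp add: \<gamma>_def)
		finally show ?thesis .
	qed
	have fc: "continuous_on (G Un Gam m \<eta>) f" using f(2) by (simp add: analytic_ext_def)
	have gc: "continuous_on S (\<gamma> k)" if k: "k < m" for k S
	proof -
		interpret W: weighted_loop "\<eta> k" "d\<eta> k" "dd\<eta> k" "%t. A (\<eta> k t)" by (rule wl[OF k])
		have "continuous_on UNIV (%t. f (\<eta> k t))" by (rule continuous_on_compose2[OF fc W.e_cont]) (use eta_in_Gam[OF k] in auto)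
		then have "continuous_on UNIV (%t. - Im (A (\<eta> k t) * f (\<eta> k t)))" by (intro continuous_intros W.a_cont)
		then have "continuous_on UNIV (\<gamma> k)" using k by (simp add: \<gamma>_def)
		then show ?thesis using continuous_on_subset by blast
	qed
	have gp: "\<gamma> k (t + 2*pi) = \<gamma> k t" if k: "k < m" for k t
		using smooth_loop.per[OF sloops[OF k]] by (simp add: \<gamma>_def)
	\<comment> \<open>So far \<open>\<gamma>\<close> is known only to be continuous; since
	  \<open>\<gamma> = N \<gamma>\<close>, the smoothing in \<open>holder_Nop\<close> supplies the
	  Hoelder condition.\<close>
	have gH: "\<gamma> \<in> Hsp m"
	proof (rule boundary_data_bounded[of \<gamma>, OF gc gp])
		fix B assume B: "!!k t. k < m ==> abs (\<gamma> k t) <= B"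
		have "(%k t. if k < m then Nn \<gamma> k t else 0) \<in> Hsp m" by (rule holder_Nop[OF gc B])
		moreover have "(%k t. if k < m then Nn \<gamma> k t else 0) = \<gamma>" using gN by (auto simp: fun_eq_iff \<gamma>_def)
		ultimately show ?thesis by simp
	qed
	have "\<gamma> \<in> NullIN m \<eta> d\<eta> A" using gH gN by (simp add: NullIN_def)
	then obtain h where h: "analytic_ext G (Gam m \<eta>) h" "!!k t. k < m ==> complex_of_real (\<gamma> k t) = A (\<eta> k t) * h (\<eta> k t)"
		using N unfolding Splus_def by blast
	have eq: "\<i> * f (\<eta> k t) - h (\<eta> k t) = \<i> * g (\<eta> k t)" if "k < m" for k t
	proof -
		have "A (\<eta> k t) * (\<i> * f (\<eta> k t) - \<i> * g (\<eta> k t)) = A (\<eta> k t) * h (\<eta> k t)" using d[OF that] h(2)[OF that] by simp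
		then have "\<i> * f (\<eta> k t) - \<i> * g (\<eta> k t) = h (\<eta> k t)" using A_nz[OF that] mult_left_cancel by blast
		then show ?thesis by (simp add: algebra_simps)
	qed
	show ?thesis
	proof (cases "k < m")
		case True
		have "\<i> * f (\<eta> k t) - h (\<eta> k t) = 0" by (rule ext_eq_int_zero[OF analytic_ext_diff[OF f1 h(1)] g1 eq True])
		then have "g (\<eta> k t) = 0" using eq[OF True, of t] by simp
		then show ?thesis using g(2)[OF True, of t] by simp
	next
		case False
		then show ?thesis using HspD(3)[OF f(1)] by simp
	qed
qed

text \<open>From \<open>Re (A f - A g) = \<mu>\<close> and \<open>Re (A f + A g) = - \<mu>\<close>
  follows \<open>Re (A f) = 0\<close>, while the imaginary parts agree. After multiplication by
  \<open>-\<i>\<close> this is the situation of \<open>ext_real_int_zero\<close>; hence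
  \<open>f = 0\<close> and \<open>\<mu> = - A g\<close>.\<close>

lemma Null_plus_Sminus:
	assumes mu: "\<mu> \<in> Hsp m" "!!j s. j < m ==> \<mu> j s = - Nn \<mu> j s"
	shows "\<mu> \<in> Sminus m \<eta> A G"
proof (rule plemelj[OF mu(1)])
	fix f g assume f: "analytic_ext G (Gam m \<eta>) f" and g: "analytic_int Gm (Gam m \<eta>) g"
		and d: "!!k t. k < m ==> A (\<eta> k t) * (f (\<eta> k t) - g (\<eta> k t)) = of_real (\<mu> k t)"
		and s: "!!k t. k < m ==> Re (A (\<eta> k t) * (f (\<eta> k t) + g (\<eta> k t))) = Nn \<mu> k t"
	have "A (\<eta> k t) * (-\<i> * f (\<eta> k t)) = of_real (Re (A (\<eta> k t) * (-\<i> * g (\<eta> k t))))" if k: "k < m" for k t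
	proof -
		define x where "x = A (\<eta> k t) * f (\<eta> k t)"
		define y where "y = A (\<eta> k t) * g (\<eta> k t)"
		have xy: "x - y = of_real (\<mu> k t)" using d[OF k, of t] by (simp add: x_def y_def right_diff_distrib)
		have "Re (x + y) = - \<mu> k t" using s[OF k, of t] mu(2)[OF k, of t] unfolding x_def y_def distrib_left[symmetric] by simp
		then have "Re x = 0" "Im x = Im y" using arg_cong[OF xy, of Re] arg_cong[OF xy, of Im] by auto
		then have "-\<i> * x = of_real (Re (-\<i> * y))" by (simp add: complex_eq_iff)
		then show ?thesis unfolding x_def y_def by (simp only: mult.left_commute)
	qed
	then have "-\<i> * f z = 0" if "z \<in> G" for z
		by (rule ext_real_int_zero[OF analytic_ext_scale[OF f] analytic_int_scale[OF g] _ that])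
	then have f0: "f (\<eta> k t) = 0" if "k < m" for k t by (intro ext_zero_boundary[OF f _ that]) simp
	have "complex_of_real (\<mu> k t) = A (\<eta> k t) * (-1 * g (\<eta> k t))" if "k < m" for k t using d[OF that, of t] f0[OF that] by simp
	then show ?thesis unfolding Sminus_def using mu(1) analytic_int_scale[OF g, of "-1"] by blast
qed

text \<open>Adding the jump relation to the boundary sum gives
  \<open>y + N y = Re (2 A f)\<close>.\<close>

lemma range_plus_Rplus:
	assumes y: "y \<in> Hsp m" and x: "x \<in> Hsp m" "!!j s. j < m ==> x j s = y j s + Nn y j s"
	shows "x \<in> Rplus m \<eta> A G"
proof (rule plemelj[OF y])
	fix f g assume f: "analytic_ext G (Gam m \<eta>) f"
		and d: "!!k t. k < m ==> A (\<eta> k t) * (f (\<eta> k t) - g (\<eta> k t)) = of_real (y k t)"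
		and s: "!!k t. k < m ==> Re (A (\<eta> k t) * (f (\<eta> k t) + g (\<eta> k t))) = Nn y k t"
	have "x k t = Re (A (\<eta> k t) * (2 * f (\<eta> k t)))" if k: "k < m" for k t
	proof -
		have "A (\<eta> k t) * (2 * f (\<eta> k t)) = A (\<eta> k t) * (f (\<eta> k t) - g (\<eta> k t)) + A (\<eta> k t) * (f (\<eta> k t) + g (\<eta> k t))" by (simp add: algebra_simps)
		then have "Re (A (\<eta> k t) * (2 * f (\<eta> k t))) = y k t + Nn y k t" unfolding d[OF k] by (simp only: plus_complex.simps Re_complex_of_real s[OF k])
		then show ?thesis using x(2)[OF k] by simp
	qed
	then show ?thesis unfolding Rplus_def using x(1) analytic_ext_scale[OF f, of 2] by blast
qed

lemma direct_sum:
	assumes "fdim (Splus m \<eta> A G) = fdim (NullIN m \<eta> d\<eta> A)"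
	shows "Hsp m = {r + s | r s. r \<in> Rplus m \<eta> A G & s \<in> Sminus m \<eta> A G}"
		and "Rplus m \<eta> A G \<inter> Sminus m \<eta> A G = {0}"
proof -
	have N: "NullIN m \<eta> d\<eta> A <= Splus m \<eta> A G" using Splus_eq_NullIN[OF assms] by simp
	show "Hsp m = {r + s | r s. r \<in> Rplus m \<eta> A G & s \<in> Sminus m \<eta> A G}"
	proof (intro set_eqI iffI)
		fix \<psi> assume "\<psi> \<in> {r + s | r s. r \<in> Rplus m \<eta> A G & s \<in> Sminus m \<eta> A G}"
		then obtain r s where rs: "\<psi> = r + s" "r \<in> Hsp m" "s \<in> Hsp m" by (auto simp: Rplus_def Sminus_def)
		have "r + s = (%k t. 1 * r k t + 1 * s k t)" by (simp add: plus_fun_def)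
		then show "\<psi> \<in> Hsp m" using Hsp_comb[OF rs(2,3), of 1 1] rs(1) by simp
	next
		fix \<psi> assume psi: "\<psi> \<in> Hsp m"
		show "\<psi> \<in> {r + s | r s. r \<in> Rplus m \<eta> A G & s \<in> Sminus m \<eta> A G}"
		proof (rule range_plus_null[of "-1" \<psi>])
			show "abs (-1::real) = 1" "\<psi> \<in> Hsp m" using psi by auto
			\<comment> \<open>As a null vector of \<open>I + N\<close>, \<open>x\<close> lies in the interior
			  space; as a value of \<open>I + N\<close>, in the exterior one.\<close>
			show "\<forall>j<m. \<forall>s. x j s = 0" if x: "x \<in> Hsp m" and y: "y \<in> Hsp m" and xN: "!!j s. j < m ==> x j s = -1 * Nn x j s"
				and xy: "!!j s. j < m ==> x j s = y j s - -1 * Nn y j s" for x y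
			proof -
				have "x \<in> Sminus m \<eta> A G" by (rule Null_plus_Sminus[OF x]) (use xN in simp)
				moreover have "x \<in> Rplus m \<eta> A G" by (rule range_plus_Rplus[OF y x]) (use xy in simp)
				ultimately show ?thesis using Rplus_Int_Sminus[OF N] by blast
			qed
			fix y z assume y: "y \<in> Hsp m" and z: "z \<in> Hsp m" and yz: "!!j s. j < m ==> \<psi> j s = y j s - -1 * Nn y j s + z j s"
				and zN: "!!j s. j < m ==> z j s = -1 * Nn z j s"
			define r where "r = (%k t. 1 * \<psi> k t + -1 * z k t)"
			have "r \<in> Hsp m" unfolding r_def by (rule Hsp_comb[OF psi z])
			then have "r \<in> Rplus m \<eta> A G" by (rule range_plus_Rplus[OF y]) (use yz in \<open>simp add: r_def\<close>)
			moreover have "z \<in> Sminus m \<eta> A G" by (rule Null_plus_Sminus[OF z]) (use zN in simp)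
			moreover have "\<psi> = r + z" by (simp add: fun_eq_iff r_def)
			ultimately show ?thesis by blast
		qed
	qed
	have "(0 :: nat => real => real) \<in> Hsp m"
		by (auto simp: Hsp_def zero_fun_def holder_continuous_def intro!: exI[of _ 0] exI[of _ 1])
	moreover have "analytic_ext G (Gam m \<eta>) (%_. 0)" "analytic_int Gm (Gam m \<eta>) (%_. 0)" by (auto simp: analytic_ext_def analytic_int_def)
	ultimately have "0 \<in> Rplus m \<eta> A G" "0 \<in> Sminus m \<eta> A G"
		unfolding Rplus_def Sminus_def by (auto simp: zero_fun_def intro!: exI[of _ "%_. 0"])
	moreover have "\<sigma> = 0" if "\<sigma> \<in> Rplus m \<eta> A G" "\<sigma> \<in> Sminus m \<eta> A G" for \<sigma>
		using Rplus_Int_Sminus[OF N that] by (simp add: fun_eq_iff)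
	ultimately show "Rplus m \<eta> A G \<inter> Sminus m \<eta> A G = {0}" by blast
qed

end

theorem theorem4p12:
  fixes m :: nat
    and \<eta> d\<eta> dd\<eta> :: "nat \<Rightarrow> real \<Rightarrow> complex"
    and A :: "complex \<Rightarrow> complex"
    and G :: "complex set"
  assumes m_pos: "m \<ge> 1"
    and eta_periodic: "\<forall>k<m. \<forall>t. \<eta> k (t + 2*pi) = \<eta> k t"
    and eta_deriv: "\<forall>k<m. \<forall>t. (\<eta> k has_vector_derivative d\<eta> k t) (at t)"
    and eta_deriv2: "\<forall>k<m. \<forall>t. (d\<eta> k has_vector_derivative dd\<eta> k t) (at t)"
    and eta_C2: "\<forall>k<m. continuous_on UNIV (dd\<eta> k)"
    and eta_regular: "\<forall>k<m. \<forall>t. d\<eta> k t \<noteq> 0"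
    and eta_simple: "\<forall>k<m. inj_on (\<eta> k) {0..<2*pi}"
    and eta_disjoint: "\<forall>k<m. \<forall>l<m. k \<noteq> l \<longrightarrow> range (\<eta> k) \<inter> range (\<eta> l) = {}"
    and clockwise: "\<forall>k<m. \<forall>z\<in>inside (range (\<eta> k)). winding_number (curve (\<eta> k)) z = -1"
    and G_open: "open G"
    and G_connected: "connected G"
    and G_boundary: "frontier G = Gam m \<eta>"
    and G_infinity: "bounded (- G)"
    and G_zero: "0 \<in> G"
    and A_nonzero: "\<forall>z\<in>Gam m \<eta>. A z \<noteq> 0"
    and A_C1: "\<forall>k<m. \<exists>dA. (\<forall>t. ((\<lambda>t. A (\<eta> k t)) has_vector_derivative dA t) (at t))
                              \<and> continuous_on UNIV dA"
    and dim_eq: "fdim (Splus m \<eta> A G) = fdim (NullIN m \<eta> d\<eta> A)"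
  shows "Hsp m = {r + s | r s. r \<in> Rplus m \<eta> A G \<and> s \<in> Sminus m \<eta> A G}
         \<and> Rplus m \<eta> A G \<inter> Sminus m \<eta> A G = {0}"
proof -
	have sl: "smooth_loop (\<eta> k) (d\<eta> k) (dd\<eta> k)" if "k < m" for k
		using that eta_periodic eta_deriv eta_deriv2 eta_C2 eta_regular eta_simple by unfold_locales auto
	have cl: "cw_loop (\<eta> k) (d\<eta> k) (dd\<eta> k)" if "k < m" for k
		using sl[OF that] clockwise that by (simp add: cw_loop_def cw_loop_axioms_def)
	have wl: "weighted_loop (\<eta> k) (d\<eta> k) (dd\<eta> k) (%t. A (\<eta> k t))" if k: "k < m" for k
	proof -
		interpret smooth_loop "\<eta> k" "d\<eta> k" "dd\<eta> k" by (rule sl[OF k])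
		obtain dA where dA: "!!t. ((%t. A (\<eta> k t)) has_vector_derivative dA t) (at t)" "continuous_on UNIV dA"
			using A_C1 k by blast
		\<comment> \<open>Periodicity makes the derivative bounded on the whole line and so yields a
		  global Lipschitz constant for \<open>A\<close> along the curve.\<close>
		have "dA (t + 2*pi) = dA t" for t
		proof -
			have "((%t. A (\<eta> k (t + 2*pi))) has_vector_derivative 1 *\<^sub>R dA (t + 2*pi)) (at t)"
				by (rule vector_diff_chain_at[of "%t. t + 2*pi" 1 t "%t. A (\<eta> k t)" "dA (t + 2*pi)", unfolded o_def])
					 (auto intro!: derivative_eq_intros dA(1))
			then have "((%t. A (\<eta> k t)) has_vector_derivative dA (t + 2*pi)) (at t)" by (simp add: per)
			then show ?thesis using dA(1)[of t] vector_derivative_unique_at by blast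
		qed
		then obtain B where B: "!!t. norm (dA t) <= B" using periodic_bounded[OF _ dA(2)] by metis
		show ?thesis
		proof unfold_locales
			show "A (\<eta> k (t + 2*pi)) = A (\<eta> k t)" for t by (simp add: per)
			show "A (\<eta> k t) ~= 0" for t using A_nonzero k by (auto simp: Gam_def)
			show "\<exists>L. \<forall>s t. norm (A (\<eta> k t) - A (\<eta> k s)) <= L * abs (t - s)"
				using vector_derivative_bound[OF dA(1) B] by blast
		qed
	qed
	interpret rh m \<eta> d\<eta> dd\<eta> G A
		by (intro rh.intro region.intro rh_axioms.intro cl wl G_open G_connected G_boundary G_infinity) (use eta_disjoint in auto)
	show ?thesis using direct_sum[OF dim_eq] by blast
qed

end
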